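(* Let $1\le p<\infty$ and let $(k_n)_{n\in\mathbb N}$ be a sequence of positive integers such that $1\le k_n\le n$, $k_n=\omega(1)$ and $k_n=o(n)$. Let $(\mathbf W_n)_{n\in\mathbb N}$ be a sequence of probability measures on $[0,\infty)$ and for each $n$ let $X_n$ be a random vector with distribution $\mathbf P_{\mathbf W_n,n,p}$. Independently of $X_n$, let $E_n$ be a uniformly distributed (Haar) random $k_n$-dimensional linear subspace of $\mathbb R^n$, and define $\mathscr Z_{n,p}:=n^{1/p}\|P_{E_n}X_n\|_2$. Let $W_n$ be a random variable with distribution $\mathbf W_n$ and suppose that the sequence of random variables $W_n/n$ satisfies an LDP with speed $n$ and a rate function $\mathbb I_W$ satisfying $\mathbb I_W(x)\ne0$ for all $x\ne0$. Let $M_p(2)=\frac{p^{2/p}}{3}\frac{\Gamma(1+3/p)}{\Gamma(1+1/p)}$. Then the following hold: (a) If $p\ge2$, then $k_n^{-1/2}\mathscr Z_{n,p}$ satisfies an MDP on $\mathbb R$ with speed $k_n$ and rate function $$\mathbb I(x)=\begin{cases}\frac{x^2-M_p(2)}{2M_p(2)}-\log\frac{x}{\sqrt{M_p(2)}}&: x>0\\+\infty&:\text{otherwise.}\end{cases}$$ (b1) If $1\le p<2$ and $k_n=o(n^{p/2})$, then $k_n^{-1/2}\mathscr Z_{n,p}$ satisfies an MDP on $\mathbb R$ with speed $k_n$ and rate function $$\mathbb I(x)=\begin{cases}\frac{x^2-M_p(2)}{2M_p(2)}-\log\frac{x}{\sqrt{M_p(2)}}&: x>0\\+\infty&:\text{otherwise.}\end{cases}$$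 (b2) If $1\le p<2$ and $k_n$ equals $n^{p/2}$ up to rounding to an integer (i.e. $|k_n-n^{p/2}|<1$ for all $n$), then $k_n^{-1/2}\mathscr Z_{n,p}$ satisfies an MDP on $\mathbb R$ with speed $n^{p/2}$ and rate function $$\mathbb I(x)=\begin{cases}\inf\limits_{y\ge\sqrt{M_p(2)}}\Big[\frac{(x/y)^2-1}{2}-\log\big(\frac xy\big)+\frac1p\big(y^2-M_p(2)\big)^{p/2}\Big]&: x>0\\+\infty&:\text{otherwise.}\end{cases}$$ (b3) If $1\le p<2$ and $k_n=\omega(n^{p/2})$, then $k_n^{-1/2}\mathscr Z_{n,p}$ satisfies an MDP on $\mathbb R$ with speed $n^{p/2}$ and rate function $$\mathbb I(x)=\begin{cases}\frac1p\big(x^2-M_p(2)\big)^{p/2}&: x\ge\sqrt{M_p(2)}\\+\infty&:\text{otherwise.}\end{cases}$$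
   Context: $\mathbb B_p^n=\{x\in\mathbb R^n:\|x\|_p\le1\}$ with $\|x\|_p=(\sum_{i=1}^n|x_i|^p)^{1/p}$; $P_E$ denotes orthogonal projection onto the subspace $E$. The measures $\mathbf P_{\mathbf W,n,p}$: let $\mathbf U_{n,p}$ be the uniform distribution on $\mathbb B_p^n$ and $\mathbf C_{n,p}$ the cone probability measure on $\mathbb S_p^{n-1}=\{x:\|x\|_p=1\}$, i.e. $\mathbf C_{n,p}(A)=\mathbf U_{n,p}(\{rx:x\in A,0\le r\le1\})$ for measurable $A\subseteq\mathbb S_p^{n-1}$. For a Borel probability measure $\mathbf W$ on $[0,\infty)$, $$\mathbf P_{\mathbf W,n,p}:=\mathbf W(\{0\})\,\mathbf C_{n,p}+H\,\mathbf U_{n,p},\qquad H(x)=h(\|x\|_p),$$ $$h(r)=\frac{1}{p^{n/p}\Gamma(1+\frac np)}\frac{1}{(1-r^p)^{1+n/p}}\int_0^\infty s^{n/p}e^{-\frac1p s r^p(1-r^p)^{-1}}\,\mathbf W(\mathrm ds),$$ where $H\,\mathbf U_{n,p}$ is the measure with density $H$ with respect to $\mathbf U_{n,p}$. Landau notation: $x_n=o(y_n)$ means $\lim x_n/y_n=0$; $x_n=\omega(y_n)$ means $\lim|x_n/y_n|=+\infty$. Large deviations principle (LDP): given positive reals $(s_n)$, a sequence $(X_n)$ of random vectors in $\mathbb R^d$ satisfies an LDP with speed $s_n$ and rate function $\mathbb I:\mathbb R^d\to[0,\infty]$ if $\mathbb I$ is lower semi-continuous with compact level sets $\{\mathbb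 I\le\alpha\}$, $\alpha\in\mathbb R$, and for all Borel sets $A\subseteq\mathbb R^d$ $$-\inf_{x\in A^\circ}\mathbb I(x)\le\liminf_{n\to\infty}s_n^{-1}\log\mathbb P[X_n\in A]\le\limsup_{n\to\infty}s_n^{-1}\log\mathbb P[X_n\in A]\le-\inf_{x\in\overline A}\mathbb I(x)$$ ($\log0=-\infty$, $\inf\emptyset=+\infty$). A moderate deviations principle (MDP) is formally the same notion. *)

theory Defs
  imports "HOL-Probability.Probability" "HOL-Library.Function_Algebras"
    "HOL-Library.Landau_Symbols"
begin

text \<open>
  The dimension \<open>n\<close> runs through a sequence, so \<open>\<real>\<^sup>n\<close> is the library's \<^term>\<open>Euclidean_space n\<close>:
  the functions \<open>nat \<Rightarrow> real\<close> that vanish at all indices \<open>i \<ge> n\<close>.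
\<close>

abbreviation Rn :: "nat \<Rightarrow> (nat \<Rightarrow> real) set" where
  "Rn n \<equiv> topspace (Euclidean_space n)"

definition Rn_borel :: "nat \<Rightarrow> (nat \<Rightarrow> real) measure" where
  "Rn_borel n = restrict_space borel (Rn n)"

definition Rn_lebesgue :: "nat \<Rightarrow> (nat \<Rightarrow> real) measure" where
  "Rn_lebesgue n = distr (Pi\<^sub>M {..<n} (\<lambda>_. lborel)) (Rn_borel n) (\<lambda>x i. if i < n then x i else 0)"

interpretation rn: vector_space "\<lambda>(c::real) (x::nat \<Rightarrow> real) i. c * x i"
  by unfold_locales (auto simp: algebra_simps)

definition lp_norm :: "nat \<Rightarrow> real \<Rightarrow> (nat \<Rightarrow> real) \<Rightarrow> real" where
  "lp_norm n p x = (\<Sum>i<n. \<bar>x i\<bar> powr p) powr (1 / p)"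

definition lp_ball :: "nat \<Rightarrow> real \<Rightarrow> (nat \<Rightarrow> real) set" where
  "lp_ball n p = {x \<in> Rn n. lp_norm n p x \<le> 1}"

definition lp_sphere :: "nat \<Rightarrow> real \<Rightarrow> (nat \<Rightarrow> real) set" where
  "lp_sphere n p = {x \<in> Rn n. lp_norm n p x = 1}"

definition unif_ball :: "nat \<Rightarrow> real \<Rightarrow> (nat \<Rightarrow> real) measure" where
  "unif_ball n p = uniform_measure (Rn_lebesgue n) (lp_ball n p)"

definition cone_over :: "(nat \<Rightarrow> real) set \<Rightarrow> (nat \<Rightarrow> real) set" where
  "cone_over A = {(\<lambda>i. r * x i) | r x. x \<in> A \<and> 0 \<le> r \<and> r \<le> 1}"

text \<open>
  The cone measure is regarded as a measure on \<open>\<real>\<^sup>n\<close> that is concentrated on the sphere. For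
  \<open>n \<ge> 1\<close> and \<open>p \<ge> 1\<close> the set function below is countably additive, because cones over disjoint
  sets meet at most in the origin; hence \<^term>\<open>measure_of\<close> does not alter its values.
\<close>

definition cone_measure :: "nat \<Rightarrow> real \<Rightarrow> (nat \<Rightarrow> real) measure" where
  "cone_measure n p = measure_of (Rn n) (sets (Rn_borel n))
     (\<lambda>A. emeasure (unif_ball n p) (cone_over (A \<inter> lp_sphere n p)))"

text \<open>
  The values at \<open>r \<ge> 1\<close> are irrelevant, since the function is only used as a density with respect
  to the uniform distribution on the ball.
\<close>

definition h_dens :: "nat \<Rightarrow> real \<Rightarrow> real measure \<Rightarrow> real \<Rightarrow> ennreal" where
  "h_dens n p W r =
     ennreal (1 / (p powr (n / p) * Gamma (1 + n / p)) * (1 / (1 - r powr p) powr (1 + n / p))) *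
     (\<integral>\<^sup>+ s\<in>{0..}. ennreal (s powr (n / p) * exp (- (1 / p) * s * r powr p * inverse (1 - r powr p))) \<partial>W)"

definition P_W :: "real measure \<Rightarrow> nat \<Rightarrow> real \<Rightarrow> (nat \<Rightarrow> real) measure" where
  "P_W W n p = measure_of (Rn n) (sets (Rn_borel n))
     (\<lambda>A. emeasure W {0} * emeasure (cone_measure n p) A +
          emeasure (density (unif_ball n p) (\<lambda>x. h_dens n p W (lp_norm n p x))) A)"

definition Rn_inner :: "nat \<Rightarrow> (nat \<Rightarrow> real) \<Rightarrow> (nat \<Rightarrow> real) \<Rightarrow> real" where
  "Rn_inner n x y = (\<Sum>i<n. x i * y i)"

definition proj :: "nat \<Rightarrow> (nat \<Rightarrow> real) set \<Rightarrow> (nat \<Rightarrow> real) \<Rightarrow> (nat \<Rightarrow> real)" where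
  "proj n E x = (THE y. y \<in> E \<and> (\<forall>z\<in>E. Rn_inner n (x - y) z = 0))"

definition grassmannian :: "nat \<Rightarrow> nat \<Rightarrow> (nat \<Rightarrow> real) set set" where
  "grassmannian n k = {E. E \<subseteq> Rn n \<and> rn.subspace E \<and> rn.dim E = k}"

text \<open>
  The topology of the Grassmannian is the one induced by the embedding that sends a subspace to
  the matrix of its orthogonal projection; this is the corresponding Borel \<open>\<sigma>\<close>-algebra.
\<close>

definition proj_matrix :: "nat \<Rightarrow> (nat \<Rightarrow> real) set \<Rightarrow> nat \<Rightarrow> nat \<Rightarrow> real" where
  "proj_matrix n E i j = proj n E (\<lambda>l. if l = j then 1 else 0) i"

definition grassmannian_borel :: "nat \<Rightarrow> nat \<Rightarrow> (nat \<Rightarrow> real) set measure" where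
  "grassmannian_borel n k = vimage_algebra (grassmannian n k) (proj_matrix n) borel"

definition orthogonal_mat :: "nat \<Rightarrow> (nat \<Rightarrow> nat \<Rightarrow> real) \<Rightarrow> bool" where
  "orthogonal_mat n Q \<longleftrightarrow>
     (\<forall>i<n. \<forall>j<n. (\<Sum>l<n. Q l i * Q l j) = (if i = j then 1 else 0))"

definition mat_apply :: "nat \<Rightarrow> (nat \<Rightarrow> nat \<Rightarrow> real) \<Rightarrow> (nat \<Rightarrow> real) \<Rightarrow> (nat \<Rightarrow> real)" where
  "mat_apply n Q x = (\<lambda>i. if i < n then (\<Sum>j<n. Q i j * x j) else 0)"

text \<open>
  The Haar probability measure on the Grassmannian is the unique Borel probability measure that is
  invariant under the action \<open>E \<mapsto> Q E\<close> of the orthogonal group.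
\<close>

definition haar_grassmannian :: "nat \<Rightarrow> nat \<Rightarrow> (nat \<Rightarrow> real) set measure \<Rightarrow> bool" where
  "haar_grassmannian n k \<mu> \<longleftrightarrow>
     prob_space \<mu> \<and> space \<mu> = grassmannian n k \<and> sets \<mu> = sets (grassmannian_borel n k) \<and>
     (\<forall>Q. orthogonal_mat n Q \<longrightarrow>
        distr \<mu> (grassmannian_borel n k) (\<lambda>E. mat_apply n Q ` E) = \<mu>)"

definition log_prob :: "real \<Rightarrow> ereal" where
  "log_prob q = (if q = 0 then -\<infinity> else ereal (ln q))"

definition rate_function :: "('b::euclidean_space \<Rightarrow> ereal) \<Rightarrow> bool" where
  "rate_function I \<longleftrightarrow>
     (\<forall>x. 0 \<le> I x) \<and> (\<forall>x. I x \<le> Liminf (at x) I) \<and> (\<forall>\<alpha>::real. compact {x. I x \<le> ereal \<alpha>})"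

text \<open>
  All sequences are indexed by \<open>n \<ge> 1\<close>; the entry at \<open>n = 0\<close> is unconstrained. The random vectors
  may live on different probability spaces \<open>M n\<close>, as only their distributions matter.
\<close>

definition satisfies_LDP ::
  "(nat \<Rightarrow> 'a measure) \<Rightarrow> (nat \<Rightarrow> 'a \<Rightarrow> 'b::euclidean_space) \<Rightarrow> (nat \<Rightarrow> real) \<Rightarrow> ('b \<Rightarrow> ereal) \<Rightarrow> bool"
where
  "satisfies_LDP M X s I \<longleftrightarrow>
     (\<forall>n\<ge>1. prob_space (M n) \<and> X n \<in> borel_measurable (M n) \<and> 0 < s n) \<and>
     rate_function I \<and>
     (\<forall>A\<in>sets borel.
        let a = (\<lambda>n. ereal (inverse (s n)) * log_prob (measure (M n) {w \<in> space (M n). X n w \<in> A}))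
        in - (INF x\<in>interior A. I x) \<le> liminf a \<and> liminf a \<le> limsup a \<and>
           limsup a \<le> - (INF x\<in>closure A. I x))"

definition M2 :: "real \<Rightarrow> real" where
  "M2 p = p powr (2 / p) / 3 * (Gamma (1 + 3 / p) / Gamma (1 + 1 / p))"

end

theory Submission
  imports Defs
begin

text \<open>
  Write \<open>k = k\<^sub>n\<close>, \<open>m = \<surd>(M2 p)\<close> and factorise \<open>Z / \<surd>k = D * R\<close> with \<open>D = n^(1/p-1/2) \<parallel>X\<parallel>\<^sub>2\<close> and
  \<open>R = (n/k)^(1/2) \<parallel>P\<^sub>E X\<parallel>\<^sub>2 / \<parallel>X\<parallel>\<^sub>2\<close>. Given \<open>X\<close>, the law of \<open>R\<close> does not depend on \<open>X\<close>, because \<open>E\<close> is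
  rotation invariant; hence \<open>D\<close> and \<open>R\<close> are independent (\<open>joint_prob\<close>) and it suffices to know the
  deviations of each factor.

  The factor \<open>R\<close>. By invariance \<open>X\<close> may be replaced by a standard Gaussian vector \<open>g\<close>. For a fixed
  subspace \<open>\<parallel>P\<^sub>E g\<parallel>\<^sup>2\<close> and \<open>\<parallel>g\<parallel>\<^sup>2\<close> have the moment generating functions of chi-square variables with \<open>k\<close>
  and \<open>n\<close> degrees of freedom. Since \<open>k = o(n)\<close>, the denominator is constant at speed \<open>k\<close>, and the
  chi-square tails give \<open>R\<close> the rate \<open>j(u) = (u\<^sup>2 - 1)/2 - log u\<close> at speed \<open>k\<close> (\<open>proj_law_upper\<close>,
  \<open>proj_law_lower\<close>, \<open>proj_law_local\<close>).

  The factor \<open>D\<close>. Write \<open>D = n^(1/p-1/2) (\<parallel>X\<parallel>\<^sub>2/\<parallel>X\<parallel>\<^sub>p) \<parallel>X\<parallel>\<^sub>p\<close>. The quotient of the norms is homogeneous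
  of degree zero, and all measures \<open>P\<^sub>W\<close> give the same law to such functions as the vector of
  independent \<open>p\<close>-Gaussian coordinates (density proportional to \<open>exp(- \<bar>y\<bar>\<^sup>p/p)\<close>), by integration in
  polar coordinates (\<open>P_W_homogeneous\<close>). The radius \<open>\<parallel>X\<parallel>\<^sub>p\<close> is at most one, and \<open>\<parallel>X\<parallel>\<^sub>p \<le> r < 1\<close> requires
  the mixing variable \<open>W\<^sub>n\<close> to be of order \<open>n\<close>; as \<open>I_W\<close> can vanish only at zero, this is exponentially
  unlikely at speed \<open>n\<close> (\<open>P_W_small_ball\<close>). For the \<open>p\<close>-Gaussian vector \<open>Y\<close> the sum of \<open>\<bar>Y\<^sub>i\<bar>\<^sup>p\<close>
  concentrates at speed \<open>n\<close>. So does the sum of squares if \<open>p \<ge> 2\<close>. If \<open>p < 2\<close>, then \<open>Y\<^sub>i\<^sup>2\<close> has the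
  tail \<open>exp(- t^(p/2)/p)\<close>, heavier than exponential, and the cheapest way of exceeding the mean by \<open>n a\<close>
  is one coordinate of size \<open>(n a)^(1/2)\<close>: the speed is \<open>n^(p/2)\<close> and the rate \<open>a^(p/2)/p\<close>
  (\<open>gg_square_heavy_upper\<close>, \<open>gg_square_heavy_lower\<close>).

  Comparing the two speeds \<open>k\<close> and \<open>n^(p/2)\<close> gives the four cases: the slower speed decides, and at
  equal speeds the rate is the infimum over all factorisations \<open>x = y * (x/y)\<close> of the sum of both rates.
  All rate functions are unimodal with minimum at \<open>m\<close>, so the upper bound is needed for half lines only
  and the lower bound for small balls (\<open>satisfies_LDP_of_half_lines\<close>).
\<close>

section \<open>Exponential bounds and the large deviations principle\<close>

text \<open>
  For a real \<open>c\<close> and a positive speed this is \<open>limsup s\<^sub>n^(-1) log P\<^sub>n \<le> - c\<close>. Quantifying over all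
  reals below \<open>c\<close> avoids the logarithm of zero and covers \<open>c = \<infinity>\<close>, which says that \<open>P\<close> is negligible at
  speed \<open>s\<close>.
\<close>

definition exp_ub :: "(nat \<Rightarrow> real) \<Rightarrow> (nat \<Rightarrow> real) \<Rightarrow> ereal \<Rightarrow> bool" where
  "exp_ub s P c \<longleftrightarrow> (\<forall>r::real. ereal r < c \<longrightarrow> (\<forall>\<^sub>F n in sequentially. P n \<le> exp (- r * s n)))"

definition exp_lb :: "(nat \<Rightarrow> real) \<Rightarrow> (nat \<Rightarrow> real) \<Rightarrow> ereal \<Rightarrow> bool" where
  "exp_lb s P c \<longleftrightarrow> (\<forall>r::real. c < ereal r \<longrightarrow> (\<forall>\<^sub>F n in sequentially. exp (- r * s n) \<le> P n))"

lemma exp_ub_mono: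
  assumes "exp_ub s Q d" "c \<le> d" "\<forall>\<^sub>F n in sequentially. P n \<le> Q n"
  shows "exp_ub s P c"
  unfolding exp_ub_def
proof (intro allI impI)
  fix r assume "ereal r < c"
  then have "ereal r < d" using assms(2) by (rule less_le_trans)
  then have "\<forall>\<^sub>F n in sequentially. Q n \<le> exp (- r * s n)" using assms(1) unfolding exp_ub_def by blast
  with assms(3) show "\<forall>\<^sub>F n in sequentially. P n \<le> exp (- r * s n)" by eventually_elim linarith
qed

lemma exp_lb_mono:
  assumes "exp_lb s Q d" "d \<le> c" "\<forall>\<^sub>F n in sequentially. Q n \<le> P n"
  shows "exp_lb s P c"
  unfolding exp_lb_def
proof (intro allI impI)
  fix r assume "c < ereal r"
  then have "d < ereal r" using assms(2) by (rule le_less_trans[rotated])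
  then have "\<forall>\<^sub>F n in sequentially. exp (- r * s n) \<le> Q n" using assms(1) unfolding exp_lb_def by blast
  with assms(3) show "\<forall>\<^sub>F n in sequentially. exp (- r * s n) \<le> P n" by eventually_elim linarith
qed

text \<open>
  Constant factors do not matter on the exponential scale: a strictly better exponent absorbs them.
\<close>

lemma exp_gap:
  assumes s: "filterlim s at_top sequentially" and "r < (r'::real)" "0 < C"
  shows "\<forall>\<^sub>F n in sequentially. C * exp (- r' * s n) \<le> exp (- r * s n)"
proof -
  have "\<forall>\<^sub>F n in sequentially. ln C / (r' - r) \<le> s n"
    using s unfolding filterlim_at_top by blast
  then show ?thesis
  proof eventually_elim
    case (elim n)
    then have "ln C \<le> (r' - r) * s n" using assms by (simp add: field_simps)
    then have "exp (ln C + - r' * s n) \<le> exp (- r * s n)" by (simp add: algebra_simps)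
    then show ?case using assms(3) by (simp only: exp_add exp_ln)
  qed
qed

lemma exp_ub_add:
  assumes "exp_ub s P c" "exp_ub s Q c" "filterlim s at_top sequentially"
  shows "exp_ub s (\<lambda>n. P n + Q n) c"
  unfolding exp_ub_def
proof (intro allI impI)
  fix r assume "ereal r < c"
  then obtain r' where r': "r < r'" "ereal r' < c" using ereal_dense2 by fastforce
  have "\<forall>\<^sub>F n in sequentially. P n \<le> exp (- r' * s n)" "\<forall>\<^sub>F n in sequentially. Q n \<le> exp (- r' * s n)"
    using assms r' unfolding exp_ub_def by blast+
  moreover have "\<forall>\<^sub>F n in sequentially. 2 * exp (- r' * s n) \<le> exp (- r * s n)"
    by (rule exp_gap) (use assms r' in auto)
  ultimately show "\<forall>\<^sub>F n in sequentially. P n + Q n \<le> exp (- r * s n)" by eventually_elim linarith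
qed

lemma exp_ub_zero: "exp_ub s (\<lambda>n. 0) c"
  unfolding exp_ub_def by simp

lemma exp_ub_sum:
  assumes "finite F" "\<And>i. i \<in> F \<Longrightarrow> exp_ub s (P i) c" "filterlim s at_top sequentially"
  shows "exp_ub s (\<lambda>n. \<Sum>i\<in>F. P i n) c"
  using assms(1,2)
proof (induction F rule: finite_induct)
  case empty then show ?case by (simp add: exp_ub_zero)
next
  case (insert x F)
  then have "exp_ub s (\<lambda>n. P x n + (\<Sum>i\<in>F. P i n)) c" by (intro exp_ub_add assms(3)) auto
  then show ?case using insert by simp
qed

lemma ereal_less_add_split:
  assumes "ereal r < c + d" "0 \<le> c" "0 \<le> d"
  obtains r1 r2 where "ereal r1 < c" "ereal r2 < d" "r = r1 + r2"
proof (cases c; cases d)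
  fix a b assume ab: "c = ereal a" "d = ereal b"
  show ?thesis using assms ab by (intro that[of "(r + a - b)/2" "(r + b - a)/2"]) (auto simp: field_simps)
next
  fix b assume "c = \<infinity>" "d = ereal b"
  then show ?thesis by (intro that[of "r - b + 1" "b - 1"]) auto
next
  fix a assume "c = ereal a" "d = \<infinity>"
  then show ?thesis by (intro that[of "a - 1" "r - a + 1"]) auto
next
  assume "c = \<infinity>" "d = \<infinity>"
  then show ?thesis by (intro that[of r 0]) auto
qed (use assms in auto)

lemma exp_ub_mult:
  assumes "exp_ub s P c" "exp_ub s Q d" "0 \<le> c" "0 \<le> d"
    "\<forall>\<^sub>F n in sequentially. 0 \<le> P n" "\<forall>\<^sub>F n in sequentially. 0 \<le> Q n"
  shows "exp_ub s (\<lambda>n. P n * Q n) (c + d)"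
  unfolding exp_ub_def
proof (intro allI impI)
  fix r assume "ereal r < c + d"
  then obtain r1 r2 where r: "ereal r1 < c" "ereal r2 < d" "r = r1 + r2"
    using ereal_less_add_split assms by metis
  have "\<forall>\<^sub>F n in sequentially. P n \<le> exp (- r1 * s n)" "\<forall>\<^sub>F n in sequentially. Q n \<le> exp (- r2 * s n)"
    using assms r unfolding exp_ub_def by blast+
  with assms(5,6) show "\<forall>\<^sub>F n in sequentially. P n * Q n \<le> exp (- r * s n)"
  proof eventually_elim
    case (elim n)
    then have "P n * Q n \<le> exp (- r1 * s n) * exp (- r2 * s n)" by (intro mult_mono) auto
    then show ?case by (simp add: r(3) mult_exp_exp algebra_simps)
  qed
qed

lemma exp_lb_mult:
  assumes "exp_lb s P c" "exp_lb s Q d" "0 \<le> c" "0 \<le> d"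
  shows "exp_lb s (\<lambda>n. P n * Q n) (c + d)"
  unfolding exp_lb_def
proof (intro allI impI)
  fix r assume cd: "c + d < ereal r"
  then obtain a b where ab: "c = ereal a" "d = ereal b" using assms by (cases c; cases d) auto
  define e where "e = (r - a - b)/2"
  have e: "e > 0" using cd ab by (auto simp: e_def)
  have "\<forall>\<^sub>F n in sequentially. exp (- (a+e) * s n) \<le> P n" "\<forall>\<^sub>F n in sequentially. exp (- (b+e) * s n) \<le> Q n"
    using assms(1,2) ab e unfolding exp_lb_def by (simp_all del: minus_add_distrib)
  then show "\<forall>\<^sub>F n in sequentially. exp (- r * s n) \<le> P n * Q n"
  proof eventually_elim
    case (elim n)
    then have "exp (- (a+e) * s n) * exp (- (b+e) * s n) \<le> P n * Q n" by (intro mult_mono) (auto intro: order_trans[OF exp_ge_zero])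
    moreover have "r = (a+e)+(b+e)" by (simp add: e_def)
    ultimately show ?case by (simp add: mult_exp_exp algebra_simps)
  qed
qed

text \<open>
  Used to pass from an event to its intersection with another event whose complement has a larger rate.
\<close>

lemma exp_lb_diff:
  assumes "exp_lb s P c" "exp_ub s Q d" "c < d" "filterlim s at_top sequentially"
  shows "exp_lb s (\<lambda>n. P n - Q n) c"
  unfolding exp_lb_def
proof (intro allI impI)
  fix r assume "c < ereal r"
  then have "c < min (ereal r) d" using assms by simp
  then obtain r1 where r1: "c < ereal r1" "ereal r1 < min (ereal r) d" using ereal_dense2 by blast
  then obtain r2 where r2: "ereal r1 < ereal r2" "ereal r2 < d" using ereal_dense2[of "ereal r1" d] by auto
  have "\<forall>\<^sub>F n in sequentially. exp (- r1 * s n) \<le> P n" "\<forall>\<^sub>F n in sequentially. Q n \<le> exp (- r2 * s n)"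
    using assms r1 r2 unfolding exp_ub_def exp_lb_def by blast+
  moreover have "\<forall>\<^sub>F n in sequentially. 2 * exp (- r2 * s n) \<le> exp (- r1 * s n)"
    by (rule exp_gap) (use assms r2 in auto)
  moreover have "\<forall>\<^sub>F n in sequentially. 2 * exp (- r * s n) \<le> exp (- r1 * s n)"
    by (rule exp_gap) (use assms r1 in auto)
  ultimately show "\<forall>\<^sub>F n in sequentially. exp (- r * s n) \<le> P n - Q n" by eventually_elim linarith
qed

text \<open>
  A positive rate at a faster speed is an infinite rate at a slower one.
\<close>

lemma exp_ub_speed_infinity:
  assumes "exp_ub s P c" "0 < c" "filterlim (\<lambda>n. s n / s' n) at_top sequentially"
    "\<forall>\<^sub>F n in sequentially. 0 < s' n"
  shows "exp_ub s' P d"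
  unfolding exp_ub_def
proof (intro allI impI)
  fix r
  obtain r0 where r0: "0 < r0" "ereal r0 < c" using assms(2) ereal_dense2[of 0 c] by auto
  have "\<forall>\<^sub>F n in sequentially. P n \<le> exp (- r0 * s n)" using assms r0 unfolding exp_ub_def by blast
  moreover have "\<forall>\<^sub>F n in sequentially. r / r0 \<le> s n / s' n" using assms(3) unfolding filterlim_at_top by blast
  ultimately show "\<forall>\<^sub>F n in sequentially. P n \<le> exp (- r * s' n)" using assms(4)
  proof eventually_elim
    case (elim n)
    then have "r * s' n \<le> r0 * s n" using r0 by (simp add: field_simps)
    then have "exp (- r0 * s n) \<le> exp (- r * s' n)" by simp
    then show ?case using elim by linarith
  qed
qed

lemma exp_ub_speed_equiv:
  assumes "exp_ub s P c" "(\<lambda>n. s n / s' n) \<longlonglongrightarrow> 1" "\<forall>\<^sub>F n in sequentially. 0 < s' n"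
  shows "exp_ub s' P c"
  unfolding exp_ub_def
proof (intro allI impI)
  fix r assume "ereal r < c"
  then obtain r' where r': "r < r'" "ereal r' < c" using ereal_dense2 by fastforce
  have "(\<lambda>n. r' * (s n / s' n)) \<longlonglongrightarrow> r' * 1" by (intro tendsto_intros assms)
  then have "\<forall>\<^sub>F n in sequentially. r < r' * (s n / s' n)" using r' by (intro order_tendstoD) auto
  moreover have "\<forall>\<^sub>F n in sequentially. P n \<le> exp (- r' * s n)" using assms r' unfolding exp_ub_def by blast
  ultimately show "\<forall>\<^sub>F n in sequentially. P n \<le> exp (- r * s' n)" using assms(3)
  proof eventually_elim
    case (elim n)
    then have "r * s' n \<le> r' * s n" by (simp add: field_simps)
    then have "exp (- r' * s n) \<le> exp (- r * s' n)" by simp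
    then show ?case using elim by linarith
  qed
qed

lemma exp_lb_speed_equiv:
  assumes "exp_lb s P c" "(\<lambda>n. s n / s' n) \<longlonglongrightarrow> 1" "\<forall>\<^sub>F n in sequentially. 0 < s' n"
  shows "exp_lb s' P c"
  unfolding exp_lb_def
proof (intro allI impI)
  fix r assume "c < ereal r"
  then obtain r' where r': "r' < r" "c < ereal r'" using ereal_dense2 by fastforce
  have "(\<lambda>n. r' * (s n / s' n)) \<longlonglongrightarrow> r' * 1" by (intro tendsto_intros assms)
  then have "\<forall>\<^sub>F n in sequentially. r' * (s n / s' n) < r" using r' by (intro order_tendstoD) auto
  moreover have "\<forall>\<^sub>F n in sequentially. exp (- r' * s n) \<le> P n" using assms r' unfolding exp_lb_def by blast
  ultimately show "\<forall>\<^sub>F n in sequentially. exp (- r * s' n) \<le> P n" using assms(3)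
  proof eventually_elim
    case (elim n)
    then have "r' * s n \<le> r * s' n" by (simp add: field_simps)
    then have "exp (- r * s' n) \<le> exp (- r' * s n)" by simp
    then show ?case using elim by linarith
  qed
qed

lemma exp_lb_const:
  assumes "0 < C" "filterlim s at_top sequentially" "\<forall>\<^sub>F n in sequentially. C \<le> P n"
  shows "exp_lb s P 0"
  unfolding exp_lb_def
proof (intro allI impI)
  fix r :: real assume "0 < ereal r"
  then have "\<forall>\<^sub>F n in sequentially. (1/C) * exp (- r * s n) \<le> exp (- 0 * s n)"
    using assms by (intro exp_gap) auto
  with assms(3) show "\<forall>\<^sub>F n in sequentially. exp (- r * s n) \<le> P n"
    by eventually_elim (use assms(1) in \<open>simp add: field_simps\<close>)
qed

lemma exp_ub_tendsto_0:
  assumes "exp_ub s P c" "0 < c" "filterlim s at_top sequentially" "0 < e"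
  shows "\<forall>\<^sub>F n in sequentially. P n \<le> e"
proof -
  obtain r0 where r0: "0 < r0" "ereal r0 < c" using assms(2) ereal_dense2[of 0 c] by auto
  have "\<forall>\<^sub>F n in sequentially. P n \<le> exp (- r0 * s n)" using assms r0 unfolding exp_ub_def by blast
  moreover have "\<forall>\<^sub>F n in sequentially. (1/e) * exp (- r0 * s n) \<le> exp (- 0 * s n)"
    by (rule exp_gap) (use assms r0 in auto)
  ultimately show ?thesis
    by eventually_elim (use assms(4) in \<open>simp add: field_simps\<close>)
qed

lemma limsup_le_of_exp_ub:
  assumes "exp_ub s P c" "\<forall>\<^sub>F n in sequentially. 0 < s n" "\<And>n. 0 \<le> P n"
  shows "limsup (\<lambda>n. ereal (inverse (s n)) * log_prob (P n)) \<le> - c"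
proof (rule ccontr)
  assume "\<not> ?thesis"
  then have "- c < limsup (\<lambda>n. ereal (inverse (s n)) * log_prob (P n))" by simp
  then obtain z where z: "- c < ereal z" "ereal z < limsup (\<lambda>n. ereal (inverse (s n)) * log_prob (P n))"
    using ereal_dense2 by blast
  have "ereal (-z) < c" using z(1) by (metis ereal_minus_less_minus ereal_uminus_uminus uminus_ereal.simps(1))
  then have "\<forall>\<^sub>F n in sequentially. P n \<le> exp (- (-z) * s n)" using assms unfolding exp_ub_def by blast
  then have "\<forall>\<^sub>F n in sequentially. ereal (inverse (s n)) * log_prob (P n) \<le> ereal z" using assms(2)
  proof eventually_elim
    case (elim n)
    show ?case
    proof (cases "P n = 0")
      case True then show ?thesis using elim by (simp add: log_prob_def)
    next
      case False
      then have "P n > 0" using assms(3)[of n] by simp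
      then have "ln (P n) \<le> z * s n" using elim ln_le_cancel_iff[of "P n" "exp (- (-z) * s n)"] by simp
      then show ?thesis using False elim by (simp add: log_prob_def field_simps)
    qed
  qed
  then have "limsup (\<lambda>n. ereal (inverse (s n)) * log_prob (P n)) \<le> ereal z" by (rule Limsup_bounded)
  with z(2) show False by simp
qed

lemma liminf_ge_of_exp_lb:
  assumes "exp_lb s P c" "\<forall>\<^sub>F n in sequentially. 0 < s n"
  shows "- c \<le> liminf (\<lambda>n. ereal (inverse (s n)) * log_prob (P n))"
proof (rule ccontr)
  assume "\<not> ?thesis"
  then have "liminf (\<lambda>n. ereal (inverse (s n)) * log_prob (P n)) < - c" by simp
  then obtain z where z: "ereal z < - c" "liminf (\<lambda>n. ereal (inverse (s n)) * log_prob (P n)) < ereal z"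
    using ereal_dense2 by blast
  have "c < ereal (-z)" using z(1) by (metis ereal_minus_less_minus ereal_uminus_uminus uminus_ereal.simps(1))
  then have "\<forall>\<^sub>F n in sequentially. exp (- (-z) * s n) \<le> P n" using assms unfolding exp_lb_def by blast
  then have "\<forall>\<^sub>F n in sequentially. ereal z \<le> ereal (inverse (s n)) * log_prob (P n)" using assms(2)
  proof eventually_elim
    case (elim n)
    then have pos: "P n > 0" by (metis exp_gt_zero less_le_trans)
    then have "z * s n \<le> ln (P n)" using elim by (simp add: ln_ge_iff)
    then show ?case using pos elim by (simp add: log_prob_def field_simps)
  qed
  then have "ereal z \<le> liminf (\<lambda>n. ereal (inverse (s n)) * log_prob (P n))" by (rule Liminf_bounded)
  with z(2) show False by simp
qed

text \<open>
  Let \<open>A\<close> be a set whose closure avoids the zero \<open>m\<close> of the rate function. Then \<open>A\<close> is contained in the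
  union of two half lines that start at the points of the closure of \<open>A\<close> nearest to \<open>m\<close> from the right
  and from the left, and the rate at these points is at least the infimum over the closure. If \<open>m\<close>
  belongs to the closure, the infimum is zero and the upper bound is trivial. The lower bound for open
  sets is local anyway.
\<close>

lemma satisfies_LDP_of_half_lines:
  fixes X :: "nat \<Rightarrow> 'a \<Rightarrow> real"
  assumes M: "\<And>n. n \<ge> 1 \<Longrightarrow> prob_space (M n)"
    and X[measurable]: "\<And>n. n \<ge> 1 \<Longrightarrow> X n \<in> borel_measurable (M n)"
    and s: "\<And>n. n \<ge> 1 \<Longrightarrow> 0 < s n" "filterlim s at_top sequentially"
    and I: "rate_function I" "I m = 0"
    and upper: "\<And>b. m < b \<Longrightarrow> exp_ub s (\<lambda>n. \<P>(w in M n. b \<le> X n w)) (I b)"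
    and lower: "\<And>a. a < m \<Longrightarrow> exp_ub s (\<lambda>n. \<P>(w in M n. X n w \<le> a)) (I a)"
    and loc: "\<And>x d. 0 < d \<Longrightarrow> exp_lb s (\<lambda>n. \<P>(w in M n. \<bar>X n w - x\<bar> < d)) (I x)"
  shows "satisfies_LDP M X s I"
proof -
  have s0: "\<forall>\<^sub>F n in sequentially. 0 < s n" using s(1) by (auto simp: eventually_sequentially)
  have ge1: "\<forall>\<^sub>F n in sequentially. (1::nat) \<le> n" by (rule eventually_ge_at_top)
  have I0: "0 \<le> I x" for x using I(1) by (simp add: rate_function_def)
  { fix A :: "real set" assume A[measurable]: "A \<in> sets borel"
    define P where "P n = \<P>(w in M n. X n w \<in> A)" for n
    define a where "a n = ereal (inverse (s n)) * log_prob (P n)" for n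
    have "- I x \<le> liminf a" if x: "x \<in> interior A" for x
    proof -
      obtain d where d: "0 < d" "ball x d \<subseteq> A" using x by (auto simp: mem_interior)
      have "exp_lb s P (I x)"
      proof (rule exp_lb_mono[OF loc[OF d(1), of x] order_refl])
        show "\<forall>\<^sub>F n in sequentially. \<P>(w in M n. \<bar>X n w - x\<bar> < d) \<le> P n"
          using ge1
        proof eventually_elim
          case (elim n)
          interpret prob_space "M n" by (rule M[OF elim])
          note X[OF elim, measurable]
          show ?case unfolding P_def
            by (rule finite_measure_mono) (use d(2) in \<open>auto simp: dist_real_def abs_minus_commute subset_iff\<close>)
        qed
      qed
      then show ?thesis unfolding a_def using s0 by (rule liminf_ge_of_exp_lb)
    qed
    then have 1: "- (INF x\<in>interior A. I x) \<le> liminf a"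
      unfolding ereal_SUP_uminus_eq[symmetric] by (rule SUP_least)
    define c where "c = (INF x\<in>closure A. I x)"
    have cle: "c \<le> I x" if "x \<in> closure A" for x unfolding c_def using that by (rule INF_lower)
    have "exp_ub s P c"
    proof (cases "m \<in> closure A")
      case True
      then have "c \<le> 0" using cle I(2) by metis
      show ?thesis unfolding exp_ub_def
      proof (intro allI impI)
        fix r assume "ereal r < c"
        from less_le_trans[OF this \<open>c \<le> 0\<close>] have "ereal r < 0" .
        then have "r < 0" by simp
        from ge1 s0 show "\<forall>\<^sub>F n in sequentially. P n \<le> exp (- r * s n)"
        proof eventually_elim
          case (elim n)
          interpret prob_space "M n" by (rule M[OF elim(1)])
          have "P n \<le> 1" unfolding P_def by simp
          also have "1 \<le> exp (- r * s n)" using \<open>r < 0\<close> elim by (simp add: mult_nonpos_nonneg)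
          finally show ?case .
        qed
      qed
    next
      case False
      define F where "F = closure A"
      have cF: "closed F" by (simp add: F_def)
      have up: "exp_ub s (\<lambda>n. \<P>(w in M n. X n w \<in> A \<and> m \<le> X n w)) c"
      proof (cases "F \<inter> {m..} = {}")
        case True
        have "{w\<in>space (M n). X n w \<in> A \<and> m \<le> X n w} = {}" for n using True closure_subset[of A] unfolding F_def by auto
        then show ?thesis by (simp only: measure_empty exp_ub_zero)
      next
        case ne: False
        define b where "b = Inf (F \<inter> {m..})"
        have bb: "bdd_below (F \<inter> {m..})" by (rule bdd_belowI[of _ m]) auto
        have "b \<in> F \<inter> {m..}" unfolding b_def
          by (rule closed_contains_Inf[OF ne bb]) (intro closed_Int cF closed_atLeast)
        then have b: "b \<in> F" "m < b" using False by (auto simp: F_def less_le)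
        show ?thesis
        proof (rule exp_ub_mono[OF upper[OF b(2)]])
          show "c \<le> I b" using b cle by (simp add: F_def)
          show "\<forall>\<^sub>F n in sequentially. \<P>(w in M n. X n w \<in> A \<and> m \<le> X n w)
             \<le> \<P>(w in M n. b \<le> X n w)"
            using ge1
          proof eventually_elim
            case (elim n)
            interpret prob_space "M n" by (rule M[OF elim(1)])
            note X[OF elim, measurable]
            show ?case
            proof (rule finite_measure_mono)
              show "{w \<in> space (M n). X n w \<in> A \<and> m \<le> X n w} \<subseteq> {w \<in> space (M n). b \<le> X n w}"
                unfolding b_def using closure_subset[of A] by (auto simp: F_def intro!: cInf_lower bb[unfolded F_def])
            qed measurable
          qed
        qed
      qed
      have lo: "exp_ub s (\<lambda>n. \<P>(w in M n. X n w \<in> A \<and> X n w \<le> m)) c"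
      proof (cases "F \<inter> {..m} = {}")
        case True
        have "{w\<in>space (M n). X n w \<in> A \<and> X n w \<le> m} = {}" for n using True closure_subset[of A] unfolding F_def by auto
        then show ?thesis by (simp only: measure_empty exp_ub_zero)
      next
        case ne: False
        define b where "b = Sup (F \<inter> {..m})"
        have bb: "bdd_above (F \<inter> {..m})" by (rule bdd_aboveI[of _ m]) auto
        have "b \<in> F \<inter> {..m}" unfolding b_def
          by (rule closed_contains_Sup[OF ne bb]) (intro closed_Int cF closed_atMost)
        then have b: "b \<in> F" "b < m" using False by (auto simp: F_def less_le)
        show ?thesis
        proof (rule exp_ub_mono[OF lower[OF b(2)]])
          show "c \<le> I b" using b cle by (simp add: F_def)
          show "\<forall>\<^sub>F n in sequentially. \<P>(w in M n. X n w \<in> A \<and> X n w \<le> m)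
             \<le> \<P>(w in M n. X n w \<le> b)"
            using ge1
          proof eventually_elim
            case (elim n)
            interpret prob_space "M n" by (rule M[OF elim(1)])
            note X[OF elim, measurable]
            show ?case
            proof (rule finite_measure_mono)
              show "{w \<in> space (M n). X n w \<in> A \<and> X n w \<le> m} \<subseteq> {w \<in> space (M n). X n w \<le> b}"
                unfolding b_def using closure_subset[of A] by (auto simp: F_def intro!: cSup_upper bb[unfolded F_def])
            qed measurable
          qed
        qed
      qed
      show ?thesis
      proof (rule exp_ub_mono[OF exp_ub_add[OF up lo s(2)] order_refl])
        show "\<forall>\<^sub>F n in sequentially. P n \<le> \<P>(w in M n. X n w \<in> A \<and> m \<le> X n w) +
              \<P>(w in M n. X n w \<in> A \<and> X n w \<le> m)"
          using ge1
        proof eventually_elim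
          case (elim n)
          interpret prob_space "M n" by (rule M[OF elim(1)])
          note X[OF elim, measurable]
          have "P n \<le> measure (M n) ({w \<in> space (M n). X n w \<in> A \<and> m \<le> X n w} \<union> {w \<in> space (M n). X n w \<in> A \<and> X n w \<le> m})"
            unfolding P_def by (rule finite_measure_mono) auto
          also have "\<dots> \<le> \<P>(w in M n. X n w \<in> A \<and> m \<le> X n w) + \<P>(w in M n. X n w \<in> A \<and> X n w \<le> m)"
            by (rule measure_Un_le) measurable
          finally show ?case .
        qed
      qed
    qed
    then have 2: "limsup a \<le> - c" unfolding a_def by (rule limsup_le_of_exp_ub[OF _ s0]) (simp add: P_def)
    have 3: "liminf a \<le> limsup a" by (rule Liminf_le_Limsup) simp
    note this 1 2[unfolded c_def]
  } note key = this
  show ?thesis unfolding satisfies_LDP_def Let_def using key M X s(1) I(1) by auto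
qed

section \<open>Products of independent factors\<close>

text \<open>
  If \<open>D R \<ge> x\<close> and \<open>D\<close> is close to \<open>y\<close>, then \<open>R\<close> is at least about \<open>x/y\<close>, which costs \<open>gD y + gR (x/y)\<close>.
  Values of \<open>D\<close> below \<open>y0\<close> or above a large \<open>yN\<close> cost more than any prescribed bound, and the compact
  interval between them is covered by finitely many neighbourhoods on which, by semicontinuity, the cost
  is at least \<open>r\<close>.
\<close>

lemma product_upper_tail:
  fixes D R :: "nat \<Rightarrow> 'a \<Rightarrow> real" and gD gR :: "real \<Rightarrow> ereal"
  assumes M: "\<And>n. n \<ge> 1 \<Longrightarrow> prob_space (M n)"
    and D: "\<And>n. n \<ge> 1 \<Longrightarrow> D n \<in> borel_measurable (M n)"
    and R: "\<And>n. n \<ge> 1 \<Longrightarrow> R n \<in> borel_measurable (M n)"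
    and nonneg: "\<And>n w. 0 \<le> D n w" "\<And>n w. 0 \<le> R n w"
    and indep: "\<And>n A B. n \<ge> 1 \<Longrightarrow> A \<in> sets borel \<Longrightarrow> B \<in> sets borel \<Longrightarrow>
      \<P>(w in M n. D n w \<in> A \<and> R n w \<in> B) =
      \<P>(w in M n. D n w \<in> A) * \<P>(w in M n. R n w \<in> B)"
    and s: "filterlim s at_top sequentially"
    and y0: "0 < y0" "exp_ub s (\<lambda>n. \<P>(w in M n. D n w \<in> {..y0})) \<infinity>"
    and Dub: "\<And>y. exp_ub s (\<lambda>n. \<P>(w in M n. D n w \<in> {y..})) (gD y)"
    and Rub: "\<And>u. exp_ub s (\<lambda>n. \<P>(w in M n. R n w \<in> {u..})) (gR u)"
    and gD: "\<And>y. 0 \<le> gD y" "\<And>y r. ereal r < gD y \<Longrightarrow> \<forall>\<^sub>F e in at_right 0. ereal r < gD (y - e)"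
      "\<And>r. \<exists>y. ereal r < gD y"
    and gR: "\<And>u. 0 \<le> gR u" "\<And>u r. ereal r < gR u \<Longrightarrow> \<forall>\<^sub>F v in at_left u. ereal r < gR v"
    and x: "0 < x" and c: "\<And>y. y0 \<le> y \<Longrightarrow> c \<le> gD y + gR (x / y)"
  shows "exp_ub s (\<lambda>n. \<P>(w in M n. x \<le> D n w * R n w)) c"
  unfolding exp_ub_def
proof (intro allI impI)
  fix r0 assume "ereal r0 < c"
  then obtain r where r: "r0 < r" "ereal r < c" using ereal_dense2 by fastforce
  obtain yN where yN: "ereal r < gD yN" using gD(3) by blast
  \<comment> \<open>The cheapest values of both factors over the ball of radius \<open>e\<close> around \<open>y\<close> still cost more than \<open>r\<close>.\<close>
  have "\<exists>e>0. ereal r < gD (y - e) + gR (x / (y + e))" if y: "y0 \<le> y" for y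
  proof -
    have "ereal r < gD y + gR (x / y)" using r c[OF y] by (meson less_le_trans)
    then obtain r1 r2 where r12: "ereal r1 < gD y" "ereal r2 < gR (x / y)" "r = r1 + r2"
      using ereal_less_add_split gD(1) gR(1) by metis
    have f1: "\<forall>\<^sub>F e in at_right 0. ereal r1 < gD (y - e)" by (rule gD(2)[OF r12(1)])
    have ev0: "\<forall>\<^sub>F e in at_right (0::real). 0 < e" by (simp add: eventually_at_right_less)
    have "filterlim (\<lambda>e. x / (y + e)) (at_left (x / y)) (at_right 0)"
      unfolding filterlim_at
    proof
      have "((\<lambda>e. x / (y + e)) \<longlongrightarrow> x / (y + 0)) (at_right 0)" using y y0 by (intro tendsto_intros) auto
      then show "((\<lambda>e. x / (y + e)) \<longlongrightarrow> x / y) (at_right 0)" by simp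
      show "\<forall>\<^sub>F e in at_right 0. x / (y + e) \<in> {..<x / y} \<and> x / (y + e) \<noteq> x / y"
        using ev0
      proof eventually_elim
        case (elim e)
        have "x / (y + e) < x / y" using x y y0 elim by (intro divide_strict_left_mono) auto
        then show ?case using elim x by auto
      qed
    qed
    then have f2: "\<forall>\<^sub>F e in at_right 0. ereal r2 < gR (x / (y + e))"
      using gR(2)[OF r12(2)] unfolding filterlim_iff by blast
    have "\<forall>\<^sub>F e in at_right (0::real). 0 < e \<and> ereal r < gD (y - e) + gR (x / (y + e))"
      using f1 f2 ev0
    proof eventually_elim
      case (elim e)
      have "ereal r = ereal r1 + ereal r2" by (simp add: r12)
      also have "\<dots> < gD (y - e) + gR (x / (y + e))" using elim(1,2) by (rule ereal_add_strict_mono2)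
      finally show ?case using elim by simp
    qed
    then show ?thesis using eventually_happens[of _ "at_right (0::real)"] by (metis (lifting) trivial_limit_at_right_real)
  qed
  then obtain e where e: "\<And>y. y0 \<le> y \<Longrightarrow> 0 < e y" "\<And>y. y0 \<le> y \<Longrightarrow> ereal r < gD (y - e y) + gR (x / (y + e y))"
    by metis
  have "compact {y0..yN}" by simp
  then obtain F where F: "F \<subseteq> {y0..yN}" "finite F" "{y0..yN} \<subseteq> (\<Union>y\<in>F. ball y (e y))"
  proof (rule compactE_image)
    show "{y0..yN} \<subseteq> (\<Union>y\<in>{y0..yN}. ball y (e y))" using e(1) by force
  qed auto
  define P where "P n A B = \<P>(w in M n. D n w \<in> A \<and> R n w \<in> B)" for n A B
  have ub: "exp_ub s (\<lambda>n. (P n {..y0} UNIV + P n {yN..} UNIV) + (\<Sum>y\<in>F. P n {y - e y..} {x / (y + e y)..})) (ereal r)"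
  proof (intro exp_ub_add exp_ub_sum s F(2))
    show "exp_ub s (\<lambda>n. P n {..y0} UNIV) (ereal r)" "exp_ub s (\<lambda>n. P n {yN..} UNIV) (ereal r)"
      using exp_ub_mono[OF y0(2), of "ereal r"] exp_ub_mono[OF Dub[of yN] less_imp_le[OF yN]]
      by (auto simp: P_def)
    fix y assume "y \<in> F"
    then have y: "y0 \<le> y" using F by auto
    show "exp_ub s (\<lambda>n. P n {y - e y..} {x / (y + e y)..}) (ereal r)"
    proof (rule exp_ub_mono[OF exp_ub_mult[OF Dub[of "y - e y"] Rub[of "x / (y + e y)"] gD(1) gR(1)]])
      show "ereal r \<le> gD (y - e y) + gR (x / (y + e y))" using e(2)[OF y] by simp
      show "\<forall>\<^sub>F n in sequentially. P n {y - e y..} {x / (y + e y)..} \<le> \<P>(w in M n. D n w \<in> {y - e y..}) *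
        \<P>(w in M n. R n w \<in> {x / (y + e y)..})"
        using eventually_ge_at_top[of "1::nat"] by eventually_elim (simp only: P_def indep atLeast_borel)
    qed auto
  qed
  have "\<forall>\<^sub>F n in sequentially. \<P>(w in M n. x \<le> D n w * R n w) \<le>
     (P n {..y0} UNIV + P n {yN..} UNIV) + (\<Sum>y\<in>F. P n {y - e y..} {x / (y + e y)..})"
    using eventually_ge_at_top[of "1::nat"]
  proof eventually_elim
    case (elim n)
    interpret prob_space "M n" by (rule M[OF elim])
    note D[OF elim, measurable] R[OF elim, measurable]
    let ?S = "\<lambda>A B. {w\<in>space (M n). D n w \<in> A \<and> R n w \<in> B}"
    have mS: "?S A B \<in> sets (M n)" if [measurable]: "A \<in> sets borel" "B \<in> sets borel" for A B
      by measurable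
    have mU: "(\<Union>y\<in>F. ?S {y - e y..} {x / (y + e y)..}) \<in> sets (M n)"
      by (intro sets.finite_UN F(2) mS) auto
    have sub: "{w\<in>space (M n). x \<le> D n w * R n w} \<subseteq>
       (?S {..y0} UNIV \<union> ?S {yN..} UNIV) \<union> (\<Union>y\<in>F. ?S {y - e y..} {x / (y + e y)..})"
    proof (rule subsetI, rule ccontr)
      fix w assume w0: "w \<in> {w\<in>space (M n). x \<le> D n w * R n w}"
        "w \<notin> (?S {..y0} UNIV \<union> ?S {yN..} UNIV) \<union> (\<Union>y\<in>F. ?S {y - e y..} {x / (y + e y)..})"
      then have w: "x \<le> D n w * R n w" "w \<in> space (M n)" "y0 < D n w" "D n w < yN" by auto
      then have "D n w \<in> {y0..yN}" by auto
      then obtain y where y: "y \<in> F" "D n w \<in> ball y (e y)" using F(3) by blast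
      have pos: "0 < y + e y" using y F y0 e(1)[of y] by (force simp: add_pos_pos)
      have "x \<le> (y + e y) * R n w"
        using w(1) y(2) nonneg(2)[of n w] by (elim order_trans) (auto simp: dist_real_def intro!: mult_right_mono)
      then have "x / (y + e y) \<le> R n w" using pos by (simp add: field_simps)
      then show False using w0(2) w(2) y by (auto simp: dist_real_def)
    qed
    have "\<P>(w in M n. x \<le> D n w * R n w) \<le>
      measure (M n) ((?S {..y0} UNIV \<union> ?S {yN..} UNIV) \<union> (\<Union>y\<in>F. ?S {y - e y..} {x / (y + e y)..}))"
      by (rule finite_measure_mono[OF sub]) (intro sets.Un mU mS; simp)
    also have "\<dots> \<le> measure (M n) (?S {..y0} UNIV \<union> ?S {yN..} UNIV) + measure (M n) (\<Union>y\<in>F. ?S {y - e y..} {x / (y + e y)..})"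
      by (rule measure_Un_le) (intro sets.Un mU mS; simp)+
    also have "\<dots> \<le> (P n {..y0} UNIV + P n {yN..} UNIV) + (\<Sum>y\<in>F. P n {y - e y..} {x / (y + e y)..})"
      unfolding P_def by (intro add_mono measure_Un_le measure_UNION_le F(2) mS) auto
    finally show ?case .
  qed
  then have "exp_ub s (\<lambda>n. \<P>(w in M n. x \<le> D n w * R n w)) (ereal r)"
    by (rule exp_ub_mono[OF ub order_refl])
  then show "\<forall>\<^sub>F n in sequentially. \<P>(w in M n. x \<le> D n w * R n w) \<le> exp (- r0 * s n)"
    using r(1) unfolding exp_ub_def by simp
qed

text \<open>
  Small values of \<open>D\<close> are negligible, so a small product forces the second factor to be at most about
  \<open>x/m\<close>.
\<close>

lemma product_lower_tail:
  fixes D R :: "nat \<Rightarrow> 'a \<Rightarrow> real"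
  assumes M: "\<And>n. n \<ge> 1 \<Longrightarrow> prob_space (M n)"
    and D: "\<And>n. n \<ge> 1 \<Longrightarrow> D n \<in> borel_measurable (M n)"
    and R: "\<And>n. n \<ge> 1 \<Longrightarrow> R n \<in> borel_measurable (M n)"
    and nonneg: "\<And>n w. 0 \<le> D n w" "\<And>n w. 0 \<le> R n w"
    and s: "filterlim s at_top sequentially" and m: "0 < m"
    and Dub: "\<And>y. y < m \<Longrightarrow> exp_ub s (\<lambda>n. \<P>(w in M n. D n w \<in> {..y})) \<infinity>"
    and Rub: "\<And>u. u < 1 \<Longrightarrow> exp_ub s (\<lambda>n. \<P>(w in M n. R n w \<in> {..u})) (hR u)"
    and hR: "\<And>u r. u < 1 \<Longrightarrow> ereal r < hR u \<Longrightarrow> \<forall>\<^sub>F v in at_right u. ereal r < hR v"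
    and x: "x < m"
  shows "exp_ub s (\<lambda>n. \<P>(w in M n. D n w * R n w \<le> x)) (hR (max 0 (x / m)))"
  unfolding exp_ub_def
proof (intro allI impI)
  fix r assume r: "ereal r < hR (max 0 (x / m))"
  define z where "z = max 0 x"
  have zm: "max 0 (x / m) = z / m" using m by (auto simp: z_def max_def field_simps)
  have z: "0 \<le> z" "z < m" using m x by (auto simp: z_def)
  then have zm1: "z / m < 1" using m by simp
  have "\<forall>\<^sub>F v in at_right (z/m). ereal r < hR v" using hR[OF zm1] r zm by simp
  then have "\<forall>\<^sub>F v in at_right (z/m). ereal r < hR v \<and> v < 1"
    using eventually_at_right_real[OF zm1] by eventually_elim auto
  moreover have "\<forall>\<^sub>F v in at_right (z/m). z/m < v" by (simp add: eventually_at_right_less)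
  ultimately have "\<forall>\<^sub>F v in at_right (z/m). ereal r < hR v \<and> v < 1 \<and> z/m < v" by eventually_elim auto
  then obtain v where v: "ereal r < hR v" "v < 1" "z / m < v"
    using eventually_happens[of _ "at_right (z/m)"] by (metis (lifting) trivial_limit_at_right_real)
  then have v0: "0 < v" using z m by (meson divide_nonneg_pos le_less_trans)
  have "z / v < m" using v v0 m by (simp add: field_simps)
  then obtain y where y: "y < m" "z / v < y" using dense by blast
  then have y0: "0 < y" using z v0 by (meson divide_nonneg_pos le_less_trans)
  have *: "exp_ub s (\<lambda>n. \<P>(w in M n. D n w \<in> {..y}) + \<P>(w in M n. R n w \<in> {..v})) (hR v)"
    by (rule exp_ub_add[OF exp_ub_mono[OF Dub[OF y(1)]] Rub[OF v(2)] s]) auto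
  have "\<forall>\<^sub>F n in sequentially. \<P>(w in M n. D n w * R n w \<le> x) \<le>
      \<P>(w in M n. D n w \<in> {..y}) + \<P>(w in M n. R n w \<in> {..v})"
    using eventually_ge_at_top[of "1::nat"]
  proof eventually_elim
    case (elim n)
    interpret prob_space "M n" by (rule M[OF elim])
    note D[OF elim, measurable] R[OF elim, measurable]
    have "{w\<in>space (M n). D n w * R n w \<le> x} \<subseteq> {w\<in>space (M n). D n w \<in> {..y}} \<union> {w\<in>space (M n). R n w \<in> {..v}}"
    proof (safe, simp_all add: not_le)
      fix w assume w: "D n w * R n w \<le> x" "v < R n w"
      show "D n w \<le> y"
      proof (rule ccontr)
        assume "\<not> D n w \<le> y"
        then have "y * v \<le> D n w * R n w" using w v0 y0 by (intro mult_mono) auto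
        moreover have "z < y * v" using y v0 by (simp add: field_simps)
        ultimately show False using w by (simp add: z_def)
      qed
    qed
    then have "\<P>(w in M n. D n w * R n w \<le> x) \<le> measure (M n) ({w\<in>space (M n). D n w \<in> {..y}} \<union> {w\<in>space (M n). R n w \<in> {..v}})"
      by (rule finite_measure_mono) measurable
    also have "\<dots> \<le> \<P>(w in M n. D n w \<in> {..y}) + \<P>(w in M n. R n w \<in> {..v})"
      by (rule measure_Un_le) measurable
    finally show ?case .
  qed
  from exp_ub_mono[OF * order_refl this] v(1)
  show "\<forall>\<^sub>F n in sequentially. \<P>(w in M n. D n w * R n w \<le> x) \<le> exp (- r * s n)"
    unfolding exp_ub_def by blast
qed

text \<open>
  Multiplication is continuous at \<open>(y, u)\<close>, so a small box around that point is mapped close to \<open>y * u\<close>.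
\<close>

lemma product_local:
  fixes D R :: "nat \<Rightarrow> 'a \<Rightarrow> real"
  assumes M: "\<And>n. n \<ge> 1 \<Longrightarrow> prob_space (M n)"
    and D: "\<And>n. n \<ge> 1 \<Longrightarrow> D n \<in> borel_measurable (M n)"
    and R: "\<And>n. n \<ge> 1 \<Longrightarrow> R n \<in> borel_measurable (M n)"
    and indep: "\<And>n A B. n \<ge> 1 \<Longrightarrow> A \<in> sets borel \<Longrightarrow> B \<in> sets borel \<Longrightarrow>
      \<P>(w in M n. D n w \<in> A \<and> R n w \<in> B) =
      \<P>(w in M n. D n w \<in> A) * \<P>(w in M n. R n w \<in> B)"
    and Dlb: "\<And>d. 0 < d \<Longrightarrow> exp_lb s (\<lambda>n. \<P>(w in M n. D n w \<in> ball y d)) cD"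
    and Rlb: "\<And>d. 0 < d \<Longrightarrow> exp_lb s (\<lambda>n. \<P>(w in M n. R n w \<in> ball u d)) cR"
    and c: "0 \<le> cD" "0 \<le> cR" and d: "0 < d"
  shows "exp_lb s (\<lambda>n. \<P>(w in M n. \<bar>D n w * R n w - y * u\<bar> < d)) (cD + cR)"
proof -
  have "((\<lambda>z. fst z * snd z) \<longlongrightarrow> fst (y, u) * snd (y, u)) (nhds (y, u))"
    by (intro tendsto_mult tendsto_fst tendsto_snd filterlim_ident)
  then have "((\<lambda>z. fst z * snd z) \<longlongrightarrow> y * u) (nhds (y, u))" by simp
  then have "\<forall>\<^sub>F z in nhds (y, u). dist (fst z * snd z) (y * u) < d" using d by (rule tendstoD)
  then obtain P Q where PQ: "eventually P (nhds y)" "eventually Q (nhds u)"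
     "\<And>a b. P a \<Longrightarrow> Q b \<Longrightarrow> dist (a * b) (y * u) < d"
    unfolding nhds_prod eventually_prod_filter by auto
  then obtain d1 d2 where d12: "0 < d1" "0 < d2" "\<And>a. a \<in> ball y d1 \<Longrightarrow> P a" "\<And>b. b \<in> ball u d2 \<Longrightarrow> Q b"
    unfolding eventually_nhds_metric by (auto simp: dist_commute)
  show ?thesis
  proof (rule exp_lb_mono[OF exp_lb_mult[OF Dlb[OF d12(1)] Rlb[OF d12(2)] c] order_refl])
    show "\<forall>\<^sub>F n in sequentially. \<P>(w in M n. D n w \<in> ball y d1) * \<P>(w in M n. R n w \<in> ball u d2)
      \<le> \<P>(w in M n. \<bar>D n w * R n w - y * u\<bar> < d)"
      using eventually_ge_at_top[of "1::nat"]
    proof eventually_elim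
      case (elim n)
      interpret prob_space "M n" by (rule M[OF elim])
      note D[OF elim, measurable] R[OF elim, measurable]
      have "\<P>(w in M n. D n w \<in> ball y d1) * \<P>(w in M n. R n w \<in> ball u d2) =
         \<P>(w in M n. D n w \<in> ball y d1 \<and> R n w \<in> ball u d2)"
        by (rule indep[OF elim, symmetric]) auto
      also have "\<dots> \<le> \<P>(w in M n. \<bar>D n w * R n w - y * u\<bar> < d)"
        by (rule finite_measure_mono) (use PQ(3) d12(3,4) in \<open>auto simp: dist_real_def\<close>)
      finally show ?case .
    qed
  qed
qed

section \<open>The rate functions\<close>

text \<open>
  Semicontinuity follows from closed sublevel sets, hence only their compactness has to be checked.
\<close>

lemma rate_functionI:
  assumes "\<And>x. 0 \<le> I x" "\<And>\<alpha>::real. compact {x. I x \<le> ereal \<alpha>}"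
  shows "rate_function I"
proof -
  have "I x \<le> Liminf (at x) I" for x
  proof (rule ccontr)
    assume "\<not> ?thesis"
    then obtain z where z: "Liminf (at x) I < ereal z" "ereal z < I x"
      using ereal_dense2[of "Liminf (at x) I" "I x"] by (auto simp: not_le)
    have "open (- {x. I x \<le> ereal z})" using assms(2)[of z] by (simp add: compact_imp_closed open_Compl)
    then have "\<forall>\<^sub>F y in at x. y \<in> - {x. I x \<le> ereal z}" using z by (intro eventually_at_in_open') auto
    then have "\<forall>\<^sub>F y in at x. ereal z \<le> I y" by eventually_elim auto
    then have "ereal z \<le> Liminf (at x) I" by (rule Liminf_bounded)
    with z show False by simp
  qed
  with assms show ?thesis by (simp add: rate_function_def)
qed

text \<open>
  The Legendre transform, at \<open>u\<^sup>2\<close>, of the cumulant generating function \<open>- log (1 - 2t) / 2\<close> of the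
  square of a standard Gaussian variable.
\<close>

definition chi_rate :: "real \<Rightarrow> real" where
  "chi_rate u = (u\<^sup>2 - 1) / 2 - ln u"

lemma chi_rate_1 [simp]: "chi_rate 1 = 0"
  by (simp add: chi_rate_def)

text \<open>
  Strict positivity away from one and the growth at infinity both come from this quadratic lower bound.
\<close>

lemma chi_rate_ge:
  assumes "0 < u" shows "(u - 1)\<^sup>2 / 2 \<le> chi_rate u"
proof -
  have "(u - 1)\<^sup>2 / 2 = (u\<^sup>2 - 1) / 2 - (u - 1)" by (simp add: power2_eq_square field_simps)
  then show ?thesis using ln_le_minus_one[OF assms] unfolding chi_rate_def by linarith
qed

lemma chi_rate_nonneg: "0 < u \<Longrightarrow> 0 \<le> chi_rate u"
  using chi_rate_ge[of u] by (smt (verit) zero_le_power2 divide_nonneg_nonneg)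

lemma chi_rate_pos: "0 < u \<Longrightarrow> u \<noteq> 1 \<Longrightarrow> 0 < chi_rate u"
  using chi_rate_ge[of u] zero_less_power2[of "u - 1"] by (smt (verit) half_gt_zero)

lemma chi_rate_mono:
  assumes "1 \<le> u" "u \<le> v" shows "chi_rate u \<le> chi_rate v"
proof -
  have "ln (v / u) \<le> v / u - 1" using assms by (intro ln_le_minus_one) auto
  also have "v / u - 1 = (v - u) / u" using assms by (simp add: field_simps)
  also have "\<dots> \<le> (v - u) * ((v + u) / 2)"
  proof -
    have "1 / u \<le> 1" "1 \<le> (v + u) / 2" using assms by auto
    then have "1 / u \<le> (v + u) / 2" by (rule order_trans)
    then have "(v - u) * (1 / u) \<le> (v - u) * ((v + u) / 2)" using assms by (intro mult_left_mono) auto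
    then show ?thesis by simp
  qed
  also have "\<dots> = (v\<^sup>2 - u\<^sup>2) / 2" by (simp add: power2_eq_square algebra_simps)
  finally show ?thesis using assms by (simp add: chi_rate_def ln_div field_simps)
qed

lemma chi_rate_sublevel:
  assumes "0 < u" "chi_rate u \<le> b"
  shows "exp (- b - 1/2) \<le> u" "u \<le> 2 + 2 * \<bar>b\<bar>"
proof -
  have "- b - 1/2 \<le> ln u" using assms(2) divide_nonneg_pos[OF zero_le_power2[of u], of 2]
    unfolding chi_rate_def diff_divide_distrib by linarith
  then show "exp (- b - 1/2) \<le> u" using assms(1) by (simp add: ln_ge_iff)
  show "u \<le> 2 + 2 * \<bar>b\<bar>"
  proof (cases "u \<le> 2")
    case False
    have "(u - 1) * 1 \<le> (u - 1) * (u - 1)" using False by (intro mult_left_mono) auto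
    also have "\<dots> \<le> 2 * b" using chi_rate_ge[OF assms(1)] assms(2) by (simp add: power2_eq_square)
    finally show ?thesis by simp
  qed auto
qed

lemma continuous_on_chi_rate:
  assumes "continuous_on S f" "\<And>x. x \<in> S \<Longrightarrow> 0 < f x"
  shows "continuous_on S (\<lambda>x. chi_rate (f x))"
  unfolding chi_rate_def using assms by (intro continuous_intros) (auto simp: less_imp_neq[symmetric] dest: assms(2))

lemma rate_function_chi:
  assumes m: "0 < m"
  shows "rate_function (\<lambda>x. if x > 0 then ereal (chi_rate (x / m)) else \<infinity>)"
proof (rule rate_functionI)
  fix a :: real
  let ?C = "{m * exp (- a - 1/2)..m * (2 + 2 * \<bar>a\<bar>)}"
  have lo: "0 < m * exp (- a - 1/2)" using m by simp
  have "continuous_on ?C (\<lambda>x. chi_rate (x / m))"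
    using m by (intro continuous_on_chi_rate continuous_intros) (auto intro!: divide_pos_pos intro: less_le_trans[OF lo])
  then have "closed {x \<in> ?C. chi_rate (x / m) \<le> a}"
    by (rule continuous_on_closed_Collect_le) auto
  moreover have "bounded {x \<in> ?C. chi_rate (x / m) \<le> a}" by (rule bounded_subset[of ?C]) auto
  ultimately have "compact {x \<in> ?C. chi_rate (x / m) \<le> a}" by (simp add: compact_eq_bounded_closed)
  also have "{x \<in> ?C. chi_rate (x / m) \<le> a} = {x. (if x > 0 then ereal (chi_rate (x / m)) else \<infinity>) \<le> ereal a}"
    (is "?A = ?B")
  proof
    show "?A \<subseteq> ?B" using less_le_trans[OF lo] by auto
    show "?B \<subseteq> ?A"
    proof
      fix x assume "x \<in> ?B"
      then have x: "0 < x" "chi_rate (x / m) \<le> a" by (auto split: if_splits)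
      show "x \<in> ?A" using chi_rate_sublevel[of "x/m" a] x m by (simp add: field_simps)
    qed
  qed
  finally show "compact {x. (if x > 0 then ereal (chi_rate (x / m)) else \<infinity>) \<le> ereal a}" .
qed (use m in \<open>auto intro: chi_rate_nonneg\<close>)

text \<open>
  The cost at speed \<open>n^(p/2)\<close> of one coordinate that raises the mean square from \<open>m\<^sup>2\<close> to \<open>y\<^sup>2\<close>.
\<close>

definition jump_rate :: "real \<Rightarrow> real \<Rightarrow> real \<Rightarrow> real" where
  "jump_rate p m y = 1 / p * (y\<^sup>2 - m\<^sup>2) powr (p / 2)"

lemma jump_rate_nonneg: "0 < p \<Longrightarrow> 0 \<le> jump_rate p m y"
  by (simp add: jump_rate_def)

lemma jump_rate_eq_0 [simp]: "jump_rate p m m = 0"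
  by (simp add: jump_rate_def)

lemma jump_rate_mono:
  assumes "0 < p" "0 \<le> m" "m \<le> y" "y \<le> z" shows "jump_rate p m y \<le> jump_rate p m z"
  unfolding jump_rate_def using assms by (intro mult_left_mono powr_mono2 diff_mono power_mono) auto

lemma jump_rate_sublevel:
  assumes "0 < p" "0 \<le> m" "m \<le> y" "jump_rate p m y \<le> b"
  shows "y \<le> 1 + m\<^sup>2 + (p * \<bar>b\<bar>) powr (2 / p)"
proof -
  have ym: "0 \<le> y\<^sup>2 - m\<^sup>2" using assms by (simp add: power_mono)
  have "(y\<^sup>2 - m\<^sup>2) powr (p / 2) \<le> p * b"
    using assms(1,4) by (simp add: jump_rate_def field_simps)
  also have "\<dots> \<le> p * \<bar>b\<bar>" using assms(1) by (intro mult_left_mono) auto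
  finally have "(y\<^sup>2 - m\<^sup>2) powr (p / 2) \<le> p * \<bar>b\<bar>" .
  then have "((y\<^sup>2 - m\<^sup>2) powr (p / 2)) powr (2 / p) \<le> (p * \<bar>b\<bar>) powr (2 / p)"
    using assms by (intro powr_mono2) auto
  then have "y\<^sup>2 - m\<^sup>2 \<le> (p * \<bar>b\<bar>) powr (2 / p)" using assms(1) ym by (simp add: powr_powr)
  moreover have "y \<le> 1 + y\<^sup>2" using sum_power2_ge_zero[of "y - 1/2" 0] by (simp add: power2_eq_square algebra_simps)
  ultimately show ?thesis by simp
qed

lemma continuous_on_jump_rate:
  assumes "0 < p" "0 \<le> m" "continuous_on S f" "\<And>x. x \<in> S \<Longrightarrow> m \<le> f x"
  shows "continuous_on S (\<lambda>x. jump_rate p m (f x))"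
  unfolding jump_rate_def
  using assms by (intro continuous_intros continuous_on_powr') (auto intro!: power_mono)

lemma rate_function_jump:
  assumes p: "0 < p" and m: "0 < m"
  shows "rate_function (\<lambda>x. if x \<ge> m then ereal (jump_rate p m x) else \<infinity>)"
proof (rule rate_functionI)
  fix a :: real
  let ?C = "{m..1 + m\<^sup>2 + (p * \<bar>a\<bar>) powr (2 / p)}"
  have "continuous_on ?C (\<lambda>x. jump_rate p m x)"
    using p m by (intro continuous_on_jump_rate continuous_intros) auto
  then have "closed {x \<in> ?C. jump_rate p m x \<le> a}"
    by (rule continuous_on_closed_Collect_le) auto
  moreover have "bounded {x \<in> ?C. jump_rate p m x \<le> a}" by (rule bounded_subset[of ?C]) auto
  ultimately have "compact {x \<in> ?C. jump_rate p m x \<le> a}" by (simp add: compact_eq_bounded_closed)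
  also have "{x \<in> ?C. jump_rate p m x \<le> a} = {x. (if x \<ge> m then ereal (jump_rate p m x) else \<infinity>) \<le> ereal a}"
    using jump_rate_sublevel[OF p less_imp_le[OF m]] by auto
  finally show "compact {x. (if x \<ge> m then ereal (jump_rate p m x) else \<infinity>) \<le> ereal a}" .
qed (use p m in \<open>auto intro: jump_rate_nonneg\<close>)

text \<open>
  A bound on the sum bounds both rates, since they are nonnegative. The bound on the jump rate confines
  \<open>y\<close> to a compact interval, and then the bound on the chi rate confines \<open>x = y * (x/y)\<close> to a compact
  interval of positive numbers.
\<close>

lemma compact_joint_sublevel:
  assumes p: "0 < p" and m: "0 < m"
  shows "compact {z. 0 < fst z \<and> m \<le> snd z \<and> chi_rate (fst z / snd z) + jump_rate p m (snd z) \<le> b}"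
    (is "compact ?K")
proof -
  define Y where "Y = 1 + m\<^sup>2 + (p * \<bar>b\<bar>) powr (2 / p)"
  define C where "C = {m * exp (- b - 1/2)..Y * (2 + 2 * \<bar>b\<bar>)} \<times> {m..Y}"
  have pos: "0 < fst z" "0 < snd z" if "z \<in> C" for z
    using that m by (auto simp: C_def intro: less_le_trans[of 0 "m * exp (- b - 1/2)"])
  have "continuous_on C (\<lambda>z. chi_rate (fst z / snd z) + jump_rate p m (snd z))"
    using p m pos by (intro continuous_on_chi_rate continuous_on_jump_rate continuous_intros) (auto simp: C_def)
  moreover have "compact C" unfolding C_def by (intro compact_Times compact_Icc)
  ultimately have cl: "closed {z \<in> C. chi_rate (fst z / snd z) + jump_rate p m (snd z) \<le> b}"
    by (intro continuous_on_closed_Collect_le continuous_on_const compact_imp_closed)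
  have "bounded {z \<in> C. chi_rate (fst z / snd z) + jump_rate p m (snd z) \<le> b}"
    by (rule bounded_subset[OF compact_imp_bounded[OF \<open>compact C\<close>]]) auto
  with cl have "compact {z \<in> C. chi_rate (fst z / snd z) + jump_rate p m (snd z) \<le> b}"
    by (simp add: compact_eq_bounded_closed)
  also have "{z \<in> C. chi_rate (fst z / snd z) + jump_rate p m (snd z) \<le> b} = ?K"
  proof
    show "?K \<subseteq> {z \<in> C. chi_rate (fst z / snd z) + jump_rate p m (snd z) \<le> b}"
    proof (safe, simp_all)
      fix x y assume xy: "0 < x" "m \<le> y" "chi_rate (x / y) + jump_rate p m y \<le> b"
      have y0: "0 < y" using xy m by simp
      have c: "chi_rate (x / y) \<le> b" using jump_rate_nonneg[OF p, of m y] xy by linarith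
      have j: "jump_rate p m y \<le> b" using chi_rate_nonneg[of "x / y"] xy y0 by simp
      have yY: "y \<le> Y" unfolding Y_def using jump_rate_sublevel[OF p _ xy(2) j] m by simp
      have "exp (- b - 1/2) \<le> x / y" "x / y \<le> 2 + 2 * \<bar>b\<bar>" using chi_rate_sublevel[OF _ c] xy y0 by auto
      then have "y * exp (- b - 1/2) \<le> x" "x \<le> y * (2 + 2 * \<bar>b\<bar>)" using y0 by (auto simp: field_simps)
      moreover have "m * exp (- b - 1/2) \<le> y * exp (- b - 1/2)" "y * (2 + 2 * \<bar>b\<bar>) \<le> Y * (2 + 2 * \<bar>b\<bar>)"
        using xy yY by (intro mult_right_mono; simp)+
      ultimately have "m * exp (- b - 1/2) \<le> x" "x \<le> Y * (2 + 2 * \<bar>b\<bar>)" by linarith+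
      then show "(x, y) \<in> C" using xy yY by (auto simp: C_def)
    qed
  qed (use pos in \<open>auto simp: C_def\<close>)
  finally show ?thesis .
qed

text \<open>
  The sublevel set at level \<open>a\<close> is the intersection over \<open>b > a\<close> of the projections of the compact sets
  of pairs \<open>(x, y)\<close> with total cost at most \<open>b\<close>.
\<close>

lemma rate_function_joint:
  assumes p: "0 < p" and m: "0 < m"
  shows "rate_function (\<lambda>x. if x > 0 then (INF y\<in>{m..}. ereal (chi_rate (x / y) + jump_rate p m y)) else \<infinity>)"
    (is "rate_function ?I")
proof (rule rate_functionI)
  define K where "K b = {z. 0 < fst z \<and> m \<le> snd z \<and> chi_rate (fst z / snd z) + jump_rate p m (snd z) \<le> b}" for b
  have cK: "compact (fst ` K b)" for b
    unfolding K_def by (intro compact_continuous_image continuous_intros compact_joint_sublevel p m)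
  fix a :: real
  have "{x. ?I x \<le> ereal a} = (\<Inter>b\<in>{a<..}. fst ` K b)"
  proof (intro equalityI subsetI)
    fix x assume "x \<in> {x. ?I x \<le> ereal a}"
    then have x: "0 < x" "(INF y\<in>{m..}. ereal (chi_rate (x / y) + jump_rate p m y)) \<le> ereal a" by (auto split: if_splits)
    show "x \<in> (\<Inter>b\<in>{a<..}. fst ` K b)"
    proof
      fix b assume "b \<in> {a<..}"
      then have "(INF y\<in>{m..}. ereal (chi_rate (x / y) + jump_rate p m y)) < ereal b" using x(2) by (auto intro: le_less_trans)
      then obtain y where "y \<in> {m..}" "ereal (chi_rate (x / y) + jump_rate p m y) < ereal b" by (auto simp: INF_less_iff)
      then have "(x, y) \<in> K b" using x(1) by (auto simp: K_def)
      then show "x \<in> fst ` K b" by force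
    qed
  next
    fix x assume x: "x \<in> (\<Inter>b\<in>{a<..}. fst ` K b)"
    have "x \<in> fst ` K (a + 1)" using x by auto
    then have "0 < x" by (auto simp: K_def)
    have *: "(INF y\<in>{m..}. ereal (chi_rate (x / y) + jump_rate p m y)) \<le> ereal b" if b: "a < b" for b
    proof -
      obtain y where "y \<in> {m..}" "chi_rate (x / y) + jump_rate p m y \<le> b"
      proof -
        have "x \<in> fst ` K b" using x b by auto
        then show ?thesis by (auto simp: K_def intro!: that)
      qed
      then show ?thesis by (intro INF_lower2[of y]) auto
    qed
    have "(INF y\<in>{m..}. ereal (chi_rate (x / y) + jump_rate p m y)) \<le> ereal a"
    proof (rule ccontr)
      assume "\<not> ?thesis"
      then have "ereal a < (INF y\<in>{m..}. ereal (chi_rate (x / y) + jump_rate p m y))" by (simp add: not_le)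
      then obtain z where "ereal a < ereal z" "ereal z < (INF y\<in>{m..}. ereal (chi_rate (x / y) + jump_rate p m y))"
        using ereal_dense2 by blast
      with *[of z] show False by (meson leD less_ereal.simps(1))
    qed
    with \<open>0 < x\<close> show "x \<in> {x. ?I x \<le> ereal a}" by simp
  qed
  also have "compact \<dots>"
  proof (rule compact_Inter)
    fix S assume "S \<in> (\<lambda>b. fst ` K b) ` {a<..}"
    then show "compact S" using cK by auto
  qed simp
  finally show "compact {x. ?I x \<le> ereal a}" .
next
  fix x
  have "0 \<le> chi_rate (x / y) + jump_rate p m y" if "0 < x" "m \<le> y" for y
    using that p m by (intro add_nonneg_nonneg chi_rate_nonneg jump_rate_nonneg divide_pos_pos) auto
  then show "0 \<le> ?I x" by (auto intro!: INF_greatest)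
qed

section \<open>The p-Gaussian distribution\<close>

text \<open>
  The total mass of \<open>exp (- \<bar>y\<bar>\<^sup>p/p)\<close>.
\<close>

definition gg_const :: "real \<Rightarrow> real" where
  "gg_const p = 2 * p powr (1 / p - 1) * Gamma (1 / p)"

text \<open>
  The \<open>p\<close>-Gaussian (generalised Gaussian) distribution.
\<close>

definition gg :: "real \<Rightarrow> real measure" where
  "gg p = density lborel (\<lambda>y. ennreal (exp (- (\<bar>y\<bar> powr p / p)) / gg_const p))"

lemma space_gg [simp]: "space (gg p) = UNIV" and sets_gg [measurable_cong, simp]: "sets (gg p) = sets borel"
  by (simp_all add: gg_def)

lemma gg_const_pos: "0 < p \<Longrightarrow> 0 < gg_const p"
  by (simp add: gg_const_def)

lemma pos_not_nonpos_Int: "0 < (x::real) \<Longrightarrow> x \<notin> \<int>\<^sub>\<le>\<^sub>0"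
  by (auto elim!: nonpos_Ints_cases)

text \<open>
  The substitution \<open>x = y\<^sup>p/p\<close> turns the integral into Euler's integral for the Gamma function.
\<close>

lemma nn_integral_half_moment:
  assumes p: "0 < p" and a: "0 \<le> a"
  shows "(\<integral>\<^sup>+y. ennreal (y powr a * exp (- (y powr p / p))) * indicator {0<..} y \<partial>lborel) =
    ennreal (p powr ((a + 1) / p - 1) * Gamma ((a + 1) / p))"
proof -
  define b where "b = (a + 1) / p"
  have b: "0 < b" using p a by (simp add: b_def)
  define f where "f x = x powr (b - 1) / exp x" for x :: real
  define g where "g y = y powr p / p" for y :: real
  have "(f has_integral Gamma b) {0..}" unfolding f_def by (rule Gamma_integral_real[OF b])
  moreover have "negligible {x \<in> {0..} - {0<..}. f x \<noteq> 0}" "negligible {x \<in> {0<..} - {0..}. f x \<noteq> 0}"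
    by (rule negligible_subset[of "{0}"]; force)+
  ultimately have fi: "(f has_integral Gamma b) {0<..}"
    using has_integral_spike_set_eq by blast
  have fabs: "f absolutely_integrable_on {0<..}"
    by (rule nonnegative_absolutely_integrable_1) (use fi in \<open>auto simp: f_def has_integral_integrable\<close>)
  have img: "g ` {0<..} = {0<..}"
  proof
    show "g ` {0<..} \<subseteq> {0<..}" using p by (auto simp: g_def)
    show "{0<..} \<subseteq> g ` {0<..}"
    proof
      fix x :: real assume x: "x \<in> {0<..}"
      have "g ((p * x) powr (1 / p)) = x" using p x by (simp add: g_def powr_powr)
      moreover have "(p * x) powr (1 / p) \<in> {0<..}" using p x by simp
      ultimately show "x \<in> g ` {0<..}" by (metis imageI)
    qed
  qed
  have inj: "inj_on g {0<..}"
  proof (rule inj_onI)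
    fix x y :: real assume xy: "x \<in> {0<..}" "y \<in> {0<..}" "g x = g y"
    then have "(x powr p) powr (1 / p) = (y powr p) powr (1 / p)" using p by (simp add: g_def)
    then show "x = y" using xy p by (simp add: powr_powr)
  qed
  have der: "(g has_field_derivative (y powr (p - 1))) (at y within {0<..})" if "y \<in> {0<..}" for y
  proof -
    have "(g has_field_derivative (p * y powr (p - 1) / p)) (at y)"
      unfolding g_def using has_real_derivative_powr[of y p] that by (intro DERIV_cdivide) auto
    then show ?thesis using p by (simp add: has_field_derivative_at_within)
  qed
  have "(\<lambda>y. \<bar>y powr (p - 1)\<bar> * f (g y)) absolutely_integrable_on {0<..} \<and>
      integral {0<..} (\<lambda>y. \<bar>y powr (p - 1)\<bar> * f (g y)) = Gamma b"
    using has_absolute_integral_change_of_variables_1'[OF _ der inj, of f "Gamma b"] fabs fi img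
    by (auto simp: integral_unique)
  then have "((\<lambda>y. \<bar>y powr (p - 1)\<bar> * f (g y)) has_integral Gamma b) {0<..}"
    using absolutely_integrable_on_def has_integral_iff by blast
  then have "((\<lambda>y. p powr (b - 1) * (\<bar>y powr (p - 1)\<bar> * f (g y))) has_integral (p powr (b - 1) * Gamma b)) {0<..}"
    by (rule has_integral_mult_right)
  also have "?this \<longleftrightarrow> ((\<lambda>y. y powr a * exp (- (y powr p / p))) has_integral (p powr (b - 1) * Gamma b)) {0<..}"
  proof (rule has_integral_cong)
    fix y :: real assume y: "y \<in> {0<..}"
    have "(y powr p / p) powr (b - 1) = y powr (p * (b - 1)) / p powr (b - 1)"
      using y p by (simp add: powr_divide powr_powr)
    moreover have "(p - 1) + p * (b - 1) = a" using p by (simp add: b_def field_simps)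
    then have "y powr (p - 1) * y powr (p * (b - 1)) = y powr a" by (metis powr_add)
    moreover have "p powr (b - 1) * (\<bar>y powr (p - 1)\<bar> * f (g y)) =
        (y powr (p - 1) * (p powr (b - 1) * (y powr p / p) powr (b - 1))) * exp (- (y powr p / p))"
      by (simp add: f_def g_def exp_minus divide_inverse)
    ultimately show "p powr (b - 1) * (\<bar>y powr (p - 1)\<bar> * f (g y)) = y powr a * exp (- (y powr p / p))"
      using p by simp
  qed
  finally have "((\<lambda>y. if y \<in> {0<..} then y powr a * exp (- (y powr p / p)) else 0) has_integral (p powr (b - 1) * Gamma b)) UNIV"
    by (simp only: has_integral_restrict_UNIV)
  then have "(\<integral>\<^sup>+y. ennreal (if y \<in> {0<..} then y powr a * exp (- (y powr p / p)) else 0) \<partial>lborel) = ennreal (p powr (b - 1) * Gamma b)"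
    by (intro nn_integral_has_integral_lborel) auto
  also have "(\<integral>\<^sup>+y. ennreal (if y \<in> {0<..} then y powr a * exp (- (y powr p / p)) else 0) \<partial>lborel) =
     (\<integral>\<^sup>+y. ennreal (y powr a * exp (- (y powr p / p))) * indicator {0<..} y \<partial>lborel)"
    by (intro nn_integral_cong) auto
  finally show ?thesis by (simp add: b_def)
qed

lemma nn_integral_moment:
  assumes p: "0 < p" and a: "0 \<le> a"
  shows "(\<integral>\<^sup>+y. ennreal (\<bar>y\<bar> powr a * exp (- (\<bar>y\<bar> powr p / p))) \<partial>lborel) =
    ennreal (2 * p powr ((a + 1) / p - 1) * Gamma ((a + 1) / p))"
proof -
  let ?f = "\<lambda>y. ennreal (\<bar>y\<bar> powr a * exp (- (\<bar>y\<bar> powr p / p)))"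
  let ?I = "ennreal (p powr ((a + 1) / p - 1) * Gamma ((a + 1) / p))"
  have pos: "(\<integral>\<^sup>+y. ?f y * indicator {0<..} y \<partial>lborel) = ?I"
    unfolding nn_integral_half_moment[OF p a, symmetric] by (intro nn_integral_cong) (auto simp: indicator_def)
  have "(\<integral>\<^sup>+y. ?f y * indicator {..<0} y \<partial>lborel) = (\<integral>\<^sup>+y. ?f y * indicator {0<..} y \<partial>lborel)"
    by (subst nn_integral_real_affine[of _ "-1" 0]) (auto intro!: nn_integral_cong simp: indicator_def)
  then have neg: "(\<integral>\<^sup>+y. ?f y * indicator {..<0} y \<partial>lborel) = ?I" using pos by simp
  have "(\<integral>\<^sup>+y. ?f y \<partial>lborel) = (\<integral>\<^sup>+y. ?f y * indicator {0<..} y + ?f y * indicator {..<0} y \<partial>lborel)"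
    by (intro nn_integral_cong) (auto simp: indicator_def)
  also have "\<dots> = ?I + ?I" unfolding pos[symmetric] neg[symmetric]
    by (subst nn_integral_add) (auto simp: pos neg)
  also have "\<dots> = ennreal (2 * p powr ((a + 1) / p - 1) * Gamma ((a + 1) / p))"
    using p a by (subst ennreal_plus[symmetric]) (auto intro!: mult_nonneg_nonneg less_imp_le[OF Gamma_real_pos])
  finally show ?thesis .
qed

lemma nn_integral_gg:
  assumes "0 < p" "f \<in> borel_measurable borel"
  shows "(\<integral>\<^sup>+y. f y \<partial>gg p) = (\<integral>\<^sup>+y. ennreal (exp (- (\<bar>y\<bar> powr p / p)) / gg_const p) * f y \<partial>lborel)"
  unfolding gg_def using assms by (intro nn_integral_density) auto

lemma gg_moment:
  assumes p: "0 < p" and a: "0 \<le> a"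
  shows "(\<integral>\<^sup>+y. ennreal (\<bar>y\<bar> powr a) \<partial>gg p) = ennreal (p powr (a / p) * Gamma ((a + 1) / p) / Gamma (1 / p))"
proof -
  have "(\<integral>\<^sup>+y. ennreal (\<bar>y\<bar> powr a) \<partial>gg p) = (\<integral>\<^sup>+y. ennreal (1 / gg_const p) * ennreal (\<bar>y\<bar> powr a * exp (- (\<bar>y\<bar> powr p / p))) \<partial>lborel)"
    using gg_const_pos[OF p] by (subst nn_integral_gg[OF p]) (auto intro!: nn_integral_cong simp: ennreal_mult[symmetric] mult.commute)
  also have "\<dots> = ennreal (1 / gg_const p) * (\<integral>\<^sup>+y. ennreal (\<bar>y\<bar> powr a * exp (- (\<bar>y\<bar> powr p / p))) \<partial>lborel)"
    by (rule nn_integral_cmult) auto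
  also have "\<dots> = ennreal (1 / gg_const p * (2 * p powr ((a + 1) / p - 1) * Gamma ((a + 1) / p)))"
    unfolding nn_integral_moment[OF p a] using gg_const_pos[OF p] by (simp add: ennreal_mult'[symmetric])
  also have "1 / gg_const p * (2 * p powr ((a + 1) / p - 1) * Gamma ((a + 1) / p)) =
      (p powr ((a + 1) / p - 1) / p powr (1 / p - 1)) * Gamma ((a + 1) / p) / Gamma (1 / p)"
    by (simp add: gg_const_def)
  also have "p powr ((a + 1) / p - 1) / p powr (1 / p - 1) = p powr (a / p)"
    by (simp add: powr_diff[symmetric] add_divide_distrib)
  finally show ?thesis .
qed

lemma prob_space_gg:
  assumes p: "0 < p" shows "prob_space (gg p)"
proof
  have AE0: "AE y in gg p. y \<noteq> 0"
  proof -
    have "AE y in lborel. y \<noteq> (0::real)" by (rule AE_lborel_singleton)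
    then show ?thesis unfolding gg_def by (subst AE_density) auto
  qed
  have "emeasure (gg p) (space (gg p)) = (\<integral>\<^sup>+y. 1 \<partial>gg p)" by simp
  also have "\<dots> = (\<integral>\<^sup>+y. ennreal (\<bar>y\<bar> powr 0) \<partial>gg p)" using AE0 by (intro nn_integral_cong_AE) auto
  also have "\<dots> = 1" using gg_moment[OF p, of 0] p less_imp_neq[OF Gamma_real_pos[of "1/p"], symmetric] by simp
  finally show "emeasure (gg p) (space (gg p)) = 1" .
qed

lemma gg_mean_power:
  assumes p: "0 < p" shows "(\<integral>\<^sup>+y. ennreal (\<bar>y\<bar> powr p) \<partial>gg p) = 1"
proof -
  have "Gamma ((p + 1) / p) = Gamma (1 / p + 1)" using p by (simp add: add_divide_distrib add.commute)
  also have "\<dots> = 1 / p * Gamma (1 / p)" using p by (intro Gamma_plus1 pos_not_nonpos_Int) auto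
  finally show ?thesis using gg_moment[OF p, of p] p less_imp_neq[OF Gamma_real_pos[of "1/p"], symmetric] by simp
qed

lemma gg_second_moment:
  assumes p: "0 < p" shows "(\<integral>\<^sup>+y. ennreal (y\<^sup>2) \<partial>gg p) = ennreal (M2 p)"
proof -
  have a: "Gamma (1 + 1 / p) = 1 / p * Gamma (1 / p)" using p Gamma_plus1[OF pos_not_nonpos_Int, of "1/p"] by (simp add: add.commute)
  have b: "Gamma (1 + 3 / p) = 3 / p * Gamma (3 / p)" using p Gamma_plus1[OF pos_not_nonpos_Int, of "3/p"] by (simp add: add.commute)
  have "M2 p = p powr (2 / p) * Gamma (3 / p) / Gamma (1 / p)"
    unfolding M2_def a b using p Gamma_real_pos[of "1/p"] by simp
  moreover have "\<bar>y\<bar> powr 2 = y\<^sup>2" for y :: real by (cases "y = 0") (auto simp: powr_numeral)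
  ultimately show ?thesis using gg_moment[OF p, of 2] by simp
qed

lemma M2_pos: "0 < p \<Longrightarrow> 0 < M2 p"
  unfolding M2_def by (intro mult_pos_pos divide_pos_pos Gamma_real_pos add_pos_pos) auto

text \<open>
  The density times \<open>exp (q \<bar>y\<bar>\<^sup>p/p)\<close> is again a \<open>p\<close>-Gaussian density after rescaling \<open>y\<close> by
  \<open>(1 - q)^(-1/p)\<close>.
\<close>

lemma gg_exp_moment:
  assumes p: "0 < p" and q: "q < 1"
  shows "(\<integral>\<^sup>+y. ennreal (exp (q * (\<bar>y\<bar> powr p / p))) \<partial>gg p) < \<infinity>"
proof -
  define e where "e = 1 - q"
  have e: "0 < e" using q by (simp add: e_def)
  define c where "c = e powr (- (1 / p))"
  have c: "0 < c" using e by (simp add: c_def)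
  have "c powr p = e powr (- 1)" using p unfolding c_def powr_powr by simp
  then have cp: "e * c powr p = 1" using e by (simp add: powr_minus)
  have "(\<integral>\<^sup>+y. ennreal (exp (q * (\<bar>y\<bar> powr p / p))) \<partial>gg p) =
     (\<integral>\<^sup>+y. ennreal (exp (- (e * (\<bar>y\<bar> powr p / p))) / gg_const p) \<partial>lborel)"
    using gg_const_pos[OF p]
    by (subst nn_integral_gg[OF p]) (auto intro!: nn_integral_cong simp: ennreal_mult[symmetric] mult_exp_exp e_def algebra_simps diff_divide_distrib)
  also have "\<dots> = ennreal \<bar>c\<bar> * (\<integral>\<^sup>+y. ennreal (exp (- (e * (\<bar>0 + c * y\<bar> powr p / p))) / gg_const p) \<partial>lborel)"
    using c by (intro nn_integral_real_affine) auto
  also have "(\<integral>\<^sup>+y. ennreal (exp (- (e * (\<bar>0 + c * y\<bar> powr p / p))) / gg_const p) \<partial>lborel) = (\<integral>\<^sup>+y. 1 \<partial>gg p)"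
  proof (subst nn_integral_gg[OF p], simp, intro nn_integral_cong)
    fix y :: real
    have "e * (\<bar>0 + c * y\<bar> powr p / p) = (e * c powr p) * (\<bar>y\<bar> powr p / p)"
      using c by (simp add: abs_mult powr_mult)
    then show "ennreal (exp (- (e * (\<bar>0 + c * y\<bar> powr p / p))) / gg_const p) = ennreal (exp (- (\<bar>y\<bar> powr p / p)) / gg_const p) * 1"
      by (simp only: cp mult_1 mult_1_right)
  qed
  also have "(\<integral>\<^sup>+y. 1 \<partial>gg p) = 1" using prob_space.emeasure_space_1[OF prob_space_gg[OF p]] by simp
  finally show ?thesis by simp
qed

lemma powr_le_exp:
  fixes x :: real
  assumes "0 \<le> x" "0 < q" "0 < d"
  shows "x powr q \<le> (q / d) powr q * exp (d * x)"
proof (cases "x = 0")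
  case False
  then have x: "0 < x" using assms by simp
  have "ln (d * x / q) \<le> d * x / q - 1" using x assms by (intro ln_le_minus_one) auto
  then have "q * ln (d * x / q) \<le> q * (d * x / q)" using assms by (intro mult_left_mono) auto
  then have "q * ln x \<le> d * x + q * ln (q / d)"
    using x assms by (simp add: ln_div ln_mult algebra_simps)
  then have "exp (q * ln x) \<le> exp (q * ln (q / d) + d * x)" by simp
  then show ?thesis using x assms by (simp add: powr_def exp_add mult.commute)
qed (use assms in auto)

lemma gg_integrable:
  assumes p: "0 < p" and q: "q < 1" and h: "h \<in> borel_measurable borel"
    and bound: "\<And>y. \<bar>h y\<bar> \<le> C * exp (q * (\<bar>y\<bar> powr p / p))"
  shows "integrable (gg p) h"
proof (rule Bochner_Integration.integrable_bound)
  show "integrable (gg p) (\<lambda>y. C * exp (q * (\<bar>y\<bar> powr p / p)))"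
    using gg_exp_moment[OF p q] by (intro integrable_mult_right integrableI_nonneg) auto
  have "\<bar>h y\<bar> \<le> norm (C * exp (q * (\<bar>y\<bar> powr p / p)))" for y using bound[of y] by (metis abs_ge_self order_trans real_norm_def)
  then show "AE x in gg p. norm (h x) \<le> norm (C * exp (q * (\<bar>x\<bar> powr p / p)))" by simp
qed (use h in simp)

lemma gg_integrable_powr_exp:
  assumes p: "0 < p" and q: "0 \<le> q" "q < 1" and a: "0 < a"
  shows "integrable (gg p) (\<lambda>y. \<bar>y\<bar> powr a * exp (q * (\<bar>y\<bar> powr p / p)))"
proof (rule gg_integrable[OF p])
  define d where "d = (1 - q) / 2 / p"
  have d: "0 < d" using p q by (simp add: d_def)
  show "(1 + q) / 2 < 1" using q by simp
  fix y :: real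
  have "\<bar>y\<bar> powr a = (\<bar>y\<bar> powr p) powr (a / p)" using p by (simp add: powr_powr)
  also have "\<dots> \<le> (a / p / d) powr (a / p) * exp (d * \<bar>y\<bar> powr p)" using p a d by (intro powr_le_exp) auto
  finally have "\<bar>y\<bar> powr a * exp (q * (\<bar>y\<bar> powr p / p)) \<le> (a / p / d) powr (a / p) * exp (d * \<bar>y\<bar> powr p) * exp (q * (\<bar>y\<bar> powr p / p))"
    by (intro mult_right_mono) auto
  also have "\<dots> = (a / p / d) powr (a / p) * exp (d * \<bar>y\<bar> powr p + q * (\<bar>y\<bar> powr p / p))" by (simp add: exp_add)
  also have "d * \<bar>y\<bar> powr p + q * (\<bar>y\<bar> powr p / p) = (1 + q) / 2 * (\<bar>y\<bar> powr p / p)"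
    using p by (simp add: d_def field_simps)
  finally show "\<bar>\<bar>y\<bar> powr a * exp (q * (\<bar>y\<bar> powr p / p))\<bar> \<le> (a / p / d) powr (a / p) * exp ((1 + q) / 2 * (\<bar>y\<bar> powr p / p))" by simp
qed auto

lemma gg_integral_power: "0 < p \<Longrightarrow> (\<integral>y. \<bar>y\<bar> powr p \<partial>gg p) = 1"
  using gg_mean_power by (subst integral_eq_nn_integral) auto

lemma gg_integral_square: "0 < p \<Longrightarrow> (\<integral>y. y\<^sup>2 \<partial>gg p) = M2 p"
  using gg_second_moment M2_pos[of p] by (subst integral_eq_nn_integral) auto

text \<open>
  Markov's inequality for \<open>exp (t (f x\<^sub>1 + \<dots> + f x\<^sub>n))\<close>, whose expectation factorises.
\<close>

lemma iid_chernoff: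
  fixes G :: "real measure"
  assumes G: "prob_space G" and sG[measurable_cong]: "sets G = sets borel"
    and f[measurable]: "f \<in> borel_measurable borel"
    and t: "(\<integral>\<^sup>+y. ennreal (exp (t * f y)) \<partial>G) \<le> ennreal K" "0 \<le> t" "0 \<le> K"
  shows "\<P>(x in Pi\<^sub>M {..<n} (\<lambda>_. G). b \<le> (\<Sum>i<n. f (x i))) \<le> exp (- t * b) * K ^ n"
proof -
  let ?P = "Pi\<^sub>M {..<n} (\<lambda>_::nat. G)"
  interpret P: prob_space ?P by (rule prob_space_PiM) (rule G)
  interpret product_sigma_finite "\<lambda>_::nat. G"
    by (simp add: product_sigma_finite_def prob_space_imp_sigma_finite G)
  let ?S = "{x\<in>space ?P. b \<le> (\<Sum>i<n. f (x i))}"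
  have S: "?S \<in> sets ?P" by measurable
  have "emeasure ?P ?S = (\<integral>\<^sup>+x. indicator ?S x \<partial>?P)" using S by simp
  also have "\<dots> \<le> (\<integral>\<^sup>+x. ennreal (exp (- t * b)) * (\<Prod>i<n. ennreal (exp (t * f (x i)))) \<partial>?P)"
  proof (rule nn_integral_mono)
    fix x
    show "indicator ?S x \<le> ennreal (exp (- t * b)) * (\<Prod>i<n. ennreal (exp (t * f (x i))))"
    proof (cases "x \<in> ?S")
      case True
      then have "t * b \<le> t * (\<Sum>i<n. f (x i))" using t by (intro mult_left_mono) auto
      then have "1 \<le> exp (- t * b + (\<Sum>i<n. t * f (x i)))" by (simp add: sum_distrib_left)
      also have "\<dots> = exp (- t * b) * (\<Prod>i<n. exp (t * f (x i)))" unfolding exp_add by (simp add: exp_sum)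
      finally have "ennreal 1 \<le> ennreal (exp (- t * b) * (\<Prod>i<n. exp (t * f (x i))))" by (rule ennreal_leI)
      then show ?thesis using True by (simp add: prod_ennreal ennreal_mult prod_nonneg)
    qed simp
  qed
  also have "\<dots> = ennreal (exp (- t * b)) * (\<integral>\<^sup>+x. (\<Prod>i<n. ennreal (exp (t * f (x i)))) \<partial>?P)"
    by (rule nn_integral_cmult) measurable
  also have "(\<integral>\<^sup>+x. (\<Prod>i<n. ennreal (exp (t * f (x i)))) \<partial>?P) = (\<Prod>i<n. \<integral>\<^sup>+y. ennreal (exp (t * f y)) \<partial>G)"
    by (rule product_nn_integral_prod) auto
  also have "\<dots> = (\<integral>\<^sup>+y. ennreal (exp (t * f y)) \<partial>G) ^ n" by simp
  also have "ennreal (exp (- t * b)) * (\<integral>\<^sup>+y. ennreal (exp (t * f y)) \<partial>G) ^ n \<le> ennreal (exp (- t * b)) * ennreal K ^ n"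
    by (intro mult_left_mono power_mono t) auto
  also have "\<dots> = ennreal (exp (- t * b) * K ^ n)" using t by (simp add: ennreal_power ennreal_mult)
  finally show ?thesis using t by (simp add: P.emeasure_eq_measure)
qed

text \<open>
  Integrate the pointwise bound and use \<open>1 + z \<le> exp z\<close>.
\<close>

lemma mgf_quadratic_bound:
  assumes G: "prob_space G" and f: "integrable G f" and g: "integrable G g"
    and m: "(\<lambda>x. exp (t * f x)) \<in> borel_measurable G"
    and bound: "\<And>x. exp (t * f x) \<le> 1 + t * f x + t\<^sup>2 * g x"
  shows "(\<integral>\<^sup>+x. ennreal (exp (t * f x)) \<partial>G) \<le> ennreal (exp (t * integral\<^sup>L G f + t\<^sup>2 * integral\<^sup>L G g))"
proof -
  interpret prob_space G by fact
  have int: "integrable G (\<lambda>x. 1 + t * f x + t\<^sup>2 * g x)" using f g by auto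
  have "(\<integral>\<^sup>+x. ennreal (exp (t * f x)) \<partial>G) \<le> (\<integral>\<^sup>+x. ennreal (1 + t * f x + t\<^sup>2 * g x) \<partial>G)"
    by (intro nn_integral_mono ennreal_leI bound)
  also have "\<dots> = ennreal (\<integral>x. 1 + t * f x + t\<^sup>2 * g x \<partial>G)"
    by (rule nn_integral_eq_integral[OF int]) (use bound in \<open>auto intro!: AE_I2 order_trans[OF exp_ge_zero]\<close>)
  also have "(\<integral>x. 1 + t * f x + t\<^sup>2 * g x \<partial>G) = 1 + (t * integral\<^sup>L G f + t\<^sup>2 * integral\<^sup>L G g)"
    using f g by (simp add: prob_space)
  also have "\<dots> \<le> exp (t * integral\<^sup>L G f + t\<^sup>2 * integral\<^sup>L G g)" by (rule exp_ge_add_one_self)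
  finally show ?thesis by (simp add: ennreal_leI)
qed

text \<open>
  The second-order term \<open>t\<^sup>2 E g\<close> is at most half of \<open>t e\<close> once \<open>t\<close> is small, so the Chernoff bound
  leaves the positive rate \<open>t e / 2\<close>.
\<close>

lemma iid_concentration:
  fixes G :: "real measure"
  assumes G: "prob_space G" and sG[measurable_cong]: "sets G = sets borel"
    and f: "f \<in> borel_measurable borel" "integrable G f" and g: "integrable G g"
    and t0: "0 < t0" and bound: "\<And>t x. 0 \<le> t \<Longrightarrow> t \<le> t0 \<Longrightarrow> exp (t * f x) \<le> 1 + t * f x + t\<^sup>2 * g x"
    and e: "0 < e"
  shows "\<exists>c>0. \<forall>n. measure (Pi\<^sub>M {..<n} (\<lambda>_. G)) {x\<in>space (Pi\<^sub>M {..<n} (\<lambda>_. G)).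
     real n * (integral\<^sup>L G f + e) \<le> (\<Sum>i<n. f (x i))} \<le> exp (- c * real n)"
proof -
  define K where "K = \<bar>integral\<^sup>L G g\<bar> + 1"
  \<comment> \<open>With this choice \<open>t K \<le> e/2\<close>.\<close>
  define t where "t = min t0 (e / (2 * K))"
  have K: "0 < K" by (simp add: K_def)
  have t: "0 < t" "t \<le> t0" "t * K \<le> e / 2"
    using t0 e K by (auto simp: t_def min_def field_simps)
  have "(\<integral>\<^sup>+x. ennreal (exp (t * f x)) \<partial>G) \<le> ennreal (exp (t * integral\<^sup>L G f + t\<^sup>2 * integral\<^sup>L G g))"
    using f t by (intro mgf_quadratic_bound G g bound) (auto cong: measurable_cong_sets simp: sG)
  note * = iid_chernoff[OF G sG f(1) this]
  have "measure (Pi\<^sub>M {..<n} (\<lambda>_. G)) {x\<in>space (Pi\<^sub>M {..<n} (\<lambda>_. G)).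
     real n * (integral\<^sup>L G f + e) \<le> (\<Sum>i<n. f (x i))} \<le> exp (- (t * e / 2) * real n)" for n
  proof -
    have "measure (Pi\<^sub>M {..<n} (\<lambda>_. G)) {x\<in>space (Pi\<^sub>M {..<n} (\<lambda>_. G)).
       real n * (integral\<^sup>L G f + e) \<le> (\<Sum>i<n. f (x i))} \<le>
       exp (- t * (real n * (integral\<^sup>L G f + e))) * exp (t * integral\<^sup>L G f + t\<^sup>2 * integral\<^sup>L G g) ^ n"
      by (rule *) (use t in auto)
    also have "\<dots> = exp (real n * (t * (t * integral\<^sup>L G g - e)))"
      by (simp add: exp_of_nat_mult[symmetric] mult_exp_exp power2_eq_square algebra_simps)
    also have "\<dots> \<le> exp (real n * (t * (- (e / 2))))"
    proof -
      have "t * integral\<^sup>L G g \<le> t * K" using t by (intro mult_left_mono) (auto simp: K_def)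
      then have "t * integral\<^sup>L G g - e \<le> - (e / 2)" using t(3) by simp
      then show ?thesis using t by (intro iffD2[OF exp_le_cancel_iff] mult_left_mono) auto
    qed
    finally show ?thesis by (simp add: algebra_simps)
  qed
  then show ?thesis using t e by (intro exI[of _ "t * e / 2"]) auto
qed

lemma exp_le_quadratic: "exp x \<le> 1 + x + x\<^sup>2 * exp \<bar>x\<bar>" for x :: real
proof (cases "0 \<le> x")
  case True
  have "(1 - x) * exp x \<le> exp (- x) * exp x" using exp_ge_add_one_self[of "- x"] by (intro mult_right_mono) auto
  then have a: "exp x - 1 \<le> x * exp x" by (simp add: mult_exp_exp algebra_simps)
  then have "x * (exp x - 1) \<le> x * (x * exp x)" using True by (intro mult_left_mono) auto
  with a show ?thesis using True by (simp add: power2_eq_square algebra_simps)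
next
  case False
  have "exp x * (1 - x) \<le> exp x * exp (- x)" using exp_ge_add_one_self[of "- x"] by (intro mult_left_mono) auto
  then have "exp x \<le> 1 / (1 - x)" using False by (simp add: mult_exp_exp field_simps)
  also have "\<dots> = 1 + x + x\<^sup>2 / (1 - x)" using False by (simp add: power2_eq_square field_simps)
  also have "\<dots> \<le> 1 + x + x\<^sup>2 * exp \<bar>x\<bar>"
  proof -
    have "1 / (1 - x) \<le> 1" "(1::real) \<le> exp \<bar>x\<bar>" using False by auto
    then have "1 / (1 - x) \<le> exp \<bar>x\<bar>" by (rule order_trans)
    then have "x\<^sup>2 * (1 / (1 - x)) \<le> x\<^sup>2 * exp \<bar>x\<bar>" by (intro mult_left_mono) auto
    then show ?thesis by simp
  qed
  finally show ?thesis .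
qed

lemma exp_neg_le_quadratic: "0 \<le> x \<Longrightarrow> exp (- x) \<le> 1 - x + x\<^sup>2" for x :: real
proof -
  assume x: "0 \<le> x"
  have "exp (- x) * (1 + x) \<le> exp (- x) * exp x" using exp_ge_add_one_self[of x] by (intro mult_left_mono) auto
  then have "exp (- x) \<le> 1 / (1 + x)" using x by (simp add: mult_exp_exp field_simps)
  also have "\<dots> = 1 - x + x\<^sup>2 / (1 + x)" using x by (simp add: power2_eq_square field_simps)
  also have "\<dots> \<le> 1 - x + x\<^sup>2" using x divide_left_mono[of 1 "1 + x" "x\<^sup>2"] by simp
  finally show ?thesis .
qed

section \<open>Sums of powers of independent p-Gaussian variables\<close>

abbreviation gg_prod :: "real \<Rightarrow> nat \<Rightarrow> (nat \<Rightarrow> real) measure" where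
  "gg_prod p n \<equiv> Pi\<^sub>M {..<n} (\<lambda>_. gg p)"

lemma prob_space_gg_prod: "0 < p \<Longrightarrow> prob_space (gg_prod p n)"
  by (rule prob_space_PiM) (rule prob_space_gg)

lemma sets_gg_prod [measurable_cong]: "sets (gg_prod p n) = sets (Pi\<^sub>M {..<n} (\<lambda>_. borel))"
  by (intro sets_PiM_cong) auto

lemma gg_power_upper:
  assumes p: "1 \<le> p" and e: "0 < e"
  shows "\<exists>c>0. \<forall>n. \<P>(x in gg_prod p n. real n * (1 + e) \<le> (\<Sum>i<n. \<bar>x i\<bar> powr p)) \<le> exp (- c * real n)"
proof -
  have p0: "0 < p" using p by simp
  have int: "integrable (gg p) (\<lambda>y. \<bar>y\<bar> powr p)"
    using gg_integrable_powr_exp[OF p0, of 0 p] p by simp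
  have intg: "integrable (gg p) (\<lambda>y. \<bar>y\<bar> powr (2 * p) * exp (1/2 * (\<bar>y\<bar> powr p / p)))"
    using gg_integrable_powr_exp[OF p0, of "1/2" "2 * p"] p by simp
  show ?thesis
    using iid_concentration[OF prob_space_gg[OF p0] sets_gg _ int intg, of "1 / (2 * p)" e]
    unfolding gg_integral_power[OF p0]
  proof
    \<comment> \<open>For \<open>t \<le> 1 / (2 p)\<close> at most half of the exponent \<open>\<bar>y\<bar>\<^sup>p / p\<close> is used up.\<close>
    show "0 < 1 / (2 * p)" using p by simp
    fix t y :: real assume t: "0 \<le> t" "t \<le> 1 / (2 * p)"
    have sq: "(\<bar>y\<bar> powr p)\<^sup>2 = \<bar>y\<bar> powr (2 * p)" by (simp add: power2_eq_square powr_add[symmetric])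
    have "exp (t * \<bar>y\<bar> powr p) \<le> 1 + t * \<bar>y\<bar> powr p + (t * \<bar>y\<bar> powr p)\<^sup>2 * exp \<bar>t * \<bar>y\<bar> powr p\<bar>" by (rule exp_le_quadratic)
    also have "(t * \<bar>y\<bar> powr p)\<^sup>2 * exp \<bar>t * \<bar>y\<bar> powr p\<bar> \<le> (t * \<bar>y\<bar> powr p)\<^sup>2 * exp (1/2 * (\<bar>y\<bar> powr p / p))"
    proof (intro mult_left_mono iffD2[OF exp_le_cancel_iff])
      have "t * \<bar>y\<bar> powr p \<le> 1 / (2 * p) * \<bar>y\<bar> powr p" by (intro mult_right_mono t) auto
      then show "\<bar>t * \<bar>y\<bar> powr p\<bar> \<le> 1/2 * (\<bar>y\<bar> powr p / p)" using t by simp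
    qed auto
    finally show "exp (t * \<bar>y\<bar> powr p) \<le> 1 + t * \<bar>y\<bar> powr p + t\<^sup>2 * (\<bar>y\<bar> powr (2 * p) * exp (1/2 * (\<bar>y\<bar> powr p / p)))"
      by (simp add: power_mult_distrib sq)
  qed (use e in auto)
qed

text \<open>
  For \<open>h \<ge> 0\<close> the variable \<open>- h\<close> is bounded above, so \<open>exp (- t h)\<close> has a quadratic bound without any
  exponential moment; lower tails of sums are always light.
\<close>

lemma nonneg_lower_concentration:
  assumes p: "0 < p" and h: "h \<in> borel_measurable borel" "\<And>y. 0 \<le> h y" "integrable (gg p) h" "integrable (gg p) (\<lambda>y. (h y)\<^sup>2)"
    and e: "0 < e"
  shows "\<exists>c>0. \<forall>n. \<P>(x in gg_prod p n. (\<Sum>i<n. h (x i)) \<le> real n * (integral\<^sup>L (gg p) h - e)) \<le> exp (- c * real n)"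
proof -
  have "\<exists>c>0. \<forall>n. measure (gg_prod p n) {x\<in>space (gg_prod p n).
      real n * (integral\<^sup>L (gg p) (\<lambda>y. - h y) + e) \<le> (\<Sum>i<n. - h (x i))} \<le> exp (- c * real n)"
  proof (rule iid_concentration[OF prob_space_gg[OF p] sets_gg _ _ h(4)])
    show "(0::real) < 1" by simp
    fix t y :: real assume t: "0 \<le> t" "t \<le> 1"
    show "exp (t * - h y) \<le> 1 + t * - h y + t\<^sup>2 * (h y)\<^sup>2"
      using exp_neg_le_quadratic[of "t * h y"] t h(2)[of y] by (simp add: power_mult_distrib)
  qed (use h e in auto)
  moreover have "real n * (integral\<^sup>L (gg p) (\<lambda>y. - h y) + e) \<le> (\<Sum>i<n. - h (x i)) \<longleftrightarrow>
     (\<Sum>i<n. h (x i)) \<le> real n * (integral\<^sup>L (gg p) h - e)" for n x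
    by (auto simp: sum_negf algebra_simps)
  ultimately show ?thesis by simp
qed

lemma gg_power_lower:
  assumes p: "1 \<le> p" and e: "0 < e"
  shows "\<exists>c>0. \<forall>n. \<P>(x in gg_prod p n. (\<Sum>i<n. \<bar>x i\<bar> powr p) \<le> real n * (1 - e)) \<le> exp (- c * real n)"
proof -
  have p0: "0 < p" using p by simp
  have sq: "(\<bar>y\<bar> powr p)\<^sup>2 = \<bar>y\<bar> powr (2 * p)" for y by (simp add: power2_eq_square powr_add[symmetric])
  have "integrable (gg p) (\<lambda>y. \<bar>y\<bar> powr p)" "integrable (gg p) (\<lambda>y. (\<bar>y\<bar> powr p)\<^sup>2)"
    unfolding sq using gg_integrable_powr_exp[OF p0, of 0 p] gg_integrable_powr_exp[OF p0, of 0 "2 * p"] p by simp_all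
  from nonneg_lower_concentration[OF p0 _ _ this e] show ?thesis unfolding gg_integral_power[OF p0] by simp
qed

lemma abs_powr_2: "\<bar>y\<bar> powr 2 = y\<^sup>2" for y :: real by (cases "y = 0") (auto simp: powr_numeral)

lemma abs_powr_4: "\<bar>y\<bar> powr 4 = (y\<^sup>2)\<^sup>2" for y :: real by (cases "y = 0") (auto simp: powr_numeral)

lemma gg_integrable_square: "0 < p \<Longrightarrow> integrable (gg p) (\<lambda>y. y\<^sup>2)"
  using gg_integrable_powr_exp[of p 0 2] by (simp add: abs_powr_2)

lemma gg_square_lower:
  assumes p: "0 < p" and e: "0 < e"
  shows "\<exists>c>0. \<forall>n. \<P>(x in gg_prod p n. (\<Sum>i<n. (x i)\<^sup>2) \<le> real n * (M2 p - e)) \<le> exp (- c * real n)"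
proof -
  have "integrable (gg p) (\<lambda>y. (y\<^sup>2)\<^sup>2)" using gg_integrable_powr_exp[of p 0 4] p by (simp add: abs_powr_4)
  from nonneg_lower_concentration[OF p _ _ gg_integrable_square[OF p] this e] show ?thesis unfolding gg_integral_square[OF p] by simp
qed

text \<open>
  For \<open>p \<ge> 2\<close> the square is dominated by \<open>1 + \<bar>y\<bar>\<^sup>p\<close> and thus has exponential moments.
\<close>

lemma gg_square_upper:
  assumes p: "2 \<le> p" and e: "0 < e"
  shows "\<exists>c>0. \<forall>n. \<P>(x in gg_prod p n. real n * (M2 p + e) \<le> (\<Sum>i<n. (x i)\<^sup>2)) \<le> exp (- c * real n)"
proof -
  have p0: "0 < p" using p by simp
  have intg: "integrable (gg p) (\<lambda>y. exp 1 * (\<bar>y\<bar> powr 4 * exp (1/2 * (\<bar>y\<bar> powr p / p))))"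
    using gg_integrable_powr_exp[OF p0, of "1/2" 4] p by (intro integrable_mult_right) simp
  show ?thesis
    using iid_concentration[OF prob_space_gg[OF p0] sets_gg _ gg_integrable_square[OF p0] intg, of "1 / (2 * p)" e]
    unfolding gg_integral_square[OF p0]
  proof
    show "0 < 1 / (2 * p)" using p by simp
    fix t y :: real assume t: "0 \<le> t" "t \<le> 1 / (2 * p)"
    have "exp (t * y\<^sup>2) \<le> 1 + t * y\<^sup>2 + (t * y\<^sup>2)\<^sup>2 * exp \<bar>t * y\<^sup>2\<bar>" by (rule exp_le_quadratic)
    also have "(t * y\<^sup>2)\<^sup>2 * exp \<bar>t * y\<^sup>2\<bar> \<le> (t * y\<^sup>2)\<^sup>2 * exp (1 + 1/2 * (\<bar>y\<bar> powr p / p))"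
    proof (intro mult_left_mono iffD2[OF exp_le_cancel_iff])
      have "y\<^sup>2 \<le> 1 + \<bar>y\<bar> powr p"
      proof (cases "\<bar>y\<bar> \<le> 1")
        case True
        then have "y\<^sup>2 \<le> 1" by (simp add: abs_square_le_1)
        then show ?thesis by (smt (verit) powr_ge_zero)
      next
        case False
        then have "\<bar>y\<bar> powr 2 \<le> \<bar>y\<bar> powr p" using p by (intro powr_mono) auto
        then show ?thesis by (simp add: abs_powr_2)
      qed
      then have "t * y\<^sup>2 \<le> 1 / (2 * p) * (1 + \<bar>y\<bar> powr p)" using t p by (intro mult_mono) auto
      also have "\<dots> \<le> 1 + 1/2 * (\<bar>y\<bar> powr p / p)" using p by (simp add: field_simps)
      finally show "\<bar>t * y\<^sup>2\<bar> \<le> 1 + 1/2 * (\<bar>y\<bar> powr p / p)" using t by simp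
    qed auto
    finally show "exp (t * y\<^sup>2) \<le> 1 + t * y\<^sup>2 + t\<^sup>2 * (exp 1 * (\<bar>y\<bar> powr 4 * exp (1/2 * (\<bar>y\<bar> powr p / p))))"
      by (simp add: power_mult_distrib abs_powr_4 exp_add algebra_simps)
  qed (use e in auto)
qed

lemma measure_PiM_component:
  fixes G :: "real measure"
  assumes G: "prob_space G" and sG: "sets G = sets borel" and i: "i < n" and A: "A \<in> sets borel"
  shows "measure (Pi\<^sub>M {..<n} (\<lambda>_::nat. G)) {x\<in>space (Pi\<^sub>M {..<n} (\<lambda>_. G)). x i \<in> A} = measure G A"
proof -
  have d: "distr (Pi\<^sub>M {..<n} (\<lambda>_::nat. G)) G (\<lambda>x. x i) = G"
    by (rule distr_PiM_component) (use G i in auto)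
  have m: "(\<lambda>x. x i) \<in> measurable (Pi\<^sub>M {..<n} (\<lambda>_::nat. G)) G" by (rule measurable_component_singleton) (use i in auto)
  have "measure G A = measure (distr (Pi\<^sub>M {..<n} (\<lambda>_::nat. G)) G (\<lambda>x. x i)) A" by (simp add: d)
  also have "\<dots> = measure (Pi\<^sub>M {..<n} (\<lambda>_::nat. G)) ((\<lambda>x. x i) -` A \<inter> space (Pi\<^sub>M {..<n} (\<lambda>_::nat. G)))"
    using A sG by (intro measure_distr m) simp
  finally show ?thesis by (simp add: vimage_def Int_def conj_commute)
qed

text \<open>
  Truncate the squares at \<open>u = n a\<close>. If \<open>0 < y\<^sup>2 \<le> u\<close>, then \<open>y\<^sup>2 u^(p/2-1) \<le> \<bar>y\<bar>\<^sup>p\<close>, because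
  \<open>p/2 - 1 < 0\<close>; so the truncated square admits the exponential parameter \<open>\<kappa> = \<theta> u^(p/2-1)/p\<close>, for which
  \<open>\<kappa> u\<close> is already the full cost \<open>\<theta> u^(p/2)/p\<close> of a single jump. The first term of the bound comes from
  the truncated sum, the second one from the event that some coordinate exceeds the truncation level.
\<close>

lemma gg_square_truncated_upper:
  assumes p: "1 \<le> p" "p < 2" and a: "0 < a" and th: "0 < \<theta>" "\<theta> < 1" and n: "1 \<le> n"
  defines "K \<equiv> integral\<^sup>L (gg p) (\<lambda>y. \<bar>y\<bar> powr 4 * exp (\<theta> * (\<bar>y\<bar> powr p / p)))"
  defines "C \<equiv> integral\<^sup>L (gg p) (\<lambda>y. exp (\<theta> * (\<bar>y\<bar> powr p / p)))"
  shows "\<P>(x in gg_prod p n. real n * (M2 p + a) \<le> (\<Sum>i<n. (x i)\<^sup>2))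
     \<le> exp (- (\<theta> * (real n * a) powr (p / 2) / p) + real n * (\<theta> * (real n * a) powr (p / 2 - 1) / p)\<^sup>2 * K)
       + real n * (exp (- (\<theta> * (real n * a) powr (p / 2) / p)) * C)"
proof -
  have p0: "0 < p" using p by simp
  define u where "u = real n * a"
  have u: "0 < u" using n a by (simp add: u_def)
  define f where "f y = (if y\<^sup>2 \<le> u then y\<^sup>2 else 0)" for y :: real
  have fm[measurable]: "f \<in> borel_measurable borel" unfolding f_def by measurable
  \<comment> \<open>The largest parameter for which \<open>lf\<close> below holds.\<close>
  define \<kappa> where "\<kappa> = \<theta> * u powr (p / 2 - 1) / p"
  have l: "0 < \<kappa>" using th u p by (simp add: \<kappa>_def)
  have lu: "\<kappa> * u = \<theta> * u powr (p / 2) / p"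
    using u by (simp add: \<kappa>_def powr_diff)
  interpret P: prob_space "gg_prod p n" by (rule prob_space_gg_prod[OF p0])
  interpret G: prob_space "gg p" by (rule prob_space_gg[OF p0])
  have fint: "integrable (gg p) f"
    by (rule Bochner_Integration.integrable_bound[OF gg_integrable_square[OF p0]]) (auto simp: f_def)
  have fle: "integral\<^sup>L (gg p) f \<le> M2 p"
    unfolding gg_integral_square[OF p0, symmetric]
    by (intro integral_mono fint gg_integrable_square[OF p0]) (auto simp: f_def)
  have gint: "integrable (gg p) (\<lambda>y. \<bar>y\<bar> powr 4 * exp (\<theta> * (\<bar>y\<bar> powr p / p)))"
    using gg_integrable_powr_exp[OF p0, of \<theta> 4] th by simp
  have cint: "integrable (gg p) (\<lambda>y. exp (\<theta> * (\<bar>y\<bar> powr p / p)))"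
    by (rule gg_integrable[OF p0 th(2), where C = 1]) auto
  have alpha: "(y\<^sup>2) powr (p / 2) = \<bar>y\<bar> powr p" for y :: real
  proof -
    have "(y\<^sup>2) powr (p / 2) = (\<bar>y\<bar> powr 2) powr (p / 2)" by (simp only: abs_powr_2)
    then show ?thesis unfolding powr_powr by simp
  qed
  have lf: "\<kappa> * f y \<le> \<theta> * (\<bar>y\<bar> powr p / p)" for y
  proof (cases "0 < y\<^sup>2 \<and> y\<^sup>2 \<le> u")
    case True
    have "u powr (p / 2 - 1) \<le> (y\<^sup>2) powr (p / 2 - 1)"
      using True p by (intro powr_mono2') auto
    then have "y\<^sup>2 * u powr (p / 2 - 1) \<le> y\<^sup>2 * (y\<^sup>2) powr (p / 2 - 1)" by (intro mult_left_mono) auto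
    also have "\<dots> = \<bar>y\<bar> powr p" using True by (simp add: powr_diff alpha)
    finally have "\<theta> / p * (y\<^sup>2 * u powr (p / 2 - 1)) \<le> \<theta> / p * \<bar>y\<bar> powr p" using th p by (intro mult_left_mono) auto
    then show ?thesis using True by (simp add: f_def \<kappa>_def algebra_simps)
  next
    case False
    then have "f y = 0" by (auto simp: f_def)
    then show ?thesis using th p by simp
  qed
  have f0: "0 \<le> f y" for y by (simp add: f_def)
  have "(\<integral>\<^sup>+y. ennreal (exp (\<kappa> * f y)) \<partial>gg p) \<le> ennreal (exp (\<kappa> * integral\<^sup>L (gg p) f + \<kappa>\<^sup>2 * K))"
    unfolding K_def
  proof (rule mgf_quadratic_bound[OF G.prob_space_axioms fint gint])
    fix y :: real
    have "exp (\<kappa> * f y) \<le> 1 + \<kappa> * f y + (\<kappa> * f y)\<^sup>2 * exp \<bar>\<kappa> * f y\<bar>" by (rule exp_le_quadratic)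
    also have "(\<kappa> * f y)\<^sup>2 * exp \<bar>\<kappa> * f y\<bar> \<le> \<kappa>\<^sup>2 * (\<bar>y\<bar> powr 4 * exp (\<theta> * (\<bar>y\<bar> powr p / p)))"
    proof -
      have "(f y)\<^sup>2 \<le> (y\<^sup>2)\<^sup>2" by (auto simp: f_def)
      moreover have "exp \<bar>\<kappa> * f y\<bar> \<le> exp (\<theta> * (\<bar>y\<bar> powr p / p))" using lf[of y] l f0[of y] by simp
      ultimately have "(f y)\<^sup>2 * exp \<bar>\<kappa> * f y\<bar> \<le> (y\<^sup>2)\<^sup>2 * exp (\<theta> * (\<bar>y\<bar> powr p / p))" by (intro mult_mono) auto
      then have "\<kappa>\<^sup>2 * ((f y)\<^sup>2 * exp \<bar>\<kappa> * f y\<bar>) \<le> \<kappa>\<^sup>2 * ((y\<^sup>2)\<^sup>2 * exp (\<theta> * (\<bar>y\<bar> powr p / p)))" by (intro mult_left_mono) auto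
      then show ?thesis unfolding abs_powr_4 power_mult_distrib by (simp only: mult.assoc)
    qed
    finally show "exp (\<kappa> * f y) \<le> 1 + \<kappa> * f y + \<kappa>\<^sup>2 * (\<bar>y\<bar> powr 4 * exp (\<theta> * (\<bar>y\<bar> powr p / p)))" by simp
  qed simp
  also have "\<dots> \<le> ennreal (exp (\<kappa> * M2 p + \<kappa>\<^sup>2 * K))" using fle l by (intro ennreal_leI) simp
  finally have "\<P>(x in gg_prod p n. real n * (M2 p + a) \<le> (\<Sum>i<n. f (x i)))
      \<le> exp (- \<kappa> * (real n * (M2 p + a))) * exp (\<kappa> * M2 p + \<kappa>\<^sup>2 * K) ^ n"
    by (rule iid_chernoff[OF G.prob_space_axioms sets_gg fm]) (use l in auto)
  also have "\<dots> = exp (- (\<kappa> * u) + real n * \<kappa>\<^sup>2 * K)"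
    by (simp add: exp_of_nat_mult[symmetric] mult_exp_exp u_def algebra_simps)
  finally have 1: "\<P>(x in gg_prod p n. real n * (M2 p + a) \<le> (\<Sum>i<n. f (x i)))
      \<le> exp (- (\<kappa> * u) + real n * \<kappa>\<^sup>2 * K)" .
  have tail: "measure (gg p) {y. u < y\<^sup>2} \<le> exp (- (\<kappa> * u)) * C"
  proof -
    have "measure (gg p) {y. u < y\<^sup>2} = (\<integral>y. indicator {y. u < y\<^sup>2} y \<partial>gg p)" by simp
    also have "\<dots> \<le> (\<integral>y. exp (- (\<kappa> * u)) * exp (\<theta> * (\<bar>y\<bar> powr p / p)) \<partial>gg p)"
    proof (rule integral_mono)
      show "integrable (gg p) (indicator {y. u < y\<^sup>2} :: real \<Rightarrow> real)"
        by (rule integrable_real_indicator) (auto simp: G.emeasure_eq_measure)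
      fix y :: real
      show "indicator {y. u < y\<^sup>2} y \<le> exp (- (\<kappa> * u)) * exp (\<theta> * (\<bar>y\<bar> powr p / p))"
      proof (cases "u < y\<^sup>2")
        case True
        have "u powr (p / 2) \<le> (y\<^sup>2) powr (p / 2)" using True u p by (intro powr_mono2) auto
        then have "\<theta> * u powr (p / 2) / p \<le> \<theta> * (\<bar>y\<bar> powr p / p)"
          unfolding alpha using th p by (simp add: divide_right_mono)
        then show ?thesis using True by (simp add: mult_exp_exp lu)
      qed simp
    qed (use cint in simp)
    also have "\<dots> = exp (- (\<kappa> * u)) * C" by (simp add: C_def)
    finally show ?thesis .
  qed
  let ?A = "{x\<in>space (gg_prod p n). real n * (M2 p + a) \<le> (\<Sum>i<n. f (x i))}"
  let ?B = "\<lambda>i. {x\<in>space (gg_prod p n). x i \<in> {y. u < y\<^sup>2}}"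
  have Sb: "{y. u < y\<^sup>2} \<in> sets borel" by measurable
  have B: "?B i \<in> sets (gg_prod p n)" if i: "i < n" for i
  proof -
    have "(\<lambda>x. x i) -` {y. u < y\<^sup>2} \<inter> space (gg_prod p n) \<in> sets (gg_prod p n)"
      by (rule measurable_sets[OF measurable_component_singleton]) (use i Sb in auto)
    also have "(\<lambda>x. x i) -` {y. u < y\<^sup>2} \<inter> space (gg_prod p n) = ?B i" by auto
    finally show ?thesis .
  qed
  have sub: "{x\<in>space (gg_prod p n). real n * (M2 p + a) \<le> (\<Sum>i<n. (x i)\<^sup>2)} \<subseteq> ?A \<union> (\<Union>i\<in>{..<n}. ?B i)"
  proof
    fix x assume x: "x \<in> {x\<in>space (gg_prod p n). real n * (M2 p + a) \<le> (\<Sum>i<n. (x i)\<^sup>2)}"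
    show "x \<in> ?A \<union> (\<Union>i\<in>{..<n}. ?B i)"
    proof (cases "\<exists>i<n. u < (x i)\<^sup>2")
      case True then show ?thesis using x by auto
    next
      case False
      then have "(x i)\<^sup>2 \<le> u" if "i < n" for i using that by (metis not_less)
      then have "(\<Sum>i<n. f (x i)) = (\<Sum>i<n. (x i)\<^sup>2)" by (intro sum.cong) (auto simp: f_def)
      then show ?thesis using x by auto
    qed
  qed
  have mA: "?A \<in> sets (gg_prod p n)" by measurable
  have mU: "(\<Union>i\<in>{..<n}. ?B i) \<in> sets (gg_prod p n)" by (intro sets.finite_UN) (use B in auto)
  have "\<P>(x in gg_prod p n. real n * (M2 p + a) \<le> (\<Sum>i<n. (x i)\<^sup>2))
     \<le> measure (gg_prod p n) (?A \<union> (\<Union>i\<in>{..<n}. ?B i))"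
    by (rule P.finite_measure_mono[OF sub sets.Un[OF mA mU]])
  also have "\<dots> \<le> measure (gg_prod p n) ?A + measure (gg_prod p n) (\<Union>i\<in>{..<n}. ?B i)"
    by (rule measure_Un_le[OF mA mU])
  also have "measure (gg_prod p n) (\<Union>i\<in>{..<n}. ?B i) \<le> (\<Sum>i<n. measure (gg_prod p n) (?B i))"
    by (rule measure_UNION_le) (use B in auto)
  also have "(\<Sum>i<n. measure (gg_prod p n) (?B i)) = (\<Sum>i<n. measure (gg p) {y. u < y\<^sup>2})"
    by (intro sum.cong refl measure_PiM_component[OF G.prob_space_axioms sets_gg _ Sb]) auto
  also have "\<dots> \<le> real n * (exp (- (\<kappa> * u)) * C)" using tail by (simp add: mult_left_mono)
  finally show ?thesis using 1 unfolding lu unfolding \<kappa>_def u_def by linarith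
qed

lemma filterlim_nat_powr: "0 < q \<Longrightarrow> filterlim (\<lambda>n. real n powr q) at_top sequentially"
  by (rule filterlim_compose[OF real_powr_at_top filterlim_real_sequentially])

text \<open>
  In the previous bound the term with \<open>K\<close> is of order \<open>n^(p-1) = o(n^(p/2))\<close>, because \<open>p < 2\<close>, and the
  factor \<open>n\<close> of the second term is subexponential; then \<open>\<theta>\<close> tends to one.
\<close>

lemma gg_square_heavy_upper:
  assumes p: "1 \<le> p" "p < 2" and a: "0 < a"
  shows "exp_ub (\<lambda>n. real n powr (p / 2))
     (\<lambda>n. \<P>(x in gg_prod p n. real n * (M2 p + a) \<le> (\<Sum>i<n. (x i)\<^sup>2))) (ereal (a powr (p / 2) / p))"
  unfolding exp_ub_def
proof (intro allI impI)
  fix r assume "ereal r < ereal (a powr (p / 2) / p)"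
  then have r0: "r < a powr (p / 2) / p" by simp
  define b where "b = a powr (p / 2) / p"
  have b: "0 < b" using a p by (simp add: b_def)
  have "r < b" using r0 by (simp add: b_def)
  then have rb: "r / b < 1" using b by (simp only: divide_less_eq_1_pos)
  then obtain \<theta> where "max 0 (r / b) < \<theta>" and th1: "\<theta> < 1" using dense[of "max 0 (r / b)" 1] by auto
  then have th: "0 < \<theta>" "\<theta> < 1" "r / b < \<theta>" by auto
  define q where "q = \<theta> * b"
  have q: "r < q" using th(3) b by (simp add: q_def field_simps)
  define K where "K = integral\<^sup>L (gg p) (\<lambda>y. \<bar>y\<bar> powr 4 * exp (\<theta> * (\<bar>y\<bar> powr p / p)))"
  define C where "C = integral\<^sup>L (gg p) (\<lambda>y. exp (\<theta> * (\<bar>y\<bar> powr p / p)))"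
  define d where "d = (q - r) / 2"
  have d: "0 < d" using q by (simp add: d_def)
  have s: "filterlim (\<lambda>n. real n powr (p / 2)) at_top sequentially" using p by (intro filterlim_nat_powr) simp
  have e1: "\<forall>\<^sub>F n in sequentially. real n * (\<theta> * (real n * a) powr (p / 2 - 1) / p)\<^sup>2 * K \<le> d * real n powr (p / 2)"
  proof -
    have "(\<lambda>n. real n powr (p / 2 - 1)) \<longlonglongrightarrow> 0" using p by (intro tendsto_neg_powr filterlim_real_sequentially) simp
    then have "(\<lambda>n. (\<theta> * a powr (p / 2 - 1) / p)\<^sup>2 * K * real n powr (p / 2 - 1)) \<longlonglongrightarrow> (\<theta> * a powr (p / 2 - 1) / p)\<^sup>2 * K * 0"
      by (intro tendsto_intros)
    then have "\<forall>\<^sub>F n in sequentially. (\<theta> * a powr (p / 2 - 1) / p)\<^sup>2 * K * real n powr (p / 2 - 1) < d"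
      using d by (intro order_tendstoD) auto
    then show ?thesis using eventually_ge_at_top[of "1::nat"]
    proof eventually_elim
      case (elim n)
      have n2: "real n * (real n powr (p / 2 - 1))\<^sup>2 = real n powr (p / 2 - 1) * real n powr (p / 2)"
        using elim by (simp add: power2_eq_square powr_diff)
      have "real n * (\<theta> * (real n * a) powr (p / 2 - 1) / p)\<^sup>2 * K
         = (\<theta> * a powr (p / 2 - 1) / p)\<^sup>2 * K * (real n * (real n powr (p / 2 - 1))\<^sup>2)"
        using a elim by (simp add: powr_mult power_mult_distrib power_divide)
      also have "\<dots> = (\<theta> * a powr (p / 2 - 1) / p)\<^sup>2 * K * real n powr (p / 2 - 1) * real n powr (p / 2)"
        unfolding n2 by simp
      also have "\<dots> \<le> d * real n powr (p / 2)" using elim by (intro mult_right_mono) auto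
      finally show ?case .
    qed
  qed
  have e2: "\<forall>\<^sub>F n in sequentially. real n * C \<le> 1/2 * exp (d * real n powr (p / 2))"
  proof -
    define c where "c = (2 / p / (d / 2)) powr (2 / p) * \<bar>C\<bar>"
    have "\<forall>\<^sub>F n in sequentially. (2 * c) * exp (- (d/2) * real n powr (p / 2)) \<le> exp (- 0 * real n powr (p / 2)) \<or> c = 0"
    proof (cases "c = 0")
      case False
      then have "0 < c" by (auto simp: c_def)
      then show ?thesis using exp_gap[OF s, of 0 "d/2" "2 * c"] d by (auto elim: eventually_mono)
    qed simp
    then show ?thesis
    proof eventually_elim
      case (elim n)
      have "real n = (real n powr (p / 2)) powr (2 / p)" using p by (simp add: powr_powr)
      also have "\<dots> \<le> (2 / p / (d / 2)) powr (2 / p) * exp (d / 2 * real n powr (p / 2))"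
        using p d by (intro powr_le_exp) auto
      finally have "real n * \<bar>C\<bar> \<le> (2 / p / (d / 2)) powr (2 / p) * exp (d / 2 * real n powr (p / 2)) * \<bar>C\<bar>" by (intro mult_right_mono) auto
      then have 1: "real n * C \<le> c * exp (d / 2 * real n powr (p / 2))"
        using mult_left_mono[OF abs_ge_self[of C], of "real n"] by (simp add: c_def algebra_simps)
      have "2 * c \<le> exp (d/2 * real n powr (p / 2))"
        using elim by (auto simp: exp_minus field_simps)
      then have "2 * c * exp (d / 2 * real n powr (p / 2)) \<le> exp (d/2 * real n powr (p / 2)) * exp (d / 2 * real n powr (p / 2))"
        by (intro mult_right_mono) auto
      also have "\<dots> = exp (d * real n powr (p / 2))" by (simp add: mult_exp_exp)
      finally show ?case using 1 by simp
    qed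
  qed
  have e3: "\<forall>\<^sub>F n in sequentially. 2 * exp (- d * real n powr (p / 2)) \<le> exp (- 0 * real n powr (p / 2))"
    by (rule exp_gap[OF s]) (use d in auto)
  show "\<forall>\<^sub>F n in sequentially. \<P>(x in gg_prod p n. real n * (M2 p + a) \<le> (\<Sum>i<n. (x i)\<^sup>2))
     \<le> exp (- r * real n powr (p / 2))"
    using e1 e2 e3 eventually_ge_at_top[of "1::nat"]
  proof eventually_elim
    case (elim n)
    let ?s = "real n powr (p / 2)"
    have qs: "\<theta> * (real n * a) powr (p / 2) / p = q * ?s" using a by (simp add: q_def b_def powr_mult)
    have q2: "q = r + 2 * d" by (simp add: d_def field_simps)
    have "\<P>(x in gg_prod p n. real n * (M2 p + a) \<le> (\<Sum>i<n. (x i)\<^sup>2))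
      \<le> exp (- (q * ?s) + real n * (\<theta> * (real n * a) powr (p / 2 - 1) / p)\<^sup>2 * K) + real n * (exp (- (q * ?s)) * C)"
      using gg_square_truncated_upper[OF p a th(1,2) elim(4)] unfolding qs K_def C_def .
    also have "exp (- (q * ?s) + real n * (\<theta> * (real n * a) powr (p / 2 - 1) / p)\<^sup>2 * K) \<le> exp (- (q * ?s) + d * ?s)"
      using elim(1) by simp
    also have "real n * (exp (- (q * ?s)) * C) \<le> exp (- (q * ?s)) * (1/2 * exp (d * ?s))"
      using elim(2) mult_left_mono[OF elim(2), of "exp (- (q * ?s))"] by (simp add: algebra_simps)
    also have "exp (- (q * ?s) + d * ?s) + exp (- (q * ?s)) * (1/2 * exp (d * ?s)) = 3/2 * (exp (- r * ?s) * exp (- d * ?s))"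
      by (simp add: mult_exp_exp q2 algebra_simps)
    also have "\<dots> \<le> exp (- r * ?s)"
    proof -
      have "exp (- d * ?s) \<le> 1/2" using elim(3) by simp
      then have "exp (- r * ?s) * exp (- d * ?s) \<le> exp (- r * ?s) * (1/2)" by (intro mult_left_mono) auto
      then show ?thesis using exp_gt_zero[of "- r * ?s"] by simp
    qed
    finally show ?case by simp
  qed
qed

lemma exp_ub_of_le:
  assumes "\<forall>n. P n \<le> exp (- c * s n)" "\<forall>\<^sub>F n in sequentially. 0 \<le> s n"
  shows "exp_ub s P (ereal c)"
  unfolding exp_ub_def
proof (intro allI impI)
  fix r assume "ereal r < ereal c"
  then have r: "r < c" by simp
  show "\<forall>\<^sub>F n in sequentially. P n \<le> exp (- r * s n)" using assms(2)
  proof eventually_elim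
    case (elim n)
    have "r * s n \<le> c * s n" using r elim by (intro mult_right_mono) auto
    then have "exp (- c * s n) \<le> exp (- r * s n)" by simp
    then show ?case using assms(1) by (meson order_trans)
  qed
qed

lemma gg_square_upper_tendsto_0:
  assumes p: "1 \<le> p" and d: "0 < d" "0 < e"
  shows "\<forall>\<^sub>F n in sequentially. \<P>(x in gg_prod p n. real n * (M2 p + d) \<le> (\<Sum>i<n. (x i)\<^sup>2)) \<le> e"
proof (cases "p < 2")
  case True
  show ?thesis
    by (rule exp_ub_tendsto_0[OF gg_square_heavy_upper[OF p True d(1)]])
       (use p d filterlim_nat_powr in auto)
next
  case False
  then obtain c where c: "0 < c" "\<forall>n. \<P>(x in gg_prod p n. real n * (M2 p + d) \<le> (\<Sum>i<n. (x i)\<^sup>2)) \<le> exp (- c * real n)"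
    using gg_square_upper[of p d] d by auto
  show ?thesis
    by (rule exp_ub_tendsto_0[OF exp_ub_of_le[OF c(2)]]) (use c d filterlim_real_sequentially in auto)
qed

lemma gg_square_near:
  assumes p: "1 \<le> p" and d: "0 < d"
  shows "\<forall>\<^sub>F n in sequentially. 1/2 \<le> \<P>(x in gg_prod p n. \<bar>(\<Sum>i<n. (x i)\<^sup>2) - real n * M2 p\<bar> < real n * d)"
proof -
  have p0: "0 < p" using p by simp
  obtain c where c: "0 < c" "\<forall>n. \<P>(x in gg_prod p n. (\<Sum>i<n. (x i)\<^sup>2) \<le> real n * (M2 p - d)) \<le> exp (- c * real n)"
    using gg_square_lower[OF p0 d] by auto
  have 1: "\<forall>\<^sub>F n in sequentially. \<P>(x in gg_prod p n. (\<Sum>i<n. (x i)\<^sup>2) \<le> real n * (M2 p - d)) \<le> 1/4"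
    by (rule exp_ub_tendsto_0[OF exp_ub_of_le[OF c(2)]]) (use c filterlim_real_sequentially in auto)
  have "(0::real) < 1/4" by simp
  from 1 gg_square_upper_tendsto_0[OF p d this] show ?thesis
  proof eventually_elim
    case (elim n)
    interpret P: prob_space "gg_prod p n" by (rule prob_space_gg_prod[OF p0])
    let ?A = "{x\<in>space (gg_prod p n). (\<Sum>i<n. (x i)\<^sup>2) \<le> real n * (M2 p - d)}"
    let ?B = "{x\<in>space (gg_prod p n). real n * (M2 p + d) \<le> (\<Sum>i<n. (x i)\<^sup>2)}"
    let ?C = "{x\<in>space (gg_prod p n). \<bar>(\<Sum>i<n. (x i)\<^sup>2) - real n * M2 p\<bar> < real n * d}"
    have m: "?A \<in> sets (gg_prod p n)" "?B \<in> sets (gg_prod p n)" "?C \<in> sets (gg_prod p n)" by measurable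
    have "1 = measure (gg_prod p n) (space (gg_prod p n))" by (simp add: P.prob_space)
    also have "\<dots> \<le> measure (gg_prod p n) (?C \<union> (?A \<union> ?B))"
      by (rule P.finite_measure_mono) (use m in \<open>auto simp: algebra_simps abs_less_iff\<close>)
    also have "\<dots> \<le> measure (gg_prod p n) ?C + measure (gg_prod p n) (?A \<union> ?B)"
      using m by (intro measure_Un_le) auto
    also have "measure (gg_prod p n) (?A \<union> ?B) \<le> measure (gg_prod p n) ?A + measure (gg_prod p n) ?B"
      using m by (intro measure_Un_le) auto
    finally show ?case using elim by simp
  qed
qed

text \<open>
  The length of the interval times the smallest value of the density on it.
\<close>

lemma gg_interval_lower:
  assumes p: "0 < p" and uv: "0 \<le> u" "u \<le> v"
  shows "(sqrt v - sqrt u) * (exp (- (v powr (p / 2) / p)) / gg_const p) \<le> measure (gg p) {y. u \<le> y\<^sup>2 \<and> y\<^sup>2 \<le> v}"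
proof -
  interpret G: prob_space "gg p" by (rule prob_space_gg[OF p])
  let ?J = "{sqrt u..sqrt v}" and ?e = "exp (- (v powr (p / 2) / p)) / gg_const p"
  have c: "0 < gg_const p" by (rule gg_const_pos[OF p])
  have "ennreal ((sqrt v - sqrt u) * ?e) = (\<integral>\<^sup>+y. ennreal ?e * indicator ?J y \<partial>lborel)"
    using uv c by (subst nn_integral_cmult_indicator) (auto simp: ennreal_mult[symmetric] mult.commute)
  also have "\<dots> \<le> (\<integral>\<^sup>+y. ennreal (exp (- (\<bar>y\<bar> powr p / p)) / gg_const p) * indicator ?J y \<partial>lborel)"
  proof (rule nn_integral_mono)
    fix y
    show "ennreal ?e * indicator ?J y \<le> ennreal (exp (- (\<bar>y\<bar> powr p / p)) / gg_const p) * indicator ?J y"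
    proof (cases "y \<in> ?J")
      case True
      then have y: "0 \<le> y" "y \<le> sqrt v" using uv by (auto intro: order_trans[OF real_sqrt_ge_zero[OF uv(1)]])
      have "\<bar>y\<bar> powr p \<le> (sqrt v) powr p" using y p by (intro powr_mono2) auto
      also have "(sqrt v) powr p = v powr (p / 2)" using uv by (simp add: powr_half_sqrt[symmetric] powr_powr)
      finally have "\<bar>y\<bar> powr p / p \<le> v powr (p / 2) / p" using p by (simp add: divide_right_mono)
      then have "?e \<le> exp (- (\<bar>y\<bar> powr p / p)) / gg_const p" using c by (intro divide_right_mono) auto
      then show ?thesis using True by (simp add: ennreal_leI)
    qed simp
  qed
  also have "\<dots> = emeasure (gg p) ?J" unfolding gg_def using p by (subst emeasure_density) auto
  also have "\<dots> \<le> emeasure (gg p) {y. u \<le> y\<^sup>2 \<and> y\<^sup>2 \<le> v}"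
  proof (rule emeasure_mono)
    show "?J \<subseteq> {y. u \<le> y\<^sup>2 \<and> y\<^sup>2 \<le> v}"
    proof safe
      fix y assume y: "y \<in> ?J"
      then have y0: "0 \<le> y" using uv by (auto intro: order_trans[OF real_sqrt_ge_zero[OF uv(1)]])
      show "u \<le> y\<^sup>2" using y y0 uv by (simp add: sqrt_le_D)
      show "y\<^sup>2 \<le> v" using power_mono[of y "sqrt v" 2] y y0 uv by simp
    qed
  qed simp
  finally have "ennreal ((sqrt v - sqrt u) * ?e) \<le> ennreal (measure (gg p) {y. u \<le> y\<^sup>2 \<and> y\<^sup>2 \<le> v})"
    by (simp add: G.emeasure_eq_measure)
  then show ?thesis by (simp add: ennreal_le_iff)
qed

text \<open>
  Splits off the last coordinate, which will carry the jump.
\<close>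

lemma PiM_Suc_product_lower:
  fixes G :: "real measure"
  assumes G: "prob_space G"
    and S: "S \<in> sets (Pi\<^sub>M {..<Suc n} (\<lambda>_. G))" and A: "A \<in> sets (Pi\<^sub>M {..<n} (\<lambda>_. G))" and J: "J \<in> sets G"
    and sub: "\<And>x y. x \<in> A \<Longrightarrow> y \<in> J \<Longrightarrow> x(n := y) \<in> S"
  shows "measure (Pi\<^sub>M {..<n} (\<lambda>_. G)) A * measure G J \<le> measure (Pi\<^sub>M {..<Suc n} (\<lambda>_. G)) S"
proof -
  interpret G: prob_space G by fact
  interpret P: prob_space "Pi\<^sub>M {..<n} (\<lambda>_::nat. G)" by (rule prob_space_PiM) (rule G)
  interpret Q: prob_space "Pi\<^sub>M {..<Suc n} (\<lambda>_::nat. G)" by (rule prob_space_PiM) (rule G)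
  interpret product_sigma_finite "\<lambda>_::nat. G"
    by (simp add: product_sigma_finite_def prob_space_imp_sigma_finite G)
  have ins: "{..<Suc n} = insert n {..<n}" by auto
  have "emeasure (Pi\<^sub>M {..<n} (\<lambda>_. G)) A * emeasure G J = (\<integral>\<^sup>+x. emeasure G J * indicator A x \<partial>Pi\<^sub>M {..<n} (\<lambda>_. G))"
    by (subst nn_integral_cmult_indicator[OF A]) (rule mult.commute)
  also have "\<dots> = (\<integral>\<^sup>+x. \<integral>\<^sup>+y. indicator A x * indicator J y \<partial>G \<partial>Pi\<^sub>M {..<n} (\<lambda>_. G))"
    using J by (intro nn_integral_cong) (simp add: nn_integral_cmult mult.commute)
  also have "\<dots> \<le> (\<integral>\<^sup>+x. \<integral>\<^sup>+y. indicator S (x(n := y)) \<partial>G \<partial>Pi\<^sub>M {..<n} (\<lambda>_. G))"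
    by (intro nn_integral_mono) (auto simp: indicator_def sub)
  also have "\<dots> = (\<integral>\<^sup>+x. indicator S x \<partial>Pi\<^sub>M {..<Suc n} (\<lambda>_. G))"
    unfolding ins by (rule product_nn_integral_insert[symmetric]) (use S ins in auto)
  also have "\<dots> = emeasure (Pi\<^sub>M {..<Suc n} (\<lambda>_. G)) S" using S by simp
  finally show ?thesis
    by (simp add: P.emeasure_eq_measure G.emeasure_eq_measure Q.emeasure_eq_measure ennreal_mult[symmetric])
qed

text \<open>
  One big jump: \<open>n\<close> coordinates behave typically, and the last one satisfies \<open>y\<^sup>2 \<approx> n a\<close>, which has
  probability about \<open>exp (- (n a)^(p/2)/p)\<close>.
\<close>

lemma gg_square_heavy_lower:
  assumes p: "1 \<le> p" "p < 2" and a: "0 \<le> a" and d: "0 < d"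
  shows "exp_lb (\<lambda>n. real n powr (p / 2))
     (\<lambda>n. \<P>(x in gg_prod p n. \<bar>(\<Sum>i<n. (x i)\<^sup>2) - real n * (M2 p + a)\<bar> < real n * d)) (ereal (a powr (p / 2) / p))"
  unfolding exp_lb_def
proof (intro allI impI)
  fix r assume "ereal (a powr (p / 2) / p) < ereal r"
  then have r: "a powr (p / 2) < r * p" using p by (simp add: field_simps)
  have p0: "0 < p" using p by simp
  have r0: "0 < r * p" using r powr_ge_zero[of a "p/2"] by linarith
  interpret G: prob_space "gg p" by (rule prob_space_gg[OF p0])
  \<comment> \<open>The jump size whose cost is exactly \<open>r\<close>.\<close>
  define b where "b = (r * p) powr (2 / p)"
  have "a = (a powr (p / 2)) powr (2 / p)" using a p by (simp add: powr_powr)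
  also have "\<dots> < b" unfolding b_def using r p by (intro powr_less_mono2) auto
  finally have ab: "a < b" .
  \<comment> \<open>The jump may overshoot by \<open>h\<close>: its cost stays below \<open>r\<close>, and the sum of squares stays in the window.\<close>
  define h where "h = min d (b - a) / 8"
  have h: "0 < h" "h < d / 4" "a + h < b" using ab d by (auto simp: h_def min_def field_simps)
  define r1 where "r1 = (a + h) powr (p / 2) / p"
  have "(a + h) powr (p / 2) < b powr (p / 2)" using h a p by (intro powr_less_mono2) auto
  also have "b powr (p / 2) = r * p" using r0 p by (simp add: b_def powr_powr)
  finally have r1: "r1 < r" using p by (simp add: r1_def field_simps)
  define l where "l = (sqrt (a + h) - sqrt a) / gg_const p"
  have l: "0 < l" using h a gg_const_pos[OF p0] by (simp add: l_def)
  define P where "P n = \<P>(x in gg_prod p n. \<bar>(\<Sum>i<n. (x i)\<^sup>2) - real n * (M2 p + a)\<bar> < real n * d)" for n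
  have s: "filterlim (\<lambda>n. real n powr (p / 2)) at_top sequentially" using p by (intro filterlim_nat_powr) simp
  have s1: "filterlim (\<lambda>n. real (Suc n) powr (p / 2)) at_top sequentially"
    using filterlim_compose[OF s filterlim_Suc] .
  have "0 < 2 / l" using l by simp
  note e1 = exp_gap[OF s1 r1 this]
  have "0 < d / 2" using d by simp
  note e2 = gg_square_near[OF p(1) this]
  have e3: "\<forall>\<^sub>F n in sequentially. 4 * M2 p / d < real n"
    using filterlim_real_sequentially by (simp add: filterlim_at_top_dense)
  have "\<forall>\<^sub>F n in sequentially. exp (- r * real (Suc n) powr (p / 2)) \<le> P (Suc n)"
    using e1 e2 e3
  proof eventually_elim
    case (elim n)
    let ?N = "real (Suc n)"
    define J where "J = {y. ?N * a \<le> y\<^sup>2 \<and> y\<^sup>2 \<le> ?N * (a + h)}"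
    define A where "A = {x\<in>space (gg_prod p n). \<bar>(\<Sum>i<n. (x i)\<^sup>2) - real n * M2 p\<bar> < real n * (d / 2)}"
    have mJ: "J \<in> sets (gg p)" unfolding J_def sets_gg by measurable
    have mA: "A \<in> sets (gg_prod p n)" unfolding A_def by measurable
    have "l * exp (- r1 * ?N powr (p / 2)) \<le> (sqrt (?N * (a + h)) - sqrt (?N * a)) * (exp (- ((?N * (a + h)) powr (p / 2) / p)) / gg_const p)"
    proof -
      have "1 * (sqrt (a + h) - sqrt a) \<le> sqrt ?N * (sqrt (a + h) - sqrt a)" using h a by (intro mult_right_mono) auto
      then have 1: "sqrt (a + h) - sqrt a \<le> sqrt (?N * (a + h)) - sqrt (?N * a)"
        unfolding real_sqrt_mult by (simp add: right_diff_distrib)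
      have 2: "(?N * (a + h)) powr (p / 2) / p = r1 * ?N powr (p / 2)" using h a by (simp only: powr_mult r1_def) simp
      have "l * exp (- r1 * ?N powr (p / 2)) = (sqrt (a + h) - sqrt a) * (exp (- (r1 * ?N powr (p / 2))) / gg_const p)"
        by (simp add: l_def)
      also have "\<dots> \<le> (sqrt (?N * (a + h)) - sqrt (?N * a)) * (exp (- (r1 * ?N powr (p / 2))) / gg_const p)"
        by (rule mult_right_mono[OF 1]) (use gg_const_pos[OF p0] in auto)
      finally show ?thesis unfolding 2 .
    qed
    also have "\<dots> \<le> measure (gg p) J" unfolding J_def
      by (rule gg_interval_lower[OF p0]) (use a h in \<open>auto intro!: mult_left_mono mult_nonneg_nonneg simp del: of_nat_Suc\<close>)
    finally have J: "l * exp (- r1 * ?N powr (p / 2)) \<le> measure (gg p) J" .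
    have "exp (- r * ?N powr (p / 2)) \<le> 1/2 * (l * exp (- r1 * ?N powr (p / 2)))"
      using elim(1) l by (simp add: field_simps)
    also have "\<dots> \<le> measure (gg_prod p n) A * measure (gg p) J"
      using elim(2) J l by (intro mult_mono) (auto simp: A_def)
    also have "\<dots> \<le> P (Suc n)"
      unfolding P_def
    proof (rule PiM_Suc_product_lower[OF G.prob_space_axioms _ mA mJ])
      show "{x \<in> space (gg_prod p (Suc n)). \<bar>(\<Sum>i<Suc n. (x i)\<^sup>2) - ?N * (M2 p + a)\<bar> < ?N * d} \<in> sets (gg_prod p (Suc n))"
        by measurable
      fix x y assume x: "x \<in> A" and y: "y \<in> J"
      have xs: "x(n := y) \<in> space (gg_prod p (Suc n))"
        using x by (auto simp: A_def space_PiM PiE_iff extensional_def)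
      have sum: "(\<Sum>i<Suc n. ((x(n := y)) i)\<^sup>2) = (\<Sum>i<n. (x i)\<^sup>2) + y\<^sup>2" by simp
      have M: "M2 p < real n * (d / 4)" using elim(3) d by (simp add: field_simps)
      have M0: "0 < M2 p" by (rule M2_pos[OF p0])
      have hN: "?N * h \<le> ?N * (d / 4)" using h by (intro mult_left_mono) auto
      have 1: "\<bar>(\<Sum>i<n. (x i)\<^sup>2) - real n * M2 p\<bar> < real n * (d / 2)" using x by (simp add: A_def)
      have 2: "?N * a \<le> y\<^sup>2" "y\<^sup>2 \<le> ?N * a + ?N * h" using y unfolding J_def by (auto simp only: mem_Collect_eq distrib_left)
      have 3: "?N * (M2 p + a) = real n * M2 p + M2 p + ?N * a" by (simp add: algebra_simps)
      have 4: "real n * (d / 2) + real n * (d / 4) \<le> ?N * d" "real n * (d / 2) + ?N * (d / 4) \<le> ?N * d"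
        using d by (simp_all add: field_simps)
      have "\<bar>(\<Sum>i<n. (x i)\<^sup>2) + y\<^sup>2 - ?N * (M2 p + a)\<bar> < ?N * d"
        unfolding 3 using 1 2 4 M M0 hN by linarith
      then show "x(n := y) \<in> {x \<in> space (gg_prod p (Suc n)). \<bar>(\<Sum>i<Suc n. (x i)\<^sup>2) - ?N * (M2 p + a)\<bar> < ?N * d}"
        using xs sum by simp
    qed
    finally show ?case .
  qed
  then show "\<forall>\<^sub>F n in sequentially. exp (- r * real n powr (p / 2)) \<le> P n"
    using eventually_sequentially_Suc[of "\<lambda>n. exp (- r * real n powr (p / 2)) \<le> P n"] by blast
qed

section \<open>Integration in polar coordinates\<close>

abbreviation leb :: "nat \<Rightarrow> (nat \<Rightarrow> real) measure" where
  "leb n \<equiv> Pi\<^sub>M {..<n} (\<lambda>_. lborel)"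

lemma product_sigma_finite_lborel: "product_sigma_finite (\<lambda>_::nat. lborel :: real measure)"
  by (simp add: product_sigma_finite_def sigma_finite_lborel)

lemma measurable_lp_norm:
  assumes "\<And>i. i < n \<Longrightarrow> (\<lambda>w. f w i) \<in> borel_measurable M"
  shows "(\<lambda>w. lp_norm n p (f w)) \<in> borel_measurable M"
  unfolding lp_norm_def using assms by measurable

lemma measurable_leb_component: "i < n \<Longrightarrow> (\<lambda>x. x i) \<in> borel_measurable (leb n)"
  using measurable_component_singleton[of i "{..<n}" "\<lambda>_. lborel :: real measure"] by simp

lemma measurable_leb_lp_norm [measurable]: "lp_norm n p \<in> borel_measurable (leb n)"
  using measurable_lp_norm[of n "\<lambda>x. x" "leb n" p] measurable_leb_component by simp

lemma lp_norm_nonneg [simp]: "0 \<le> lp_norm n p x"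
  by (simp add: lp_norm_def)

lemma lp_norm_powr: "0 < p \<Longrightarrow> lp_norm n p x powr p = (\<Sum>i<n. \<bar>x i\<bar> powr p)"
  by (simp add: lp_norm_def powr_powr sum_nonneg)

lemma lp_norm_scale:
  assumes "0 < p" "0 \<le> r"
  shows "lp_norm n p (\<lambda>i. r * x i) = r * lp_norm n p x"
proof -
  have "(\<Sum>i<n. \<bar>r * x i\<bar> powr p) = r powr p * (\<Sum>i<n. \<bar>x i\<bar> powr p)"
    using assms by (simp add: abs_mult powr_mult sum_distrib_left)
  then show ?thesis using assms by (simp add: lp_norm_def powr_mult sum_nonneg powr_powr)
qed

lemma lp_norm_cong: "(\<And>i. i < n \<Longrightarrow> x i = y i) \<Longrightarrow> lp_norm n p x = lp_norm n p y"
  by (simp add: lp_norm_def)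

lemma lp_norm_eq_0_iff: "0 < p \<Longrightarrow> lp_norm n p x = 0 \<longleftrightarrow> (\<forall>i<n. x i = 0)"
  by (auto simp: lp_norm_def sum_nonneg_eq_0_iff)

text \<open>
  The joint density depends on the point through its \<open>\<ell>\<^sub>p\<close> norm only. This is what ties the \<open>p\<close>-Gaussian
  vector to the uniform distribution on the \<open>\<ell>\<^sub>p\<close> ball.
\<close>

lemma gg_prod_density:
  assumes p: "0 < p"
  shows "gg_prod p n = density (leb n) (\<lambda>x. ennreal (exp (- (lp_norm n p x powr p / p)) / gg_const p ^ n))"
    (is "_ = ?D")
proof -
  interpret G: product_sigma_finite "\<lambda>_::nat. gg p"
    by (simp add: product_sigma_finite_def prob_space_imp_sigma_finite prob_space_gg[OF p])
  interpret L: product_sigma_finite "\<lambda>_::nat. lborel :: real measure" by (rule product_sigma_finite_lborel)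
  have c: "0 < gg_const p" by (rule gg_const_pos[OF p])
  show ?thesis
  proof (rule G.PiM_eqI[symmetric])
    show "finite {..<n}" by simp
    show "sets ?D = sets (gg_prod p n)" by (simp cong: sets_PiM_cong)
    fix A assume A: "\<And>i. i \<in> {..<n} \<Longrightarrow> A i \<in> sets (gg p)"
    then have A': "\<And>i. i < n \<Longrightarrow> A i \<in> sets borel" by simp
    have box: "Pi\<^sub>E {..<n} A \<in> sets (leb n)" using A' by (intro sets_PiM_I_finite) auto
    have "emeasure ?D (Pi\<^sub>E {..<n} A) = (\<integral>\<^sup>+x. ennreal (exp (- (lp_norm n p x powr p / p)) / gg_const p ^ n) * indicator (Pi\<^sub>E {..<n} A) x \<partial>leb n)"
      by (rule emeasure_density[OF _ box]) measurable
    also have "\<dots> = (\<integral>\<^sup>+x. (\<Prod>i<n. ennreal (exp (- (\<bar>x i\<bar> powr p / p)) / gg_const p) * indicator (A i) (x i)) \<partial>leb n)"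
    proof (rule nn_integral_cong)
      fix x assume x: "x \<in> space (leb n)"
      have "exp (- (lp_norm n p x powr p / p)) / gg_const p ^ n = (\<Prod>i<n. exp (- (\<bar>x i\<bar> powr p / p)) / gg_const p)"
        unfolding lp_norm_powr[OF p] by (simp add: prod_dividef exp_sum[symmetric] sum_negf sum_divide_distrib)
      moreover have "indicator (Pi\<^sub>E {..<n} A) x = (\<Prod>i<n. indicator (A i) (x i) :: ennreal)"
      proof (cases "x \<in> Pi\<^sub>E {..<n} A")
        case True then show ?thesis by (auto simp: PiE_mem)
      next
        case False
        then obtain i where i: "i < n" "x i \<notin> A i" using x by (auto simp: space_PiM PiE_iff)
        have "(\<Prod>i<n. indicator (A i) (x i) :: ennreal) = 0" by (rule prod_zero) (use i in \<open>auto intro!: bexI[of _ i]\<close>)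
        then show ?thesis using False by simp
      qed
      ultimately show "ennreal (exp (- (lp_norm n p x powr p / p)) / gg_const p ^ n) * indicator (Pi\<^sub>E {..<n} A) x =
          (\<Prod>i<n. ennreal (exp (- (\<bar>x i\<bar> powr p / p)) / gg_const p) * indicator (A i) (x i))"
        using c by (simp only: prod.distrib) (simp add: prod_ennreal)
    qed
    also have "\<dots> = (\<Prod>i<n. \<integral>\<^sup>+y. ennreal (exp (- (\<bar>y\<bar> powr p / p)) / gg_const p) * indicator (A i) y \<partial>lborel)"
      using A' by (intro L.product_nn_integral_prod) auto
    also have "\<dots> = (\<Prod>i<n. emeasure (gg p) (A i))"
      unfolding gg_def using A' by (intro prod.cong refl emeasure_density[symmetric]) auto
    finally show "emeasure ?D (Pi\<^sub>E {..<n} A) = (\<Prod>i\<in>{..<n}. emeasure (gg p) (A i))" .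
  qed
qed

definition dilate :: "nat \<Rightarrow> real \<Rightarrow> (nat \<Rightarrow> real) \<Rightarrow> (nat \<Rightarrow> real)" where
  "dilate n r x = (\<lambda>i\<in>{..<n}. r * x i)"

lemma dilate_measurable [measurable]: "dilate n r \<in> measurable (leb n) (leb n)"
  unfolding dilate_def
  by (intro measurable_restrict) (use measurable_leb_component in \<open>auto intro!: borel_measurable_times\<close>)

lemma leb_dilate:
  assumes r: "0 < r"
  shows "leb n = density (distr (leb n) (leb n) (dilate n r)) (\<lambda>_. ennreal (r ^ n))"
    (is "_ = ?D")
proof -
  interpret L: product_sigma_finite "\<lambda>_::nat. lborel :: real measure" by (rule product_sigma_finite_lborel)
  show ?thesis
  proof (rule L.PiM_eqI[symmetric])
    show "finite {..<n}" "sets ?D = sets (leb n)" by simp_all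
    fix A :: "nat \<Rightarrow> real set" assume A: "\<And>i. i \<in> {..<n} \<Longrightarrow> A i \<in> sets lborel"
    have box: "Pi\<^sub>E {..<n} A \<in> sets (leb n)" using A by (intro sets_PiM_I_finite) auto
    have pre: "dilate n r -` Pi\<^sub>E {..<n} A \<inter> space (leb n) = Pi\<^sub>E {..<n} (\<lambda>i. (\<lambda>y. r * y) -` A i)"
      by (auto simp: dilate_def space_PiM PiE_iff)
    have mA: "(\<lambda>y. r * y) -` A i \<in> sets borel" if "i < n" for i
      using measurable_sets[of "\<lambda>y. r * y" borel borel "A i"] A[of i] that by simp
    have one: "emeasure lborel (A i) = ennreal r * emeasure lborel ((\<lambda>y. r * y) -` A i)" if "i < n" for i
    proof -
      have "emeasure lborel ((\<lambda>y. r * y) -` A i) = emeasure (distr lborel borel ((*) r)) (A i)"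
        using A[of i] that by (subst emeasure_distr) auto
      also have "\<dots> = ennreal (inverse r) * emeasure lborel (A i)"
        using r A[of i] that by (simp add: lborel_distr_mult emeasure_density nn_integral_cmult)
      finally show ?thesis using r by (simp add: mult.assoc[symmetric] ennreal_mult[symmetric])
    qed
    have "emeasure ?D (Pi\<^sub>E {..<n} A) = ennreal (r ^ n) * emeasure (leb n) (dilate n r -` Pi\<^sub>E {..<n} A \<inter> space (leb n))"
      using box by (simp add: emeasure_density nn_integral_cmult emeasure_distr)
    also have "\<dots> = ennreal (r ^ n) * (\<Prod>i<n. emeasure lborel ((\<lambda>y. r * y) -` A i))"
      unfolding pre using mA by (subst L.emeasure_PiM) auto
    also have "\<dots> = (\<Prod>i<n. ennreal r * emeasure lborel ((\<lambda>y. r * y) -` A i))"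
      using r by (simp add: prod.distrib ennreal_power)
    also have "\<dots> = (\<Prod>i<n. emeasure lborel (A i))" using one by (intro prod.cong) auto
    finally show "emeasure ?D (Pi\<^sub>E {..<n} A) = (\<Prod>i\<in>{..<n}. emeasure lborel (A i))" .
  qed
qed

text \<open>
  Measurable cones with apex at the origin.
\<close>

definition homogeneous_set :: "nat \<Rightarrow> (nat \<Rightarrow> real) set \<Rightarrow> bool" where
  "homogeneous_set n D \<longleftrightarrow> D \<in> sets (leb n) \<and> (\<forall>r>0. \<forall>x\<in>space (leb n). dilate n r x \<in> D \<longleftrightarrow> x \<in> D)"

lemma lp_norm_dilate: "0 < p \<Longrightarrow> 0 \<le> r \<Longrightarrow> lp_norm n p (dilate n r x) = r * lp_norm n p x"
  by (subst lp_norm_scale[symmetric]) (auto intro: lp_norm_cong simp: dilate_def)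

lemma homogeneous_ball:
  assumes D: "homogeneous_set n D" and p: "0 < p" and r: "0 < r"
  shows "emeasure (leb n) {x\<in>D. lp_norm n p x \<le> r} = ennreal (r ^ n) * emeasure (leb n) {x\<in>D. lp_norm n p x \<le> 1}"
proof -
  have mD: "D \<in> sets (leb n)" using D by (simp add: homogeneous_set_def)
  have S: "{x\<in>D. lp_norm n p x \<le> t} \<in> sets (leb n)" for t
  proof -
    have "{x\<in>D. lp_norm n p x \<le> t} = D \<inter> {x\<in>space (leb n). lp_norm n p x \<le> t}" using sets.sets_into_space[OF mD] by auto
    also have "\<dots> \<in> sets (leb n)"
    proof (rule sets.Int[OF mD])
      show "{x\<in>space (leb n). lp_norm n p x \<le> t} \<in> sets (leb n)" by measurable
    qed
    finally show ?thesis .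
  qed
  have "emeasure (leb n) {x\<in>D. lp_norm n p x \<le> r} =
      emeasure (density (distr (leb n) (leb n) (dilate n r)) (\<lambda>_. ennreal (r ^ n))) {x\<in>D. lp_norm n p x \<le> r}"
    using leb_dilate[OF r] by metis
  also have "\<dots> = ennreal (r ^ n) * emeasure (leb n) (dilate n r -` {x\<in>D. lp_norm n p x \<le> r} \<inter> space (leb n))"
    using S[of r] by (simp add: emeasure_density nn_integral_cmult emeasure_distr)
  also have "dilate n r -` {x\<in>D. lp_norm n p x \<le> r} \<inter> space (leb n) = {x\<in>D. lp_norm n p x \<le> 1}"
  proof -
    have "lp_norm n p (dilate n r x) \<le> r \<longleftrightarrow> lp_norm n p x \<le> 1" for x
      using r p by (simp add: lp_norm_dilate)
    then show ?thesis using D r sets.sets_into_space[OF mD] by (auto simp: homogeneous_set_def)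
  qed
  finally show ?thesis .
qed

lemma leb_norm_zero:
  assumes p: "0 < p" and n: "1 \<le> n"
  shows "{x\<in>space (leb n). lp_norm n p x \<le> 0} \<in> null_sets (leb n)"
proof -
  interpret L: product_sigma_finite "\<lambda>_::nat. lborel :: real measure" by (rule product_sigma_finite_lborel)
  have "{x\<in>space (leb n). lp_norm n p x \<le> 0} = Pi\<^sub>E {..<n} (\<lambda>_. {0})"
    using lp_norm_eq_0_iff[OF p, of n] lp_norm_nonneg[of n p]
    by (auto simp: space_PiM PiE_iff antisym_conv extensional_def fun_eq_iff restrict_def)
  moreover have "emeasure (leb n) (Pi\<^sub>E {..<n} (\<lambda>_. {0})) = 0"
    using n by (subst L.emeasure_PiM) auto
  moreover have "Pi\<^sub>E {..<n} (\<lambda>_. {0}) \<in> sets (leb n)" by (intro sets_PiM_I_finite) auto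
  ultimately show ?thesis by (simp add: null_sets_def)
qed

text \<open>
  The ball is contained in a cube.
\<close>

lemma leb_ball_finite:
  assumes p: "0 < p" shows "emeasure (leb n) {x\<in>space (leb n). lp_norm n p x \<le> 1} < \<infinity>"
proof -
  interpret L: product_sigma_finite "\<lambda>_::nat. lborel :: real measure" by (rule product_sigma_finite_lborel)
  have "{x\<in>space (leb n). lp_norm n p x \<le> 1} \<subseteq> Pi\<^sub>E {..<n} (\<lambda>_. {-1..1})"
  proof
    fix x assume x: "x \<in> {x\<in>space (leb n). lp_norm n p x \<le> 1}"
    have "\<bar>x i\<bar> \<le> 1" if "i < n" for i
    proof -
      have "\<bar>x i\<bar> powr p \<le> (\<Sum>i<n. \<bar>x i\<bar> powr p)" using that by (intro member_le_sum) auto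
      also have "\<dots> = lp_norm n p x powr p" by (simp add: lp_norm_powr[OF p])
      also have "\<dots> \<le> 1" using x p by (simp add: powr_le1)
      finally have "(\<bar>x i\<bar> powr p) powr (1 / p) \<le> 1" using p by (intro powr_le1) auto
      then show ?thesis using p by (simp add: powr_powr)
    qed
    then show "x \<in> Pi\<^sub>E {..<n} (\<lambda>_. {-1..1})" using x by (auto simp: space_PiM PiE_iff abs_le_iff minus_le_iff)
  qed
  then have "emeasure (leb n) {x\<in>space (leb n). lp_norm n p x \<le> 1} \<le> emeasure (leb n) (Pi\<^sub>E {..<n} (\<lambda>_. {-1..1}))"
    by (rule emeasure_mono) (intro sets_PiM_I_finite; auto)
  also have "\<dots> = (\<Prod>i<n. ennreal 2)" by (subst L.emeasure_PiM) auto
  also have "\<dots> < \<infinity>" by (simp add: ennreal_power[symmetric] power_less_top_ennreal)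
  finally show ?thesis .
qed

text \<open>
  By scaling, the part of the cone \<open>D\<close> inside the ball of radius \<open>r\<close> has measure proportional to \<open>r\<^sup>n\<close>.
  Hence the image of Lebesgue measure on \<open>D\<close> under the norm and the measure with density \<open>n r^(n-1)\<close>
  agree on all half lines, up to the factor in front, and therefore everywhere.
\<close>

lemma polar_integration:
  assumes D: "homogeneous_set n D" and p: "0 < p" and n: "1 \<le> n" and f[measurable]: "f \<in> borel_measurable borel"
  shows "(\<integral>\<^sup>+x. f (lp_norm n p x) * indicator D x \<partial>leb n) =
    emeasure (leb n) {x\<in>D. lp_norm n p x \<le> 1} * (\<integral>\<^sup>+r. f r * ennreal (real n * r ^ (n - 1)) * indicator {0..} r \<partial>lborel)"
proof -
  have mD[measurable]: "D \<in> sets (leb n)" using D by (simp add: homogeneous_set_def)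
  define A where "A = emeasure (leb n) {x\<in>D. lp_norm n p x \<le> 1}"
  define M1 where "M1 = distr (density (leb n) (indicator D)) borel (lp_norm n p)"
  define M2 where "M2 = density lborel (\<lambda>r. A * (ennreal (real n * r ^ (n - 1)) * indicator {0..} r))"
  have S: "{x\<in>D. lp_norm n p x \<le> t} = D \<inter> {x\<in>space (leb n). lp_norm n p x \<le> t}" for t
    using sets.sets_into_space[OF mD] by auto
  have "A \<le> emeasure (leb n) {x\<in>space (leb n). lp_norm n p x \<le> 1}" unfolding A_def S by (rule emeasure_mono) auto
  then have Afin: "A < \<infinity>" using leb_ball_finite[OF p, of n] by (rule le_less_trans)
  have m1: "emeasure M1 {..r} = emeasure (leb n) {x\<in>D. lp_norm n p x \<le> r}" for r
  proof -
    have "emeasure M1 {..r} = emeasure (density (leb n) (indicator D)) (lp_norm n p -` {..r} \<inter> space (leb n))"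
      unfolding M1_def by (subst emeasure_distr) auto
    also have "\<dots> = emeasure (leb n) (D \<inter> (lp_norm n p -` {..r} \<inter> space (leb n)))"
      by (subst emeasure_density) (auto simp: indicator_inter_arith[symmetric])
    also have "D \<inter> (lp_norm n p -` {..r} \<inter> space (leb n)) = {x\<in>D. lp_norm n p x \<le> r}" unfolding S by auto
    finally show ?thesis .
  qed
  have m2: "emeasure M2 {..r} = A * ennreal (r ^ n)" if r: "0 \<le> r" for r
  proof -
    have "emeasure M2 {..r} = (\<integral>\<^sup>+t. A * (ennreal (real n * t ^ (n - 1)) * indicator {0..} t) * indicator {..r} t \<partial>lborel)"
      unfolding M2_def by (rule emeasure_density) auto
    also have "\<dots> = (\<integral>\<^sup>+t. A * (ennreal (real n * t ^ (n - 1)) * indicator {0..r} t) \<partial>lborel)"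
      by (intro nn_integral_cong) (auto simp: indicator_def)
    also have "\<dots> = A * (\<integral>\<^sup>+t. ennreal (real n * t ^ (n - 1)) * indicator {0..r} t \<partial>lborel)"
      by (rule nn_integral_cmult) auto
    also have "(\<integral>\<^sup>+t. ennreal (real n * t ^ (n - 1)) * indicator {0..r} t \<partial>lborel) = ennreal (r ^ n - 0 ^ n)"
      by (rule nn_integral_FTC_Icc) (use r in \<open>auto intro!: derivative_eq_intros\<close>)
    finally show ?thesis using n by (simp add: power_0_left)
  qed
  have eq: "emeasure M1 {..r} = emeasure M2 {..r}" for r
  proof -
    consider "r < 0" | "r = 0" | "0 < r" by linarith
    then show ?thesis
    proof cases
      case 1
      have e: "{x\<in>D. lp_norm n p x \<le> r} = {}" using 1 lp_norm_nonneg[of n p] by (auto simp: not_le intro: less_le_trans)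
      have "emeasure M1 {..r} = 0" unfolding m1 e by simp
      moreover have "emeasure M2 {..r} \<le> emeasure M2 {..0}" using 1 by (intro emeasure_mono) (auto simp: M2_def)
      then have "emeasure M2 {..r} = 0" using m2[of 0] n by (simp add: power_0_left)
      ultimately show ?thesis by simp
    next
      case 2
      have "emeasure M1 {..r} \<le> emeasure (leb n) {x\<in>space (leb n). lp_norm n p x \<le> 0}"
        unfolding m1 2 S by (rule emeasure_mono) auto
      then have "emeasure M1 {..r} = 0" using leb_norm_zero[OF p n] by (simp add: null_sets_def)
      then show ?thesis using m2[of 0] n 2 by (simp add: power_0_left)
    next
      case 3
      then show ?thesis unfolding m1 homogeneous_ball[OF D p 3] using m2[of r] by (simp add: A_def mult.commute)
    qed
  qed
  have "M1 = M2"
  proof (rule measure_eqI_generator_eq[where E = "range atMost" and \<Omega> = UNIV and A = "\<lambda>i::nat. {..real i}"])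
    show "Int_stable (range atMost :: real set set)" by (auto simp: Int_stable_def)
    show "sets M1 = sigma_sets UNIV (range atMost)" "sets M2 = sigma_sets UNIV (range atMost)"
      unfolding M1_def M2_def by (simp_all add: borel_eq_atMost)
    show "\<And>X. X \<in> range atMost \<Longrightarrow> emeasure M1 X = emeasure M2 X" using eq by auto
    show "(\<Union>i. {..real i}) = UNIV" by (auto intro: real_arch_simple)
    show "emeasure M1 {..real i} \<noteq> \<infinity>" for i
      unfolding eq using m2[of "real i"] Afin by (simp add: ennreal_mult_eq_top_iff)
  qed auto
  then have "(\<integral>\<^sup>+r. f r \<partial>M1) = (\<integral>\<^sup>+r. f r \<partial>M2)" by simp
  also have "(\<integral>\<^sup>+r. f r \<partial>M1) = (\<integral>\<^sup>+x. f (lp_norm n p x) \<partial>density (leb n) (indicator D))"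
    unfolding M1_def by (rule nn_integral_distr) auto
  also have "\<dots> = (\<integral>\<^sup>+x. f (lp_norm n p x) * indicator D x \<partial>leb n)"
    by (subst nn_integral_density) (auto simp: mult.commute)
  also have "(\<integral>\<^sup>+r. f r \<partial>M2) = (\<integral>\<^sup>+r. A * (f r * ennreal (real n * r ^ (n - 1)) * indicator {0..} r) \<partial>lborel)"
    unfolding M2_def by (subst nn_integral_density) (auto simp: mult_ac)
  also have "\<dots> = A * (\<integral>\<^sup>+r. f r * ennreal (real n * r ^ (n - 1)) * indicator {0..} r \<partial>lborel)"
    by (rule nn_integral_cmult) auto
  finally show ?thesis by (simp add: A_def)
qed

lemma homogeneous_space: "homogeneous_set n (space (leb n))"
proof -
  have "dilate n r x \<in> space (leb n)" for r x by (auto simp: dilate_def space_PiM)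
  then show ?thesis by (auto simp: homogeneous_set_def)
qed

text \<open>
  If the ball were a null set, polar integration would give the \<open>p\<close>-Gaussian density total mass zero.
\<close>

lemma leb_ball_pos:
  assumes p: "0 < p" and n: "1 \<le> n"
  shows "emeasure (leb n) {x\<in>space (leb n). lp_norm n p x \<le> 1} \<noteq> 0"
proof
  assume z: "emeasure (leb n) {x\<in>space (leb n). lp_norm n p x \<le> 1} = 0"
  interpret P: prob_space "gg_prod p n" by (rule prob_space_gg_prod[OF p])
  have "1 = (\<integral>\<^sup>+x. 1 \<partial>gg_prod p n)" using P.emeasure_space_1 by simp
  also have "\<dots> = (\<integral>\<^sup>+x. ennreal (exp (- (lp_norm n p x powr p / p)) / gg_const p ^ n) * indicator (space (leb n)) x \<partial>leb n)"
    unfolding gg_prod_density[OF p] by (subst nn_integral_density) (auto intro!: nn_integral_cong)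
  also have "\<dots> = 0" using polar_integration[OF homogeneous_space p n, of "\<lambda>r. ennreal (exp (- (r powr p / p)) / gg_const p ^ n)"] z by simp
  finally show False by simp
qed

text \<open>
  The radial integral of the density does not depend on the cone, and for the cone of all vectors it is
  determined by the total mass one. So the \<open>p\<close>-Gaussian vector and the uniform distribution on the ball
  agree on cones.
\<close>

lemma gg_prod_homogeneous:
  assumes D: "homogeneous_set n D" and p: "0 < p" and n: "1 \<le> n"
  shows "emeasure (gg_prod p n) D * emeasure (leb n) {x\<in>space (leb n). lp_norm n p x \<le> 1} =
    emeasure (leb n) {x\<in>D. lp_norm n p x \<le> 1}"
proof -
  interpret P: prob_space "gg_prod p n" by (rule prob_space_gg_prod[OF p])
  have mD[measurable]: "D \<in> sets (leb n)" using D by (simp add: homogeneous_set_def)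
  let ?f = "\<lambda>r. ennreal (exp (- (r powr p / p)) / gg_const p ^ n)"
  let ?I = "\<integral>\<^sup>+r. ?f r * ennreal (real n * r ^ (n - 1)) * indicator {0..} r \<partial>lborel"
  have *: "emeasure (gg_prod p n) D' = emeasure (leb n) {x\<in>D'. lp_norm n p x \<le> 1} * ?I"
    if D': "homogeneous_set n D'" for D'
  proof -
    have mD': "D' \<in> sets (leb n)" using D' by (simp add: homogeneous_set_def)
    have "emeasure (gg_prod p n) D' = (\<integral>\<^sup>+x. ?f (lp_norm n p x) * indicator D' x \<partial>leb n)"
      unfolding gg_prod_density[OF p] by (rule emeasure_density[OF _ mD']) measurable
    also have "\<dots> = emeasure (leb n) {x\<in>D'. lp_norm n p x \<le> 1} * ?I"
      by (rule polar_integration[OF D' p n]) measurable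
    finally show ?thesis .
  qed
  have sp: "space (leb n) = space (gg_prod p n)" by (simp add: space_PiM)
  have "1 = emeasure (gg_prod p n) (space (leb n))" unfolding sp by (simp add: P.emeasure_space_1)
  also have "\<dots> = emeasure (leb n) {x\<in>space (leb n). lp_norm n p x \<le> 1} * ?I" by (rule *[OF homogeneous_space])
  finally have 1: "?I * emeasure (leb n) {x\<in>space (leb n). lp_norm n p x \<le> 1} = 1" by (simp add: mult.commute)
  show ?thesis unfolding *[OF D] using 1 by (simp add: mult.assoc)
qed

section \<open>Uniform distribution and cone measure\<close>

lemma Rn_iff: "x \<in> Rn n \<longleftrightarrow> (\<forall>i\<ge>n. x i = 0)"
  by (simp add: topspace_Euclidean_space)

text \<open>
  Identifies functions on \<open>{..<n}\<close>, extended by \<^term>\<open>undefined\<close>, with sequences that vanish beyond \<open>n\<close>.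
\<close>

definition emb :: "nat \<Rightarrow> (nat \<Rightarrow> real) \<Rightarrow> (nat \<Rightarrow> real)" where
  "emb n x = (\<lambda>i. if i < n then x i else 0)"

lemma space_Rn_borel [simp]: "space (Rn_borel n) = Rn n"
  by (simp add: Rn_borel_def space_restrict_space)

lemma measurable_Rn_component [measurable]: "(\<lambda>x. x i) \<in> borel_measurable (Rn_borel n)"
  unfolding Rn_borel_def by (rule measurable_restrict_space1) (rule measurable_product_coordinates)

lemma measurable_into_Rn:
  assumes "\<And>i. (\<lambda>w. f w i) \<in> borel_measurable M" "\<And>w. w \<in> space M \<Longrightarrow> f w \<in> Rn n"
  shows "f \<in> measurable M (Rn_borel n)"
  unfolding Rn_borel_def
  by (rule measurable_restrict_space2) (use assms in \<open>auto intro: measurable_coordinatewise_then_product\<close>)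

lemma emb_measurable [measurable]: "emb n \<in> measurable (leb n) (Rn_borel n)"
proof (rule measurable_into_Rn)
  fix i show "(\<lambda>w. emb n w i) \<in> borel_measurable (leb n)"
    by (cases "i < n") (auto simp: emb_def measurable_leb_component)
qed (simp add: emb_def Rn_iff)

lemma measurable_Rn_lp_norm [measurable]: "lp_norm n p \<in> borel_measurable (Rn_borel n)"
  using measurable_lp_norm[of n "\<lambda>x. x" "Rn_borel n" p] by simp

lemma Rn_lebesgue_eq: "Rn_lebesgue n = distr (leb n) (Rn_borel n) (emb n)"
  by (simp add: Rn_lebesgue_def emb_def[abs_def])

lemma lp_norm_emb [simp]: "lp_norm n p (emb n x) = lp_norm n p x"
  by (rule lp_norm_cong) (simp add: emb_def)

lemma lp_ball_sets [measurable]: "lp_ball n p \<in> sets (Rn_borel n)"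
proof -
  have "{x\<in>space (Rn_borel n). lp_norm n p x \<le> 1} \<in> sets (Rn_borel n)" by measurable
  then show ?thesis by (simp add: lp_ball_def)
qed

lemma lp_sphere_sets [measurable]: "lp_sphere n p \<in> sets (Rn_borel n)"
proof -
  have "{x\<in>space (Rn_borel n). lp_norm n p x = 1} \<in> sets (Rn_borel n)" by measurable
  then show ?thesis by (simp add: lp_sphere_def)
qed

lemma sets_Rn_lebesgue [simp, measurable_cong]: "sets (Rn_lebesgue n) = sets (Rn_borel n)"
  and sets_unif_ball [simp, measurable_cong]: "sets (unif_ball n p) = sets (Rn_borel n)"
  by (simp_all add: Rn_lebesgue_def unif_ball_def)

lemma space_unif_ball [simp]: "space (unif_ball n p) = Rn n"
  using sets_eq_imp_space_eq[OF sets_unif_ball] by simp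

lemma emb_in_Rn: "emb n x \<in> Rn n"
  by (simp add: emb_def Rn_iff)

lemma emeasure_lp_ball:
  "emeasure (Rn_lebesgue n) (lp_ball n p) = emeasure (leb n) {x\<in>space (leb n). lp_norm n p x \<le> 1}"
  unfolding Rn_lebesgue_eq
  by (subst emeasure_distr[OF emb_measurable lp_ball_sets])
     (auto intro!: arg_cong[where f = "emeasure _"] simp: lp_ball_def emb_in_Rn)

text \<open>
  Polar integration, normalised by the volume of the ball: the direction and the radius separate, and
  the direction may be sampled from the \<open>p\<close>-Gaussian vector.
\<close>

lemma unif_polar:
  assumes p: "0 < p" and n: "1 \<le> n" and f[measurable]: "f \<in> borel_measurable borel"
    and D[measurable]: "D \<in> sets (Rn_borel n)" and hom: "homogeneous_set n {x\<in>space (leb n). emb n x \<in> D}"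
  shows "(\<integral>\<^sup>+x. f (lp_norm n p x) * indicator D x \<partial>unif_ball n p) =
     emeasure (gg_prod p n) {x\<in>space (leb n). emb n x \<in> D} *
       (\<integral>\<^sup>+r. f r * ennreal (real n * r ^ (n - 1)) * indicator {0..1} r \<partial>lborel)"
proof -
  let ?D = "{x\<in>space (leb n). emb n x \<in> D}"
  let ?B = "emeasure (leb n) {x\<in>space (leb n). lp_norm n p x \<le> 1}"
  let ?I = "\<integral>\<^sup>+r. f r * ennreal (real n * r ^ (n - 1)) * indicator {0..1} r \<partial>lborel"
  have "(\<integral>\<^sup>+x. f (lp_norm n p x) * indicator D x \<partial>unif_ball n p) =
     (\<integral>\<^sup>+x. f (lp_norm n p x) * indicator D x * indicator (lp_ball n p) x \<partial>Rn_lebesgue n) / ?B"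
    unfolding unif_ball_def emeasure_lp_ball[symmetric] by (rule nn_integral_uniform_measure) measurable
  also have "(\<integral>\<^sup>+x. f (lp_norm n p x) * indicator D x * indicator (lp_ball n p) x \<partial>Rn_lebesgue n) =
     (\<integral>\<^sup>+x. f (lp_norm n p (emb n x)) * indicator D (emb n x) * indicator (lp_ball n p) (emb n x) \<partial>leb n)"
    unfolding Rn_lebesgue_eq by (rule nn_integral_distr) measurable
  also have "\<dots> = (\<integral>\<^sup>+x. (\<lambda>r. f r * indicator {..1} r) (lp_norm n p x) * indicator ?D x \<partial>leb n)"
    by (intro nn_integral_cong) (auto simp: indicator_def lp_ball_def emb_in_Rn)
  also have "\<dots> = emeasure (leb n) {x\<in>?D. lp_norm n p x \<le> 1} *
       (\<integral>\<^sup>+r. (f r * indicator {..1} r) * ennreal (real n * r ^ (n - 1)) * indicator {0..} r \<partial>lborel)"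
    by (rule polar_integration[OF hom p n]) measurable
  also have "(\<integral>\<^sup>+r. (f r * indicator {..1} r) * ennreal (real n * r ^ (n - 1)) * indicator {0..} r \<partial>lborel) = ?I"
    by (intro nn_integral_cong) (auto simp: indicator_def)
  also have "emeasure (leb n) {x\<in>?D. lp_norm n p x \<le> 1} = emeasure (gg_prod p n) ?D * ?B"
    by (rule gg_prod_homogeneous[OF hom p n, symmetric])
  also have "emeasure (gg_prod p n) ?D * ?B * ?I / ?B = emeasure (gg_prod p n) ?D * ?I"
  proof -
    have "?B \<noteq> 0" "?B \<noteq> \<infinity>" using leb_ball_pos[OF p n] leb_ball_finite[OF p, of n] by auto
    then have "(emeasure (gg_prod p n) ?D * ?I) * ?B / ?B = emeasure (gg_prod p n) ?D * ?I"
      by (intro mult_divide_eq_ennreal) auto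
    then show ?thesis by (simp only: mult_ac)
  qed
  finally show ?thesis .
qed

lemma radial_mass:
  assumes n: "1 \<le> n"
  shows "(\<integral>\<^sup>+r. ennreal (real n * r ^ (n - 1)) * indicator {0..1} r \<partial>lborel) = 1"
proof -
  have "(\<integral>\<^sup>+t. ennreal (real n * t ^ (n - 1)) * indicator {0..1} t \<partial>lborel) = ennreal (1 ^ n - 0 ^ n)"
    by (rule nn_integral_FTC_Icc) (auto intro!: derivative_eq_intros)
  then show ?thesis using n by (simp add: power_0_left)
qed

lemma emb_space: "{x\<in>space (leb n). emb n x \<in> Rn n} = space (leb n)"
  by (auto simp: emb_in_Rn)

lemma gg_prod_space: "space (leb n) = space (gg_prod p n)"
  by (simp add: space_PiM)

lemma emeasure_unif_ball:
  assumes p: "0 < p" and n: "1 \<le> n"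
    and D: "D \<in> sets (Rn_borel n)" and hom: "homogeneous_set n {x\<in>space (leb n). emb n x \<in> D}"
  shows "emeasure (unif_ball n p) D = emeasure (gg_prod p n) {x\<in>space (leb n). emb n x \<in> D}"
proof -
  have "emeasure (unif_ball n p) D = (\<integral>\<^sup>+x. 1 * indicator D x \<partial>unif_ball n p)" using D by simp
  also have "\<dots> = emeasure (gg_prod p n) {x\<in>space (leb n). emb n x \<in> D}"
    using unif_polar[OF p n _ D hom, of "\<lambda>_. 1"] radial_mass[OF n] by simp
  finally show ?thesis .
qed

lemma unif_norm_zero:
  assumes p: "0 < p" and n: "1 \<le> n"
  shows "{x\<in>Rn n. lp_norm n p x \<le> 0} \<in> null_sets (unif_ball n p)"
proof -
  have S: "{x\<in>space (Rn_borel n). lp_norm n p x \<le> 0} \<in> sets (Rn_borel n)" by measurable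
  have R: "Rn n \<in> sets (Rn_borel n)" by (metis sets.top space_Rn_borel)
  have ind: "indicator {x\<in>Rn n. lp_norm n p x \<le> 0} x = (indicator {..0} (lp_norm n p x) * indicator (Rn n) x :: ennreal)" for x
    by (auto simp: indicator_def)
  have "emeasure (unif_ball n p) {x\<in>Rn n. lp_norm n p x \<le> 0} = (\<integral>\<^sup>+x. indicator {..0} (lp_norm n p x) * indicator (Rn n) x \<partial>unif_ball n p)"
    unfolding ind[symmetric] using S by simp
  also have "\<dots> = emeasure (gg_prod p n) {x\<in>space (leb n). emb n x \<in> Rn n} *
      (\<integral>\<^sup>+r. indicator {..0} r * ennreal (real n * r ^ (n - 1)) * indicator {0..1} r \<partial>lborel)"
    by (rule unif_polar[OF p n _ R]) (auto simp: emb_space homogeneous_space)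
  also have "(\<integral>\<^sup>+r. indicator {..0} r * ennreal (real n * r ^ (n - 1)) * indicator {0..1} r \<partial>lborel) = (\<integral>\<^sup>+r. 0 \<partial>(lborel :: real measure))"
    by (rule nn_integral_cong_AE, rule AE_mp[OF AE_lborel_singleton[of 0]]) (auto simp: indicator_def)
  finally show ?thesis using S by (simp add: null_sets_def)
qed

text \<open>
  The cone over \<open>A\<close> consists, up to the origin, of the points of the ball whose radial projection lies
  in \<open>A\<close>. Thus the cone measure is the image of the uniform distribution under \<open>x \<mapsto> x/\<parallel>x\<parallel>\<^sub>p\<close>, in
  particular a measure, and \<^term>\<open>measure_of\<close> returns the given set function.
\<close>

lemma emeasure_cone_measure:
  assumes p: "0 < p" and n: "1 \<le> n" and A: "A \<in> sets (Rn_borel n)"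
  shows "emeasure (cone_measure n p) A =
    emeasure (unif_ball n p) {x\<in>Rn n. (\<lambda>i. x i / lp_norm n p x) \<in> A \<inter> lp_sphere n p}"
proof -
  define T where "T x = (\<lambda>i. x i / lp_norm n p x)" for x :: "nat \<Rightarrow> real"
  have T[measurable]: "T \<in> measurable (unif_ball n p) (Rn_borel n)"
    by (rule measurable_into_Rn) (auto simp: T_def Rn_iff)
  define N where "N = density (distr (unif_ball n p) (Rn_borel n) T) (indicator (lp_sphere n p))"
  have N: "emeasure N A = emeasure (unif_ball n p) {x\<in>Rn n. T x \<in> A \<inter> lp_sphere n p}" if A[measurable]: "A \<in> sets (Rn_borel n)" for A
  proof -
    have "emeasure N A = emeasure (distr (unif_ball n p) (Rn_borel n) T) (lp_sphere n p \<inter> A)"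
      unfolding N_def by (subst emeasure_density) (auto simp: indicator_inter_arith[symmetric])
    also have "\<dots> = emeasure (unif_ball n p) (T -` (lp_sphere n p \<inter> A) \<inter> space (unif_ball n p))"
      by (rule emeasure_distr) measurable
    also have "T -` (lp_sphere n p \<inter> A) \<inter> space (unif_ball n p) = {x\<in>Rn n. T x \<in> A \<inter> lp_sphere n p}" by auto
    finally show ?thesis .
  qed
  have cone: "emeasure (unif_ball n p) (cone_over (A \<inter> lp_sphere n p)) = emeasure N A" if A: "A \<in> sets (Rn_borel n)" for A
  proof -
    let ?P = "{x\<in>Rn n. T x \<in> A \<inter> lp_sphere n p}"
    let ?Z = "{x\<in>Rn n. lp_norm n p x \<le> 0}"
    have P: "?P \<in> sets (unif_ball n p)"
    proof -
      have "T -` (A \<inter> lp_sphere n p) \<inter> space (unif_ball n p) \<in> sets (unif_ball n p)" using A by measurable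
      then show ?thesis by (simp add: vimage_def Int_def conj_commute)
    qed
    have sub1: "?P \<inter> lp_ball n p \<subseteq> cone_over (A \<inter> lp_sphere n p)"
    proof
      fix x assume x: "x \<in> ?P \<inter> lp_ball n p"
      have nz: "lp_norm n p x \<noteq> 0"
      proof
        assume z: "lp_norm n p x = 0"
        then have "T x = (\<lambda>i. 0)" by (simp add: T_def)
        then have "lp_norm n p (\<lambda>i. 0::real) = 1" using x by (simp add: lp_sphere_def)
        moreover have "lp_norm n p (\<lambda>i. 0::real) = 0" using lp_norm_eq_0_iff[OF p] by blast
        ultimately show False by simp
      qed
      then have "x = (\<lambda>i. lp_norm n p x * T x i)" by (simp add: T_def fun_eq_iff)
      then show "x \<in> cone_over (A \<inter> lp_sphere n p)"
        using x unfolding cone_over_def by (auto simp: lp_ball_def intro!: exI[of _ "lp_norm n p x"] exI[of _ "T x"])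
    qed
    have sub2: "cone_over (A \<inter> lp_sphere n p) \<subseteq> (?P \<inter> lp_ball n p) \<union> ?Z"
    proof
      fix x assume "x \<in> cone_over (A \<inter> lp_sphere n p)"
      then obtain r y where ry: "x = (\<lambda>i. r * y i)" "y \<in> A" "y \<in> lp_sphere n p" "0 \<le> r" "r \<le> 1" by (auto simp: cone_over_def)
      have ny: "lp_norm n p y = 1" "y \<in> Rn n" using ry by (auto simp: lp_sphere_def)
      have nx: "lp_norm n p x = r" unfolding ry(1) using lp_norm_scale[OF p ry(4), of n y] ny by simp
      have xR: "x \<in> Rn n" using ny by (simp add: Rn_iff ry(1))
      show "x \<in> (?P \<inter> lp_ball n p) \<union> ?Z"
      proof (cases "r = 0")
        case True then show ?thesis using nx xR by simp
      next
        case False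
        then have "T x = y" using nx unfolding ry(1) by (simp add: T_def)
        then show ?thesis using ry nx xR by (auto simp: lp_ball_def)
      qed
    qed
    have "emeasure (unif_ball n p) (cone_over (A \<inter> lp_sphere n p)) = emeasure (unif_ball n p) (?P \<inter> lp_ball n p)"
    proof (rule emeasure_eq_AE)
      have "AE x in unif_ball n p. x \<notin> ?Z" by (rule AE_not_in[OF unif_norm_zero[OF p n]])
      then show "AE x in unif_ball n p. (x \<in> cone_over (A \<inter> lp_sphere n p)) = (x \<in> ?P \<inter> lp_ball n p)"
        by eventually_elim (use sub1 sub2 in blast)
      show P': "?P \<inter> lp_ball n p \<in> sets (unif_ball n p)" using P by auto
      have eq: "cone_over (A \<inter> lp_sphere n p) = (?P \<inter> lp_ball n p) \<union> (cone_over (A \<inter> lp_sphere n p) \<inter> ?Z)" using sub1 sub2 by blast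
      have Zs: "cone_over (A \<inter> lp_sphere n p) \<inter> ?Z \<in> sets (unif_ball n p)"
      proof -
        have "?Z = {\<lambda>i. 0}"
          using lp_norm_eq_0_iff[OF p, of n] lp_norm_nonneg[of n p] by (auto simp: Rn_iff antisym_conv fun_eq_iff) (metis not_less)
        then have "cone_over (A \<inter> lp_sphere n p) \<inter> ?Z = ?Z \<or> cone_over (A \<inter> lp_sphere n p) \<inter> ?Z = {}" by auto
        then show ?thesis using unif_norm_zero[OF p n] by auto
      qed
      show "cone_over (A \<inter> lp_sphere n p) \<in> sets (unif_ball n p)" by (subst eq) (rule sets.Un[OF P' Zs])
    qed
    also have "\<dots> = emeasure (unif_ball n p) ?P"
    proof (rule emeasure_eq_AE)
      have "AE x in unif_ball n p. x \<in> lp_ball n p"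
        unfolding unif_ball_def by (rule AE_uniform_measureI) auto
      then show "AE x in unif_ball n p. (x \<in> ?P \<inter> lp_ball n p) = (x \<in> ?P)" by eventually_elim auto
    qed (use P in auto)
    finally show ?thesis using N[OF A] by simp
  qed
  have spN: "space N = Rn n" "sets N = sets (Rn_borel n)" by (simp_all add: N_def)
  have "cone_measure n p = measure_of (space N) (sets N) (emeasure N)"
    unfolding cone_measure_def spN
  proof (rule measure_of_eq)
    show "sets (Rn_borel n) \<subseteq> Pow (Rn n)" using sets.space_closed[of "Rn_borel n"] by simp
    fix a assume "a \<in> sigma_sets (Rn n) (sets (Rn_borel n))"
    then have "a \<in> sets (Rn_borel n)" using sets.sigma_sets_eq[of "Rn_borel n"] by simp
    then show "emeasure (unif_ball n p) (cone_over (a \<inter> lp_sphere n p)) = emeasure N a" by (rule cone)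
  qed
  then have "cone_measure n p = N" by (simp add: measure_of_of_measure)
  then show ?thesis using N[OF A] by (simp add: T_def)
qed

text \<open>
  If the defining set function were not countably additive, \<^term>\<open>measure_of\<close> would return the zero measure;
  so a nonzero total mass already gives access to the definition.
\<close>

lemma emeasure_P_W:
  assumes tot: "emeasure (P_W W n p) (Rn n) \<noteq> 0" and A: "A \<in> sets (Rn_borel n)"
  shows "emeasure (P_W W n p) A = emeasure W {0} * emeasure (cone_measure n p) A +
      emeasure (density (unif_ball n p) (\<lambda>x. h_dens n p W (lp_norm n p x))) A"
proof -
  have cl: "sets (Rn_borel n) \<subseteq> Pow (Rn n)" using sets.space_closed[of "Rn_borel n"] by simp
  have sig: "sigma_sets (Rn n) (sets (Rn_borel n)) = sets (Rn_borel n)" using sets.sigma_sets_eq[of "Rn_borel n"] by simp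
  note conv = emeasure_measure_of_conv[of "Rn n" "sets (Rn_borel n)"]
  show ?thesis using tot A unfolding P_W_def conv sig by (auto split: if_splits)
qed

section \<open>Mixtures of radial laws\<close>

declare measurable_Rn_component [measurable del]

text \<open>
  For fixed \<open>s\<close> this is, as a function of \<open>r\<close>, the density with respect to the uniform distribution that
  belongs to the mixing distribution concentrated at \<open>s\<close>; averaging over \<open>s\<close> gives the density \<open>h\<close>
  (\<open>h_dens_eq\<close>).
\<close>

definition kern :: "nat \<Rightarrow> real \<Rightarrow> real \<Rightarrow> real \<Rightarrow> real" where
  "kern n p r s = (1 / (p powr (n / p) * Gamma (1 + n / p)) * (1 / (1 - r powr p) powr (1 + n / p))) *
     (s powr (n / p) * exp (- (1 / p) * s * r powr p * inverse (1 - r powr p)))"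

lemma kern_measurable: "(\<lambda>(r, s). kern n p r s) \<in> borel_measurable (borel \<Otimes>\<^sub>M borel)"
  unfolding kern_def by measurable

lemma kern_measurable_snd: "(\<lambda>s. kern n p r s) \<in> borel_measurable borel"
  unfolding kern_def by measurable

lemma kern_measurable_fst: "(\<lambda>r. kern n p r s) \<in> borel_measurable borel"
  unfolding kern_def by measurable

lemma kern_nonneg: "0 < p \<Longrightarrow> 0 \<le> kern n p r s"
  unfolding kern_def by (intro mult_nonneg_nonneg divide_nonneg_nonneg) (auto intro!: less_imp_le[OF Gamma_real_pos] add_pos_nonneg)

lemma h_dens_eq:
  assumes p: "0 < p" and sW[measurable_cong]: "sets W = sets borel"
  shows "h_dens n p W r = (\<integral>\<^sup>+s. ennreal (kern n p r s) * indicator {0..} s \<partial>W)"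
proof -
  let ?c = "1 / (p powr (n / p) * Gamma (1 + n / p)) * (1 / (1 - r powr p) powr (1 + n / p))"
  have c: "0 \<le> ?c" using p by (intro mult_nonneg_nonneg divide_nonneg_nonneg) (auto intro!: less_imp_le[OF Gamma_real_pos] add_pos_nonneg)
  have "h_dens n p W r = (\<integral>\<^sup>+s. ennreal ?c * (ennreal (s powr (n / p) * exp (- (1 / p) * s * r powr p * inverse (1 - r powr p))) * indicator {0..} s) \<partial>W)"
    unfolding h_dens_def by (rule nn_integral_cmult[symmetric]) measurable
  also have "\<dots> = (\<integral>\<^sup>+s. ennreal (kern n p r s) * indicator {0..} s \<partial>W)"
    unfolding kern_def using c by (intro nn_integral_cong) (simp only: mult.assoc[symmetric] ennreal_mult'[symmetric])
  finally show ?thesis .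
qed

lemma h_dens_measurable:
  assumes p: "0 < p" and W: "prob_space W" and sW[measurable_cong]: "sets W = sets borel"
  shows "h_dens n p W \<in> borel_measurable borel"
proof -
  interpret prob_space W by fact
  have [measurable]: "(\<lambda>x. kern n p (fst x) (snd x)) \<in> borel_measurable (borel \<Otimes>\<^sub>M W)"
    using kern_measurable[of n p] by (simp add: split_beta' cong: measurable_cong_sets sets_pair_measure_cong)
  have "(\<lambda>r. \<integral>\<^sup>+s. ennreal (kern n p r s) * indicator {0..} s \<partial>W) \<in> borel_measurable borel"
    by (rule borel_measurable_nn_integral) (simp add: split_beta')
  then show ?thesis unfolding h_dens_eq[OF p sW] .
qed

text \<open>
  The substitution \<open>x = (s/p) r\<^sup>p / (1 - r\<^sup>p)\<close> maps the unit interval onto the positive half line and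
  the integral to that of the Gamma density with shape \<open>n/p\<close>.
\<close>

lemma kern_radial_integral:
  assumes p: "0 < p" and n: "1 \<le> n" and s: "0 < s"
  shows "(\<integral>\<^sup>+r. ennreal (kern n p r s) * ennreal (real n * r ^ (n - 1)) * indicator {0..1} r \<partial>lborel) = 1"
proof -
  define b where "b = real n / p"
  have b: "0 < b" using p n by (simp add: b_def)
  have nb: "real n = b * p" using p by (simp add: b_def)
  define f where "f x = x powr (b - 1) / exp x" for x :: real
  define g where "g r = s / p * (r powr p / (1 - r powr p))" for r :: real
  define g' where "g' r = s * r powr (p - 1) / (1 - r powr p)\<^sup>2" for r :: real
  have lt1: "r powr p < 1" "0 < r powr p" if "r \<in> {0<..<1}" for r :: real
    using that p powr_less_mono2[of p r 1] by auto
  have "(f has_integral Gamma b) {0..}" unfolding f_def by (rule Gamma_integral_real[OF b])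
  moreover have "negligible {x \<in> {0..} - {0<..}. f x \<noteq> 0}" "negligible {x \<in> {0<..} - {0..}. f x \<noteq> 0}"
    by (rule negligible_subset[of "{0}"]; force)+
  ultimately have fi: "(f has_integral Gamma b) {0<..}"
    using has_integral_spike_set_eq by blast
  have fabs: "f absolutely_integrable_on {0<..}"
    by (rule nonnegative_absolutely_integrable_1) (use fi in \<open>auto simp: f_def has_integral_integrable\<close>)
  have inv: "r = (p * g r / s / (1 + p * g r / s)) powr (1 / p)" if r: "r \<in> {0<..<1}" for r
  proof -
    have "p * g r / s = r powr p / (1 - r powr p)" using s p by (simp add: g_def)
    moreover have "r powr p / (1 - r powr p) / (1 + r powr p / (1 - r powr p)) = r powr p" using lt1[OF r] by (simp add: field_simps)
    ultimately have "p * g r / s / (1 + p * g r / s) = r powr p" by (simp only:)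
    then show ?thesis using r p by (simp add: powr_powr)
  qed
  have img: "g ` {0<..<1} = {0<..}"
  proof
    show "g ` {0<..<1} \<subseteq> {0<..}" using lt1 s p by (auto simp: g_def intro!: mult_pos_pos divide_pos_pos)
    show "{0<..} \<subseteq> g ` {0<..<1}"
    proof
      fix v :: real assume v: "v \<in> {0<..}"
      define w where "w = p * v / s"
      have w: "0 < w" using v p s by (simp add: w_def)
      define r where "r = (w / (1 + w)) powr (1 / p)"
      have rp: "r powr p = w / (1 + w)" using w p by (simp add: r_def powr_powr)
      have "(w / (1 + w)) powr (1 / p) < 1 powr (1 / p)" using w p by (intro powr_less_mono2) auto
      then have "r \<in> {0<..<1}" using w by (simp add: r_def)
      moreover have "g r = v"
      proof -
        have X: "w / (1 + w) / (1 - w / (1 + w)) = w" using w by (simp add: field_simps)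
        have "g r = s / p * w" unfolding g_def rp X ..
        then show ?thesis using p s by (simp add: w_def)
      qed
      ultimately show "v \<in> g ` {0<..<1}" by (metis imageI)
    qed
  qed
  have inj: "inj_on g {0<..<1}" using inv by (metis inj_onI)
  have der: "(g has_field_derivative g' r) (at r within {0<..<1})" if r: "r \<in> {0<..<1}" for r
  proof -
    have d: "((\<lambda>r. r powr p) has_field_derivative (p * r powr (p - 1))) (at r)"
      using has_real_derivative_powr[of r p] r by simp
    have "((\<lambda>r. r powr p / (1 - r powr p)) has_field_derivative
        ((p * r powr (p - 1)) * (1 - r powr p) - r powr p * (0 - p * r powr (p - 1))) / ((1 - r powr p) * (1 - r powr p))) (at r)"
      using lt1[OF r] by (intro DERIV_divide DERIV_diff DERIV_const d) auto
    then have "(g has_field_derivative (s / p * (((p * r powr (p - 1)) * (1 - r powr p) - r powr p * (0 - p * r powr (p - 1))) / ((1 - r powr p) * (1 - r powr p))))) (at r)"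
      unfolding g_def by (rule DERIV_cmult)
    moreover have "s / p * (((p * r powr (p - 1)) * (1 - r powr p) - r powr p * (0 - p * r powr (p - 1))) / ((1 - r powr p) * (1 - r powr p))) = g' r"
    proof -
      have "(p * r powr (p - 1)) * (1 - r powr p) - r powr p * (0 - p * r powr (p - 1)) = p * r powr (p - 1)" by (simp add: algebra_simps)
      then show ?thesis using p by (simp add: g'_def power2_eq_square)
    qed
    ultimately show ?thesis by (simp add: has_field_derivative_at_within)
  qed
  have "(\<lambda>r. \<bar>g' r\<bar> * f (g r)) absolutely_integrable_on {0<..<1} \<and>
      integral {0<..<1} (\<lambda>r. \<bar>g' r\<bar> * f (g r)) = Gamma b"
    using has_absolute_integral_change_of_variables_1'[OF _ der inj, of f "Gamma b"] fabs fi img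
    by (auto simp: integral_unique)
  then have "((\<lambda>r. \<bar>g' r\<bar> * f (g r)) has_integral Gamma b) {0<..<1}"
    using absolutely_integrable_on_def has_integral_iff by blast
  then have "((\<lambda>r. 1 / Gamma b * (\<bar>g' r\<bar> * f (g r))) has_integral (1 / Gamma b * Gamma b)) {0<..<1}"
    by (rule has_integral_mult_right)
  also have "?this \<longleftrightarrow> ((\<lambda>r. kern n p r s * (real n * r ^ (n - 1))) has_integral (1 / Gamma b * Gamma b)) {0<..<1}"
  proof (rule has_integral_cong)
    fix r :: real assume r: "r \<in> {0<..<1}"
    define A where "A = 1 - r powr p"
    have A: "0 < A" using lt1[OF r] by (simp add: A_def)
    have r0: "0 < r" using r by simp
    have G: "Gamma (1 + b) = b * Gamma b" using Gamma_plus1[OF pos_not_nonpos_Int[OF b]] by (simp add: add.commute)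
    have rn: "r ^ (n - 1) = r powr (p - 1) * (r powr p) powr (b - 1)"
    proof -
      have "(p - 1) + p * (b - 1) = real (n - 1)" using n by (simp add: nb algebra_simps of_nat_diff)
      then have "r powr (p - 1) * r powr (p * (b - 1)) = r powr real (n - 1)" by (metis powr_add)
      then show ?thesis using r0 by (simp add: powr_powr powr_realpow)
    qed
    have gp: "(g r) powr (b - 1) = s powr (b - 1) / p powr (b - 1) * ((r powr p) powr (b - 1) / A powr (b - 1))"
      unfolding g_def A_def[symmetric] using A p s by (simp add: powr_mult powr_divide)
    have sb: "s powr b = s * s powr (b - 1)" using s by (simp add: powr_diff)
    have pb: "p powr b = p * p powr (b - 1)" using p by (simp add: powr_diff)
    have Ab: "A powr (1 + b) = A\<^sup>2 * A powr (b - 1)"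
      using A by (simp add: powr_diff powr_add power2_eq_square)
    have ex: "exp (- (1 / p) * s * r powr p * inverse A) = 1 / exp (g r)"
      unfolding g_def A_def[symmetric] by (simp add: exp_minus divide_inverse mult_ac)
    have K: "kern n p r s = 1 / (p powr b * Gamma (1 + b)) * (1 / A powr (1 + b)) * (s powr b * (1 / exp (g r)))"
      unfolding kern_def b_def[symmetric] A_def[symmetric] ex ..
    have "kern n p r s * (real n * r ^ (n - 1)) =
       1 / Gamma b * (s * r powr (p - 1) / A\<^sup>2 * (s powr (b - 1) / p powr (b - 1) * ((r powr p) powr (b - 1) / A powr (b - 1)) / exp (g r)))"
      unfolding K rn sb pb Ab G nb using b p A s by (simp add: field_simps)
    also have "\<dots> = 1 / Gamma b * (\<bar>g' r\<bar> * f (g r))"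
      unfolding f_def gp using s by (simp add: g'_def A_def[symmetric])
    finally show "1 / Gamma b * (\<bar>g' r\<bar> * f (g r)) = kern n p r s * (real n * r ^ (n - 1))" ..
  qed
  finally have hi: "((\<lambda>r. kern n p r s * (real n * r ^ (n - 1))) has_integral 1) {0<..<1}"
    using less_imp_neq[OF Gamma_real_pos[OF b], symmetric] by simp
  have km: "(\<lambda>r. kern n p r s) \<in> borel_measurable borel" unfolding kern_def by measurable
  have "((\<lambda>r. if r \<in> {0<..<1} then kern n p r s * (real n * r ^ (n - 1)) else 0) has_integral 1) UNIV"
    using hi by (simp only: has_integral_restrict_UNIV)
  then have "(\<integral>\<^sup>+r. ennreal (if r \<in> {0<..<1} then kern n p r s * (real n * r ^ (n - 1)) else 0) \<partial>lborel) = ennreal 1"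
    using km kern_nonneg[OF p] by (intro nn_integral_has_integral_lborel) auto
  also have "(\<integral>\<^sup>+r. ennreal (if r \<in> {0<..<1} then kern n p r s * (real n * r ^ (n - 1)) else 0) \<partial>lborel) =
     (\<integral>\<^sup>+r. ennreal (kern n p r s) * ennreal (real n * r ^ (n - 1)) * indicator {0..1} r \<partial>lborel)"
  proof (rule nn_integral_cong_AE)
    have "AE r in lborel. r \<noteq> (0::real)" "AE r in lborel. r \<noteq> (1::real)" by (rule AE_lborel_singleton)+
    then show "AE r in lborel. ennreal (if r \<in> {0<..<1} then kern n p r s * (real n * r ^ (n - 1)) else 0) =
        ennreal (kern n p r s) * ennreal (real n * r ^ (n - 1)) * indicator {0..1} r"
      by eventually_elim (use kern_nonneg[OF p] in \<open>auto simp: indicator_def ennreal_mult[symmetric]\<close>)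
  qed
  finally show ?thesis by simp
qed

text \<open>
  Restrict Euler's integral to the half line right of \<open>x\<close>, where \<open>t\<^sup>x \<ge> x\<^sup>x\<close>, and integrate the
  exponential.
\<close>

lemma Gamma_ge:
  assumes x: "0 < (x::real)" shows "x powr x * exp (- x) \<le> Gamma (1 + x)"
proof -
  have G: "((\<lambda>t. t powr x / exp t) has_integral Gamma (1 + x)) {0..}"
    using Gamma_integral_real[of "1 + x"] x by simp
  have E: "((\<lambda>t. x powr x * exp (- 1 * t)) has_integral (x powr x * (exp (- 1 * x) / 1))) {x..}"
    by (intro has_integral_mult_right has_integral_exp_minus_to_infinity) simp
  then have E': "((\<lambda>t. if t \<in> {x..} then x powr x * exp (- 1 * t) else 0) has_integral (x powr x * exp (- x))) {0..}"
    using x by (subst has_integral_restrict) auto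
  show ?thesis
  proof (rule has_integral_le[OF E' G])
    fix t :: real assume "t \<in> {0..}"
    show "(if t \<in> {x..} then x powr x * exp (- 1 * t) else 0) \<le> t powr x / exp t"
      using x by (auto simp: exp_minus divide_inverse intro!: powr_mono2)
  qed
qed

text \<open>
  With \<open>b = n/p\<close> and \<open>Gamma (1 + b) \<ge> b\<^sup>b e^(-b)\<close> the powers of \<open>A\<close>, \<open>p\<close> and \<open>b\<close> cancel and
  \<open>e^(-2b) e\<^sup>b = e^(-b)\<close> remains; the constant \<open>e^(-2)\<close> is chosen for this.
\<close>

lemma P_W_bound_arith:
  assumes p: "0 < p" and n: "1 \<le> n" and A: "0 < A" "A \<le> 1"
  shows "1 / (p powr (n / p) * Gamma (1 + n / p)) * (1 / A powr (1 + n / p)) * ((A * exp (- 2) * real n) powr (n / p))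
    \<le> 1 / A * exp (- (real n / p))"
proof -
  define b where "b = real n / p"
  have b: "0 < b" using p n by (simp add: b_def)
  have nb: "real n = p * b" using p by (simp add: b_def)
  have "(A * exp (- 2) * real n) powr b = A powr b * exp (- 2 * b) * (p powr b * b powr b)"
    unfolding nb using A p b by (simp add: powr_mult exp_powr_real)
  also have "b powr b = b powr b * exp (- b) * exp b" by (simp add: mult.assoc mult_exp_exp)
  also have "A powr b * exp (- 2 * b) * (p powr b * (b powr b * exp (- b) * exp b)) \<le>
      A powr b * exp (- 2 * b) * (p powr b * (Gamma (1 + b) * exp b))"
    using Gamma_ge[OF b] by (intro mult_left_mono mult_right_mono) auto
  also have "\<dots> = A powr b * p powr b * Gamma (1 + b) * exp (- b)"
    by (simp add: exp_minus exp_double[symmetric] field_simps mult_exp_exp)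
  finally have le: "(A * exp (- 2) * real n) powr b \<le> A powr b * p powr b * Gamma (1 + b) * exp (- b)" .
  have G: "0 < Gamma (1 + b)" using b by (intro Gamma_real_pos) auto
  have "1 / (p powr b * Gamma (1 + b)) * (1 / A powr (1 + b)) * ((A * exp (- 2) * real n) powr b) \<le>
     1 / (p powr b * Gamma (1 + b)) * (1 / A powr (1 + b)) * (A powr b * p powr b * Gamma (1 + b) * exp (- b))"
    using le G by (intro mult_left_mono) auto
  also have "\<dots> = 1 / A * exp (- b)" using A p G by (simp add: powr_add field_simps)
  finally show ?thesis unfolding b_def .
qed

context
  fixes W :: "real measure" and n :: nat and p :: real
  assumes p: "1 \<le> p" and n: "1 \<le> n" and W: "prob_space W" "sets W = sets borel" "emeasure W {0..} = 1"
    and tot: "emeasure (P_W W n p) (Rn n) = 1"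
begin

lemma p0: "0 < p" using p by simp

lemma density_part:
  assumes D: "D \<in> sets (Rn_borel n)" and hom: "homogeneous_set n {x\<in>space (leb n). emb n x \<in> D}"
    and A: "A \<in> sets borel"
  shows "emeasure (density (unif_ball n p) (\<lambda>x. h_dens n p W (lp_norm n p x))) {x\<in>D. lp_norm n p x \<in> A} =
    emeasure (gg_prod p n) {x\<in>space (leb n). emb n x \<in> D} *
    (\<integral>\<^sup>+r. h_dens n p W r * indicator A r * ennreal (real n * r ^ (n - 1)) * indicator {0..1} r \<partial>lborel)"
proof -
  note h_dens_measurable[OF p0 W(1,2), measurable] D[measurable] A[measurable]
  have S: "{x\<in>D. lp_norm n p x \<in> A} \<in> sets (unif_ball n p)"
  proof -
    have "{x\<in>space (Rn_borel n). lp_norm n p x \<in> A} \<in> sets (Rn_borel n)" by measurable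
    then have "D \<inter> {x\<in>space (Rn_borel n). lp_norm n p x \<in> A} \<in> sets (Rn_borel n)" using D by auto
    moreover have "D \<inter> {x\<in>space (Rn_borel n). lp_norm n p x \<in> A} = {x\<in>D. lp_norm n p x \<in> A}"
      using sets.sets_into_space[OF D] by auto
    ultimately show ?thesis by simp
  qed
  have "emeasure (density (unif_ball n p) (\<lambda>x. h_dens n p W (lp_norm n p x))) {x\<in>D. lp_norm n p x \<in> A} =
     (\<integral>\<^sup>+x. h_dens n p W (lp_norm n p x) * indicator {x\<in>D. lp_norm n p x \<in> A} x \<partial>unif_ball n p)"
    by (rule emeasure_density[OF _ S]) measurable
  also have "\<dots> = (\<integral>\<^sup>+x. (\<lambda>r. h_dens n p W r * indicator A r) (lp_norm n p x) * indicator D x \<partial>unif_ball n p)"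
    by (intro nn_integral_cong) (auto simp: indicator_def)
  also have "\<dots> = emeasure (gg_prod p n) {x\<in>space (leb n). emb n x \<in> D} *
    (\<integral>\<^sup>+r. h_dens n p W r * indicator A r * ennreal (real n * r ^ (n - 1)) * indicator {0..1} r \<partial>lborel)"
    by (rule unif_polar[OF p0 n _ D hom]) measurable
  finally show ?thesis .
qed

text \<open>
  On a cone both the cone measure and the uniform distribution coincide with the \<open>p\<close>-Gaussian vector,
  and a radial density multiplies the measure of every cone by the same factor. Since the total mass is
  one, these factors add up to one.
\<close>

lemma P_W_homogeneous:
  assumes D: "D \<in> sets (Rn_borel n)" and hom: "homogeneous_set n {x\<in>space (leb n). emb n x \<in> D}"
    and inv: "\<And>x r. x \<in> Rn n \<Longrightarrow> 0 < r \<Longrightarrow> (\<lambda>i. x i / r) \<in> D \<longleftrightarrow> x \<in> D"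
  shows "emeasure (P_W W n p) D = emeasure (gg_prod p n) {x\<in>space (leb n). emb n x \<in> D}"
proof -
  define H where "H = (\<integral>\<^sup>+r. h_dens n p W r * indicator UNIV r * ennreal (real n * r ^ (n - 1)) * indicator {0..1} r \<partial>lborel)"
  have *: "emeasure (P_W W n p) D' = emeasure (gg_prod p n) {x\<in>space (leb n). emb n x \<in> D'} * (emeasure W {0} + H)"
    if D': "D' \<in> sets (Rn_borel n)" "homogeneous_set n {x\<in>space (leb n). emb n x \<in> D'}"
    "\<And>x r. x \<in> Rn n \<Longrightarrow> 0 < r \<Longrightarrow> (\<lambda>i. x i / r) \<in> D' \<longleftrightarrow> x \<in> D'" for D'
  proof -
    have "emeasure (cone_measure n p) D' = emeasure (unif_ball n p) {x\<in>Rn n. (\<lambda>i. x i / lp_norm n p x) \<in> D' \<inter> lp_sphere n p}"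
      by (rule emeasure_cone_measure[OF p0 n D'(1)])
    also have "\<dots> = emeasure (unif_ball n p) D'"
    proof (rule emeasure_eq_AE)
      have "AE x in unif_ball n p. x \<notin> {x\<in>Rn n. lp_norm n p x \<le> 0}" by (rule AE_not_in[OF unif_norm_zero[OF p0 n]])
      moreover have "AE x in unif_ball n p. x \<in> Rn n" using AE_space[of "unif_ball n p"] by simp
      ultimately show "AE x in unif_ball n p. (x \<in> {x\<in>Rn n. (\<lambda>i. x i / lp_norm n p x) \<in> D' \<inter> lp_sphere n p}) = (x \<in> D')"
      proof eventually_elim
        case (elim x)
        then have pos: "0 < lp_norm n p x" by auto
        have "lp_norm n p (\<lambda>i. (1 / lp_norm n p x) * x i) = 1 / lp_norm n p x * lp_norm n p x"
          by (rule lp_norm_scale[OF p0]) simp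
        then have "lp_norm n p (\<lambda>i. x i / lp_norm n p x) = 1" using pos by simp
        moreover have "(\<lambda>i. x i / lp_norm n p x) \<in> Rn n" using elim by (simp add: Rn_iff)
        ultimately show ?case using D'(3)[OF elim(2) pos] elim by (auto simp: lp_sphere_def)
      qed
      define T where "T x = (\<lambda>i. x i / lp_norm n p x)" for x :: "nat \<Rightarrow> real"
      note measurable_Rn_component [measurable]
      have T[measurable]: "T \<in> measurable (unif_ball n p) (Rn_borel n)"
        by (rule measurable_into_Rn) (auto simp: T_def Rn_iff)
      have "T -` (D' \<inter> lp_sphere n p) \<inter> space (unif_ball n p) \<in> sets (unif_ball n p)" using D'(1) by measurable
      then show "{x\<in>Rn n. (\<lambda>i. x i / lp_norm n p x) \<in> D' \<inter> lp_sphere n p} \<in> sets (unif_ball n p)"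
        by (simp add: vimage_def Int_def conj_commute T_def)
    qed (use D' in simp)
    also have "\<dots> = emeasure (gg_prod p n) {x\<in>space (leb n). emb n x \<in> D'}" by (rule emeasure_unif_ball[OF p0 n D'(1,2)])
    finally have C: "emeasure (cone_measure n p) D' = emeasure (gg_prod p n) {x\<in>space (leb n). emb n x \<in> D'}" .
    have "emeasure (density (unif_ball n p) (\<lambda>x. h_dens n p W (lp_norm n p x))) D' =
       emeasure (gg_prod p n) {x\<in>space (leb n). emb n x \<in> D'} * H"
      using density_part[OF D'(1,2), of UNIV] unfolding H_def by simp
    then show ?thesis using emeasure_P_W[of W n p D'] tot D'(1) C by (simp add: distrib_left distrib_right mult.commute)
  qed
  have R: "Rn n \<in> sets (Rn_borel n)" by (metis sets.top space_Rn_borel)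
  interpret P: prob_space "gg_prod p n" by (rule prob_space_gg_prod[OF p0])
  have hs: "homogeneous_set n {x\<in>space (leb n). emb n x \<in> Rn n}" unfolding emb_space by (rule homogeneous_space)
  have "emeasure (P_W W n p) (Rn n) = emeasure (gg_prod p n) {x\<in>space (leb n). emb n x \<in> Rn n} * (emeasure W {0} + H)"
    by (rule *[OF R hs]) (simp add: Rn_iff)
  then have "1 = emeasure (gg_prod p n) (space (leb n)) * (emeasure W {0} + H)" unfolding tot emb_space .
  then have "emeasure W {0} + H = 1" unfolding gg_prod_space[of n p] by (simp add: P.emeasure_space_1)
  then show ?thesis using *[OF D hom inv] by simp
qed

lemma cone_measure_off_sphere:
  assumes "1 \<notin> A" "A \<in> sets borel"
  shows "emeasure (cone_measure n p) {x\<in>Rn n. lp_norm n p x \<in> A} = 0"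
proof -
  have S: "{x\<in>space (Rn_borel n). lp_norm n p x \<in> A} \<in> sets (Rn_borel n)" using assms(2) by measurable
  have e: "{x\<in>Rn n. (\<lambda>i. x i / lp_norm n p x) \<in> {x\<in>Rn n. lp_norm n p x \<in> A} \<inter> lp_sphere n p} = {}"
    using assms(1) by (auto simp: lp_sphere_def)
  show ?thesis using emeasure_cone_measure[OF p0 n S] unfolding space_Rn_borel e by simp
qed

text \<open>
  The cone measure lives on the sphere, so an event that avoids the radius one has mass only in the
  absolutely continuous part.
\<close>

lemma P_W_norm_event:
  assumes A: "1 \<notin> A" "A \<in> sets borel"
  shows "emeasure (P_W W n p) {x\<in>Rn n. lp_norm n p x \<in> A} =
    (\<integral>\<^sup>+r. h_dens n p W r * indicator A r * ennreal (real n * r ^ (n - 1)) * indicator {0..1} r \<partial>lborel)"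
proof -
  interpret P: prob_space "gg_prod p n" by (rule prob_space_gg_prod[OF p0])
  have R: "Rn n \<in> sets (Rn_borel n)" by (metis sets.top space_Rn_borel)
  have S: "{x\<in>space (Rn_borel n). lp_norm n p x \<in> A} \<in> sets (Rn_borel n)" using A(2) by measurable
  have "emeasure (density (unif_ball n p) (\<lambda>x. h_dens n p W (lp_norm n p x))) {x\<in>Rn n. lp_norm n p x \<in> A} =
     emeasure (gg_prod p n) (space (leb n)) * (\<integral>\<^sup>+r. h_dens n p W r * indicator A r * ennreal (real n * r ^ (n - 1)) * indicator {0..1} r \<partial>lborel)"
    using density_part[OF R _ A(2)] by (simp add: emb_space homogeneous_space)
  then show ?thesis
    using emeasure_P_W[of W n p "{x\<in>Rn n. lp_norm n p x \<in> A}"] tot S cone_measure_off_sphere[OF A] gg_prod_space[of n p]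
    by (simp add: P.emeasure_space_1)
qed

lemma P_W_outside_ball: "emeasure (P_W W n p) {x\<in>Rn n. lp_norm n p x \<in> {1<..}} = 0"
proof -
  have "emeasure (P_W W n p) {x\<in>Rn n. lp_norm n p x \<in> {1<..}} =
    (\<integral>\<^sup>+r. h_dens n p W r * indicator {1<..} r * ennreal (real n * r ^ (n - 1)) * indicator {0..1} r \<partial>lborel)"
    by (rule P_W_norm_event) auto
  also have "\<dots> = (\<integral>\<^sup>+r. 0 \<partial>(lborel :: real measure))" by (intro nn_integral_cong) (auto simp: indicator_def)
  finally show ?thesis by simp
qed

text \<open>
  Average over \<open>s\<close> the probability of the ball under the mixing component \<open>s\<close>. For \<open>s > A e^(-2) n\<close> it
  is bounded by one, which gives the tail of \<open>W\<close>. For smaller \<open>s\<close> the density itself is uniformly small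
  on the ball of radius \<open>r0 < 1\<close>, because \<open>s^(n/p)\<close> is beaten by the Gamma function.
\<close>

lemma P_W_small_ball:
  assumes r0: "0 \<le> r0" "r0 < 1"
  defines "A \<equiv> 1 - r0 powr p"
  shows "emeasure (P_W W n p) {x\<in>Rn n. lp_norm n p x \<in> {..r0}} \<le>
     ennreal (1 / A * exp (- (real n / p))) + emeasure W {A * exp (- 2) * real n<..}"
proof -
  interpret prob_space W by (rule W(1))
  interpret pair_sigma_finite lborel W ..
  note [measurable_cong] = W(2)
  have A: "0 < A" "A \<le> 1" using r0 p powr_less_mono2[of p r0 1] by (auto simp: A_def)
  define T where "T = A * exp (- 2) * real n"
  have T0: "0 \<le> T" using A by (simp add: T_def)
  define w where "w r = ennreal (real n * r ^ (n - 1)) * indicator {0..1} r" for r :: real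
  have w: "w \<in> borel_measurable borel" unfolding w_def by measurable
  have km: "(\<lambda>x. kern n p (fst x) (snd x)) \<in> borel_measurable (lborel \<Otimes>\<^sub>M W)"
    using kern_measurable[of n p] W(2) by (simp add: split_beta' cong: measurable_cong_sets sets_pair_measure_cong)
  note w[measurable] km[measurable]
  define C where "C = 1 / (p powr (n / p) * Gamma (1 + n / p)) * (1 / A powr (1 + n / p)) * (T powr (n / p))"
  have C0: "0 \<le> C" unfolding C_def using p0 by (intro mult_nonneg_nonneg divide_nonneg_nonneg) (auto intro!: less_imp_le[OF Gamma_real_pos] add_pos_nonneg)
  have kC: "kern n p r s \<le> C" if rs: "0 \<le> r" "r \<le> r0" "0 \<le> s" "s \<le> T" for r s
  proof -
    have rp: "r powr p \<le> r0 powr p" using rs p by (intro powr_mono2) auto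
    then have A1: "A \<le> 1 - r powr p" by (simp add: A_def)
    have a: "1 / (1 - r powr p) powr (1 + n / p) \<le> 1 / A powr (1 + n / p)"
      using A A1 p0 by (intro divide_left_mono powr_mono2 mult_pos_pos) auto
    have "- (1 / p) * s * r powr p * inverse (1 - r powr p) \<le> 0"
      using A A1 p0 rs by (simp add: mult_nonneg_nonneg)
    then have "exp (- (1 / p) * s * r powr p * inverse (1 - r powr p)) \<le> 1" by simp
    moreover have "s powr (n / p) \<le> T powr (n / p)" using rs p0 by (intro powr_mono2) auto
    ultimately have b: "s powr (n / p) * exp (- (1 / p) * s * r powr p * inverse (1 - r powr p)) \<le> T powr (n / p) * 1"
      by (intro mult_mono) auto
    have g: "0 \<le> 1 / (p powr (n / p) * Gamma (1 + n / p))"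
      using p0 by (intro divide_nonneg_nonneg mult_nonneg_nonneg) (auto intro!: less_imp_le[OF Gamma_real_pos] add_pos_nonneg)
    show ?thesis unfolding kern_def C_def using mult_mono[OF mult_left_mono[OF a g] b] g by simp
  qed
  have "emeasure (P_W W n p) {x\<in>Rn n. lp_norm n p x \<in> {..r0}} =
    (\<integral>\<^sup>+r. h_dens n p W r * indicator {..r0} r * ennreal (real n * r ^ (n - 1)) * indicator {0..1} r \<partial>lborel)"
    by (rule P_W_norm_event) (use r0 in auto)
  also have "\<dots> = (\<integral>\<^sup>+r. \<integral>\<^sup>+s. ennreal (kern n p r s) * indicator {0..} s * (indicator {..r0} r * w r) \<partial>W \<partial>lborel)"
    unfolding h_dens_eq[OF p0 W(2)]
  proof (intro nn_integral_cong)
    fix r :: real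
    have [measurable]: "(\<lambda>s. kern n p r s) \<in> borel_measurable W"
      unfolding measurable_cong_sets[OF W(2) refl] by (rule kern_measurable_snd)
    show "(\<integral>\<^sup>+s. ennreal (kern n p r s) * indicator {0..} s \<partial>W) * indicator {..r0} r * ennreal (real n * r ^ (n - 1)) * indicator {0..1} r =
       (\<integral>\<^sup>+s. ennreal (kern n p r s) * indicator {0..} s * (indicator {..r0} r * w r) \<partial>W)"
      unfolding w_def by (subst nn_integral_multc) (auto simp: mult.assoc)
  qed
  also have "\<dots> = (\<integral>\<^sup>+s. \<integral>\<^sup>+r. ennreal (kern n p r s) * indicator {0..} s * (indicator {..r0} r * w r) \<partial>lborel \<partial>W)"
    by (rule Fubini'[symmetric]) (simp add: split_beta')
  also have "\<dots> \<le> (\<integral>\<^sup>+s. ennreal C + indicator {T<..} s \<partial>W)"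
  proof (rule nn_integral_mono)
    fix s
    note kern_measurable_fst[measurable]
    show "(\<integral>\<^sup>+r. ennreal (kern n p r s) * indicator {0..} s * (indicator {..r0} r * w r) \<partial>lborel) \<le> ennreal C + indicator {T<..} s"
    proof (cases "T < s")
      case True
      then have s: "0 < s" using T0 by simp
      have "(\<integral>\<^sup>+r. ennreal (kern n p r s) * indicator {0..} s * (indicator {..r0} r * w r) \<partial>lborel) \<le>
          (\<integral>\<^sup>+r. ennreal (kern n p r s) * ennreal (real n * r ^ (n - 1)) * indicator {0..1} r \<partial>lborel)"
        unfolding w_def by (intro nn_integral_mono) (auto simp: indicator_def)
      also have "\<dots> = 1" by (rule kern_radial_integral[OF p0 n s])
      also have "1 \<le> ennreal C + indicator {T<..} s" using True by simp
      finally show ?thesis .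
    next
      case False
      have "(\<integral>\<^sup>+r. ennreal (kern n p r s) * indicator {0..} s * (indicator {..r0} r * w r) \<partial>lborel) \<le> (\<integral>\<^sup>+r. ennreal C * w r \<partial>lborel)"
      proof (rule nn_integral_mono)
        fix r
        show "ennreal (kern n p r s) * indicator {0..} s * (indicator {..r0} r * w r) \<le> ennreal C * w r"
        proof (cases "0 \<le> s \<and> r \<le> r0 \<and> 0 \<le> r")
          case True
          then show ?thesis using kC[of r s] False by (auto intro!: mult_right_mono ennreal_leI)
        qed (auto simp: w_def indicator_def)
      qed
      also have "\<dots> = ennreal C * (\<integral>\<^sup>+r. w r \<partial>lborel)" by (rule nn_integral_cmult) measurable
      also have "\<dots> = ennreal C" unfolding w_def radial_mass[OF n] by simp
      finally show ?thesis using False by simp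
    qed
  qed
  also have "\<dots> = ennreal C + emeasure W {T<..}"
    by (subst nn_integral_add) (auto simp: emeasure_space_1 W(2))
  also have "C \<le> 1 / A * exp (- (real n / p))"
    unfolding C_def T_def by (rule P_W_bound_arith[OF p0 n A])
  finally show ?thesis unfolding T_def by (auto intro: order_trans add_right_mono ennreal_leI)
qed

end

section \<open>Tails of chi-square variables\<close>

text \<open>
  A chi-square variable with \<open>k\<close> degrees of freedom is used through its moment generating function only;
  tails and the exponential change of measure need nothing else.
\<close>

definition chisq_mgf :: "'a measure \<Rightarrow> ('a \<Rightarrow> real) \<Rightarrow> real \<Rightarrow> bool" where
  "chisq_mgf \<mu> T k \<longleftrightarrow> T \<in> borel_measurable \<mu> \<and>
     (\<forall>t<1/2. (\<integral>\<^sup>+x. ennreal (exp (t * T x)) \<partial>\<mu>) = ennreal ((1 - 2 * t) powr (- k / 2)))"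

text \<open>
  The parameter \<open>t\<close> is the optimal one, where the derivative of the cumulant generating function equals
  \<open>u\<^sup>2\<close>. It is positive for \<open>u > 1\<close> and negative for \<open>u < 1\<close>, which yields the two tails.
\<close>

lemma chisq_chernoff:
  assumes "prob_space \<mu>" "chisq_mgf \<mu> T k" "0 < u"
  defines "t \<equiv> (1 - 1 / u\<^sup>2) / 2"
  shows "measure \<mu> {x\<in>space \<mu>. t * (u\<^sup>2 * k) \<le> t * T x} \<le> exp (- k * chi_rate u)"
proof -
  interpret prob_space \<mu> by fact
  have T[measurable]: "T \<in> borel_measurable \<mu>" using assms(2) by (simp add: chisq_mgf_def)
  have t: "1 - 2 * t = 1 / u\<^sup>2" by (simp add: t_def diff_divide_distrib)
  have "0 < 1 / u\<^sup>2" using assms(3) by simp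
  then have t2: "t < 1/2" using t by linarith
  let ?S = "{x\<in>space \<mu>. t * (u\<^sup>2 * k) \<le> t * T x}"
  have "emeasure \<mu> ?S = (\<integral>\<^sup>+x. indicator ?S x \<partial>\<mu>)" by simp
  also have "\<dots> \<le> (\<integral>\<^sup>+x. ennreal (exp (- (t * (u\<^sup>2 * k)))) * ennreal (exp (t * T x)) \<partial>\<mu>)"
    by (intro nn_integral_mono) (auto simp: indicator_def mult_exp_exp ennreal_mult[symmetric])
  also have "\<dots> = ennreal (exp (- (t * (u\<^sup>2 * k)))) * (\<integral>\<^sup>+x. ennreal (exp (t * T x)) \<partial>\<mu>)"
    by (rule nn_integral_cmult) measurable
  also have "\<dots> = ennreal (exp (- (t * (u\<^sup>2 * k)))) * ennreal ((1 / u\<^sup>2) powr (- k / 2))"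
    using assms(2) t2 t by (simp add: chisq_mgf_def)
  also have "(1 / u\<^sup>2) powr (- k / 2) = exp (k * ln u)"
    using assms(3) by (simp add: powr_def ln_div ln_realpow)
  also have "ennreal (exp (- (t * (u\<^sup>2 * k)))) * ennreal (exp (k * ln u)) = ennreal (exp (- (t * (u\<^sup>2 * k)) + k * ln u))"
    by (simp add: ennreal_mult[symmetric] mult_exp_exp)
  also have "- (t * (u\<^sup>2 * k)) + k * ln u = - k * chi_rate u"
  proof -
    have "t * (u\<^sup>2 * k) = k * ((u\<^sup>2 - 1) / 2)"
      using assms(3) by (simp add: t_def field_simps)
    then show ?thesis by (simp add: chi_rate_def algebra_simps diff_divide_distrib)
  qed
  finally show ?thesis by (simp add: emeasure_eq_measure)
qed

lemma chisq_upper_tail: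
  assumes "prob_space \<mu>" "chisq_mgf \<mu> T k" "1 \<le> u"
  shows "measure \<mu> {x\<in>space \<mu>. u\<^sup>2 * k \<le> T x} \<le> exp (- k * chi_rate u)"
proof -
  interpret prob_space \<mu> by fact
  have T[measurable]: "T \<in> borel_measurable \<mu>" using assms(2) by (simp add: chisq_mgf_def)
  have "0 \<le> (1 - 1 / u\<^sup>2) / 2" using assms(3) by (simp add: field_simps)
  then have "measure \<mu> {x\<in>space \<mu>. u\<^sup>2 * k \<le> T x} \<le> measure \<mu> {x\<in>space \<mu>. (1 - 1 / u\<^sup>2) / 2 * (u\<^sup>2 * k) \<le> (1 - 1 / u\<^sup>2) / 2 * T x}"
    by (intro finite_measure_mono) (auto intro: mult_left_mono simp del: mult_le_cancel_left)
  with chisq_chernoff[OF assms(1,2), of u] assms(3) show ?thesis by simp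
qed

lemma chisq_lower_tail:
  assumes "prob_space \<mu>" "chisq_mgf \<mu> T k" "0 < u" "u \<le> 1"
  shows "measure \<mu> {x\<in>space \<mu>. T x \<le> u\<^sup>2 * k} \<le> exp (- k * chi_rate u)"
proof -
  interpret prob_space \<mu> by fact
  have T[measurable]: "T \<in> borel_measurable \<mu>" using assms(2) by (simp add: chisq_mgf_def)
  have "u\<^sup>2 \<le> 1" using assms(3,4) by (simp add: power_le_one)
  then have "(1 - 1 / u\<^sup>2) / 2 \<le> 0" using assms(3) by (simp add: field_simps)
  then have "measure \<mu> {x\<in>space \<mu>. T x \<le> u\<^sup>2 * k} \<le> measure \<mu> {x\<in>space \<mu>. (1 - 1 / u\<^sup>2) / 2 * (u\<^sup>2 * k) \<le> (1 - 1 / u\<^sup>2) / 2 * T x}"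
    by (intro finite_measure_mono) (auto intro: mult_left_mono_neg simp del: mult_le_cancel_left)
  with chisq_chernoff[OF assms(1,2), of u] assms(3) show ?thesis by simp
qed

text \<open>
  Tilting a chi-square law by \<open>exp (t T)\<close> gives the law of a multiple of a chi-square variable; with the
  optimal \<open>t\<close> the mean moves from \<open>k\<close> to \<open>u\<^sup>2 k\<close>.
\<close>

lemma chisq_tilt:
  assumes "prob_space \<mu>" "chisq_mgf \<mu> T k" "0 < u"
  defines "t \<equiv> (1 - 1 / u\<^sup>2) / 2"
  defines "\<nu> \<equiv> density \<mu> (\<lambda>x. ennreal (exp (t * T x) * exp (- k * ln u)))"
  shows "prob_space \<nu>" "chisq_mgf \<nu> (\<lambda>x. T x / u\<^sup>2) k"
proof -
  have T[measurable]: "T \<in> borel_measurable \<mu>" using assms(2) by (simp add: chisq_mgf_def)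
  have mgf: "(\<integral>\<^sup>+x. ennreal (exp (s * (T x / u\<^sup>2))) \<partial>\<nu>) = ennreal ((1 - 2 * s) powr (- k / 2))" if s: "s < 1/2" for s
  proof -
    have eq: "t + s / u\<^sup>2 < 1/2" "1 - 2 * (t + s / u\<^sup>2) = (1 - 2 * s) * (1 / u\<^sup>2)"
      using s assms(3) by (simp_all add: t_def field_simps)
    have "(\<integral>\<^sup>+x. ennreal (exp (s * (T x / u\<^sup>2))) \<partial>\<nu>) =
        (\<integral>\<^sup>+x. ennreal (exp (t * T x) * exp (- k * ln u)) * ennreal (exp (s * (T x / u\<^sup>2))) \<partial>\<mu>)"
      unfolding \<nu>_def by (rule nn_integral_density) measurable
    also have "\<dots> = (\<integral>\<^sup>+x. ennreal (exp (- k * ln u)) * ennreal (exp ((t + s / u\<^sup>2) * T x)) \<partial>\<mu>)"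
      by (intro nn_integral_cong) (simp add: ennreal_mult[symmetric] mult_exp_exp algebra_simps)
    also have "\<dots> = ennreal (exp (- k * ln u)) * (\<integral>\<^sup>+x. ennreal (exp ((t + s / u\<^sup>2) * T x)) \<partial>\<mu>)"
      by (rule nn_integral_cmult) measurable
    also have "\<dots> = ennreal (exp (- k * ln u)) * ennreal (((1 - 2 * s) * (1 / u\<^sup>2)) powr (- k / 2))"
      using assms(2) eq by (simp add: chisq_mgf_def)
    also have "((1 - 2 * s) * (1 / u\<^sup>2)) powr (- k / 2) = (1 - 2 * s) powr (- k / 2) * exp (k * ln u)"
      using assms(3) s by (subst powr_mult) (simp_all add: powr_def ln_div ln_realpow)
    finally show ?thesis by (simp add: ennreal_mult[symmetric] mult_exp_exp exp_minus field_simps)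
  qed
  show "prob_space \<nu>"
  proof
    have "emeasure \<nu> (space \<nu>) = (\<integral>\<^sup>+x. ennreal (exp (0 * (T x / u\<^sup>2))) \<partial>\<nu>)" by simp
    also have "\<dots> = 1" using mgf[of 0] by simp
    finally show "emeasure \<nu> (space \<nu>) = 1" .
  qed
  show "chisq_mgf \<nu> (\<lambda>x. T x / u\<^sup>2) k"
    unfolding chisq_mgf_def using mgf by (auto simp: \<nu>_def)
qed

text \<open>
  Under the tilted measure \<open>T\<close> concentrates at \<open>u\<^sup>2 k\<close>, by the tail bounds applied to it, and near that
  point the density of the tilted measure is at most \<open>exp (k j(u))\<close> up to the stated error.
\<close>

lemma chisq_local_lower:
  assumes P: "prob_space \<mu>" and mgf: "chisq_mgf \<mu> T k" and u: "0 < u" and e: "0 < e" "e < 1" and k: "0 \<le> k"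
  shows "exp (- k * (chi_rate u + e * \<bar>u\<^sup>2 - 1\<bar> / 2)) *
      (1 - exp (- k * chi_rate (sqrt (1 + e))) - exp (- k * chi_rate (sqrt (1 - e))))
    \<le> measure \<mu> {x\<in>space \<mu>. \<bar>T x - u\<^sup>2 * k\<bar> \<le> e * u\<^sup>2 * k}"
proof -
  define t where "t = (1 - 1 / u\<^sup>2) / 2"
  define \<nu> where "\<nu> = density \<mu> (\<lambda>x. ennreal (exp (t * T x) * exp (- k * ln u)))"
  interpret m: prob_space \<mu> by fact
  interpret n: prob_space \<nu> unfolding \<nu>_def t_def by (rule chisq_tilt[OF P mgf u])
  have mgf2: "chisq_mgf \<nu> (\<lambda>x. T x / u\<^sup>2) k" unfolding \<nu>_def t_def by (rule chisq_tilt[OF P mgf u])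
  have T[measurable]: "T \<in> borel_measurable \<mu>" using mgf by (simp add: chisq_mgf_def)
  have sp: "space \<nu> = space \<mu>" "sets \<nu> = sets \<mu>" by (simp_all add: \<nu>_def)
  have Tn[measurable]: "T \<in> borel_measurable \<nu>" using T by (simp add: \<nu>_def)
  define S where "S = {x\<in>space \<mu>. \<bar>T x - u\<^sup>2 * k\<bar> \<le> e * u\<^sup>2 * k}"
  have S[measurable]: "S \<in> sets \<mu>" unfolding S_def by measurable
  let ?A = "{x\<in>space \<nu>. (sqrt (1 + e))\<^sup>2 * k \<le> T x / u\<^sup>2}" and ?B = "{x\<in>space \<nu>. T x / u\<^sup>2 \<le> (sqrt (1 - e))\<^sup>2 * k}"
  have AB: "?A \<in> sets \<nu>" "?B \<in> sets \<nu>" by measurable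
  have sub: "space \<nu> \<subseteq> S \<union> (?A \<union> ?B)"
  proof
    fix x assume x: "x \<in> space \<nu>"
    show "x \<in> S \<union> (?A \<union> ?B)"
    proof (rule ccontr)
      assume "x \<notin> S \<union> (?A \<union> ?B)"
      then have "T x / u\<^sup>2 < (1 + e) * k" "(1 - e) * k < T x / u\<^sup>2" "x \<notin> S" using e x by (auto simp: not_le)
      then have "T x < (1 + e) * k * u\<^sup>2" "(1 - e) * k * u\<^sup>2 < T x" using u by (simp_all add: field_simps)
      then have "x \<in> S" using x sp by (auto simp: S_def abs_le_iff algebra_simps)
      with \<open>x \<notin> S\<close> show False by simp
    qed
  qed
  have "1 = measure \<nu> (space \<nu>)" by (simp add: n.prob_space)
  also have "\<dots> \<le> measure \<nu> (S \<union> (?A \<union> ?B))" using sub sp AB S by (intro n.finite_measure_mono) auto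
  also have "\<dots> \<le> measure \<nu> S + measure \<nu> (?A \<union> ?B)" using sp AB S by (intro measure_Un_le) auto
  also have "\<dots> \<le> measure \<nu> S + (measure \<nu> ?A + measure \<nu> ?B)" using AB by (intro add_left_mono measure_Un_le) auto
  also have "measure \<nu> ?A \<le> exp (- k * chi_rate (sqrt (1 + e)))"
    by (rule chisq_upper_tail[OF n.prob_space_axioms mgf2]) (use e in auto)
  also have "measure \<nu> ?B \<le> exp (- k * chi_rate (sqrt (1 - e)))"
    by (rule chisq_lower_tail[OF n.prob_space_axioms mgf2]) (use e in auto)
  finally have 1: "1 - exp (- k * chi_rate (sqrt (1 + e))) - exp (- k * chi_rate (sqrt (1 - e))) \<le> measure \<nu> S" by simp
  \<comment> \<open>A bound for the density of the tilted measure on \<open>S\<close>.\<close>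
  define C where "C = exp (k * (chi_rate u + e * \<bar>u\<^sup>2 - 1\<bar> / 2))"
  have "emeasure \<nu> S = (\<integral>\<^sup>+x. ennreal (exp (t * T x) * exp (- k * ln u)) * indicator S x \<partial>\<mu>)"
    unfolding \<nu>_def by (rule emeasure_density) measurable
  also have "\<dots> \<le> (\<integral>\<^sup>+x. ennreal C * indicator S x \<partial>\<mu>)"
  proof (rule nn_integral_mono)
    fix x assume "x \<in> space \<mu>"
    show "ennreal (exp (t * T x) * exp (- k * ln u)) * indicator S x \<le> ennreal C * indicator S x"
    proof (cases "x \<in> S")
      case True
      have "t * T x = t * (u\<^sup>2 * k) + t * (T x - u\<^sup>2 * k)" by (simp add: algebra_simps)
      also have "\<dots> \<le> t * (u\<^sup>2 * k) + \<bar>t\<bar> * (e * u\<^sup>2 * k)"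
      proof -
        have "t * (T x - u\<^sup>2 * k) \<le> \<bar>t\<bar> * \<bar>T x - u\<^sup>2 * k\<bar>" by (metis abs_ge_self abs_mult)
        also have "\<dots> \<le> \<bar>t\<bar> * (e * u\<^sup>2 * k)" using True by (intro mult_left_mono) (auto simp: S_def)
        finally show ?thesis by simp
      qed
      also have "t * (u\<^sup>2 * k) = k * ((u\<^sup>2 - 1) / 2)" using u by (simp add: t_def field_simps)
      also have "\<bar>t\<bar> * (e * u\<^sup>2 * k) = k * (e * \<bar>u\<^sup>2 - 1\<bar> / 2)"
      proof -
        have "\<bar>t\<bar> * u\<^sup>2 = \<bar>t * u\<^sup>2\<bar>" by (simp add: abs_mult)
        also have "t * u\<^sup>2 = (u\<^sup>2 - 1) / 2" using u by (simp add: t_def field_simps)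
        finally show ?thesis by (simp add: algebra_simps)
      qed
      finally have "t * T x + - k * ln u \<le> k * (chi_rate u + e * \<bar>u\<^sup>2 - 1\<bar> / 2)"
        by (simp add: chi_rate_def algebra_simps)
      then have "exp (t * T x) * exp (- k * ln u) \<le> C" unfolding C_def mult_exp_exp by simp
      then show ?thesis using True by (simp add: ennreal_leI)
    qed simp
  qed
  also have "\<dots> = ennreal C * emeasure \<mu> S" by (simp add: nn_integral_cmult)
  finally have "ennreal (measure \<nu> S) \<le> ennreal (C * measure \<mu> S)"
    by (simp add: n.emeasure_eq_measure m.emeasure_eq_measure ennreal_mult C_def)
  then have "measure \<nu> S \<le> C * measure \<mu> S" by (simp add: C_def)
  with 1 have "1 - exp (- k * chi_rate (sqrt (1 + e))) - exp (- k * chi_rate (sqrt (1 - e))) \<le> C * measure \<mu> S" by linarith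
  then have "inverse C * (1 - exp (- k * chi_rate (sqrt (1 + e))) - exp (- k * chi_rate (sqrt (1 - e)))) \<le> inverse C * (C * measure \<mu> S)"
    by (intro mult_left_mono) (auto simp: C_def)
  also have "inverse C * (C * measure \<mu> S) = measure \<mu> S" by (simp add: C_def)
  also have "inverse C = exp (- k * (chi_rate u + e * \<bar>u\<^sup>2 - 1\<bar> / 2))" by (simp add: C_def exp_minus)
  finally show ?thesis unfolding S_def .
qed

section \<open>Gaussian vectors and their projections\<close>

abbreviation std_gauss :: "nat \<Rightarrow> (nat \<Rightarrow> real) measure" where
  "std_gauss n \<equiv> Pi\<^sub>M {..<n} (\<lambda>_. std_normal_distribution)"

lemma prob_space_std_normal: "prob_space std_normal_distribution"
  by (rule prob_space_normal_density) simp

lemma prob_space_std_gauss: "prob_space (std_gauss n)"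
  by (rule prob_space_PiM) (rule prob_space_std_normal)

lemma product_sigma_finite_std_normal: "product_sigma_finite (\<lambda>_::nat. std_normal_distribution)"
  by (simp add: product_sigma_finite_def prob_space_imp_sigma_finite prob_space_std_normal)

lemma sets_std_gauss [measurable_cong]: "sets (std_gauss n) = sets (Pi\<^sub>M {..<n} (\<lambda>_. borel))"
  by (intro sets_PiM_cong) auto

lemma measurable_std_gauss_component [measurable]: "i < n \<Longrightarrow> (\<lambda>g. g i) \<in> borel_measurable (std_gauss n)"
  using measurable_component_singleton[of i "{..<n}" "\<lambda>_. std_normal_distribution"] by simp

lemma nn_integral_normal_exp:
  "(\<integral>\<^sup>+x. ennreal (exp (c * x)) \<partial>std_normal_distribution) = ennreal (exp (c\<^sup>2 / 2))"
proof -
  have "(\<integral>\<^sup>+x. ennreal (exp (c * x)) \<partial>std_normal_distribution) = (\<integral>\<^sup>+x. ennreal (std_normal_density x) * ennreal (exp (c * x)) \<partial>lborel)"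
    by (rule nn_integral_density) auto
  also have "\<dots> = (\<integral>\<^sup>+x. ennreal (exp (c\<^sup>2 / 2)) * ennreal (normal_density c 1 x) \<partial>lborel)"
  proof (intro nn_integral_cong)
    fix x :: real
    have "std_normal_density x * exp (c * x) = exp (c\<^sup>2 / 2) * normal_density c 1 x"
      by (simp add: normal_density_def mult_exp_exp field_simps power2_eq_square)
    then show "ennreal (std_normal_density x) * ennreal (exp (c * x)) = ennreal (exp (c\<^sup>2 / 2)) * ennreal (normal_density c 1 x)"
      by (simp add: ennreal_mult[symmetric])
  qed
  also have "\<dots> = ennreal (exp (c\<^sup>2 / 2)) * (\<integral>\<^sup>+x. ennreal (normal_density c 1 x) \<partial>lborel)"
    by (rule nn_integral_cmult) auto
  also have "(\<integral>\<^sup>+x. ennreal (normal_density c 1 x) \<partial>lborel) = 1"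
    using prob_space.emeasure_space_1[OF prob_space_normal_density[of 1 c]] by (simp add: emeasure_density)
  finally show ?thesis by simp
qed

lemma nn_integral_normal_exp_square:
  assumes "t < 1/2"
  shows "(\<integral>\<^sup>+x. ennreal (exp (t * x\<^sup>2)) \<partial>std_normal_distribution) = ennreal ((1 - 2 * t) powr (- 1 / 2))"
proof -
  define s where "s = (1 - 2 * t) powr (- 1 / 2)"
  have s: "0 < s" using assms by (simp add: s_def)
  have "s powr 2 = (1 - 2 * t) powr (- 1)" by (simp add: s_def powr_powr)
  then have "s\<^sup>2 = 1 / (1 - 2 * t)" using s assms by (simp add: powr_minus_divide)
  then have s2: "1 / s\<^sup>2 = 1 - 2 * t" by simp
  have "(\<integral>\<^sup>+x. ennreal (exp (t * x\<^sup>2)) \<partial>std_normal_distribution) = (\<integral>\<^sup>+x. ennreal (std_normal_density x) * ennreal (exp (t * x\<^sup>2)) \<partial>lborel)"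
    by (rule nn_integral_density) auto
  also have "\<dots> = (\<integral>\<^sup>+x. ennreal s * ennreal (normal_density 0 s x) \<partial>lborel)"
  proof (intro nn_integral_cong)
    fix x :: real
    have "- (x\<^sup>2) / (2 * s\<^sup>2) = - (x\<^sup>2) / 2 * (1 / s\<^sup>2)" by simp
    also have "\<dots> = - (x\<^sup>2) / 2 + t * x\<^sup>2" unfolding s2 by (simp add: field_simps)
    finally have e: "- (x\<^sup>2) / (2 * s\<^sup>2) = - (x\<^sup>2) / 2 + t * x\<^sup>2" .
    have "std_normal_density x * exp (t * x\<^sup>2) = 1 / sqrt (2 * pi) * exp (- (x\<^sup>2) / 2 + t * x\<^sup>2)"
      unfolding std_normal_density_def exp_add by simp
    also have "\<dots> = s * (1 / sqrt (2 * pi * s\<^sup>2) * exp (- (x\<^sup>2) / (2 * s\<^sup>2)))"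
      unfolding e using s by (simp add: real_sqrt_mult)
    also have "\<dots> = s * normal_density 0 s x" by (simp add: normal_density_def)
    finally show "ennreal (std_normal_density x) * ennreal (exp (t * x\<^sup>2)) = ennreal s * ennreal (normal_density 0 s x)"
      using s by (simp add: ennreal_mult[symmetric])
  qed
  also have "\<dots> = ennreal s * (\<integral>\<^sup>+x. ennreal (normal_density 0 s x) \<partial>lborel)"
    by (rule nn_integral_cmult) auto
  also have "(\<integral>\<^sup>+x. ennreal (normal_density 0 s x) \<partial>lborel) = 1"
    using prob_space.emeasure_space_1[OF prob_space_normal_density[of s 0]] s by (simp add: emeasure_density)
  finally show ?thesis by (simp add: s_def)
qed

lemma nn_integral_gauss_exp:
  "(\<integral>\<^sup>+g. ennreal (exp (\<Sum>i<n. c i * g i)) \<partial>std_gauss n) = ennreal (exp ((\<Sum>i<n. (c i)\<^sup>2) / 2))"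
proof -
  interpret product_sigma_finite "\<lambda>_::nat. std_normal_distribution" by (rule product_sigma_finite_std_normal)
  have "(\<integral>\<^sup>+g. ennreal (exp (\<Sum>i<n. c i * g i)) \<partial>std_gauss n) = (\<integral>\<^sup>+g. (\<Prod>i<n. ennreal (exp (c i * g i))) \<partial>std_gauss n)"
    by (simp add: exp_sum prod_ennreal)
  also have "\<dots> = (\<Prod>i<n. \<integral>\<^sup>+x. ennreal (exp (c i * x)) \<partial>std_normal_distribution)"
    by (rule product_nn_integral_prod) auto
  also have "\<dots> = (\<Prod>i<n. ennreal (exp ((c i)\<^sup>2 / 2)))" by (simp only: nn_integral_normal_exp)
  also have "\<dots> = ennreal (exp ((\<Sum>i<n. (c i)\<^sup>2) / 2))" by (simp add: prod_ennreal exp_sum[symmetric] sum_divide_distrib)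
  finally show ?thesis .
qed

lemma nn_integral_gauss_exp_squares:
  assumes "t < 1/2"
  shows "(\<integral>\<^sup>+g. ennreal (exp (t * (\<Sum>i<n. (g i)\<^sup>2))) \<partial>std_gauss n) = ennreal ((1 - 2 * t) powr (- real n / 2))"
proof -
  interpret product_sigma_finite "\<lambda>_::nat. std_normal_distribution" by (rule product_sigma_finite_std_normal)
  have "(\<integral>\<^sup>+g. ennreal (exp (t * (\<Sum>i<n. (g i)\<^sup>2))) \<partial>std_gauss n) = (\<integral>\<^sup>+g. (\<Prod>i<n. ennreal (exp (t * (g i)\<^sup>2))) \<partial>std_gauss n)"
    by (simp add: exp_sum prod_ennreal sum_distrib_left)
  also have "\<dots> = (\<Prod>i<n. \<integral>\<^sup>+x. ennreal (exp (t * x\<^sup>2)) \<partial>std_normal_distribution)"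
    by (rule product_nn_integral_prod) auto
  also have "\<dots> = (\<Prod>i<n. ennreal ((1 - 2 * t) powr (- 1 / 2)))" by (simp only: nn_integral_normal_exp_square[OF assms])
  also have "\<dots> = ennreal (((1 - 2 * t) powr (- 1 / 2)) ^ n)" by (simp add: ennreal_power)
  also have "((1 - 2 * t) powr (- 1 / 2)) ^ n = (1 - 2 * t) powr (- real n / 2)"
    using assms by (simp add: powr_realpow[symmetric] powr_powr)
  finally show ?thesis .
qed

lemma integral_gauss_iexp:
  "(\<integral>g. exp (\<i> * complex_of_real (\<Sum>i<n. c i * g i)) \<partial>std_gauss n) = complex_of_real (exp (- (\<Sum>i<n. (c i)\<^sup>2) / 2))"
proof -
  interpret product_sigma_finite "\<lambda>_::nat. std_normal_distribution" by (rule product_sigma_finite_std_normal)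
  interpret real_distribution std_normal_distribution by (rule real_dist_normal_dist)
  have "(\<integral>g. exp (\<i> * complex_of_real (\<Sum>i<n. c i * g i)) \<partial>std_gauss n) = (\<integral>g. (\<Prod>i<n. iexp (c i * g i)) \<partial>std_gauss n)"
    by (simp add: exp_sum sum_distrib_left)
  also have "\<dots> = (\<Prod>i<n. \<integral>x. iexp (c i * x) \<partial>std_normal_distribution)"
    by (rule product_integral_prod) (auto intro!: integrable_iexp)
  also have "\<dots> = (\<Prod>i<n. char std_normal_distribution (c i))" by (simp add: char_def)
  also have "\<dots> = (\<Prod>i<n. complex_of_real (exp (- ((c i)\<^sup>2) / 2)))" by (simp add: char_std_normal_distribution)
  also have "\<dots> = complex_of_real (exp (- (\<Sum>i<n. (c i)\<^sup>2) / 2))"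
    by (simp add: exp_sum[symmetric] sum_negf sum_divide_distrib flip: of_real_prod)
  finally show ?thesis .
qed

definition orthonormal_rows :: "nat \<Rightarrow> nat \<Rightarrow> (nat \<Rightarrow> nat \<Rightarrow> real) \<Rightarrow> bool" where
  "orthonormal_rows n k e \<longleftrightarrow> (\<forall>l<k. \<forall>m<k. Rn_inner n (e l) (e m) = (if l = m then 1 else 0))"

lemma orthonormal_rows_norm:
  assumes "orthonormal_rows n k e"
  shows "(\<Sum>i<n. (\<Sum>l<k. h l * e l i)\<^sup>2) = (\<Sum>l<k. (h l)\<^sup>2)"
proof -
  have "(\<Sum>i<n. (\<Sum>l<k. h l * e l i)\<^sup>2) = (\<Sum>i<n. \<Sum>l<k. \<Sum>m<k. h l * h m * (e l i * e m i))"
    by (simp add: power2_eq_square sum_product algebra_simps)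
  also have "\<dots> = (\<Sum>l<k. \<Sum>i<n. \<Sum>m<k. h l * h m * (e l i * e m i))" by (rule sum.swap)
  also have "\<dots> = (\<Sum>l<k. \<Sum>m<k. \<Sum>i<n. h l * h m * (e l i * e m i))" by (intro sum.cong refl sum.swap)
  also have "\<dots> = (\<Sum>l<k. \<Sum>m<k. h l * h m * Rn_inner n (e l) (e m))" by (simp add: Rn_inner_def sum_distrib_left)
  also have "\<dots> = (\<Sum>l<k. \<Sum>m<k. if l = m then h l * h m else 0)"
    using assms by (intro sum.cong refl) (auto simp: orthonormal_rows_def)
  also have "\<dots> = (\<Sum>l<k. (h l)\<^sup>2)" by (simp add: power2_eq_square)
  finally show ?thesis .
qed

text \<open>
  Linearise the square by an independent Gaussian vector \<open>h\<close> of dimension \<open>k\<close>: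
  \<open>exp (t \<Sum> a\<^sub>l\<^sup>2) = E exp (\<surd>(2t) \<Sum> a\<^sub>l h\<^sub>l)\<close>. After exchanging the expectations, the inner one over \<open>g\<close>
  gives \<open>exp (t \<parallel>\<Sum> h\<^sub>l e\<^sub>l\<parallel>\<^sup>2) = exp (t \<parallel>h\<parallel>\<^sup>2)\<close> by orthonormality. For \<open>t < 0\<close> the root is imaginary and
  characteristic functions take the place of exponential moments.
\<close>

lemma chisq_mgf_gauss_projection:
  assumes e: "orthonormal_rows n k e"
  shows "chisq_mgf (std_gauss n) (\<lambda>g. \<Sum>l<k. (Rn_inner n g (e l))\<^sup>2) (real k)"
proof -
  interpret gn: prob_space "std_gauss n" by (rule prob_space_std_gauss)
  interpret gk: prob_space "std_gauss k" by (rule prob_space_std_gauss)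
  interpret pair_prob_space "std_gauss n" "std_gauss k" ..
  define T where "T g = (\<Sum>l<k. (Rn_inner n g (e l))\<^sup>2)" for g
  have inner_meas: "(\<lambda>g. Rn_inner n g (e l)) \<in> borel_measurable (std_gauss n)" for l
    unfolding Rn_inner_def by measurable
  have T: "T \<in> borel_measurable (std_gauss n)"
    unfolding T_def using inner_meas by measurable
  \<comment> \<open>The exponent is bilinear in \<open>g\<close> and \<open>h\<close>.\<close>
  have swap: "(\<Sum>l<k. (c * Rn_inner n g (e l)) * h l) = (\<Sum>i<n. (c * (\<Sum>l<k. h l * e l i)) * g i)" for c g h
    unfolding Rn_inner_def sum_distrib_left sum_distrib_right
    by (subst sum.swap) (simp add: algebra_simps)
  have meas2: "(\<lambda>x. \<Sum>l<k. (c * Rn_inner n (fst x) (e l)) * snd x l) \<in> borel_measurable (std_gauss n \<Otimes>\<^sub>M std_gauss k)" for c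
    unfolding Rn_inner_def by measurable
  have pos: "(\<integral>\<^sup>+g. ennreal (exp (t * T g)) \<partial>std_gauss n) = ennreal ((1 - 2 * t) powr (- real k / 2))"
    if t: "0 \<le> t" "t < 1/2" for t
  proof -
    define c where "c = sqrt (2 * t)"
    have c: "c\<^sup>2 = 2 * t" using t by (simp add: c_def)
    have "(\<integral>\<^sup>+g. ennreal (exp (t * T g)) \<partial>std_gauss n) =
       (\<integral>\<^sup>+g. \<integral>\<^sup>+h. ennreal (exp (\<Sum>l<k. (c * Rn_inner n g (e l)) * h l)) \<partial>std_gauss k \<partial>std_gauss n)"
      unfolding nn_integral_gauss_exp by (simp add: T_def power_mult_distrib c sum_distrib_left[symmetric])
    also have "\<dots> = (\<integral>\<^sup>+h. \<integral>\<^sup>+g. ennreal (exp (\<Sum>l<k. (c * Rn_inner n g (e l)) * h l)) \<partial>std_gauss n \<partial>std_gauss k)"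
      using meas2[of c] by (intro Fubini'[symmetric]) (simp add: split_beta')
    also have "\<dots> = (\<integral>\<^sup>+h. ennreal (exp (t * (\<Sum>l<k. (h l)\<^sup>2))) \<partial>std_gauss k)"
      unfolding swap nn_integral_gauss_exp
      by (simp add: power_mult_distrib c sum_distrib_left[symmetric] orthonormal_rows_norm[OF e])
    also have "\<dots> = ennreal ((1 - 2 * t) powr (- real k / 2))" by (rule nn_integral_gauss_exp_squares[OF t(2)])
    finally show ?thesis .
  qed
  have neg: "(\<integral>\<^sup>+g. ennreal (exp (t * T g)) \<partial>std_gauss n) = ennreal ((1 - 2 * t) powr (- real k / 2))"
    if t: "t < 0" for t
  proof -
    define c where "c = sqrt (- 2 * t)"
    have c: "c\<^sup>2 = - 2 * t" using t by (simp add: c_def)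
    have T0: "0 \<le> T g" for g by (auto simp: T_def intro: sum_nonneg)
    have bound: "exp (t * T g) \<le> 1" for g using t T0[of g] by (simp add: mult_nonpos_nonneg)
    have bound2: "exp (t * (\<Sum>l<k. (h l)\<^sup>2)) \<le> 1" for h :: "nat \<Rightarrow> real"
      using t by (simp add: mult_nonpos_nonneg sum_nonneg)
    have int1: "integrable (std_gauss n) (\<lambda>g. exp (t * T g))"
      by (rule gn.integrable_const_bound[where B = 1]) (use bound T in auto)
    have int2: "integrable (std_gauss k) (\<lambda>h. exp (t * (\<Sum>l<k. (h l)\<^sup>2)))"
      by (rule gk.integrable_const_bound[where B = 1]) (use bound2 in auto)
    have "complex_of_real (\<integral>g. exp (t * T g) \<partial>std_gauss n) = (\<integral>g. complex_of_real (exp (t * T g)) \<partial>std_gauss n)"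
      by simp
    also have "\<dots> = (\<integral>g. \<integral>h. exp (\<i> * complex_of_real (\<Sum>l<k. (c * Rn_inner n g (e l)) * h l)) \<partial>std_gauss k \<partial>std_gauss n)"
      unfolding integral_gauss_iexp
      by (simp add: T_def power_mult_distrib c sum_distrib_left[symmetric] sum_negf)
    also have "\<dots> = (\<integral>h. \<integral>g. exp (\<i> * complex_of_real (\<Sum>l<k. (c * Rn_inner n g (e l)) * h l)) \<partial>std_gauss n \<partial>std_gauss k)"
    proof (rule Fubini_integral[symmetric])
      show "integrable (std_gauss n \<Otimes>\<^sub>M std_gauss k) (\<lambda>(g, h). exp (\<i> * complex_of_real (\<Sum>l<k. (c * Rn_inner n g (e l)) * h l)))"
      proof (rule integrable_const_bound[where B = 1])
        have "(\<lambda>r. exp (\<i> * complex_of_real r)) \<in> borel_measurable borel" by measurable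
        from measurable_compose[OF meas2[of c] this]
        show "(\<lambda>(g, h). exp (\<i> * complex_of_real (\<Sum>l<k. (c * Rn_inner n g (e l)) * h l)))
            \<in> borel_measurable (std_gauss n \<Otimes>\<^sub>M std_gauss k)"
          by (simp add: split_beta' del: of_real_sum)
      qed (simp add: split_beta' del: of_real_sum)
    qed
    also have "\<dots> = (\<integral>h. complex_of_real (exp (t * (\<Sum>l<k. (h l)\<^sup>2))) \<partial>std_gauss k)"
      unfolding swap integral_gauss_iexp
      by (simp add: power_mult_distrib c sum_distrib_left[symmetric] orthonormal_rows_norm[OF e] sum_negf)
    also have "\<dots> = complex_of_real (\<integral>h. exp (t * (\<Sum>l<k. (h l)\<^sup>2)) \<partial>std_gauss k)" by simp
    finally have eq: "(\<integral>g. exp (t * T g) \<partial>std_gauss n) = (\<integral>h. exp (t * (\<Sum>l<k. (h l)\<^sup>2)) \<partial>std_gauss k)"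
      using of_real_eq_iff by blast
    have "(\<integral>\<^sup>+g. ennreal (exp (t * T g)) \<partial>std_gauss n) = ennreal (\<integral>g. exp (t * T g) \<partial>std_gauss n)"
      by (rule nn_integral_eq_integral[OF int1]) simp
    also have "\<dots> = (\<integral>\<^sup>+h. ennreal (exp (t * (\<Sum>l<k. (h l)\<^sup>2))) \<partial>std_gauss k)"
      unfolding eq by (rule nn_integral_eq_integral[OF int2, symmetric]) simp
    also have "\<dots> = ennreal ((1 - 2 * t) powr (- real k / 2))" by (rule nn_integral_gauss_exp_squares) (use t in simp)
    finally show ?thesis .
  qed
  show ?thesis unfolding chisq_mgf_def T_def[symmetric]
    using T pos neg by (metis not_le)
qed

section \<open>Subspaces, orthogonal projections and rotations\<close>

declare measurable_std_gauss_component [measurable del]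

lemma subspace_Rn: "rn.subspace (Rn n)"
  by (auto simp: rn.subspace_def Rn_iff)

lemma Rn_inner_add: "Rn_inner n (x + y) z = Rn_inner n x z + Rn_inner n y z"
  by (simp add: Rn_inner_def algebra_simps sum.distrib)

lemma Rn_inner_diff: "Rn_inner n (x - y) z = Rn_inner n x z - Rn_inner n y z"
  by (simp add: Rn_inner_def algebra_simps sum_subtractf)

lemma Rn_inner_scale: "Rn_inner n (\<lambda>i. c * x i) z = c * Rn_inner n x z"
  by (simp add: Rn_inner_def algebra_simps sum_distrib_left)

lemma Rn_inner_commute: "Rn_inner n x y = Rn_inner n y x"
  by (simp add: Rn_inner_def algebra_simps)

lemma Rn_inner_sum: "Rn_inner n (\<lambda>i. \<Sum>l\<in>A. c l * e l i) z = (\<Sum>l\<in>A. c l * Rn_inner n (e l) z)"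
  unfolding Rn_inner_def sum_distrib_left sum_distrib_right
  by (subst sum.swap) (simp add: algebra_simps)

lemma Rn_inner_self_eq_0: "Rn_inner n x x = 0 \<longleftrightarrow> (\<forall>i<n. x i = 0)"
  by (auto simp: Rn_inner_def sum_nonneg_eq_0_iff)

lemma Rn_inner_self_nonneg: "0 \<le> Rn_inner n x x"
  by (auto simp: Rn_inner_def intro: sum_nonneg)

lemma subspace_orthogonal: "rn.subspace {z. Rn_inner n x z = 0}"
  by (auto simp: rn.subspace_def Rn_inner_commute[of n x] Rn_inner_add Rn_inner_scale)
     (simp add: Rn_inner_def)

definition onb :: "nat \<Rightarrow> nat \<Rightarrow> (nat \<Rightarrow> nat \<Rightarrow> real) \<Rightarrow> (nat \<Rightarrow> real) set \<Rightarrow> bool" where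
  "onb n k e E \<longleftrightarrow> (\<forall>l<k. e l \<in> Rn n) \<and> orthonormal_rows n k e \<and> E = rn.span (e ` {..<k})"

lemma combination_in_span:
  fixes e :: "nat \<Rightarrow> nat \<Rightarrow> real"
  shows "(\<lambda>i. \<Sum>l<k. c l * e l i) \<in> rn.span (e ` {..<k})"
proof -
  have "(\<Sum>l<j. (\<lambda>i. c l * e l i)) = (\<lambda>i. \<Sum>l<j. c l * e l i)" for j :: nat
    by (induction j) (auto simp: fun_eq_iff)
  moreover have "(\<Sum>l<k. (\<lambda>i. c l * e l i)) \<in> rn.span (e ` {..<k})"
    by (intro rn.span_sum rn.span_scale rn.span_base) auto
  ultimately show ?thesis by simp
qed

text \<open>
  The number \<open>k\<close> of vectors is left open, so that generators which depend on the preceding ones can be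
  dropped.
\<close>

lemma gram_schmidt:
  assumes "finite B" "B \<subseteq> Rn n"
  shows "\<exists>k e. onb n k e (rn.span B)"
  using assms
proof (induction B rule: finite_induct)
  case empty
  have "onb n 0 (\<lambda>_ _. 0) (rn.span {})" by (simp add: onb_def orthonormal_rows_def)
  then show ?case by blast
next
  case (insert b B)
  then obtain k e where e: "onb n k e (rn.span B)" by auto
  then have on: "Rn_inner n (e l) (e m) = (if l = m then 1 else 0)" if "l < k" "m < k" for l m
    using that by (auto simp: onb_def orthonormal_rows_def)
  have spB: "rn.span B = rn.span (e ` {..<k})" and eR: "\<And>l. l < k \<Longrightarrow> e l \<in> Rn n" using e by (auto simp: onb_def)
  define q where "q = (\<lambda>i. \<Sum>l<k. Rn_inner n b (e l) * e l i)"
  define r where "r = b - q"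
  have q: "q \<in> rn.span (e ` {..<k})" unfolding q_def by (rule combination_in_span)
  have qR: "q \<in> Rn n" using eR by (auto simp: q_def Rn_iff intro!: sum.neutral)
  then have rR: "r \<in> Rn n" using insert.prems by (auto simp: r_def Rn_iff)
  have b: "b = r + q" by (simp add: r_def)
  have re: "Rn_inner n r (e m) = 0" if m: "m < k" for m
  proof -
    have "Rn_inner n q (e m) = (\<Sum>l<k. Rn_inner n b (e l) * (if l = m then 1 else 0))"
      unfolding q_def Rn_inner_sum using on m by (intro sum.cong refl) simp
    also have "\<dots> = (\<Sum>l<k. if l = m then Rn_inner n b (e m) else 0)" by (intro sum.cong) auto
    also have "\<dots> = Rn_inner n b (e m)" using m by simp
    finally show ?thesis by (simp add: r_def Rn_inner_diff)
  qed
  show ?case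
  proof (cases "Rn_inner n r r = 0")
    case True
    then have "r = 0" using rR by (auto simp: Rn_inner_self_eq_0 Rn_iff fun_eq_iff not_less) (metis not_less)
    then have "b \<in> rn.span B" using b q spB by simp
    then have "rn.span (insert b B) = rn.span B" by (rule rn.span_redundant)
    then show ?thesis using e by metis
  next
    case False
    define c where "c = 1 / sqrt (Rn_inner n r r)"
    have rr: "0 < Rn_inner n r r" using False Rn_inner_self_nonneg[of n r] by simp
    have c: "c \<noteq> 0" "c * (c * Rn_inner n r r) = 1" using rr by (simp_all add: c_def)
    define f where "f = e(k := (\<lambda>i. c * r i))"
    have fe: "f ` {..<Suc k} = insert (\<lambda>i. c * r i) (e ` {..<k})"
      by (auto simp: f_def lessThan_Suc)
    have 1: "\<forall>l<Suc k. f l \<in> Rn n" using eR rR by (auto simp: f_def Rn_iff less_Suc_eq)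
    have 2: "orthonormal_rows n (Suc k) f"
      unfolding orthonormal_rows_def
    proof (intro allI impI)
      fix l m assume lm: "l < Suc k" "m < Suc k"
      consider "l < k" "m < k" | "l < k" "m = k" | "l = k" "m < k" | "l = k" "m = k" using lm by linarith
      then show "Rn_inner n (f l) (f m) = (if l = m then 1 else 0)"
      proof cases
        case 1 then show ?thesis using on by (simp add: f_def)
      next
        case 2 then show ?thesis
          using re[of l] Rn_inner_commute[of n "e l" "\<lambda>i. c * r i"] by (simp add: f_def Rn_inner_scale)
      next
        case 3 then show ?thesis using re[of m] by (simp add: f_def Rn_inner_scale)
      next
        case 4 then show ?thesis
          using c Rn_inner_commute[of n r "\<lambda>i. c * r i"] by (simp add: f_def Rn_inner_scale)
      qed
    qed
    have f_sp: "rn.subspace (rn.span (f ` {..<Suc k}))" "rn.subspace (rn.span (insert b B))" by (rule rn.subspace_span)+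
    have "rn.span (insert b B) \<subseteq> rn.span (f ` {..<Suc k})"
    proof (rule rn.span_minimal[OF _ f_sp(1)])
      have eB: "rn.span (e ` {..<k}) \<subseteq> rn.span (f ` {..<Suc k})" unfolding fe by (intro rn.span_mono) auto
      have "(\<lambda>i. (1 / c) * (c * r i)) \<in> rn.span (f ` {..<Suc k})"
        by (rule rn.span_scale, rule rn.span_base) (simp add: fe)
      then have "r \<in> rn.span (f ` {..<Suc k})" using c by simp
      then have "b \<in> rn.span (f ` {..<Suc k})" unfolding b using q eB by (intro rn.span_add) auto
      then show "insert b B \<subseteq> rn.span (f ` {..<Suc k})"
        using eB spB rn.span_superset[of B] by auto
    qed
    moreover have "rn.span (f ` {..<Suc k}) \<subseteq> rn.span (insert b B)"
    proof (rule rn.span_minimal[OF _ f_sp(2)])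
      have sub: "rn.span B \<subseteq> rn.span (insert b B)" by (intro rn.span_mono) auto
      have "b \<in> rn.span (insert b B)" by (rule rn.span_base) simp
      moreover have "q \<in> rn.span (insert b B)" using q spB sub by auto
      ultimately have "r \<in> rn.span (insert b B)" unfolding r_def by (rule rn.span_diff)
      then have "(\<lambda>i. c * r i) \<in> rn.span (insert b B)" by (rule rn.span_scale)
      then show "f ` {..<Suc k} \<subseteq> rn.span (insert b B)"
        unfolding fe using sub spB rn.span_superset[of "e ` {..<k}"] by auto
    qed
    ultimately have "onb n (Suc k) f (rn.span (insert b B))" using 1 2 by (simp add: onb_def)
    then show ?thesis by blast
  qed
qed

text \<open>
  Orthonormal vectors are independent and distinct.
\<close>

lemma onb_dim:
  assumes "onb n k e E"
  shows "rn.dim E = k"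
proof -
  have on: "Rn_inner n (e l) (e m) = (if l = m then 1 else 0)" if "l < k" "m < k" for l m
    using assms that by (auto simp: onb_def orthonormal_rows_def)
  have inj: "inj_on e {..<k}"
  proof (rule inj_onI)
    fix l m assume "l \<in> {..<k}" "m \<in> {..<k}" "e l = e m"
    then show "l = m" using on[of l m] on[of l l] by (auto split: if_splits)
  qed
  have "rn.independent (e ` {..<k})"
    unfolding rn.dependent_def
  proof
    assume "\<exists>a\<in>e ` {..<k}. a \<in> rn.span (e ` {..<k} - {a})"
    then obtain l where l: "l < k" "e l \<in> rn.span (e ` {..<k} - {e l})" by auto
    have "rn.span (e ` {..<k} - {e l}) \<subseteq> {z. Rn_inner n (e l) z = 0}"
    proof (rule rn.span_minimal[OF _ subspace_orthogonal])
      show "e ` {..<k} - {e l} \<subseteq> {z. Rn_inner n (e l) z = 0}" using on l by auto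
    qed
    with l have "Rn_inner n (e l) (e l) = 0" by auto
    then show False using on[of l l] l by simp
  qed
  then have "rn.dim E = card (e ` {..<k})" using assms rn.dim_span_eq_card_independent unfolding onb_def by metis
  then show ?thesis using inj by (simp add: card_image)
qed

lemma onb_in_grassmannian:
  assumes "onb n k e E" shows "E \<in> grassmannian n k"
proof -
  have "E \<subseteq> Rn n" using assms rn.span_minimal[OF _ subspace_Rn, of "e ` {..<k}" n] by (auto simp: onb_def)
  then show ?thesis using onb_dim[OF assms] assms by (auto simp: grassmannian_def onb_def)
qed

lemma grassmannian_onb:
  assumes "E \<in> grassmannian n k" "1 \<le> k"
  obtains e where "onb n k e E"
proof -
  obtain B where B: "B \<subseteq> E" "rn.independent B" "E \<subseteq> rn.span B" "card B = rn.dim E" using rn.basis_exists by blast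
  have "card B = k" using B assms by (simp add: grassmannian_def)
  then have "finite B" using assms(2) card.infinite by fastforce
  moreover have "B \<subseteq> Rn n" using B assms by (auto simp: grassmannian_def)
  ultimately obtain k' e where e: "onb n k' e (rn.span B)" using gram_schmidt by blast
  have "rn.span B \<subseteq> E" using B(1) assms by (intro rn.span_minimal) (auto simp: grassmannian_def)
  then have "rn.span B = E" using B(3) by auto
  then have "onb n k' e E" using e by simp
  moreover have "k' = k" using onb_dim[OF \<open>onb n k' e E\<close>] assms by (simp add: grassmannian_def)
  ultimately show thesis using that by simp
qed

text \<open>
  Two vectors that satisfy the defining condition differ by an element of \<open>E\<close> that is orthogonal to
  itself.
\<close>

lemma proj_onb:
  assumes "onb n k e E"
  shows "proj n E x = (\<lambda>i. \<Sum>l<k. Rn_inner n x (e l) * e l i)" (is "_ = ?y")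
  unfolding proj_def
proof (rule the_equality)
  have on: "Rn_inner n (e l) (e m) = (if l = m then 1 else 0)" if "l < k" "m < k" for l m
    using assms that by (auto simp: onb_def orthonormal_rows_def)
  have E: "E = rn.span (e ` {..<k})" "rn.subspace E" using assms by (auto simp: onb_def)
  have ER: "E \<subseteq> Rn n" using onb_in_grassmannian[OF assms] by (auto simp: grassmannian_def)
  have yE: "?y \<in> E" unfolding E by (rule combination_in_span)
  have orth: "Rn_inner n (x - ?y) z = 0" if "z \<in> E" for z
  proof -
    have "rn.span (e ` {..<k}) \<subseteq> {z. Rn_inner n (x - ?y) z = 0}"
    proof (rule rn.span_minimal[OF _ subspace_orthogonal], safe)
      fix m assume m: "m < k"
      have "Rn_inner n ?y (e m) = (\<Sum>l<k. Rn_inner n x (e l) * (if l = m then 1 else 0))"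
        unfolding Rn_inner_sum using on m by (intro sum.cong refl) simp
      also have "\<dots> = (\<Sum>l<k. if l = m then Rn_inner n x (e m) else 0)" by (intro sum.cong) auto
      also have "\<dots> = Rn_inner n x (e m)" using m by simp
      finally show "Rn_inner n (x - ?y) (e m) = 0" by (simp only: Rn_inner_diff diff_self)
    qed
    then show ?thesis using that E by auto
  qed
  show "?y \<in> E \<and> (\<forall>z\<in>E. Rn_inner n (x - ?y) z = 0)" using yE orth by blast
  fix y assume y: "y \<in> E \<and> (\<forall>z\<in>E. Rn_inner n (x - y) z = 0)"
  have d: "y - ?y \<in> E" using y yE E by (intro rn.subspace_diff) auto
  have "Rn_inner n (y - ?y) (y - ?y) = Rn_inner n (x - ?y) (y - ?y) - Rn_inner n (x - y) (y - ?y)"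
    unfolding Rn_inner_diff[symmetric] by (simp add: algebra_simps)
  also have "\<dots> = 0" using y orth d by simp
  finally have "\<forall>i<n. (y - ?y) i = 0" by (simp only: Rn_inner_self_eq_0)
  moreover have "\<forall>i\<ge>n. (y - ?y) i = 0" using d ER Rn_iff by blast
  ultimately have "(y - ?y) i = 0" for i by (metis not_le)
  then show "y = ?y" by (simp add: fun_eq_iff)
qed

lemma lp_norm_2: "lp_norm n 2 y = sqrt (\<Sum>i<n. (y i)\<^sup>2)"
proof -
  have "\<bar>z\<bar> powr 2 = z\<^sup>2" for z :: real by (cases "z = 0") (auto simp: powr_numeral)
  then show ?thesis by (simp add: lp_norm_def powr_half_sqrt sum_nonneg)
qed

lemma lp_norm_2_eq: "lp_norm n 2 y = sqrt (Rn_inner n y y)"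
  by (simp add: lp_norm_2 Rn_inner_def power2_eq_square)

lemma norm_proj_onb:
  assumes "onb n k e E"
  shows "lp_norm n 2 (proj n E x) = sqrt (\<Sum>l<k. (Rn_inner n x (e l))\<^sup>2)"
  unfolding proj_onb[OF assms] lp_norm_2
  by (subst orthonormal_rows_norm) (use assms in \<open>auto simp: onb_def\<close>)

lemma Rn_inner_unit: "Rn_inner n (\<lambda>l. if l = j then 1 else 0) z = (if j < n then z j else 0)"
  by (simp add: Rn_inner_def if_distrib[of "\<lambda>a. a * _"] cong: if_cong)

lemma proj_matrix_onb:
  assumes "onb n k e E"
  shows "proj_matrix n E i j = (if j < n then \<Sum>l<k. e l j * e l i else 0)"
  unfolding proj_matrix_def proj_onb[OF assms] Rn_inner_unit by auto

lemma proj_eq_matrix: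
  assumes "E \<in> grassmannian n k" "1 \<le> k"
  shows "proj n E x i = (\<Sum>j<n. proj_matrix n E i j * x j)"
proof -
  obtain e where e: "onb n k e E" using grassmannian_onb[OF assms] .
  have "proj n E x i = (\<Sum>l<k. \<Sum>j<n. e l j * e l i * x j)"
    unfolding proj_onb[OF e] Rn_inner_def sum_distrib_right by (simp add: algebra_simps)
  also have "\<dots> = (\<Sum>j<n. \<Sum>l<k. e l j * e l i * x j)" by (rule sum.swap)
  also have "\<dots> = (\<Sum>j<n. proj_matrix n E i j * x j)"
    unfolding proj_matrix_onb[OF e] by (simp add: sum_distrib_right)
  finally show ?thesis .
qed

lemma mat_apply_inner:
  assumes "orthogonal_mat n Q"
  shows "Rn_inner n (mat_apply n Q x) (mat_apply n Q y) = Rn_inner n x y"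
proof -
  have "Rn_inner n (mat_apply n Q x) (mat_apply n Q y) = (\<Sum>l<n. \<Sum>i<n. \<Sum>j<n. x i * y j * (Q l i * Q l j))"
    by (simp add: Rn_inner_def mat_apply_def sum_product algebra_simps)
  also have "\<dots> = (\<Sum>i<n. \<Sum>l<n. \<Sum>j<n. x i * y j * (Q l i * Q l j))" by (rule sum.swap)
  also have "\<dots> = (\<Sum>i<n. \<Sum>j<n. \<Sum>l<n. x i * y j * (Q l i * Q l j))" by (intro sum.cong refl sum.swap)
  also have "\<dots> = (\<Sum>i<n. \<Sum>j<n. x i * y j * (\<Sum>l<n. Q l i * Q l j))" by (simp add: sum_distrib_left)
  also have "\<dots> = (\<Sum>i<n. \<Sum>j<n. if i = j then x i * y j else 0)"
    using assms by (intro sum.cong refl) (auto simp: orthogonal_mat_def)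
  also have "\<dots> = Rn_inner n x y" by (simp add: Rn_inner_def)
  finally show ?thesis .
qed

lemma onb_rotate:
  assumes e: "onb n k e E" and Q: "orthogonal_mat n Q"
  shows "onb n k (\<lambda>l. mat_apply n Q (e l)) (mat_apply n Q ` E)"
proof -
  interpret module_hom "\<lambda>(c::real) (x::nat \<Rightarrow> real) i. c * x i" "\<lambda>(c::real) (x::nat \<Rightarrow> real) i. c * x i" "mat_apply n Q"
    by unfold_locales (auto simp: mat_apply_def fun_eq_iff algebra_simps sum.distrib sum_distrib_left)
  have "mat_apply n Q ` E = rn.span ((\<lambda>l. mat_apply n Q (e l)) ` {..<k})"
    using e span_image[of "e ` {..<k}"] by (simp add: onb_def image_image)
  moreover have "mat_apply n Q x \<in> Rn n" for x by (simp add: mat_apply_def Rn_iff)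
  ultimately show ?thesis using e by (auto simp: onb_def orthonormal_rows_def mat_apply_inner[OF Q])
qed

lemma norm_proj_rotate:
  assumes "E \<in> grassmannian n k" "1 \<le> k" "orthogonal_mat n Q"
  shows "lp_norm n 2 (proj n (mat_apply n Q ` E) (mat_apply n Q x)) = lp_norm n 2 (proj n E x)"
proof -
  obtain e where e: "onb n k e E" using grassmannian_onb[OF assms(1,2)] .
  show ?thesis
    unfolding norm_proj_onb[OF e] norm_proj_onb[OF onb_rotate[OF e assms(3)]] mat_apply_inner[OF assms(3)] ..
qed

lemma proj_matrix_rotate:
  assumes "E \<in> grassmannian n k" "1 \<le> k" "orthogonal_mat n Q"
  shows "proj_matrix n (mat_apply n Q ` E) i j =
    (if i < n \<and> j < n then \<Sum>a<n. \<Sum>b<n. Q i a * Q j b * proj_matrix n E a b else 0)"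
proof -
  obtain e where e: "onb n k e E" using grassmannian_onb[OF assms(1,2)] .
  show ?thesis
  proof (cases "i < n \<and> j < n")
    case True
    have "proj_matrix n (mat_apply n Q ` E) i j = (\<Sum>l<k. (\<Sum>a<n. Q i a * e l a) * (\<Sum>b<n. Q j b * e l b))"
      unfolding proj_matrix_onb[OF onb_rotate[OF e assms(3)]] using True by (simp add: mat_apply_def mult.commute)
    also have "\<dots> = (\<Sum>l<k. \<Sum>a<n. \<Sum>b<n. Q i a * Q j b * (e l b * e l a))"
      by (simp add: sum_product algebra_simps)
    also have "\<dots> = (\<Sum>a<n. \<Sum>l<k. \<Sum>b<n. Q i a * Q j b * (e l b * e l a))" by (rule sum.swap)
    also have "\<dots> = (\<Sum>a<n. \<Sum>b<n. \<Sum>l<k. Q i a * Q j b * (e l b * e l a))" by (intro sum.cong refl sum.swap)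
    also have "\<dots> = (\<Sum>a<n. \<Sum>b<n. Q i a * Q j b * proj_matrix n E a b)"
      by (simp add: proj_matrix_onb[OF e] sum_distrib_left)
    finally show ?thesis using True by simp
  next
    case False
    then show ?thesis unfolding proj_matrix_onb[OF onb_rotate[OF e assms(3)]] by (auto simp: mat_apply_def)
  qed
qed

text \<open>
  Two vectors of equal length are exchanged by the reflection in the hyperplane orthogonal to their
  difference \<open>v\<close>, given by the matrix \<open>1 - 2 v v\<^sup>T/\<parallel>v\<parallel>\<^sup>2\<close>.
\<close>

lemma householder:
  assumes "Rn_inner n x x = Rn_inner n y y"
  obtains Q where "orthogonal_mat n Q" "\<And>i. i < n \<Longrightarrow> mat_apply n Q x i = y i"
proof (cases "Rn_inner n (x - y) (x - y) = 0")
  case True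
  then have xy: "\<And>i. i < n \<Longrightarrow> x i = y i" by (simp add: Rn_inner_self_eq_0)
  show thesis
    by (rule that[of "\<lambda>i j. if i = j then 1 else 0"])
       (auto simp: orthogonal_mat_def mat_apply_def xy if_distrib[of "\<lambda>a. a * _"] cong: if_cong)
next
  case False
  define v where "v = x - y"
  define s where "s = Rn_inner n v v"
  have s: "s \<noteq> 0" using False by (simp add: s_def v_def)
  have vx: "2 * Rn_inner n v x = s"
    unfolding s_def v_def Rn_inner_diff Rn_inner_commute[of n _ "x - y"] Rn_inner_commute[of n y x]
    using assms by (simp add: Rn_inner_diff Rn_inner_commute[of n y x])
  define Q where "Q i j = (if i = j then 1 else 0) - 2 * v i * v j / s" for i j :: nat
  have "orthogonal_mat n Q"
    unfolding orthogonal_mat_def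
  proof (intro allI impI)
    fix i j assume ij: "i < n" "j < n"
    define C where "C = 4 * v i * v j / s\<^sup>2"
    have sv: "(\<Sum>l<n. v l * v l) = s" by (simp add: s_def Rn_inner_def)
    have "(\<Sum>l<n. Q l i * Q l j) = (\<Sum>l<n. (if l = i then (if l = j then 1 else 0) else 0)
        - (if l = i then 2 * v l * v j / s else 0) - (if l = j then 2 * v l * v i / s else 0)
        + C * (v l * v l))"
      unfolding Q_def C_def by (intro sum.cong refl) (use s in \<open>auto simp: power2_eq_square field_simps\<close>)
    also have "\<dots> = (if i = j then 1 else 0) - 2 * v i * v j / s - 2 * v j * v i / s + C * s"
      using ij by (simp add: sum.distrib sum_subtractf sum_distrib_left[symmetric] sv)
    also have "\<dots> = (if i = j then 1 else 0)" using s by (simp add: C_def power2_eq_square field_simps)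
    finally show "(\<Sum>l<n. Q l i * Q l j) = (if i = j then 1 else 0)" .
  qed
  moreover have "mat_apply n Q x i = y i" if i: "i < n" for i
  proof -
    define d where "d = 2 * v i / s"
    have "mat_apply n Q x i = (\<Sum>j<n. (if i = j then x j else 0) - d * (v j * x j))"
      using i unfolding mat_apply_def Q_def d_def by (auto intro!: sum.cong simp: field_simps)
    also have "\<dots> = x i - d * Rn_inner n v x"
      using i by (simp add: sum_subtractf sum_distrib_left[symmetric] Rn_inner_def)
    also have "\<dots> = x i - v i / s * (2 * Rn_inner n v x)" by (simp add: d_def)
    also have "\<dots> = y i" unfolding vx using s by (simp add: v_def)
    finally show ?thesis .
  qed
  ultimately show thesis by (rule that)
qed

lemma proj_cong:
  assumes "\<And>i. i < n \<Longrightarrow> x i = y i"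
  shows "proj n E x = proj n E y"
proof -
  have "Rn_inner n (x - a) z = Rn_inner n (y - a) z" for a z
    using assms by (simp add: Rn_inner_def)
  then show ?thesis by (simp add: proj_def)
qed

lemma proj_matrix_measurable:
  "(\<lambda>E. proj_matrix n E i j) \<in> borel_measurable (grassmannian_borel n k)"
proof -
  have "proj_matrix n \<in> measurable (grassmannian_borel n k) borel"
    unfolding grassmannian_borel_def by (rule measurable_vimage_algebra1) auto
  moreover have "(\<lambda>(P::nat \<Rightarrow> nat \<Rightarrow> real). P i j) \<in> borel_measurable borel"
    using measurable_compose[OF measurable_product_coordinates[of i] measurable_product_coordinates[of j]] .
  ultimately show ?thesis by (rule measurable_compose)
qed

lemma space_grassmannian_borel [simp]: "space (grassmannian_borel n k) = grassmannian n k"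
  by (simp add: grassmannian_borel_def)

text \<open>
  The \<open>\<sigma>\<close>-algebra of the Grassmannian is generated by the projection matrices, and the projection of a
  vector is the product of that matrix with the vector.
\<close>

lemma measurable_norm_proj:
  assumes "1 \<le> k" "f \<in> measurable N (grassmannian_borel n k)"
    and "\<And>i. i < n \<Longrightarrow> (\<lambda>w. g w i) \<in> borel_measurable N"
  shows "(\<lambda>w. lp_norm n 2 (proj n (f w) (g w))) \<in> borel_measurable N"
proof -
  have [measurable]: "(\<lambda>w. proj_matrix n (f w) i j) \<in> borel_measurable N" for i j
    using measurable_compose[OF assms(2) proj_matrix_measurable] .
  have "(\<lambda>w. sqrt (\<Sum>i<n. (\<Sum>j<n. proj_matrix n (f w) i j * g w j)\<^sup>2)) \<in> borel_measurable N"
    using assms(3) by measurable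
  also have "?this \<longleftrightarrow> ?thesis"
  proof (rule measurable_cong)
    fix w assume "w \<in> space N"
    then have "f w \<in> grassmannian n k" using assms(2) by (auto dest: measurable_space)
    then show "sqrt (\<Sum>i<n. (\<Sum>j<n. proj_matrix n (f w) i j * g w j)\<^sup>2) = lp_norm n 2 (proj n (f w) (g w))"
      unfolding lp_norm_2 by (simp add: proj_eq_matrix[OF _ assms(1)])
  qed
  finally show ?thesis .
qed

text \<open>
  Rotating a subspace conjugates its projection matrix.
\<close>

lemma measurable_rotate:
  assumes "1 \<le> k" "orthogonal_mat n Q"
  shows "(\<lambda>E. mat_apply n Q ` E) \<in> measurable (grassmannian_borel n k) (grassmannian_borel n k)"
  unfolding grassmannian_borel_def[of n k] 
proof (rule measurable_vimage_algebra2)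
  let ?N = "vimage_algebra (grassmannian n k) (proj_matrix n) borel"
  have N: "?N = grassmannian_borel n k" by (simp add: grassmannian_borel_def)
  have "mat_apply n Q ` E \<in> grassmannian n k" if E: "E \<in> grassmannian n k" for E
  proof -
    obtain e where "onb n k e E" using grassmannian_onb[OF E assms(1)] .
    from onb_in_grassmannian[OF onb_rotate[OF this assms(2)]] show ?thesis .
  qed
  then show "(`) (mat_apply n Q) \<in> space ?N \<rightarrow> grassmannian n k" by auto
  have pm [measurable]: "(\<lambda>E. proj_matrix n E a b) \<in> borel_measurable ?N" for a b
    unfolding N by (rule proj_matrix_measurable)
  show "(\<lambda>E. proj_matrix n (mat_apply n Q ` E)) \<in> borel_measurable ?N"
  proof (intro measurable_coordinatewise_then_product)
    fix i j
    have "(\<lambda>E. if i < n \<and> j < n then \<Sum>a<n. \<Sum>b<n. Q i a * Q j b * proj_matrix n E a b else 0) \<in> borel_measurable ?N"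
      by measurable
    also have "?this \<longleftrightarrow> (\<lambda>E. proj_matrix n (mat_apply n Q ` E) i j) \<in> borel_measurable ?N"
      by (rule measurable_cong) (simp add: proj_matrix_rotate[OF _ assms])
    finally show "(\<lambda>E. proj_matrix n (mat_apply n Q ` E) i j) \<in> borel_measurable ?N" .
  qed
qed

text \<open>
  An orthogonal map that takes \<open>x\<close> to \<open>y\<close> preserves the law of \<open>E\<close> and the length of the projection.
\<close>

lemma haar_projection_law:
  assumes "haar_grassmannian n k \<mu>" "1 \<le> k" "Rn_inner n x x = Rn_inner n y y" "B \<in> sets borel"
  shows "emeasure \<mu> {E\<in>space \<mu>. lp_norm n 2 (proj n E x) \<in> B} = emeasure \<mu> {E\<in>space \<mu>. lp_norm n 2 (proj n E y) \<in> B}"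
proof -
  obtain Q where Q: "orthogonal_mat n Q" "\<And>i. i < n \<Longrightarrow> mat_apply n Q x i = y i"
    using householder[OF assms(3)] by blast
  have \<mu>: "space \<mu> = grassmannian n k" "sets \<mu> = sets (grassmannian_borel n k)"
    "distr \<mu> (grassmannian_borel n k) (\<lambda>E. mat_apply n Q ` E) = \<mu>"
    using assms(1) Q(1) by (auto simp: haar_grassmannian_def)
  have rot: "(\<lambda>E. mat_apply n Q ` E) \<in> measurable \<mu> (grassmannian_borel n k)"
    using measurable_rotate[OF assms(2) Q(1)] \<mu> by (simp cong: measurable_cong_sets)
  have m: "(\<lambda>E. lp_norm n 2 (proj n E z)) \<in> borel_measurable (grassmannian_borel n k)" for z
    by (rule measurable_norm_proj[OF assms(2)]) auto
  let ?A = "\<lambda>z. {E\<in>space (grassmannian_borel n k). lp_norm n 2 (proj n E z) \<in> B}"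
  have A: "?A z \<in> sets (grassmannian_borel n k)" for z
    using measurable_sets[OF m assms(4)] by (simp add: vimage_def Int_def conj_commute)
  have "emeasure \<mu> (?A y) = emeasure (distr \<mu> (grassmannian_borel n k) (\<lambda>E. mat_apply n Q ` E)) (?A y)" by (simp add: \<mu>(3))
  also have "\<dots> = emeasure \<mu> ((\<lambda>E. mat_apply n Q ` E) -` ?A y \<inter> space \<mu>)" by (rule emeasure_distr[OF rot A])
  also have "(\<lambda>E. mat_apply n Q ` E) -` ?A y \<inter> space \<mu> = ?A x"
  proof -
    have "mat_apply n Q ` E \<in> ?A y \<longleftrightarrow> E \<in> ?A x" if "E \<in> grassmannian n k" for E
    proof -
      have "mat_apply n Q ` E \<in> grassmannian n k" using measurable_space[OF rot] \<mu>(1) that by auto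
      moreover have "proj n (mat_apply n Q ` E) y = proj n (mat_apply n Q ` E) (mat_apply n Q x)"
        using Q(2) by (intro proj_cong) simp
      ultimately show ?thesis using norm_proj_rotate[OF that assms(2) Q(1), of x] that by simp
    qed
    then show ?thesis using \<mu>(1) by auto
  qed
  finally show ?thesis using \<mu>(1) by simp
qed

section \<open>The relative length of a random projection\<close>

declare measurable_std_gauss_component [measurable]

definition unit0 :: "nat \<Rightarrow> real" where
  "unit0 = (\<lambda>i. if i = 0 then 1 else 0)"

lemma Rn_inner_unit0: "1 \<le> n \<Longrightarrow> Rn_inner n unit0 unit0 = 1"
  using Rn_inner_unit[of n 0 unit0] by (simp add: unit0_def)

lemma norm_proj_scale:
  assumes "F \<in> grassmannian n k" "1 \<le> k"
  shows "lp_norm n 2 (proj n F (\<lambda>i. c * x i)) = \<bar>c\<bar> * lp_norm n 2 (proj n F x)"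
proof -
  obtain e where e: "onb n k e F" using grassmannian_onb[OF assms] .
  show ?thesis
    unfolding norm_proj_onb[OF e] Rn_inner_scale
    by (simp add: power_mult_distrib sum_distrib_left[symmetric] real_sqrt_mult)
qed

lemma haar_space:
  assumes "haar_grassmannian n k \<mu>"
  shows "prob_space \<mu>" "space \<mu> = grassmannian n k" "sets \<mu> = sets (grassmannian_borel n k)"
  using assms by (auto simp: haar_grassmannian_def)

text \<open>
  Scale \<open>x\<close> to unit length and compare with the first unit vector by the invariance of the law.
\<close>

lemma haar_ratio:
  assumes haar: "haar_grassmannian n k \<mu>" and k: "1 \<le> k" and n: "1 \<le> n"
    and x: "lp_norm n 2 x \<noteq> 0" and B: "B \<in> sets borel"
  shows "emeasure \<mu> {F\<in>space \<mu>. lp_norm n 2 (proj n F x) / lp_norm n 2 x \<in> B} =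
    emeasure \<mu> {F\<in>space \<mu>. lp_norm n 2 (proj n F unit0) \<in> B}"
proof -
  define c where "c = 1 / lp_norm n 2 x"
  define y where "y = (\<lambda>i. c * x i)"
  have xx: "Rn_inner n x x = (lp_norm n 2 x)\<^sup>2"
    by (simp add: lp_norm_2_eq Rn_inner_self_nonneg)
  have "Rn_inner n y y = c * (c * Rn_inner n x x)"
    unfolding y_def Rn_inner_scale by (subst Rn_inner_commute) (simp only: Rn_inner_scale)
  also have "\<dots> = 1" unfolding xx using x by (simp add: c_def power2_eq_square)
  finally have "Rn_inner n y y = Rn_inner n unit0 unit0" using Rn_inner_unit0[OF n] by simp
  note law = haar_projection_law[OF haar k this B]
  have "lp_norm n 2 (proj n F y) = lp_norm n 2 (proj n F x) / lp_norm n 2 x" if "F \<in> space \<mu>" for F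
    using norm_proj_scale[OF _ k, of F n c x] that haar_space(2)[OF haar] x by (simp add: y_def c_def)
  then have "{F\<in>space \<mu>. lp_norm n 2 (proj n F y) \<in> B} = {F\<in>space \<mu>. lp_norm n 2 (proj n F x) / lp_norm n 2 x \<in> B}" by auto
  with law show ?thesis by simp
qed

lemma std_gauss_norm_nonzero:
  assumes n: "1 \<le> n"
  shows "AE g in std_gauss n. lp_norm n 2 g \<noteq> 0"
proof -
  interpret prob_space "std_gauss n" by (rule prob_space_std_gauss)
  have "AE y in lborel. y \<noteq> (0::real)" by (rule AE_lborel_singleton)
  then have "AE y in std_normal_distribution. y \<noteq> 0" by (subst AE_density) auto
  then have "measure std_normal_distribution {0} = 0"
    by (subst prob_space.prob_eq_0[OF prob_space_std_normal]) auto
  then have z: "\<P>(x in std_gauss n. x 0 \<in> {0}) = 0"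
    using measure_PiM_component[OF prob_space_std_normal _ _, of 0 n "{0}"] n by simp
  have "(\<lambda>x. x 0) \<in> borel_measurable (std_gauss n)" using n by (intro measurable_std_gauss_component) simp
  from measurable_sets[OF this, of "{0}"]
  have "{x\<in>space (std_gauss n). x 0 \<in> {0}} \<in> sets (std_gauss n)"
    by (simp add: vimage_def Int_def conj_commute)
  with z have "AE g in std_gauss n. g \<notin> {x\<in>space (std_gauss n). x 0 \<in> {0}}" by (subst (asm) prob_eq_0) auto
  with AE_space show ?thesis
  proof eventually_elim
    case (elim g)
    then have "g 0 \<noteq> 0" by auto
    then show ?case using n lp_norm_eq_0_iff[of 2 n g] by auto
  qed
qed

text \<open>
  For a fixed nonzero \<open>g\<close> the inner probability over \<open>F\<close> is the left-hand side; average over Gaussian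
  \<open>g\<close> and exchange the integrals. This trades a random subspace for a random vector.
\<close>

lemma haar_eq_gauss_average:
  assumes haar: "haar_grassmannian n k \<mu>" and k: "1 \<le> k" and n: "1 \<le> n" and B: "B \<in> sets borel"
  shows "emeasure \<mu> {F\<in>space \<mu>. lp_norm n 2 (proj n F unit0) \<in> B} =
    (\<integral>\<^sup>+F. emeasure (std_gauss n) {g\<in>space (std_gauss n). lp_norm n 2 (proj n F g) / lp_norm n 2 g \<in> B} \<partial>\<mu>)"
proof -
  interpret H: prob_space \<mu> by (rule haar_space[OF haar])
  interpret G: prob_space "std_gauss n" by (rule prob_space_std_gauss)
  interpret pair_prob_space "std_gauss n" \<mu> ..
  let ?q = "\<lambda>x. lp_norm n 2 (proj n (snd x) (fst x)) / lp_norm n 2 (fst x)"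
  have comp: "i < n \<Longrightarrow> (\<lambda>w. fst w i) \<in> borel_measurable (std_gauss n \<Otimes>\<^sub>M \<mu>)" for i by measurable
  have sn: "snd \<in> measurable (std_gauss n \<Otimes>\<^sub>M \<mu>) (grassmannian_borel n k)"
    using measurable_snd[of "std_gauss n" \<mu>] haar_space(3)[OF haar] by (simp cong: measurable_cong_sets)
  have q: "?q \<in> borel_measurable (std_gauss n \<Otimes>\<^sub>M \<mu>)"
    by (intro borel_measurable_divide measurable_norm_proj[OF k sn] measurable_lp_norm comp)
  have qg: "(\<lambda>F. ?q (g, F)) \<in> borel_measurable \<mu>" if "g \<in> space (std_gauss n)" for g
    using measurable_compose[OF measurable_Pair1'[OF that] q] by simp
  have qF: "(\<lambda>g. ?q (g, F)) \<in> borel_measurable (std_gauss n)" if "F \<in> space \<mu>" for F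
    using measurable_compose[OF measurable_Pair2'[OF that] q] by simp
  have ind: "(\<lambda>x. indicator B (?q x) :: ennreal) \<in> borel_measurable (std_gauss n \<Otimes>\<^sub>M \<mu>)"
    using measurable_compose[OF q borel_measurable_indicator[OF B]] .
  have "emeasure \<mu> {F\<in>space \<mu>. lp_norm n 2 (proj n F unit0) \<in> B} =
      (\<integral>\<^sup>+g. emeasure \<mu> {F\<in>space \<mu>. lp_norm n 2 (proj n F unit0) \<in> B} \<partial>std_gauss n)"
    by (simp add: G.emeasure_space_1)
  also have "\<dots> = (\<integral>\<^sup>+g. \<integral>\<^sup>+F. indicator B (?q (g, F)) \<partial>\<mu> \<partial>std_gauss n)"
  proof (rule nn_integral_cong_AE)
    show "AE g in std_gauss n. emeasure \<mu> {F\<in>space \<mu>. lp_norm n 2 (proj n F unit0) \<in> B} = (\<integral>\<^sup>+F. indicator B (?q (g, F)) \<partial>\<mu>)"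
      using std_gauss_norm_nonzero[OF n] AE_space
    proof eventually_elim
      case (elim g)
      have S: "{F\<in>space \<mu>. ?q (g, F) \<in> B} \<in> sets \<mu>"
        using measurable_sets[OF qg[OF elim(2)] B] by (simp add: vimage_def Int_def conj_commute)
      have "emeasure \<mu> {F\<in>space \<mu>. lp_norm n 2 (proj n F unit0) \<in> B} = emeasure \<mu> {F\<in>space \<mu>. ?q (g, F) \<in> B}"
        using haar_ratio[OF haar k n elim(1) B] by simp
      also have "\<dots> = (\<integral>\<^sup>+F. indicator {F\<in>space \<mu>. ?q (g, F) \<in> B} F \<partial>\<mu>)" using S by simp
      also have "\<dots> = (\<integral>\<^sup>+F. indicator B (?q (g, F)) \<partial>\<mu>)" by (intro nn_integral_cong) (auto simp: indicator_def)
      finally show ?case .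
    qed
  qed
  also have "\<dots> = (\<integral>\<^sup>+F. \<integral>\<^sup>+g. indicator B (?q (g, F)) \<partial>std_gauss n \<partial>\<mu>)"
    using ind by (intro Fubini'[symmetric]) (simp add: split_beta')
  also have "\<dots> = (\<integral>\<^sup>+F. emeasure (std_gauss n) {g\<in>space (std_gauss n). lp_norm n 2 (proj n F g) / lp_norm n 2 g \<in> B} \<partial>\<mu>)"
  proof (rule nn_integral_cong)
    fix F assume F: "F \<in> space \<mu>"
    have S: "{g\<in>space (std_gauss n). ?q (g, F) \<in> B} \<in> sets (std_gauss n)"
      using measurable_sets[OF qF[OF F] B] by (simp add: vimage_def Int_def conj_commute)
    have "(\<integral>\<^sup>+g. indicator B (?q (g, F)) \<partial>std_gauss n) = (\<integral>\<^sup>+g. indicator {g\<in>space (std_gauss n). ?q (g, F) \<in> B} g \<partial>std_gauss n)"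
      by (intro nn_integral_cong) (auto simp: indicator_def)
    also have "\<dots> = emeasure (std_gauss n) {g\<in>space (std_gauss n). ?q (g, F) \<in> B}" using S by simp
    finally show "(\<integral>\<^sup>+g. indicator B (?q (g, F)) \<partial>std_gauss n) =
      emeasure (std_gauss n) {g\<in>space (std_gauss n). lp_norm n 2 (proj n F g) / lp_norm n 2 g \<in> B}" by simp
  qed
  finally show ?thesis .
qed

lemma haar_measure_le:
  assumes haar: "haar_grassmannian n k \<mu>" and k: "1 \<le> k" and n: "1 \<le> n" and B: "B \<in> sets borel"
    and le: "\<And>F. F \<in> grassmannian n k \<Longrightarrow> \<P>(g in std_gauss n. lp_norm n 2 (proj n F g) / lp_norm n 2 g \<in> B) \<le> c"
    and c: "0 \<le> c"
  shows "measure \<mu> {F\<in>space \<mu>. lp_norm n 2 (proj n F unit0) \<in> B} \<le> c"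
proof -
  interpret H: prob_space \<mu> by (rule haar_space[OF haar])
  interpret G: prob_space "std_gauss n" by (rule prob_space_std_gauss)
  have "emeasure \<mu> {F\<in>space \<mu>. lp_norm n 2 (proj n F unit0) \<in> B} \<le> (\<integral>\<^sup>+F. ennreal c \<partial>\<mu>)"
    unfolding haar_eq_gauss_average[OF haar k n B] G.emeasure_eq_measure
    using le haar_space(2)[OF haar] by (intro nn_integral_mono ennreal_leI) auto
  then show ?thesis using c by (simp add: H.emeasure_space_1 H.emeasure_eq_measure H.prob_space)
qed

lemma haar_measure_ge:
  assumes haar: "haar_grassmannian n k \<mu>" and k: "1 \<le> k" and n: "1 \<le> n" and B: "B \<in> sets borel"
    and ge: "\<And>F. F \<in> grassmannian n k \<Longrightarrow> c \<le> \<P>(g in std_gauss n. lp_norm n 2 (proj n F g) / lp_norm n 2 g \<in> B)"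
  shows "c \<le> measure \<mu> {F\<in>space \<mu>. lp_norm n 2 (proj n F unit0) \<in> B}"
proof -
  interpret H: prob_space \<mu> by (rule haar_space[OF haar])
  interpret G: prob_space "std_gauss n" by (rule prob_space_std_gauss)
  have "(\<integral>\<^sup>+F. ennreal c \<partial>\<mu>) \<le> emeasure \<mu> {F\<in>space \<mu>. lp_norm n 2 (proj n F unit0) \<in> B}"
    unfolding haar_eq_gauss_average[OF haar k n B] G.emeasure_eq_measure
    using ge haar_space(2)[OF haar] by (intro nn_integral_mono ennreal_leI) auto
  then show ?thesis by (simp add: H.emeasure_space_1 H.emeasure_eq_measure H.prob_space)
qed

declare measurable_std_gauss_component [measurable del]

lemma sqrt_square_mult: "0 \<le> u \<Longrightarrow> sqrt (u\<^sup>2 * x) = u * sqrt x"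
  by (simp add: real_sqrt_mult)

context
  fixes n k :: nat and F :: "(nat \<Rightarrow> real) set"
  assumes F: "F \<in> grassmannian n k" and k: "1 \<le> k" and n: "1 \<le> n"
begin

definition "sq_proj g = (lp_norm n 2 (proj n F g))\<^sup>2"
definition "sq_full g = (lp_norm n 2 g)\<^sup>2"

lemma chisq_sq_proj: "chisq_mgf (std_gauss n) sq_proj (real k)"
proof -
  obtain e where e: "onb n k e F" using grassmannian_onb[OF F k] .
  have "sq_proj = (\<lambda>g. \<Sum>l<k. (Rn_inner n g (e l))\<^sup>2)"
    unfolding sq_proj_def[abs_def] norm_proj_onb[OF e] by (simp add: sum_nonneg)
  then show ?thesis using chisq_mgf_gauss_projection[of n k e] e by (simp add: onb_def)
qed

lemma chisq_sq_full: "chisq_mgf (std_gauss n) sq_full (real n)"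
proof -
  have "sq_full = (\<lambda>g. \<Sum>i<n. (g i)\<^sup>2)" unfolding sq_full_def[abs_def] lp_norm_2 by (simp add: sum_nonneg)
  then show ?thesis using nn_integral_gauss_exp_squares[of _ n] by (simp add: chisq_mgf_def)
qed

text \<open>
  The square of the normalised ratio is \<open>(sq_proj g / k) / (sq_full g / n)\<close>, the quotient of two
  chi-square variables divided by their degrees of freedom.
\<close>

lemma ratio_square:
  "(sqrt (real n / real k) * (lp_norm n 2 (proj n F g) / lp_norm n 2 g))\<^sup>2 * (sq_full g * real k) = real n * sq_proj g \<or> sq_full g = 0"
  using k by (auto simp: sq_proj_def sq_full_def power_mult_distrib power_divide field_simps)

lemma sets_sq:
  "{g\<in>space (std_gauss n). a \<le> sq_proj g} \<in> sets (std_gauss n)" "{g\<in>space (std_gauss n). sq_proj g \<le> a} \<in> sets (std_gauss n)"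
  "{g\<in>space (std_gauss n). a \<le> sq_full g} \<in> sets (std_gauss n)" "{g\<in>space (std_gauss n). sq_full g \<le> a} \<in> sets (std_gauss n)"
  "{g\<in>space (std_gauss n). \<bar>sq_proj g - a\<bar> \<le> b} \<in> sets (std_gauss n)"
proof -
  have [measurable]: "sq_proj \<in> borel_measurable (std_gauss n)" "sq_full \<in> borel_measurable (std_gauss n)"
    using chisq_sq_proj chisq_sq_full by (simp_all add: chisq_mgf_def)
  show "{g\<in>space (std_gauss n). a \<le> sq_proj g} \<in> sets (std_gauss n)" by measurable
  show "{g\<in>space (std_gauss n). sq_proj g \<le> a} \<in> sets (std_gauss n)" by measurable
  show "{g\<in>space (std_gauss n). a \<le> sq_full g} \<in> sets (std_gauss n)" by measurable
  show "{g\<in>space (std_gauss n). sq_full g \<le> a} \<in> sets (std_gauss n)" by measurable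
  show "{g\<in>space (std_gauss n). \<bar>sq_proj g - a\<bar> \<le> b} \<in> sets (std_gauss n)" by measurable
qed

text \<open>
  Either the numerator is large or the denominator is below \<open>(1 - e) n\<close>; the latter has a positive rate
  at speed \<open>n\<close>, so it is negligible at speed \<open>k = o(n)\<close>.
\<close>

lemma gauss_ratio_upper:
  assumes e: "0 < e" "e < 1" and u: "0 \<le> u" "1 \<le> u * sqrt (1 - e)"
  shows "\<P>(g in std_gauss n. lp_norm n 2 (proj n F g) / lp_norm n 2 g \<in> {x. u \<le> sqrt (real n / real k) * x})
    \<le> exp (- real k * chi_rate (u * sqrt (1 - e))) + exp (- real n * chi_rate (sqrt (1 - e)))"
proof -
  interpret G: prob_space "std_gauss n" by (rule prob_space_std_gauss)
  let ?A = "{g\<in>space (std_gauss n). (u * sqrt (1 - e))\<^sup>2 * real k \<le> sq_proj g}"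
  let ?B = "{g\<in>space (std_gauss n). sq_full g \<le> (sqrt (1 - e))\<^sup>2 * real n}"
  have sub: "{g\<in>space (std_gauss n). lp_norm n 2 (proj n F g) / lp_norm n 2 g \<in> {x. u \<le> sqrt (real n / real k) * x}} \<subseteq> ?A \<union> ?B"
  proof
    fix g assume g: "g \<in> {g\<in>space (std_gauss n). lp_norm n 2 (proj n F g) / lp_norm n 2 g \<in> {x. u \<le> sqrt (real n / real k) * x}}"
    show "g \<in> ?A \<union> ?B"
    proof (cases "sq_full g \<le> (1 - e) * real n")
      case True then show ?thesis using g e by simp
    next
      case False
      define r where "r = sqrt (real n / real k) * (lp_norm n 2 (proj n F g) / lp_norm n 2 g)"
      have S: "(1 - e) * real n < sq_full g" "0 < sq_full g" using False e n by (auto intro: le_less_trans[of 0 "(1 - e) * real n"])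
      have r: "r\<^sup>2 * (sq_full g * real k) = real n * sq_proj g" using ratio_square[of g] S unfolding r_def by auto
      have "u\<^sup>2 * ((1 - e) * real n * real k) \<le> r\<^sup>2 * (sq_full g * real k)"
        using g u S e by (intro mult_mono power_mono mult_nonneg_nonneg) (auto simp: r_def)
      then have "real n * (u\<^sup>2 * (1 - e) * real k) \<le> real n * sq_proj g" unfolding r by (simp add: algebra_simps)
      then have "u\<^sup>2 * (1 - e) * real k \<le> sq_proj g" using n by simp
      then show ?thesis using g e by (simp add: power_mult_distrib)
    qed
  qed
  have "\<P>(g in std_gauss n. lp_norm n 2 (proj n F g) / lp_norm n 2 g \<in> {x. u \<le> sqrt (real n / real k) * x}) \<le> measure (std_gauss n) (?A \<union> ?B)"
    by (rule G.finite_measure_mono[OF sub sets.Un[OF sets_sq(1) sets_sq(4)]])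
  also have "\<dots> \<le> measure (std_gauss n) ?A + measure (std_gauss n) ?B" by (rule measure_Un_le[OF sets_sq(1) sets_sq(4)])
  also have "\<dots> \<le> exp (- real k * chi_rate (u * sqrt (1 - e))) + exp (- real n * chi_rate (sqrt (1 - e)))"
    using e u by (intro add_mono chisq_upper_tail[OF G.prob_space_axioms chisq_sq_proj] chisq_lower_tail[OF G.prob_space_axioms chisq_sq_full]) auto
  finally show ?thesis .
qed

lemma gauss_ratio_lower:
  assumes e: "0 < e" and u: "0 < u" "u * sqrt (1 + e) \<le> 1"
  shows "\<P>(g in std_gauss n. lp_norm n 2 (proj n F g) / lp_norm n 2 g \<in> {x. sqrt (real n / real k) * x \<le> u})
    \<le> exp (- real k * chi_rate (u * sqrt (1 + e))) + exp (- real n * chi_rate (sqrt (1 + e)))"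
proof -
  interpret G: prob_space "std_gauss n" by (rule prob_space_std_gauss)
  let ?A = "{g\<in>space (std_gauss n). sq_proj g \<le> (u * sqrt (1 + e))\<^sup>2 * real k}"
  let ?B1 = "{g\<in>space (std_gauss n). (sqrt (1 + e))\<^sup>2 * real n \<le> sq_full g}"
  have A0: "AE g in std_gauss n. lp_norm n 2 g \<noteq> 0" by (rule std_gauss_norm_nonzero[OF n])
  let ?L = "{g\<in>space (std_gauss n). lp_norm n 2 (proj n F g) / lp_norm n 2 g \<in> {x. sqrt (real n / real k) * x \<le> u}}"
  have imp: "g \<in> ?A \<union> ?B1" if g: "g \<in> ?L" and nz: "lp_norm n 2 g \<noteq> 0" for g
  proof (cases "(1 + e) * real n \<le> sq_full g")
    case True then show ?thesis using g e by simp
  next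
    case False
    define r where "r = sqrt (real n / real k) * (lp_norm n 2 (proj n F g) / lp_norm n 2 g)"
    have S: "sq_full g \<le> (1 + e) * real n" "sq_full g \<noteq> 0" using False nz by (auto simp: sq_full_def)
    have r: "r\<^sup>2 * (sq_full g * real k) = real n * sq_proj g" using ratio_square[of g] S unfolding r_def by auto
    have "0 \<le> r" by (simp add: r_def)
    then have "r\<^sup>2 * (sq_full g * real k) \<le> u\<^sup>2 * ((1 + e) * real n * real k)"
      using g u S e by (intro mult_mono power_mono mult_nonneg_nonneg) (auto simp: r_def sq_full_def)
    then have "real n * sq_proj g \<le> real n * (u\<^sup>2 * (1 + e) * real k)" unfolding r by (simp add: algebra_simps)
    then have "sq_proj g \<le> u\<^sup>2 * (1 + e) * real k" using n by simp
    then show ?thesis using g e by (simp add: power_mult_distrib)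
  qed
  have "measure (std_gauss n) ?L \<le> measure (std_gauss n) (?A \<union> ?B1)"
    by (rule G.finite_measure_mono_AE) (use A0 imp sets.Un[OF sets_sq(2) sets_sq(3)] in auto)
  also have "\<dots> \<le> measure (std_gauss n) ?A + measure (std_gauss n) ?B1" by (rule measure_Un_le[OF sets_sq(2) sets_sq(3)])
  also have "\<dots> \<le> exp (- real k * chi_rate (u * sqrt (1 + e))) + exp (- real n * chi_rate (sqrt (1 + e)))"
    using e u by (intro add_mono chisq_lower_tail[OF G.prob_space_axioms chisq_sq_proj] chisq_upper_tail[OF G.prob_space_axioms chisq_sq_full]) auto
  finally show ?thesis .
qed

lemma gauss_ratio_local:
  assumes e: "0 < e" "e < 1" and u: "0 < u" and d: "u * sqrt ((1 + e) / (1 - e)) < u + d" "u - d < u * sqrt ((1 - e) / (1 + e))"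
  shows "exp (- real k * (chi_rate u + e * \<bar>u\<^sup>2 - 1\<bar> / 2)) *
      (1 - exp (- real k * chi_rate (sqrt (1 + e))) - exp (- real k * chi_rate (sqrt (1 - e))))
      - (exp (- real n * chi_rate (sqrt (1 - e))) + exp (- real n * chi_rate (sqrt (1 + e))))
    \<le> \<P>(g in std_gauss n. lp_norm n 2 (proj n F g) / lp_norm n 2 g \<in> {x. sqrt (real n / real k) * x \<in> ball u d})"
proof -
  interpret G: prob_space "std_gauss n" by (rule prob_space_std_gauss)
  let ?A = "{g\<in>space (std_gauss n). \<bar>sq_proj g - u\<^sup>2 * real k\<bar> \<le> e * u\<^sup>2 * real k}"
  let ?B = "{g\<in>space (std_gauss n). sq_full g \<le> (sqrt (1 - e))\<^sup>2 * real n}"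
  let ?C = "{g\<in>space (std_gauss n). (sqrt (1 + e))\<^sup>2 * real n \<le> sq_full g}"
  let ?L = "{g\<in>space (std_gauss n). lp_norm n 2 (proj n F g) / lp_norm n 2 g \<in> {x. sqrt (real n / real k) * x \<in> ball u d}}"
  have mL: "?L \<in> sets (std_gauss n)"
  proof -
    have "(\<lambda>g. lp_norm n 2 (proj n F g)) \<in> borel_measurable (std_gauss n)"
      by (rule measurable_norm_proj[OF k]) (use F in auto)
    moreover have "(\<lambda>g. lp_norm n 2 g) \<in> borel_measurable (std_gauss n)" by (rule measurable_lp_norm) (rule measurable_std_gauss_component)
    ultimately have "(\<lambda>g. sqrt (real n / real k) * (lp_norm n 2 (proj n F g) / lp_norm n 2 g)) \<in> borel_measurable (std_gauss n)" by measurable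
    from measurable_sets[OF this, of "ball u d"] show ?thesis by (simp add: vimage_def Int_def conj_commute)
  qed
  have sub: "?A \<subseteq> ?L \<union> (?B \<union> ?C)"
  proof (rule subsetI, rule ccontr)
    fix g assume g: "g \<in> ?A" and ng: "g \<notin> ?L \<union> (?B \<union> ?C)"
    define r where "r = sqrt (real n / real k) * (lp_norm n 2 (proj n F g) / lp_norm n 2 g)"
    have r0: "0 \<le> r" by (simp add: r_def)
    have S: "(1 - e) * real n < sq_full g" "sq_full g < (1 + e) * real n" using g ng e by (auto simp: not_le)
    then have S0: "0 < sq_full g" using e n by (auto intro: le_less_trans[of 0 "(1 - e) * real n"])
    have r: "r\<^sup>2 * (sq_full g * real k) = real n * sq_proj g" using ratio_square[of g] S0 unfolding r_def by auto
    have T: "(1 - e) * u\<^sup>2 * real k \<le> sq_proj g" "sq_proj g \<le> (1 + e) * u\<^sup>2 * real k"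
      using g by (auto simp: abs_le_iff algebra_simps)
    have kn: "0 < real k" "0 < real n" using k n by auto
    have "r\<^sup>2 * ((1 - e) * real n * real k) \<le> r\<^sup>2 * (sq_full g * real k)"
      using S kn by (intro mult_left_mono mult_right_mono) auto
    also have "\<dots> \<le> real n * ((1 + e) * u\<^sup>2 * real k)" unfolding r using T by (intro mult_left_mono) auto
    finally have "(real n * real k) * (r\<^sup>2 * (1 - e)) \<le> (real n * real k) * ((1 + e) * u\<^sup>2)" by (simp add: algebra_simps)
    then have "r\<^sup>2 * (1 - e) \<le> (1 + e) * u\<^sup>2" using kn by simp
    then have "r\<^sup>2 \<le> u\<^sup>2 * ((1 + e) / (1 - e))" using e by (simp add: field_simps)
    then have "sqrt (r\<^sup>2) \<le> u * sqrt ((1 + e) / (1 - e))"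
      unfolding sqrt_square_mult[OF less_imp_le[OF u], symmetric] by (rule real_sqrt_le_mono)
    then have up: "r \<le> u * sqrt ((1 + e) / (1 - e))" using r0 by simp
    have "real n * ((1 - e) * u\<^sup>2 * real k) \<le> r\<^sup>2 * (sq_full g * real k)" unfolding r using T by (intro mult_left_mono) auto
    also have "\<dots> \<le> r\<^sup>2 * ((1 + e) * real n * real k)" using S kn by (intro mult_left_mono mult_right_mono) auto
    finally have "(real n * real k) * ((1 - e) * u\<^sup>2) \<le> (real n * real k) * (r\<^sup>2 * (1 + e))" by (simp add: algebra_simps)
    then have "(1 - e) * u\<^sup>2 \<le> r\<^sup>2 * (1 + e)" using kn by simp
    then have "u\<^sup>2 * ((1 - e) / (1 + e)) \<le> r\<^sup>2" using e by (simp add: field_simps)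
    then have "u * sqrt ((1 - e) / (1 + e)) \<le> sqrt (r\<^sup>2)"
      unfolding sqrt_square_mult[OF less_imp_le[OF u], symmetric] by (rule real_sqrt_le_mono)
    then have lo: "u * sqrt ((1 - e) / (1 + e)) \<le> r" using r0 by simp
    have "g \<in> ?L" using g up lo d unfolding r_def by (auto simp: dist_real_def)
    then show False using ng by simp
  qed
  have "measure (std_gauss n) ?A \<le> measure (std_gauss n) (?L \<union> (?B \<union> ?C))"
    by (rule G.finite_measure_mono[OF sub sets.Un[OF mL sets.Un[OF sets_sq(4) sets_sq(3)]]])
  also have "\<dots> \<le> measure (std_gauss n) ?L + measure (std_gauss n) (?B \<union> ?C)"
    by (rule measure_Un_le[OF mL sets.Un[OF sets_sq(4) sets_sq(3)]])
  also have "measure (std_gauss n) (?B \<union> ?C) \<le> measure (std_gauss n) ?B + measure (std_gauss n) ?C" by (rule measure_Un_le[OF sets_sq(4) sets_sq(3)])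
  also have "measure (std_gauss n) ?B \<le> exp (- real n * chi_rate (sqrt (1 - e)))"
    by (rule chisq_lower_tail[OF G.prob_space_axioms chisq_sq_full]) (use e in auto)
  also have "measure (std_gauss n) ?C \<le> exp (- real n * chi_rate (sqrt (1 + e)))"
    by (rule chisq_upper_tail[OF G.prob_space_axioms chisq_sq_full]) (use e in auto)
  finally have "measure (std_gauss n) ?A \<le> measure (std_gauss n) ?L + (exp (- real n * chi_rate (sqrt (1 - e))) + exp (- real n * chi_rate (sqrt (1 + e))))" by simp
  moreover have "exp (- real k * (chi_rate u + e * \<bar>u\<^sup>2 - 1\<bar> / 2)) *
      (1 - exp (- real k * chi_rate (sqrt (1 + e))) - exp (- real k * chi_rate (sqrt (1 - e)))) \<le> measure (std_gauss n) ?A"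
    by (rule chisq_local_lower[OF G.prob_space_axioms chisq_sq_proj u e]) simp
  ultimately show ?thesis by linarith
qed

end

lemma isCont_chi_rate: "0 < u \<Longrightarrow> isCont chi_rate u"
  unfolding chi_rate_def[abs_def] by (intro continuous_intros) auto

lemma chi_rate_eventually_gt:
  assumes "(f \<longlongrightarrow> u) G" "0 < u" "r < chi_rate u"
  shows "\<forall>\<^sub>F x in G. r < chi_rate (f x)"
  by (rule order_tendstoD(1)[OF isCont_tendsto_compose[OF isCont_chi_rate[OF assms(2)] assms(1)] assms(3)])

lemma exp_ub_any:
  assumes "exp_ub (\<lambda>n. real n) P (ereal c)" "0 < c" "filterlim (\<lambda>n. real n / s n) at_top sequentially"
    "\<forall>\<^sub>F n in sequentially. 0 < s n"
  shows "exp_ub s P d"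
  by (rule exp_ub_speed_infinity[OF assms(1) _ assms(3,4)]) (use assms(2) in simp)

text \<open>
  The law of \<open>R\<close>, with the direction of \<open>X\<close> replaced by the first unit vector.
\<close>

definition proj_law :: "(nat \<Rightarrow> nat) \<Rightarrow> (nat \<Rightarrow> (nat \<Rightarrow> real) set measure) \<Rightarrow> nat \<Rightarrow> real set \<Rightarrow> real" where
  "proj_law k \<mu> n B = \<P>(F in \<mu> n. sqrt (real n / real (k n)) * lp_norm n 2 (proj n F unit0) \<in> B)"

context
  fixes k :: "nat \<Rightarrow> nat" and \<mu> :: "nat \<Rightarrow> (nat \<Rightarrow> real) set measure"
  assumes haar: "\<And>n. 1 \<le> n \<Longrightarrow> haar_grassmannian n (k n) (\<mu> n)"
    and k1: "\<And>n. 1 \<le> n \<Longrightarrow> 1 \<le> k n"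
    and k_lim: "filterlim (\<lambda>n. real (k n)) at_top sequentially"
    and k_small: "filterlim (\<lambda>n. real n / real (k n)) at_top sequentially"
begin

lemma ev1: "\<forall>\<^sub>F n in sequentially. (1::nat) \<le> n"
  by (rule eventually_ge_at_top)

lemma evk: "\<forall>\<^sub>F n in sequentially. 0 < real (k n)"
  using k_lim unfolding filterlim_at_top_dense by blast

lemma scaled_vimage_borel: "B \<in> sets borel \<Longrightarrow> {x::real. c * x \<in> B} \<in> sets borel"
  using measurable_sets[of "\<lambda>x. c * x" borel borel B] by (simp add: vimage_def)

lemma exp_n_fast: "0 < c \<Longrightarrow> exp_ub (\<lambda>n. real (k n)) (\<lambda>n. exp (- real n * c)) d"
  by (rule exp_ub_any[OF exp_ub_of_le[of _ c], OF _ _ _ k_small evk]) (auto simp: mult.commute)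

lemma proj_law_upper:
  assumes u: "1 < u"
  shows "exp_ub (\<lambda>n. real (k n)) (\<lambda>n. proj_law k \<mu> n {u..}) (ereal (chi_rate u))"
  unfolding exp_ub_def
proof (intro allI impI)
  fix r assume "ereal r < ereal (chi_rate u)"
  then obtain r' where r': "r < r'" "r' < chi_rate u" using dense[of r "chi_rate u"] by auto
  have lim: "((\<lambda>e. u * sqrt (1 - e)) \<longlongrightarrow> u * sqrt (1 - 0)) (at_right 0)" by (intro tendsto_intros)
  then have lim: "((\<lambda>e. u * sqrt (1 - e)) \<longlongrightarrow> u) (at_right 0)" by simp
  have a: "\<forall>\<^sub>F e in at_right 0. r' < chi_rate (u * sqrt (1 - e))"
    by (rule chi_rate_eventually_gt[OF lim]) (use u r' in auto)
  have b: "\<forall>\<^sub>F e in at_right 0. 1 < u * sqrt (1 - e)" by (rule order_tendstoD(1)[OF lim u])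
  have c: "\<forall>\<^sub>F e in at_right (0::real). 0 < e \<and> e < 1" using eventually_at_right_real[of 0 "1::real"] by (auto elim: eventually_mono)
  have "\<forall>\<^sub>F e in at_right 0. r' < chi_rate (u * sqrt (1 - e)) \<and> 1 < u * sqrt (1 - e) \<and> 0 < e \<and> e < 1"
    using a b c by eventually_elim auto
  then obtain e where e: "r' < chi_rate (u * sqrt (1 - e))" "1 < u * sqrt (1 - e)" "0 < e" "e < 1"
    using eventually_happens[of _ "at_right (0::real)"] by (metis (lifting) trivial_limit_at_right_real)
  let ?c = "chi_rate (sqrt (1 - e))"
  have cp: "0 < ?c" using e by (intro chi_rate_pos) auto
  have "exp_ub (\<lambda>n. real (k n)) (\<lambda>n. exp (- real (k n) * chi_rate (u * sqrt (1 - e))) + exp (- real n * ?c)) (ereal (chi_rate (u * sqrt (1 - e))))"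
    by (rule exp_ub_add[OF exp_ub_of_le exp_n_fast[OF cp] k_lim]) (auto simp: mult.commute)
  then have *: "exp_ub (\<lambda>n. real (k n)) (\<lambda>n. exp (- real (k n) * chi_rate (u * sqrt (1 - e))) + exp (- real n * ?c)) (ereal r')"
    by (rule exp_ub_mono) (use e in auto)
  have "\<forall>\<^sub>F n in sequentially. proj_law k \<mu> n {u..} \<le> exp (- real (k n) * chi_rate (u * sqrt (1 - e))) + exp (- real n * ?c)"
    using ev1
  proof eventually_elim
    case (elim n)
    have "\<P>(F in \<mu> n. lp_norm n 2 (proj n F unit0) \<in> {x. u \<le> sqrt (real n / real (k n)) * x}) \<le>
        exp (- real (k n) * chi_rate (u * sqrt (1 - e))) + exp (- real n * ?c)"
      using e u scaled_vimage_borel[of "{u..}" "sqrt (real n / real (k n))"]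
      by (intro haar_measure_le[OF haar[OF elim] k1[OF elim] elim] gauss_ratio_upper k1 elim add_nonneg_nonneg) auto
    then show ?case by (simp add: proj_law_def)
  qed
  from exp_ub_mono[OF * order_refl this]
  show "\<forall>\<^sub>F n in sequentially. proj_law k \<mu> n {u..} \<le> exp (- r * real (k n))" using r'(1) unfolding exp_ub_def by simp
qed

lemma proj_law_lower:
  assumes u: "0 < u" "u < 1"
  shows "exp_ub (\<lambda>n. real (k n)) (\<lambda>n. proj_law k \<mu> n {..u}) (ereal (chi_rate u))"
  unfolding exp_ub_def
proof (intro allI impI)
  fix r assume "ereal r < ereal (chi_rate u)"
  then obtain r' where r': "r < r'" "r' < chi_rate u" using dense[of r "chi_rate u"] by auto
  have lim: "((\<lambda>e. u * sqrt (1 + e)) \<longlongrightarrow> u * sqrt (1 + 0)) (at_right 0)" by (intro tendsto_intros)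
  then have lim: "((\<lambda>e. u * sqrt (1 + e)) \<longlongrightarrow> u) (at_right 0)" by simp
  have a: "\<forall>\<^sub>F e in at_right 0. r' < chi_rate (u * sqrt (1 + e))"
    by (rule chi_rate_eventually_gt[OF lim]) (use u r' in auto)
  have b: "\<forall>\<^sub>F e in at_right 0. u * sqrt (1 + e) < 1" by (rule order_tendstoD(2)[OF lim u(2)])
  have c: "\<forall>\<^sub>F e in at_right (0::real). 0 < e" by (simp add: eventually_at_right_less)
  have "\<forall>\<^sub>F e in at_right 0. r' < chi_rate (u * sqrt (1 + e)) \<and> u * sqrt (1 + e) < 1 \<and> 0 < e"
    using a b c by eventually_elim auto
  then obtain e where e: "r' < chi_rate (u * sqrt (1 + e))" "u * sqrt (1 + e) < 1" "0 < e"
    using eventually_happens[of _ "at_right (0::real)"] by (metis (lifting) trivial_limit_at_right_real)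
  let ?c = "chi_rate (sqrt (1 + e))"
  have cp: "0 < ?c" using e by (intro chi_rate_pos) auto
  have "exp_ub (\<lambda>n. real (k n)) (\<lambda>n. exp (- real (k n) * chi_rate (u * sqrt (1 + e))) + exp (- real n * ?c)) (ereal (chi_rate (u * sqrt (1 + e))))"
    by (rule exp_ub_add[OF exp_ub_of_le exp_n_fast[OF cp] k_lim]) (auto simp: mult.commute)
  then have *: "exp_ub (\<lambda>n. real (k n)) (\<lambda>n. exp (- real (k n) * chi_rate (u * sqrt (1 + e))) + exp (- real n * ?c)) (ereal r')"
    by (rule exp_ub_mono) (use e in auto)
  have "\<forall>\<^sub>F n in sequentially. proj_law k \<mu> n {..u} \<le> exp (- real (k n) * chi_rate (u * sqrt (1 + e))) + exp (- real n * ?c)"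
    using ev1
  proof eventually_elim
    case (elim n)
    have "\<P>(F in \<mu> n. lp_norm n 2 (proj n F unit0) \<in> {x. sqrt (real n / real (k n)) * x \<le> u}) \<le>
        exp (- real (k n) * chi_rate (u * sqrt (1 + e))) + exp (- real n * ?c)"
      using e u scaled_vimage_borel[of "{..u}" "sqrt (real n / real (k n))"]
      by (intro haar_measure_le[OF haar[OF elim] k1[OF elim] elim] gauss_ratio_lower k1 elim add_nonneg_nonneg) auto
    then show ?case by (simp add: proj_law_def)
  qed
  from exp_ub_mono[OF * order_refl this]
  show "\<forall>\<^sub>F n in sequentially. proj_law k \<mu> n {..u} \<le> exp (- r * real (k n))" using r'(1) unfolding exp_ub_def by simp
qed

lemma proj_law_local:
  assumes u: "0 < u" and d: "0 < d"
  shows "exp_lb (\<lambda>n. real (k n)) (\<lambda>n. proj_law k \<mu> n (ball u d)) (ereal (chi_rate u))"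
  unfolding exp_lb_def
proof (intro allI impI)
  fix r assume "ereal (chi_rate u) < ereal r"
  then have r: "chi_rate u < r" by simp
  have "((\<lambda>e. u * sqrt ((1 + e) / (1 - e))) \<longlongrightarrow> u * sqrt ((1 + 0) / (1 - 0))) (at_right (0::real))"
    by (intro tendsto_intros) auto
  then have a: "\<forall>\<^sub>F e in at_right 0. u * sqrt ((1 + e) / (1 - e)) < u + d" by (rule order_tendstoD(2)) (use d in simp)
  have "((\<lambda>e. u * sqrt ((1 - e) / (1 + e))) \<longlongrightarrow> u * sqrt ((1 - 0) / (1 + 0))) (at_right (0::real))"
    by (intro tendsto_intros) auto
  then have b: "\<forall>\<^sub>F e in at_right 0. u - d < u * sqrt ((1 - e) / (1 + e))" by (rule order_tendstoD(1)) (use d in simp)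
  have "((\<lambda>e. chi_rate u + e * \<bar>u\<^sup>2 - 1\<bar> / 2) \<longlongrightarrow> chi_rate u + 0 * \<bar>u\<^sup>2 - 1\<bar> / 2) (at_right (0::real))"
    by (intro tendsto_intros) auto
  then have c: "\<forall>\<^sub>F e in at_right 0. chi_rate u + e * \<bar>u\<^sup>2 - 1\<bar> / 2 < r" by (rule order_tendstoD(2)) (use r in simp)
  have c2: "\<forall>\<^sub>F e in at_right (0::real). 0 < e \<and> e < 1" using eventually_at_right_real[of 0 "1::real"] by (auto elim: eventually_mono)
  have "\<forall>\<^sub>F e in at_right 0. u * sqrt ((1 + e) / (1 - e)) < u + d \<and> u - d < u * sqrt ((1 - e) / (1 + e))
     \<and> chi_rate u + e * \<bar>u\<^sup>2 - 1\<bar> / 2 < r \<and> 0 < e \<and> e < 1"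
    using a b c c2 by eventually_elim auto
  then obtain e where e: "u * sqrt ((1 + e) / (1 - e)) < u + d" "u - d < u * sqrt ((1 - e) / (1 + e))"
     "chi_rate u + e * \<bar>u\<^sup>2 - 1\<bar> / 2 < r" "0 < e" "e < 1"
    using eventually_happens[of _ "at_right (0::real)"] by (metis (lifting) trivial_limit_at_right_real)
  define A where "A = chi_rate u + e * \<bar>u\<^sup>2 - 1\<bar> / 2"
  have A0: "0 \<le> A" unfolding A_def using chi_rate_nonneg[OF u] e by simp
  have c1: "0 < chi_rate (sqrt (1 - e))" "0 < chi_rate (sqrt (1 + e))" using e by (auto intro!: chi_rate_pos)
  have lbA: "exp_lb (\<lambda>n. real (k n)) (\<lambda>n. exp (- real (k n) * A)) (ereal A)"
    unfolding exp_lb_def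
  proof (intro allI impI)
    fix r assume "ereal A < ereal r"
    then have "A * real (k n) \<le> r * real (k n)" for n by (intro mult_right_mono) auto
    then show "\<forall>\<^sub>F n in sequentially. exp (- r * real (k n)) \<le> exp (- real (k n) * A)" by (simp add: mult.commute)
  qed
  have small: "\<forall>\<^sub>F n in sequentially. exp (- real (k n) * c) \<le> 1/4" if c: "0 < c" for c
    by (rule exp_ub_tendsto_0[OF exp_ub_of_le[of _ c] _ k_lim]) (use c in \<open>auto simp: mult.commute\<close>)
  have "\<forall>\<^sub>F n in sequentially. 1/2 \<le> 1 - exp (- real (k n) * chi_rate (sqrt (1 + e))) - exp (- real (k n) * chi_rate (sqrt (1 - e)))"
    using small[OF c1(1)] small[OF c1(2)] by eventually_elim linarith
  then have "exp_lb (\<lambda>n. real (k n)) (\<lambda>n. 1 - exp (- real (k n) * chi_rate (sqrt (1 + e))) - exp (- real (k n) * chi_rate (sqrt (1 - e)))) 0"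
    by (rule exp_lb_const[OF _ k_lim, rotated]) simp
  note lb = exp_lb_mult[OF lbA this]
  have ub: "exp_ub (\<lambda>n. real (k n)) (\<lambda>n. exp (- real n * chi_rate (sqrt (1 - e))) + exp (- real n * chi_rate (sqrt (1 + e)))) \<infinity>"
    by (rule exp_ub_add[OF exp_n_fast[OF c1(1)] exp_n_fast[OF c1(2)] k_lim])
  have "exp_lb (\<lambda>n. real (k n)) (\<lambda>n. exp (- real (k n) * A) * (1 - exp (- real (k n) * chi_rate (sqrt (1 + e))) - exp (- real (k n) * chi_rate (sqrt (1 - e))))
      - (exp (- real n * chi_rate (sqrt (1 - e))) + exp (- real n * chi_rate (sqrt (1 + e))))) (ereal A + 0)"
    by (rule exp_lb_diff[OF lb ub _ k_lim]) (use A0 in auto)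
  then have "exp_lb (\<lambda>n. real (k n)) (\<lambda>n. proj_law k \<mu> n (ball u d)) (ereal A + 0)"
  proof (rule exp_lb_mono[OF _ order_refl])
    show "\<forall>\<^sub>F n in sequentially. exp (- real (k n) * A) * (1 - exp (- real (k n) * chi_rate (sqrt (1 + e))) - exp (- real (k n) * chi_rate (sqrt (1 - e))))
      - (exp (- real n * chi_rate (sqrt (1 - e))) + exp (- real n * chi_rate (sqrt (1 + e)))) \<le> proj_law k \<mu> n (ball u d)"
      using ev1
    proof eventually_elim
      case (elim n)
      have "exp (- real (k n) * A) * (1 - exp (- real (k n) * chi_rate (sqrt (1 + e))) - exp (- real (k n) * chi_rate (sqrt (1 - e))))
          - (exp (- real n * chi_rate (sqrt (1 - e))) + exp (- real n * chi_rate (sqrt (1 + e))))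
        \<le> \<P>(F in \<mu> n. lp_norm n 2 (proj n F unit0) \<in> {x. sqrt (real n / real (k n)) * x \<in> ball u d})"
        unfolding A_def
      proof (rule haar_measure_ge[OF haar[OF elim] k1[OF elim] elim])
        show "{x. sqrt (real n / real (k n)) * x \<in> ball u d} \<in> sets borel" by (rule scaled_vimage_borel) simp
        fix F assume F: "F \<in> grassmannian n (k n)"
        show "exp (- real (k n) * (chi_rate u + e * \<bar>u\<^sup>2 - 1\<bar> / 2)) *
            (1 - exp (- real (k n) * chi_rate (sqrt (1 + e))) - exp (- real (k n) * chi_rate (sqrt (1 - e))))
            - (exp (- real n * chi_rate (sqrt (1 - e))) + exp (- real n * chi_rate (sqrt (1 + e))))
          \<le> \<P>(g in std_gauss n. lp_norm n 2 (proj n F g) / lp_norm n 2 g \<in>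
              {x. sqrt (real n / real (k n)) * x \<in> ball u d})"
          by (rule gauss_ratio_local[OF F k1[OF elim] elim e(4,5) u e(1,2)])
      qed
      then show ?case by (simp add: proj_law_def)
    qed
  qed
  then show "\<forall>\<^sub>F n in sequentially. exp (- r * real (k n)) \<le> proj_law k \<mu> n (ball u d)"
    using e(3) unfolding exp_lb_def A_def by simp
qed

end

section \<open>The quotient of two norms of a p-Gaussian vector\<close>

abbreviation gprob :: "real \<Rightarrow> nat \<Rightarrow> ((nat \<Rightarrow> real) \<Rightarrow> bool) \<Rightarrow> real" where
  "gprob p n Q \<equiv> \<P>(x in gg_prod p n. Q x)"

text \<open>
  The scale-invariant part of \<open>n^(1/p-1/2) \<parallel>x\<parallel>\<^sub>2\<close>.
\<close>

definition norm_ratio :: "real \<Rightarrow> nat \<Rightarrow> (nat \<Rightarrow> real) \<Rightarrow> real" where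
  "norm_ratio p n x = real n powr (1 / p - 1 / 2) * (lp_norm n 2 x / lp_norm n p x)"

text \<open>
  In this form the law of large numbers is visible: the numerator tends to \<open>\<surd>(M2 p)\<close> and the denominator
  to one.
\<close>

lemma norm_ratio_eq:
  assumes p: "0 < p" and n: "1 \<le> n"
  shows "norm_ratio p n x = sqrt ((\<Sum>i<n. (x i)\<^sup>2) / n) / ((\<Sum>i<n. \<bar>x i\<bar> powr p) / n) powr (1 / p)"
proof -
  have 1: "lp_norm n 2 x = real n powr (1 / 2) * sqrt ((\<Sum>i<n. (x i)\<^sup>2) / n)"
    unfolding lp_norm_2 using n by (simp add: real_sqrt_divide powr_half_sqrt)
  have 2: "lp_norm n p x = real n powr (1 / p) * ((\<Sum>i<n. \<bar>x i\<bar> powr p) / n) powr (1 / p)"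
    unfolding lp_norm_def using n by (simp add: powr_divide sum_nonneg)
  have 3: "real n powr (1 / p - 1 / 2) * real n powr (1 / 2) = real n powr (1 / p)"
    by (simp add: powr_add[symmetric])
  have "norm_ratio p n x = (real n powr (1 / p - 1 / 2) * real n powr (1 / 2)) * sqrt ((\<Sum>i<n. (x i)\<^sup>2) / n) /
      (real n powr (1 / p) * ((\<Sum>i<n. \<bar>x i\<bar> powr p) / n) powr (1 / p))"
    unfolding norm_ratio_def 1 2 by simp
  also have "\<dots> = sqrt ((\<Sum>i<n. (x i)\<^sup>2) / n) / ((\<Sum>i<n. \<bar>x i\<bar> powr p) / n) powr (1 / p)"
    unfolding 3 using n by simp
  finally show ?thesis .
qed

lemma norm_ratio_nonneg: "0 \<le> norm_ratio p n x"
  by (simp add: norm_ratio_def)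

lemma gg_sets:
  "{x\<in>space (gg_prod p n). a \<le> (\<Sum>i<n. (x i)\<^sup>2)} \<in> sets (gg_prod p n)"
  "{x\<in>space (gg_prod p n). (\<Sum>i<n. (x i)\<^sup>2) \<le> a} \<in> sets (gg_prod p n)"
  "{x\<in>space (gg_prod p n). \<bar>(\<Sum>i<n. (x i)\<^sup>2) - a\<bar> < b} \<in> sets (gg_prod p n)"
  "{x\<in>space (gg_prod p n). a \<le> (\<Sum>i<n. \<bar>x i\<bar> powr p)} \<in> sets (gg_prod p n)"
  "{x\<in>space (gg_prod p n). (\<Sum>i<n. \<bar>x i\<bar> powr p) \<le> a} \<in> sets (gg_prod p n)"
  by measurable

lemma gg_prod_lp_norm_measurable: "lp_norm n q \<in> borel_measurable (gg_prod p n)"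
  using measurable_leb_lp_norm[of n q] by (simp cong: measurable_cong_sets)

lemma norm_ratio_measurable: "norm_ratio p n \<in> borel_measurable (gg_prod p n)"
  unfolding norm_ratio_def[abs_def]
  by (intro borel_measurable_times borel_measurable_divide borel_measurable_const gg_prod_lp_norm_measurable)

lemma norm_ratio_sets: "B \<in> sets borel \<Longrightarrow> {x\<in>space (gg_prod p n). norm_ratio p n x \<in> B} \<in> sets (gg_prod p n)"
  using measurable_sets[OF norm_ratio_measurable, of B p n] by (simp add: vimage_def Int_def conj_commute)

lemma gprob_ratio_upper:
  assumes p: "0 < p" and n: "1 \<le> n" and e: "0 < e" "e < 1" and y: "0 < y" and a: "b \<le> y\<^sup>2 * (1 - e) powr (2 / p)"
  shows "gprob p n (\<lambda>x. norm_ratio p n x \<in> {y..}) \<le>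
    gprob p n (\<lambda>x. (\<Sum>i<n. \<bar>x i\<bar> powr p) \<le> real n * (1 - e)) + gprob p n (\<lambda>x. real n * b \<le> (\<Sum>i<n. (x i)\<^sup>2))"
proof -
  interpret P: prob_space "gg_prod p n" by (rule prob_space_gg_prod[OF p])
  let ?A = "{x\<in>space (gg_prod p n). (\<Sum>i<n. \<bar>x i\<bar> powr p) \<le> real n * (1 - e)}"
  let ?B = "{x\<in>space (gg_prod p n). real n * b \<le> (\<Sum>i<n. (x i)\<^sup>2)}"
  have sub: "{x\<in>space (gg_prod p n). norm_ratio p n x \<in> {y..}} \<subseteq> ?A \<union> ?B"
  proof
    fix x assume x: "x \<in> {x\<in>space (gg_prod p n). norm_ratio p n x \<in> {y..}}"
    define s where "s = (\<Sum>i<n. (x i)\<^sup>2) / n"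
    define t where "t = (\<Sum>i<n. \<bar>x i\<bar> powr p) / n"
    have s0: "0 \<le> s" by (simp add: s_def sum_nonneg)
    show "x \<in> ?A \<union> ?B"
    proof (cases "t \<le> 1 - e")
      case True then show ?thesis using x n by (simp add: t_def field_simps)
    next
      case False
      then have t: "1 - e < t" "0 < t" using e by auto
      have "y \<le> sqrt s / t powr (1 / p)" using x norm_ratio_eq[OF p n, of x] by (simp add: s_def t_def)
      then have "y * t powr (1 / p) \<le> sqrt s" using t by (simp add: field_simps)
      moreover have "y * (1 - e) powr (1 / p) \<le> y * t powr (1 / p)" using y t e p by (intro mult_left_mono powr_mono2) auto
      ultimately have "y * (1 - e) powr (1 / p) \<le> sqrt s" by linarith
      then have "(y * (1 - e) powr (1 / p))\<^sup>2 \<le> (sqrt s)\<^sup>2" using y by (intro power_mono) auto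
      moreover have "(y * (1 - e) powr (1 / p))\<^sup>2 = y\<^sup>2 * (1 - e) powr (2 / p)"
        by (simp add: power_mult_distrib power2_eq_square[of "_ powr _"] powr_add[symmetric])
      ultimately have "b \<le> s" using a s0 by simp
      then show ?thesis using x n by (simp add: s_def field_simps)
    qed
  qed
  have "gprob p n (\<lambda>x. norm_ratio p n x \<in> {y..}) \<le> measure (gg_prod p n) (?A \<union> ?B)"
    by (rule P.finite_measure_mono[OF sub sets.Un[OF gg_sets(5) gg_sets(1)]])
  also have "\<dots> \<le> measure (gg_prod p n) ?A + measure (gg_prod p n) ?B" by (rule measure_Un_le[OF gg_sets(5) gg_sets(1)])
  finally show ?thesis .
qed

lemma gprob_ratio_lower:
  assumes p: "0 < p" and n: "1 \<le> n" and e: "0 < e" and y: "0 \<le> y" and a: "y\<^sup>2 * (1 + e) powr (2 / p) \<le> b"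
  shows "gprob p n (\<lambda>x. norm_ratio p n x \<in> {..y}) \<le>
    gprob p n (\<lambda>x. real n * (1 + e) \<le> (\<Sum>i<n. \<bar>x i\<bar> powr p)) + gprob p n (\<lambda>x. (\<Sum>i<n. (x i)\<^sup>2) \<le> real n * b)"
proof -
  interpret P: prob_space "gg_prod p n" by (rule prob_space_gg_prod[OF p])
  let ?A = "{x\<in>space (gg_prod p n). real n * (1 + e) \<le> (\<Sum>i<n. \<bar>x i\<bar> powr p)}"
  let ?B = "{x\<in>space (gg_prod p n). (\<Sum>i<n. (x i)\<^sup>2) \<le> real n * b}"
  have sub: "{x\<in>space (gg_prod p n). norm_ratio p n x \<in> {..y}} \<subseteq> ?A \<union> ?B"
  proof
    fix x assume x: "x \<in> {x\<in>space (gg_prod p n). norm_ratio p n x \<in> {..y}}"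
    define s where "s = (\<Sum>i<n. (x i)\<^sup>2) / n"
    define t where "t = (\<Sum>i<n. \<bar>x i\<bar> powr p) / n"
    have s0: "0 \<le> s" and t0: "0 \<le> t" by (simp_all add: s_def t_def sum_nonneg)
    show "x \<in> ?A \<union> ?B"
    proof (cases "1 + e \<le> t")
      case True then show ?thesis using x n by (simp add: t_def field_simps)
    next
      case False
      have "sqrt s \<le> y * t powr (1 / p)"
      proof (cases "t = 0")
        case True
        then have "(\<Sum>i<n. \<bar>x i\<bar> powr p) = 0" using n by (simp add: t_def)
        then have "\<forall>i<n. x i = 0" by (subst (asm) sum_nonneg_eq_0_iff) auto
        then have "s = 0" by (simp add: s_def)
        then show ?thesis using y by simp
      next
        case False
        have "sqrt s / t powr (1 / p) \<le> y" using x norm_ratio_eq[OF p n, of x] by (simp add: s_def t_def)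
        then show ?thesis using False t0 by (simp add: field_simps)
      qed
      also have "\<dots> \<le> y * (1 + e) powr (1 / p)" using y t0 False p by (intro mult_left_mono powr_mono2) auto
      finally have "(sqrt s)\<^sup>2 \<le> (y * (1 + e) powr (1 / p))\<^sup>2" using s0 by (intro power_mono) auto
      moreover have "(y * (1 + e) powr (1 / p))\<^sup>2 = y\<^sup>2 * (1 + e) powr (2 / p)"
        by (simp add: power_mult_distrib power2_eq_square[of "_ powr _"] powr_add[symmetric])
      ultimately have "s \<le> b" using a s0 by simp
      then show ?thesis using x n by (simp add: s_def field_simps)
    qed
  qed
  have "gprob p n (\<lambda>x. norm_ratio p n x \<in> {..y}) \<le> measure (gg_prod p n) (?A \<union> ?B)"
    by (rule P.finite_measure_mono[OF sub sets.Un[OF gg_sets(4) gg_sets(2)]])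
  also have "\<dots> \<le> measure (gg_prod p n) ?A + measure (gg_prod p n) ?B" by (rule measure_Un_le[OF gg_sets(4) gg_sets(2)])
  finally show ?thesis .
qed

text \<open>
  By continuity of \<open>(s, t) \<mapsto> \<surd>s / t^(1/p)\<close> at \<open>(y\<^sup>2, 1)\<close>.
\<close>

lemma gprob_ratio_local:
  assumes p: "0 < p" and y: "0 < y" and d: "0 < d"
  obtains a e where "0 < a" "0 < e" "\<And>n. 1 \<le> n \<Longrightarrow>
    gprob p n (\<lambda>x. \<bar>(\<Sum>i<n. (x i)\<^sup>2) - real n * y\<^sup>2\<bar> < real n * a) -
      (gprob p n (\<lambda>x. (\<Sum>i<n. \<bar>x i\<bar> powr p) \<le> real n * (1 - e)) + gprob p n (\<lambda>x. real n * (1 + e) \<le> (\<Sum>i<n. \<bar>x i\<bar> powr p)))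
    \<le> gprob p n (\<lambda>x. norm_ratio p n x \<in> ball y d)"
proof -
  have 1: "((\<lambda>z. fst z) \<longlongrightarrow> fst (y\<^sup>2, 1::real)) (nhds (y\<^sup>2, 1::real))" by (rule tendsto_fst[OF filterlim_ident])
  have 2: "((\<lambda>z. snd z) \<longlongrightarrow> snd (y\<^sup>2, 1::real)) (nhds (y\<^sup>2, 1::real))" by (rule tendsto_snd[OF filterlim_ident])
  have "((\<lambda>z. sqrt (fst z) / snd z powr (1 / p)) \<longlongrightarrow> sqrt (fst (y\<^sup>2, 1::real)) / snd (y\<^sup>2, 1::real) powr (1 / p)) (nhds (y\<^sup>2, 1::real))"
    by (rule tendsto_divide[OF tendsto_real_sqrt[OF 1] tendsto_powr[OF 2 tendsto_const]]) auto
  then have "((\<lambda>z. sqrt (fst z) / snd z powr (1 / p)) \<longlongrightarrow> y) (nhds (y\<^sup>2, 1::real))" using y by simp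
  then have "\<forall>\<^sub>F z in nhds (y\<^sup>2, 1::real). dist (sqrt (fst z) / snd z powr (1 / p)) y < d" using d by (rule tendstoD)
  then obtain P Q where PQ: "eventually P (nhds (y\<^sup>2))" "eventually Q (nhds (1::real))"
     "\<And>s t. P s \<Longrightarrow> Q t \<Longrightarrow> dist (sqrt s / t powr (1 / p)) y < d"
    unfolding nhds_prod eventually_prod_filter by auto
  then obtain a e where ae: "0 < a" "0 < e" "\<And>s. \<bar>s - y\<^sup>2\<bar> < a \<Longrightarrow> P s" "\<And>t. \<bar>t - 1\<bar> < e \<Longrightarrow> Q t"
    unfolding eventually_nhds_metric by (auto simp: dist_real_def)
  show thesis
  proof (rule that[OF ae(1,2)])
    fix n :: nat assume n: "1 \<le> n"
    interpret G: prob_space "gg_prod p n" by (rule prob_space_gg_prod[OF p])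
    let ?A = "{x\<in>space (gg_prod p n). \<bar>(\<Sum>i<n. (x i)\<^sup>2) - real n * y\<^sup>2\<bar> < real n * a}"
    let ?B = "{x\<in>space (gg_prod p n). (\<Sum>i<n. \<bar>x i\<bar> powr p) \<le> real n * (1 - e)}"
    let ?C = "{x\<in>space (gg_prod p n). real n * (1 + e) \<le> (\<Sum>i<n. \<bar>x i\<bar> powr p)}"
    let ?L = "{x\<in>space (gg_prod p n). norm_ratio p n x \<in> ball y d}"
    have L: "?L \<in> sets (gg_prod p n)" by (rule norm_ratio_sets) simp
    have sub: "?A \<subseteq> ?L \<union> (?B \<union> ?C)"
    proof (rule subsetI, rule ccontr)
      fix x assume x: "x \<in> ?A" and nx: "x \<notin> ?L \<union> (?B \<union> ?C)"
      have n0: "0 < real n" using n by simp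
      have "\<bar>(\<Sum>i<n. (x i)\<^sup>2) / n - y\<^sup>2\<bar> = \<bar>(\<Sum>i<n. (x i)\<^sup>2) - real n * y\<^sup>2\<bar> / n" using n0 by (simp add: field_simps)
      also have "\<dots> < a" using x n0 by (simp add: field_simps)
      finally have 1: "P ((\<Sum>i<n. (x i)\<^sup>2) / n)" by (rule ae(3))
      have "real n * (1 - e) < (\<Sum>i<n. \<bar>x i\<bar> powr p)" "(\<Sum>i<n. \<bar>x i\<bar> powr p) < real n * (1 + e)" using x nx by auto
      then have "\<bar>(\<Sum>i<n. \<bar>x i\<bar> powr p) / n - 1\<bar> < e" using n0 by (simp add: abs_less_iff field_simps)
      then have 2: "Q ((\<Sum>i<n. \<bar>x i\<bar> powr p) / n)" by (rule ae(4))
      have "dist (norm_ratio p n x) y < d" unfolding norm_ratio_eq[OF p n] by (rule PQ(3)[OF 1 2])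
      then show False using x nx by (simp add: dist_commute)
    qed
    have "measure (gg_prod p n) ?A \<le> measure (gg_prod p n) (?L \<union> (?B \<union> ?C))"
      by (rule G.finite_measure_mono[OF sub sets.Un[OF L sets.Un[OF gg_sets(5) gg_sets(4)]]])
    also have "\<dots> \<le> measure (gg_prod p n) ?L + measure (gg_prod p n) (?B \<union> ?C)"
      by (rule measure_Un_le[OF L sets.Un[OF gg_sets(5) gg_sets(4)]])
    also have "measure (gg_prod p n) (?B \<union> ?C) \<le> measure (gg_prod p n) ?B + measure (gg_prod p n) ?C"
      by (rule measure_Un_le[OF gg_sets(5) gg_sets(4)])
    finally show "measure (gg_prod p n) ?A - (measure (gg_prod p n) ?B + measure (gg_prod p n) ?C) \<le> measure (gg_prod p n) ?L" by simp
  qed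
qed

text \<open>
  At such a speed, events that are exponentially unlikely at speed \<open>n\<close> can be ignored.
\<close>

definition slow_speed :: "(nat \<Rightarrow> real) \<Rightarrow> bool" where
  "slow_speed s \<longleftrightarrow> filterlim s at_top sequentially \<and> filterlim (\<lambda>n. real n / s n) at_top sequentially"

lemma slow_speed_pos: "slow_speed s \<Longrightarrow> \<forall>\<^sub>F n in sequentially. 0 < s n"
  unfolding slow_speed_def filterlim_at_top_dense by blast

lemma slow_speed_ub:
  assumes "slow_speed s" "\<exists>c>0. \<forall>n. P n \<le> exp (- c * real n)"
  shows "exp_ub s P d"
proof -
  obtain c where c: "0 < c" "\<forall>n. P n \<le> exp (- c * real n)" using assms(2) by blast
  show ?thesis
    by (rule exp_ub_any[OF exp_ub_of_le[OF c(2)] c(1)]) (use assms(1) slow_speed_pos[OF assms(1)] in \<open>auto simp: slow_speed_def\<close>)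
qed

lemma ratio_upper_ub:
  assumes p: "1 \<le> p" and s: "slow_speed s" and y: "0 < y" and a: "b < y\<^sup>2"
    and ub: "exp_ub s (\<lambda>n. gprob p n (\<lambda>x. real n * b \<le> (\<Sum>i<n. (x i)\<^sup>2))) c"
  shows "exp_ub s (\<lambda>n. gprob p n (\<lambda>x. norm_ratio p n x \<in> {y..})) c"
proof -
  have "((\<lambda>e. y\<^sup>2 * (1 - e) powr (2 / p)) \<longlongrightarrow> y\<^sup>2 * (1 - 0) powr (2 / p)) (at_right (0::real))"
    by (intro tendsto_intros) auto
  then have "\<forall>\<^sub>F e in at_right 0. b < y\<^sup>2 * (1 - e) powr (2 / p)" by (rule order_tendstoD(1)) (use a in simp)
  moreover have "\<forall>\<^sub>F e in at_right (0::real). 0 < e \<and> e < 1" using eventually_at_right_real[of 0 "1::real"] by (auto elim: eventually_mono)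
  ultimately have "\<forall>\<^sub>F e in at_right 0. b < y\<^sup>2 * (1 - e) powr (2 / p) \<and> 0 < e \<and> e < 1" by eventually_elim auto
  then obtain e where e: "b < y\<^sup>2 * (1 - e) powr (2 / p)" "0 < e" "e < 1"
    using eventually_happens[of _ "at_right (0::real)"] by (metis (lifting) trivial_limit_at_right_real)
  have sl: "filterlim s at_top sequentially" using s by (simp add: slow_speed_def)
  have 1: "exp_ub s (\<lambda>n. gprob p n (\<lambda>x. (\<Sum>i<n. \<bar>x i\<bar> powr p) \<le> real n * (1 - e))) c"
    by (rule slow_speed_ub[OF s gg_power_lower[OF p e(2)]])
  show ?thesis
  proof (rule exp_ub_mono[OF exp_ub_add[OF 1 ub sl] order_refl])
    show "\<forall>\<^sub>F n in sequentially. gprob p n (\<lambda>x. norm_ratio p n x \<in> {y..}) \<le>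
      gprob p n (\<lambda>x. (\<Sum>i<n. \<bar>x i\<bar> powr p) \<le> real n * (1 - e)) + gprob p n (\<lambda>x. real n * b \<le> (\<Sum>i<n. (x i)\<^sup>2))"
      using eventually_ge_at_top[of "1::nat"]
      by eventually_elim (rule gprob_ratio_upper[OF _ _ e(2,3) y less_imp_le[OF e(1)]]; use p in simp)
  qed
qed

lemma ratio_lower_ub:
  assumes p: "1 \<le> p" and s: "slow_speed s" and y: "0 \<le> y" "y < sqrt (M2 p)"
  shows "exp_ub s (\<lambda>n. gprob p n (\<lambda>x. norm_ratio p n x \<in> {..y})) c"
proof -
  have p0: "0 < p" using p by simp
  have "y\<^sup>2 < (sqrt (M2 p))\<^sup>2" using y by (intro power_strict_mono) auto
  then have ym: "y\<^sup>2 < M2 p" using M2_pos[OF p0] by simp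
  then obtain b where b: "y\<^sup>2 < b" "b < M2 p" using dense by blast
  have "((\<lambda>e. y\<^sup>2 * (1 + e) powr (2 / p)) \<longlongrightarrow> y\<^sup>2 * (1 + 0) powr (2 / p)) (at_right (0::real))"
    by (intro tendsto_intros) auto
  then have "\<forall>\<^sub>F e in at_right 0. y\<^sup>2 * (1 + e) powr (2 / p) < b" by (rule order_tendstoD(2)) (use b in simp)
  moreover have "\<forall>\<^sub>F e in at_right (0::real). 0 < e" by (simp add: eventually_at_right_less)
  ultimately have "\<forall>\<^sub>F e in at_right 0. y\<^sup>2 * (1 + e) powr (2 / p) < b \<and> 0 < e" by eventually_elim auto
  then obtain e where e: "y\<^sup>2 * (1 + e) powr (2 / p) < b" "0 < e"
    using eventually_happens[of _ "at_right (0::real)"] by (metis (lifting) trivial_limit_at_right_real)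
  have sl: "filterlim s at_top sequentially" using s by (simp add: slow_speed_def)
  have 1: "exp_ub s (\<lambda>n. gprob p n (\<lambda>x. real n * (1 + e) \<le> (\<Sum>i<n. \<bar>x i\<bar> powr p))) c"
    by (rule slow_speed_ub[OF s gg_power_upper[OF p e(2)]])
  have "0 < M2 p - b" using b by simp
  from slow_speed_ub[OF s gg_square_lower[OF p0 this]]
  have 2: "exp_ub s (\<lambda>n. gprob p n (\<lambda>x. (\<Sum>i<n. (x i)\<^sup>2) \<le> real n * b)) c" by simp
  show ?thesis
  proof (rule exp_ub_mono[OF exp_ub_add[OF 1 2 sl] order_refl])
    show "\<forall>\<^sub>F n in sequentially. gprob p n (\<lambda>x. norm_ratio p n x \<in> {..y}) \<le>
      gprob p n (\<lambda>x. real n * (1 + e) \<le> (\<Sum>i<n. \<bar>x i\<bar> powr p)) + gprob p n (\<lambda>x. (\<Sum>i<n. (x i)\<^sup>2) \<le> real n * b)"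
      using eventually_ge_at_top[of "1::nat"]
      by eventually_elim (rule gprob_ratio_lower[OF p0 _ e(2) y(1) less_imp_le[OF e(1)]])
  qed
qed

lemma ratio_local_lb:
  assumes p: "1 \<le> p" and s: "slow_speed s" and y: "0 < y" and d: "0 < d" and c: "c < \<infinity>"
    and lb: "\<And>a. 0 < a \<Longrightarrow> exp_lb s (\<lambda>n. gprob p n (\<lambda>x. \<bar>(\<Sum>i<n. (x i)\<^sup>2) - real n * y\<^sup>2\<bar> < real n * a)) c"
  shows "exp_lb s (\<lambda>n. gprob p n (\<lambda>x. norm_ratio p n x \<in> ball y d)) c"
proof -
  have p0: "0 < p" using p by simp
  obtain a e where ae: "0 < a" "0 < e" "\<And>n. 1 \<le> n \<Longrightarrow>
    gprob p n (\<lambda>x. \<bar>(\<Sum>i<n. (x i)\<^sup>2) - real n * y\<^sup>2\<bar> < real n * a) -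
      (gprob p n (\<lambda>x. (\<Sum>i<n. \<bar>x i\<bar> powr p) \<le> real n * (1 - e)) + gprob p n (\<lambda>x. real n * (1 + e) \<le> (\<Sum>i<n. \<bar>x i\<bar> powr p)))
    \<le> gprob p n (\<lambda>x. norm_ratio p n x \<in> ball y d)"
    using gprob_ratio_local[OF p0 y d] by blast
  have sl: "filterlim s at_top sequentially" using s by (simp add: slow_speed_def)
  have ub: "exp_ub s (\<lambda>n. gprob p n (\<lambda>x. (\<Sum>i<n. \<bar>x i\<bar> powr p) \<le> real n * (1 - e)) + gprob p n (\<lambda>x. real n * (1 + e) \<le> (\<Sum>i<n. \<bar>x i\<bar> powr p))) \<infinity>"
    by (rule exp_ub_add[OF slow_speed_ub[OF s gg_power_lower[OF p ae(2)]] slow_speed_ub[OF s gg_power_upper[OF p ae(2)]] sl])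
  show ?thesis
    by (rule exp_lb_mono[OF exp_lb_diff[OF lb[OF ae(1)] ub c sl] order_refl])
       (use ae(3) in \<open>auto simp: eventually_sequentially\<close>)
qed

lemma norm_ratio_zero_null:
  assumes p: "0 < p" and n: "1 \<le> n"
  shows "gprob p n (\<lambda>x. norm_ratio p n x \<in> {0}) = 0"
proof -
  interpret G: prob_space "gg_prod p n" by (rule prob_space_gg_prod[OF p])
  have "AE x in leb n. x \<notin> {x\<in>space (leb n). lp_norm n p x \<le> 0}" by (rule AE_not_in[OF leb_norm_zero[OF p n]])
  then have "AE x in gg_prod p n. x \<notin> {x\<in>space (leb n). lp_norm n p x \<le> 0}"
    unfolding gg_prod_density[OF p] by (subst AE_density) auto
  with AE_space have "AE x in gg_prod p n. x \<notin> {x\<in>space (gg_prod p n). norm_ratio p n x \<in> {0}}"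
  proof eventually_elim
    case (elim x)
    have "lp_norm n p x \<noteq> 0" using elim lp_norm_nonneg[of n p x] by (auto simp: space_PiM)
    then have "lp_norm n 2 x \<noteq> 0" using lp_norm_eq_0_iff[OF p, of n x] lp_norm_eq_0_iff[of 2 n x] by simp
    then show ?case using \<open>lp_norm n p x \<noteq> 0\<close> n by (simp add: norm_ratio_def)
  qed
  then show ?thesis using norm_ratio_sets[of "{0}" n p] by (subst G.prob_eq_0) auto
qed

section \<open>The two factors of the projected norm\<close>

lemma scale_preimage_borel: "B \<in> sets borel \<Longrightarrow> {t::real. c * t \<in> B} \<in> sets borel"
  using measurable_sets[of "\<lambda>x. c * x" borel borel B] by (simp add: vimage_def)

locale projected_point =
  fixes p :: real and k :: "nat \<Rightarrow> nat" and W :: "nat \<Rightarrow> real measure"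
    and M :: "nat \<Rightarrow> 'a measure"
    and X :: "nat \<Rightarrow> 'a \<Rightarrow> (nat \<Rightarrow> real)" and E :: "nat \<Rightarrow> 'a \<Rightarrow> (nat \<Rightarrow> real) set"
  assumes p: "1 \<le> p"
    and k1: "\<And>n. n \<ge> 1 \<Longrightarrow> 1 \<le> k n"
    and k_lim: "filterlim (\<lambda>n. real (k n)) at_top sequentially"
    and k_small: "filterlim (\<lambda>n. real n / real (k n)) at_top sequentially"
    and W: "\<And>n. n \<ge> 1 \<Longrightarrow> prob_space (W n)" "\<And>n. n \<ge> 1 \<Longrightarrow> sets (W n) = sets borel" "\<And>n. n \<ge> 1 \<Longrightarrow> emeasure (W n) {0..} = 1"
    and W_tail: "\<And>\<eta>. 0 < \<eta> \<Longrightarrow> \<exists>c>0. exp_ub (\<lambda>n. real n) (\<lambda>n. measure (W n) {\<eta> * real n<..}) (ereal c)"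
    and M: "\<And>n. n \<ge> 1 \<Longrightarrow> prob_space (M n)"
    and X: "\<And>n. n \<ge> 1 \<Longrightarrow> X n \<in> measurable (M n) (Rn_borel n)"
    and X_distr: "\<And>n. n \<ge> 1 \<Longrightarrow> distr (M n) (Rn_borel n) (X n) = P_W (W n) n p"
    and E: "\<And>n. n \<ge> 1 \<Longrightarrow> E n \<in> measurable (M n) (grassmannian_borel n (k n))"
    and E_haar: "\<And>n. n \<ge> 1 \<Longrightarrow> haar_grassmannian n (k n) (distr (M n) (grassmannian_borel n (k n)) (E n))"
    and indep: "\<And>n. n \<ge> 1 \<Longrightarrow> prob_space.indep_set (M n)
      (sets (vimage_algebra (space (M n)) (X n) (Rn_borel n)))
      (sets (vimage_algebra (space (M n)) (E n) (grassmannian_borel n (k n))))"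
begin

definition D :: "nat \<Rightarrow> 'a \<Rightarrow> real" where
  "D n w = real n powr (1 / p - 1 / 2) * lp_norm n 2 (X n w)"

definition R :: "nat \<Rightarrow> 'a \<Rightarrow> real" where
  "R n w = sqrt (real n / real (k n)) * (lp_norm n 2 (proj n (E n w) (X n w)) / lp_norm n 2 (X n w))"

definition \<mu> :: "nat \<Rightarrow> (nat \<Rightarrow> real) set measure" where
  "\<mu> n = distr (M n) (grassmannian_borel n (k n)) (E n)"

lemma p_pos: "0 < p" using p by simp

lemma D_nonneg: "0 \<le> D n w" by (simp add: D_def)
lemma R_nonneg: "0 \<le> R n w" by (simp add: R_def)

lemma X_component: "n \<ge> 1 \<Longrightarrow> (\<lambda>w. X n w i) \<in> borel_measurable (M n)"
  using measurable_compose[OF X measurable_Rn_component] .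

lemma D_measurable: "n \<ge> 1 \<Longrightarrow> D n \<in> borel_measurable (M n)"
  unfolding D_def[abs_def]
  by (intro borel_measurable_times borel_measurable_const measurable_lp_norm X_component)

lemma R_measurable: "n \<ge> 1 \<Longrightarrow> R n \<in> borel_measurable (M n)"
  unfolding R_def[abs_def]
  by (intro borel_measurable_times borel_measurable_divide borel_measurable_const measurable_lp_norm
      measurable_norm_proj[OF k1 E] X_component)

text \<open>
  If \<open>X = 0\<close>, both sides vanish, since division by zero gives zero.
\<close>

lemma D_times_R:
  assumes n: "n \<ge> 1" and w: "w \<in> space (M n)"
  shows "real n powr (1 / p) * lp_norm n 2 (proj n (E n w) (X n w)) / sqrt (real (k n)) = D n w * R n w"
proof (cases "lp_norm n 2 (X n w) = 0")
  case True
  have "E n w \<in> grassmannian n (k n)" using measurable_space[OF E[OF n] w] by simp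
  then obtain e where e: "onb n (k n) e (E n w)" using grassmannian_onb k1[OF n] by metis
  have "X n w i = 0" if "i < n" for i using True lp_norm_eq_0_iff[of 2 n "X n w"] that by simp
  then have "Rn_inner n (X n w) (e l) = 0" for l by (simp add: Rn_inner_def)
  then have "lp_norm n 2 (proj n (E n w) (X n w)) = 0" unfolding norm_proj_onb[OF e] by simp
  then show ?thesis using True by (simp add: D_def)
next
  case False
  have kp: "0 < real (k n)" using k1[OF n] by simp
  have "real n powr (1 / p - 1 / 2) * sqrt (real n) = real n powr (1 / p)"
    using n by (simp add: powr_half_sqrt[symmetric] powr_add[symmetric])
  then have "real n powr (1 / p) = real n powr (1 / p - 1 / 2) * sqrt (real n)" ..
  then show ?thesis using False kp by (simp add: D_def R_def real_sqrt_divide)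
qed

lemma P_W_total: "n \<ge> 1 \<Longrightarrow> emeasure (P_W (W n) n p) (Rn n) = 1"
proof -
  assume n: "n \<ge> 1"
  interpret prob_space "distr (M n) (Rn_borel n) (X n)"
    by (rule prob_space.prob_space_distr[OF M[OF n] X[OF n]])
  show ?thesis using emeasure_space_1 unfolding X_distr[OF n, symmetric] by simp
qed

lemma X_prob:
  assumes n: "n \<ge> 1" and S: "S \<in> sets (Rn_borel n)"
  shows "\<P>(w in M n. X n w \<in> S) = measure (P_W (W n) n p) S"
  unfolding X_distr[OF n, symmetric]
  by (subst measure_distr[OF X[OF n] S]) (simp add: vimage_def Int_def conj_commute)

lemma norm_sets: "B \<in> sets borel \<Longrightarrow> {x\<in>Rn n. lp_norm n q x \<in> B} \<in> sets (Rn_borel n)"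
  using measurable_sets[OF measurable_Rn_lp_norm, of B n q] by (simp add: vimage_def Int_def conj_commute)

lemma norm_ratio_Rn_sets: "B \<in> sets borel \<Longrightarrow> {x\<in>Rn n. norm_ratio p n x \<in> B} \<in> sets (Rn_borel n)"
proof -
  assume B: "B \<in> sets borel"
  have "norm_ratio p n \<in> borel_measurable (Rn_borel n)"
    unfolding norm_ratio_def[abs_def]
    by (intro borel_measurable_times borel_measurable_divide borel_measurable_const measurable_Rn_lp_norm)
  from measurable_sets[OF this B] show ?thesis by (simp add: vimage_def Int_def conj_commute)
qed

text \<open>
  The quotient of two norms is homogeneous of degree zero, so the \<open>p\<close>-Gaussian vector may be used in
  place of \<open>X\<close>.
\<close>

lemma ratio_law:
  assumes n: "n \<ge> 1" and B: "B \<in> sets borel"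
  shows "\<P>(w in M n. norm_ratio p n (X n w) \<in> B) = gprob p n (\<lambda>x. norm_ratio p n x \<in> B)"
proof -
  let ?D = "{x\<in>Rn n. norm_ratio p n x \<in> B}"
  have emb: "norm_ratio p n (emb n x) = norm_ratio p n x" for x by (simp add: norm_ratio_def)
  have pre: "{x\<in>space (leb n). emb n x \<in> ?D} = {x\<in>space (gg_prod p n). norm_ratio p n x \<in> B}"
    by (auto simp: emb emb_in_Rn space_PiM)
  have scale: "norm_ratio p n (\<lambda>i. r * x i) = norm_ratio p n x" if "0 < r" for r x
    using that p_pos by (simp add: norm_ratio_def lp_norm_scale)
  have hom: "homogeneous_set n {x\<in>space (leb n). emb n x \<in> ?D}"
    unfolding homogeneous_set_def
  proof (intro conjI allI impI ballI)
    show "{x\<in>space (leb n). emb n x \<in> ?D} \<in> sets (leb n)"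
      using measurable_sets[OF emb_measurable norm_ratio_Rn_sets[OF B]] by (simp add: vimage_def Int_def conj_commute)
    fix r :: real and x assume r: "0 < r" and x: "x \<in> space (leb n)"
    have "norm_ratio p n (dilate n r x) = norm_ratio p n x"
      using r p_pos by (simp add: norm_ratio_def lp_norm_dilate)
    moreover have "dilate n r x \<in> space (leb n)" by (auto simp: dilate_def space_PiM)
    ultimately show "(dilate n r x \<in> {x\<in>space (leb n). emb n x \<in> ?D}) = (x \<in> {x\<in>space (leb n). emb n x \<in> ?D})"
      using x by (simp add: emb emb_in_Rn)
  qed
  have "emeasure (P_W (W n) n p) ?D = emeasure (gg_prod p n) {x\<in>space (leb n). emb n x \<in> ?D}"
  proof (rule P_W_homogeneous[OF p n W[OF n] P_W_total[OF n] norm_ratio_Rn_sets[OF B] hom])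
    fix x :: "nat \<Rightarrow> real" and r :: real assume x: "x \<in> Rn n" "0 < r"
    have "norm_ratio p n (\<lambda>i. (1 / r) * x i) = norm_ratio p n x" by (rule scale) (use x in simp)
    moreover have "(\<lambda>i. x i / r) \<in> Rn n" using x by (simp add: Rn_iff)
    ultimately show "((\<lambda>i. x i / r) \<in> ?D) = (x \<in> ?D)" using x by simp
  qed
  then have "measure (P_W (W n) n p) ?D = gprob p n (\<lambda>x. norm_ratio p n x \<in> B)" unfolding pre by (simp add: measure_def)
  moreover have "{w\<in>space (M n). norm_ratio p n (X n w) \<in> B} = {w\<in>space (M n). X n w \<in> ?D}"
    using measurable_space[OF X[OF n]] by auto
  ultimately show ?thesis using X_prob[OF n norm_ratio_Rn_sets[OF B]] by simp
qed

lemma D_eq_ratio: "D n w = norm_ratio p n (X n w) * lp_norm n p (X n w)"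
proof (cases "lp_norm n p (X n w) = 0")
  case True
  then have "lp_norm n 2 (X n w) = 0" using lp_norm_eq_0_iff[OF p_pos, of n "X n w"] lp_norm_eq_0_iff[of 2 n "X n w"] by simp
  then show ?thesis using True by (simp add: D_def)
qed (simp add: D_def norm_ratio_def)

lemma X_sets:
  assumes n: "n \<ge> 1"
  shows "B \<in> sets borel \<Longrightarrow> {w\<in>space (M n). norm_ratio p n (X n w) \<in> B} \<in> sets (M n)"
    "B \<in> sets borel \<Longrightarrow> {w\<in>space (M n). lp_norm n p (X n w) \<in> B} \<in> sets (M n)"
    "B \<in> sets borel \<Longrightarrow> {w\<in>space (M n). D n w \<in> B} \<in> sets (M n)"
proof -
  have N: "(\<lambda>w. lp_norm n q (X n w)) \<in> borel_measurable (M n)" for q by (intro measurable_lp_norm X_component n)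
  have Q: "(\<lambda>w. norm_ratio p n (X n w)) \<in> borel_measurable (M n)"
    unfolding norm_ratio_def by (intro borel_measurable_times borel_measurable_divide borel_measurable_const N)
  show "B \<in> sets borel \<Longrightarrow> {w\<in>space (M n). norm_ratio p n (X n w) \<in> B} \<in> sets (M n)"
    using measurable_sets[OF Q] by (simp add: vimage_def Int_def conj_commute)
  show "B \<in> sets borel \<Longrightarrow> {w\<in>space (M n). lp_norm n p (X n w) \<in> B} \<in> sets (M n)"
    using measurable_sets[OF N] by (simp add: vimage_def Int_def conj_commute)
  show "B \<in> sets borel \<Longrightarrow> {w\<in>space (M n). D n w \<in> B} \<in> sets (M n)"
    using measurable_sets[OF D_measurable[OF n]] by (simp add: vimage_def Int_def conj_commute)
qed

lemma X_outside_ball: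
  assumes n: "n \<ge> 1"
  shows "\<P>(w in M n. lp_norm n p (X n w) \<in> {1<..}) = 0"
proof -
  have "{w\<in>space (M n). lp_norm n p (X n w) \<in> {1<..}} = {w\<in>space (M n). X n w \<in> {x\<in>Rn n. lp_norm n p x \<in> {1<..}}}"
    using measurable_space[OF X[OF n]] by auto
  also have "measure (M n) \<dots> = measure (P_W (W n) n p) {x\<in>Rn n. lp_norm n p x \<in> {1<..}}"
    by (rule X_prob[OF n norm_sets]) simp
  also have "\<dots> = 0" using P_W_outside_ball[OF p n W[OF n] P_W_total[OF n]] by (simp add: measure_def)
  finally show ?thesis .
qed

text \<open>
  At a slow speed both terms of the bound for the small ball are negligible.
\<close>

lemma X_small_ball:
  assumes s: "slow_speed s" and r0: "0 \<le> r0" "r0 < 1"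
  shows "exp_ub s (\<lambda>n. \<P>(w in M n. lp_norm n p (X n w) \<in> {..r0})) d"
proof -
  define A where "A = 1 - r0 powr p"
  have A: "0 < A" using r0 p powr_less_mono2[of p r0 1] by (auto simp: A_def)
  have "0 < A * exp (- 2)" using A by simp
  from W_tail[OF this] obtain c where c: "0 < c" "exp_ub (\<lambda>n. real n) (\<lambda>n. measure (W n) {A * exp (- 2) * real n<..}) (ereal c)" by blast
  have s': "filterlim (\<lambda>n. real n / s n) at_top sequentially" "filterlim s at_top sequentially" using s by (auto simp: slow_speed_def)
  note pos = slow_speed_pos[OF s]
  have 1: "exp_ub s (\<lambda>n. measure (W n) {A * exp (- 2) * real n<..}) d" by (rule exp_ub_any[OF c(2,1) s'(1) pos])
  have "exp_ub (\<lambda>n. real n) (\<lambda>n. 1 / A * exp (- (real n / p))) (ereal (1 / p))"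
    unfolding exp_ub_def
  proof (intro allI impI)
    fix r assume "ereal r < ereal (1 / p)"
    then have "\<forall>\<^sub>F n in sequentially. 1 / A * exp (- (1 / p) * real n) \<le> exp (- r * real n)"
      using A by (intro exp_gap filterlim_real_sequentially) auto
    then show "\<forall>\<^sub>F n in sequentially. 1 / A * exp (- (real n / p)) \<le> exp (- r * real n)" by simp
  qed
  then have 2: "exp_ub s (\<lambda>n. 1 / A * exp (- (real n / p))) d" by (rule exp_ub_any[OF _ _ s'(1) pos]) (use p in simp)
  show ?thesis
  proof (rule exp_ub_mono[OF exp_ub_add[OF 2 1 s'(2)] order_refl])
    show "\<forall>\<^sub>F n in sequentially. \<P>(w in M n. lp_norm n p (X n w) \<in> {..r0}) \<le>
       1 / A * exp (- (real n / p)) + measure (W n) {A * exp (- 2) * real n<..}"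
      using eventually_ge_at_top[of "1::nat"]
    proof eventually_elim
      case (elim n)
      interpret Wn: prob_space "W n" by (rule W(1)[OF elim])
      interpret Pn: prob_space "P_W (W n) n p"
        unfolding X_distr[OF elim, symmetric] by (rule prob_space.prob_space_distr[OF M[OF elim] X[OF elim]])
      have "{w\<in>space (M n). lp_norm n p (X n w) \<in> {..r0}} = {w\<in>space (M n). X n w \<in> {x\<in>Rn n. lp_norm n p x \<in> {..r0}}}"
        using measurable_space[OF X[OF elim]] by auto
      also have "measure (M n) \<dots> = measure (P_W (W n) n p) {x\<in>Rn n. lp_norm n p x \<in> {..r0}}"
        by (rule X_prob[OF elim norm_sets]) simp
      finally have e: "\<P>(w in M n. lp_norm n p (X n w) \<in> {..r0}) = measure (P_W (W n) n p) {x\<in>Rn n. lp_norm n p x \<in> {..r0}}" .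
      have "ennreal (measure (P_W (W n) n p) {x\<in>Rn n. lp_norm n p x \<in> {..r0}}) \<le>
          ennreal (1 / A * exp (- (real n / p)) + measure (W n) {A * exp (- 2) * real n<..})"
        using P_W_small_ball[OF p elim W[OF elim] P_W_total[OF elim] r0] A
        unfolding A_def[symmetric] Wn.emeasure_eq_measure Pn.emeasure_eq_measure by simp
      then show ?case unfolding e using A by (subst (asm) ennreal_le_iff) auto
    qed
  qed
qed

lemma D_ub_upper:
  assumes s: "slow_speed s" and y: "0 < y" and ub: "exp_ub s (\<lambda>n. gprob p n (\<lambda>x. norm_ratio p n x \<in> {y..})) c"
  shows "exp_ub s (\<lambda>n. \<P>(w in M n. D n w \<in> {y..})) c"
proof (rule exp_ub_mono[OF ub order_refl])
  show "\<forall>\<^sub>F n in sequentially. \<P>(w in M n. D n w \<in> {y..}) \<le> gprob p n (\<lambda>x. norm_ratio p n x \<in> {y..})"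
    using eventually_ge_at_top[of "1::nat"]
  proof eventually_elim
    case (elim n)
    interpret prob_space "M n" by (rule M[OF elim])
    let ?A = "{w\<in>space (M n). norm_ratio p n (X n w) \<in> {y..}}" and ?B = "{w\<in>space (M n). lp_norm n p (X n w) \<in> {1<..}}"
    have mA: "?A \<in> sets (M n)" and mB: "?B \<in> sets (M n)" by (rule X_sets[OF elim]; simp)+
    have sub: "{w\<in>space (M n). D n w \<in> {y..}} \<subseteq> ?A \<union> ?B"
    proof (rule subsetI, rule ccontr)
      fix w assume w: "w \<in> {w\<in>space (M n). D n w \<in> {y..}}" and nw: "w \<notin> ?A \<union> ?B"
      have "norm_ratio p n (X n w) * lp_norm n p (X n w) \<le> norm_ratio p n (X n w) * 1"
        using w nw by (intro mult_left_mono norm_ratio_nonneg) auto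
      then show False using w nw by (simp add: D_eq_ratio)
    qed
    have "\<P>(w in M n. D n w \<in> {y..}) \<le> measure (M n) (?A \<union> ?B)"
      by (rule finite_measure_mono[OF sub sets.Un[OF mA mB]])
    also have "\<dots> \<le> measure (M n) ?A + measure (M n) ?B" by (rule measure_Un_le[OF mA mB])
    finally show ?case using X_outside_ball[OF elim] ratio_law[OF elim, of "{y..}"] by simp
  qed
qed

text \<open>
  \<open>D\<close> is the norm ratio times \<open>\<parallel>X\<parallel>\<^sub>p\<close>, which is close to one. So if \<open>D\<close> is below \<open>y < m\<close>, then the norm
  ratio is below a slightly larger number that is still less than \<open>m\<close>, or \<open>\<parallel>X\<parallel>\<^sub>p\<close> is bounded away from
  one.
\<close>

lemma D_ub_lower:
  assumes s: "slow_speed s" and y: "y < sqrt (M2 p)"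
  shows "exp_ub s (\<lambda>n. \<P>(w in M n. D n w \<in> {..y})) c"
proof -
  define m where "m = sqrt (M2 p)"
  have m: "0 < m" using M2_pos[OF p_pos] by (simp add: m_def)
  define z where "z = max y (m / 2)"
  have "0 < m / 2" "m / 2 < m" "y < m" using m y by (simp_all add: m_def)
  then have z: "0 < z" "z < m" "y \<le> z" by (simp_all add: z_def less_max_iff_disj)
  have "z / m < 1" using z m by simp
  then obtain r0 where r0: "z / m < r0" "r0 < 1" using dense by blast
  have r0p: "0 < r0" using z m r0(1) by (meson divide_pos_pos less_trans)
  have zr: "0 \<le> z / r0" "z / r0 < m" using r0 r0p z m by (auto simp: field_simps)
  have sl: "filterlim s at_top sequentially" using s by (simp add: slow_speed_def)
  have 1: "exp_ub s (\<lambda>n. gprob p n (\<lambda>x. norm_ratio p n x \<in> {..z / r0})) c"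
    by (rule ratio_lower_ub[OF p s]) (use zr in \<open>auto simp: m_def\<close>)
  have 2: "exp_ub s (\<lambda>n. \<P>(w in M n. lp_norm n p (X n w) \<in> {..r0})) c"
    by (rule X_small_ball[OF s]) (use r0 r0p in auto)
  show ?thesis
  proof (rule exp_ub_mono[OF exp_ub_add[OF 1 2 sl] order_refl])
    show "\<forall>\<^sub>F n in sequentially. \<P>(w in M n. D n w \<in> {..y}) \<le>
       gprob p n (\<lambda>x. norm_ratio p n x \<in> {..z / r0}) + \<P>(w in M n. lp_norm n p (X n w) \<in> {..r0})"
      using eventually_ge_at_top[of "1::nat"]
    proof eventually_elim
      case (elim n)
      interpret prob_space "M n" by (rule M[OF elim])
      let ?A = "{w\<in>space (M n). norm_ratio p n (X n w) \<in> {..z / r0}}" and ?B = "{w\<in>space (M n). lp_norm n p (X n w) \<in> {..r0}}"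
      have mA: "?A \<in> sets (M n)" and mB: "?B \<in> sets (M n)" by (rule X_sets[OF elim]; simp)+
      have sub: "{w\<in>space (M n). D n w \<in> {..y}} \<subseteq> ?A \<union> ?B"
      proof (rule subsetI, rule ccontr)
        fix w assume w: "w \<in> {w\<in>space (M n). D n w \<in> {..y}}" and nw: "w \<notin> ?A \<union> ?B"
        have "z / r0 * r0 < norm_ratio p n (X n w) * r0" using w nw r0p by (intro mult_strict_right_mono) auto
        also have "\<dots> \<le> norm_ratio p n (X n w) * lp_norm n p (X n w)"
          using w nw by (intro mult_left_mono norm_ratio_nonneg) auto
        finally have "z < D n w" using r0p by (simp add: D_eq_ratio)
        then show False using w z by simp
      qed
      have "\<P>(w in M n. D n w \<in> {..y}) \<le> measure (M n) (?A \<union> ?B)"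
        by (rule finite_measure_mono[OF sub sets.Un[OF mA mB]])
      also have "\<dots> \<le> measure (M n) ?A + measure (M n) ?B" by (rule measure_Un_le[OF mA mB])
      finally show ?case using ratio_law[OF elim, of "{..z / r0}"] by simp
    qed
  qed
qed

text \<open>
  Near \<open>y\<close> the norm ratio and \<open>D\<close> differ little, unless \<open>\<parallel>X\<parallel>\<^sub>p\<close> is bounded away from one, which is
  negligible.
\<close>

lemma D_lb:
  assumes s: "slow_speed s" and y: "0 < y" and c: "c < \<infinity>" and d: "0 < d"
    and lb: "\<And>a. 0 < a \<Longrightarrow> exp_lb s (\<lambda>n. gprob p n (\<lambda>x. \<bar>(\<Sum>i<n. (x i)\<^sup>2) - real n * y\<^sup>2\<bar> < real n * a)) c"
  shows "exp_lb s (\<lambda>n. \<P>(w in M n. D n w \<in> ball y d)) c"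
proof -
  define h where "h = d / 2"
  have h: "0 < h" "h + h = d" using d by (simp_all add: h_def)
  \<comment> \<open>Multiplying a nonnegative number below \<open>y + h\<close> by a factor in \<open>(r0, 1]\<close> moves it by at most \<open>h\<close>.\<close>
  define r0 where "r0 = 1 - h / (y + h)"
  have r0: "0 \<le> r0" "r0 < 1" using h y by (auto simp: r0_def field_simps)
  have r0h: "(1 - r0) * (y + h) = h" using h y by (simp add: r0_def)
  have sl: "filterlim s at_top sequentially" using s by (simp add: slow_speed_def)
  have 1: "exp_lb s (\<lambda>n. gprob p n (\<lambda>x. norm_ratio p n x \<in> ball y h)) c"
    by (rule ratio_local_lb[OF p s y h(1) c lb])
  have 2: "exp_ub s (\<lambda>n. \<P>(w in M n. lp_norm n p (X n w) \<in> {..r0})) \<infinity>"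
    by (rule X_small_ball[OF s r0])
  show ?thesis
  proof (rule exp_lb_mono[OF exp_lb_diff[OF 1 2 c sl] order_refl])
    show "\<forall>\<^sub>F n in sequentially. gprob p n (\<lambda>x. norm_ratio p n x \<in> ball y h) - \<P>(w in M n. lp_norm n p (X n w) \<in> {..r0})
        \<le> \<P>(w in M n. D n w \<in> ball y d)"
      using eventually_ge_at_top[of "1::nat"]
    proof eventually_elim
      case (elim n)
      interpret prob_space "M n" by (rule M[OF elim])
      let ?A = "{w\<in>space (M n). norm_ratio p n (X n w) \<in> ball y h}" and ?B = "{w\<in>space (M n). lp_norm n p (X n w) \<in> {..r0}}"
      let ?C = "{w\<in>space (M n). lp_norm n p (X n w) \<in> {1<..}}" and ?L = "{w\<in>space (M n). D n w \<in> ball y d}"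
      have mL: "?L \<in> sets (M n)" and mB: "?B \<in> sets (M n)" and mC: "?C \<in> sets (M n)" by (rule X_sets[OF elim]; simp)+
      have sub: "?A \<subseteq> ?L \<union> (?B \<union> ?C)"
      proof (rule subsetI, rule ccontr)
        fix w assume w: "w \<in> ?A" and nw: "w \<notin> ?L \<union> (?B \<union> ?C)"
        define q where "q = norm_ratio p n (X n w)"
        define l where "l = lp_norm n p (X n w)"
        have q: "0 \<le> q" "y - h < q" "q < y + h" using w norm_ratio_nonneg by (auto simp: q_def dist_real_def)
        have l: "r0 < l" "l \<le> 1" using w nw by (auto simp: l_def)
        have "q * l \<le> q * 1" using q l by (intro mult_left_mono) auto
        moreover have "q * (1 - l) \<le> (y + h) * (1 - r0)" using q l r0 by (intro mult_mono) auto
        then have "q - q * l \<le> h" using r0h by (simp add: algebra_simps)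
        ultimately have "\<bar>y - q * l\<bar> < d" using q h by (simp add: abs_less_iff)
        then have "w \<in> ?L" using w by (simp add: D_eq_ratio q_def l_def dist_real_def)
        then show False using nw by simp
      qed
      have "measure (M n) ?A \<le> measure (M n) (?L \<union> (?B \<union> ?C))"
        by (rule finite_measure_mono[OF sub sets.Un[OF mL sets.Un[OF mB mC]]])
      also have "\<dots> \<le> measure (M n) ?L + measure (M n) (?B \<union> ?C)" by (rule measure_Un_le[OF mL sets.Un[OF mB mC]])
      also have "measure (M n) (?B \<union> ?C) \<le> measure (M n) ?B + measure (M n) ?C" by (rule measure_Un_le[OF mB mC])
      finally show ?case using X_outside_ball[OF elim] ratio_law[OF elim, of "ball y h"] by simp
    qed
  qed
qed

lemma X_norm_nonzero:
  assumes n: "n \<ge> 1"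
  shows "AE w in M n. lp_norm n 2 (X n w) \<noteq> 0"
proof -
  interpret prob_space "M n" by (rule M[OF n])
  have "\<P>(w in M n. norm_ratio p n (X n w) \<in> {0}) = 0"
    using ratio_law[OF n, of "{0}"] norm_ratio_zero_null[OF p_pos n] by simp
  then have "AE w in M n. w \<notin> {w\<in>space (M n). norm_ratio p n (X n w) \<in> {0}}"
    using X_sets(1)[OF n, of "{0}"] by (subst (asm) prob_eq_0) auto
  with AE_space show ?thesis by eventually_elim (auto simp: norm_ratio_def)
qed

text \<open>
  The independence of the generated \<open>\<sigma>\<close>-algebras, put as a product law in order to apply Fubini's
  theorem.
\<close>

lemma joint_law:
  assumes n: "n \<ge> 1"
  shows "distr (M n) (Rn_borel n \<Otimes>\<^sub>M grassmannian_borel n (k n)) (\<lambda>w. (X n w, E n w)) =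
     distr (M n) (Rn_borel n) (X n) \<Otimes>\<^sub>M \<mu> n"
proof -
  interpret prob_space "M n" by (rule M[OF n])
  interpret XX: prob_space "distr (M n) (Rn_borel n) (X n)" by (rule prob_space_distr[OF X[OF n]])
  interpret EE: prob_space "\<mu> n" unfolding \<mu>_def by (rule prob_space_distr[OF E[OF n]])
  let ?N = "Rn_borel n \<Otimes>\<^sub>M grassmannian_borel n (k n)"
  have XE: "(\<lambda>w. (X n w, E n w)) \<in> measurable (M n) ?N" using X[OF n] E[OF n] by (rule measurable_Pair)
  show ?thesis
  proof (rule pair_measure_eqI[symmetric])
    show "sigma_finite_measure (distr (M n) (Rn_borel n) (X n))" "sigma_finite_measure (\<mu> n)"
      by (rule XX.sigma_finite_measure_axioms, rule EE.sigma_finite_measure_axioms)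
    show "sets (distr (M n) (Rn_borel n) (X n) \<Otimes>\<^sub>M \<mu> n) = sets (distr (M n) ?N (\<lambda>w. (X n w, E n w)))"
      unfolding sets_distr by (rule sets_pair_measure_cong) (simp_all add: \<mu>_def)
    fix A B assume "A \<in> sets (distr (M n) (Rn_borel n) (X n))" "B \<in> sets (\<mu> n)"
    then have A: "A \<in> sets (Rn_borel n)" and B: "B \<in> sets (grassmannian_borel n (k n))" by (simp_all add: \<mu>_def)
    have AB: "A \<times> B \<in> sets ?N" using A B by (rule pair_measureI)
    let ?a = "X n -` A \<inter> space (M n)" and ?b = "E n -` B \<inter> space (M n)"
    have "measure (M n) (?a \<inter> ?b) = measure (M n) ?a * measure (M n) ?b"
      by (rule indep_setD[OF indep[OF n] in_vimage_algebra[OF A] in_vimage_algebra[OF B]])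
    then have "emeasure (M n) ?a * emeasure (M n) ?b = emeasure (M n) (?a \<inter> ?b)"
      by (simp add: emeasure_eq_measure ennreal_mult)
    also have "?a \<inter> ?b = (\<lambda>w. (X n w, E n w)) -` (A \<times> B) \<inter> space (M n)" by auto
    finally show "emeasure (distr (M n) (Rn_borel n) (X n)) A * emeasure (\<mu> n) B =
        emeasure (distr (M n) ?N (\<lambda>w. (X n w, E n w))) (A \<times> B)"
      unfolding \<mu>_def emeasure_distr[OF X[OF n] A] emeasure_distr[OF E[OF n] B] emeasure_distr[OF XE AB] .
  qed
qed

text \<open>
  Condition on \<open>X = x\<close>. The event for \<open>D\<close> is then decided, and the conditional probability of the event
  for \<open>R\<close> is the same for all nonzero \<open>x\<close>, by \<open>haar_ratio\<close>.
\<close>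

lemma joint_prob:
  assumes n: "n \<ge> 1" and A: "A \<in> sets borel" and B: "B \<in> sets borel"
  shows "emeasure (M n) {w\<in>space (M n). D n w \<in> A \<and> R n w \<in> B} =
    emeasure (M n) {w\<in>space (M n). D n w \<in> A} * emeasure (\<mu> n) {F\<in>space (\<mu> n). sqrt (real n / real (k n)) * lp_norm n 2 (proj n F unit0) \<in> B}"
proof -
  define \<rho> where "\<rho> = distr (M n) (Rn_borel n) (X n)"
  interpret prob_space "M n" by (rule M[OF n])
  interpret X: prob_space \<rho> unfolding \<rho>_def by (rule prob_space_distr[OF X[OF n]])
  interpret E: prob_space "\<mu> n" unfolding \<mu>_def by (rule prob_space_distr[OF E[OF n]])
  have s\<rho>: "sets \<rho> = sets (Rn_borel n)" "space \<rho> = Rn n" by (simp_all add: \<rho>_def)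
  have s\<mu>: "sets (\<mu> n) = sets (grassmannian_borel n (k n))" "space (\<mu> n) = grassmannian n (k n)" by (simp_all add: \<mu>_def)
  have haar: "haar_grassmannian n (k n) (\<mu> n)" unfolding \<mu>_def by (rule E_haar[OF n])
  let ?c = "sqrt (real n / real (k n))"
  let ?N = "Rn_borel n \<Otimes>\<^sub>M grassmannian_borel n (k n)"
  have comp: "(\<lambda>z. fst z i) \<in> borel_measurable ?N" for i
    using measurable_compose[OF measurable_fst measurable_Rn_component] .
  define d where "d z = real n powr (1 / p - 1 / 2) * lp_norm n 2 (fst z)" for z :: "(nat \<Rightarrow> real) \<times> (nat \<Rightarrow> real) set"
  define r where "r z = ?c * (lp_norm n 2 (proj n (snd z) (fst z)) / lp_norm n 2 (fst z))" for z :: "(nat \<Rightarrow> real) \<times> (nat \<Rightarrow> real) set"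
  have d: "d \<in> borel_measurable ?N"
    unfolding d_def[abs_def] by (intro borel_measurable_times borel_measurable_const measurable_lp_norm comp)
  have r: "r \<in> borel_measurable ?N"
    unfolding r_def[abs_def]
    by (intro borel_measurable_times borel_measurable_divide borel_measurable_const measurable_lp_norm
        measurable_norm_proj[OF k1[OF n] measurable_snd] comp)
  define S where "S = {z\<in>space ?N. d z \<in> A \<and> r z \<in> B}"
  have S: "S \<in> sets ?N"
  proof -
    have "(d -` A \<inter> space ?N) \<inter> (r -` B \<inter> space ?N) \<in> sets ?N"
      using measurable_sets[OF d A] measurable_sets[OF r B] by (rule sets.Int)
    also have "(d -` A \<inter> space ?N) \<inter> (r -` B \<inter> space ?N) = S" by (auto simp: S_def)
    finally show ?thesis .
  qed
  have XE: "(\<lambda>w. (X n w, E n w)) \<in> measurable (M n) ?N" using X[OF n] E[OF n] by (rule measurable_Pair)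
  have pre: "{w\<in>space (M n). D n w \<in> A \<and> R n w \<in> B} = (\<lambda>w. (X n w, E n w)) -` S \<inter> space (M n)"
    using measurable_space[OF XE] by (auto simp: S_def d_def r_def D_def R_def)
  have \<rho>D: "emeasure \<rho> {x\<in>Rn n. real n powr (1 / p - 1 / 2) * lp_norm n 2 x \<in> A} = emeasure (M n) {w\<in>space (M n). D n w \<in> A}"
  proof -
    have "{x\<in>Rn n. lp_norm n 2 x \<in> {t. real n powr (1 / p - 1 / 2) * t \<in> A}} \<in> sets (Rn_borel n)"
      by (rule norm_sets[OF scale_preimage_borel[OF A]])
    then have DS: "{x\<in>Rn n. real n powr (1 / p - 1 / 2) * lp_norm n 2 x \<in> A} \<in> sets (Rn_borel n)" by simp
    show ?thesis unfolding \<rho>_def emeasure_distr[OF X[OF n] DS]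
      using measurable_space[OF X[OF n]] by (intro arg_cong[where f = "emeasure (M n)"]) (auto simp: D_def)
  qed
  have "emeasure (M n) {w\<in>space (M n). D n w \<in> A \<and> R n w \<in> B} = emeasure (\<rho> \<Otimes>\<^sub>M \<mu> n) S"
    unfolding pre \<rho>_def joint_law[OF n, symmetric] by (rule emeasure_distr[OF XE S, symmetric])
  also have "\<dots> = (\<integral>\<^sup>+x. emeasure (\<mu> n) (Pair x -` S) \<partial>\<rho>)"
  proof (rule E.emeasure_pair_measure_alt)
    show "S \<in> sets (\<rho> \<Otimes>\<^sub>M \<mu> n)" using S sets_pair_measure_cong[OF s\<rho>(1) s\<mu>(1)] by simp
  qed
  also have "\<dots> = (\<integral>\<^sup>+x. indicator {x\<in>Rn n. real n powr (1 / p - 1 / 2) * lp_norm n 2 x \<in> A} x *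
      emeasure (\<mu> n) {F\<in>space (\<mu> n). ?c * lp_norm n 2 (proj n F unit0) \<in> B} \<partial>\<rho>)"
  proof (rule nn_integral_cong_AE)
    have "AE x in \<rho>. lp_norm n 2 x \<noteq> 0"
      unfolding \<rho>_def
    proof (subst AE_distr_iff[OF X[OF n]])
      have "{x\<in>Rn n. lp_norm n 2 x \<in> - {0}} \<in> sets (Rn_borel n)" by (rule norm_sets) simp
      then show "{x\<in>space (Rn_borel n). lp_norm n 2 x \<noteq> 0} \<in> sets (Rn_borel n)" by simp
    qed (rule X_norm_nonzero[OF n])
    with AE_space show "AE x in \<rho>. emeasure (\<mu> n) (Pair x -` S) = indicator {x\<in>Rn n. real n powr (1 / p - 1 / 2) * lp_norm n 2 x \<in> A} x *
      emeasure (\<mu> n) {F\<in>space (\<mu> n). ?c * lp_norm n 2 (proj n F unit0) \<in> B}"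
    proof eventually_elim
      case (elim x)
      have x: "x \<in> Rn n" using elim s\<rho> by simp
      show ?case
      proof (cases "real n powr (1 / p - 1 / 2) * lp_norm n 2 x \<in> A")
        case True
        have PS: "Pair x -` S = {F\<in>space (\<mu> n). lp_norm n 2 (proj n F x) / lp_norm n 2 x \<in> {t. ?c * t \<in> B}}"
          using True x s\<mu> by (auto simp: S_def d_def r_def space_pair_measure)
        have "emeasure (\<mu> n) (Pair x -` S) = emeasure (\<mu> n) {F\<in>space (\<mu> n). lp_norm n 2 (proj n F unit0) \<in> {t. ?c * t \<in> B}}"
          unfolding PS by (rule haar_ratio[OF haar k1[OF n] n elim(2) scale_preimage_borel[OF B]])
        then show ?thesis using True x by simp
      next
        case False
        then have "Pair x -` S = {}" by (auto simp: S_def d_def)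
        then show ?thesis using False by simp
      qed
    qed
  qed
  also have "\<dots> = emeasure \<rho> {x\<in>Rn n. real n powr (1 / p - 1 / 2) * lp_norm n 2 x \<in> A} *
      emeasure (\<mu> n) {F\<in>space (\<mu> n). ?c * lp_norm n 2 (proj n F unit0) \<in> B}"
  proof -
    have "{x\<in>Rn n. lp_norm n 2 x \<in> {t. real n powr (1 / p - 1 / 2) * t \<in> A}} \<in> sets (Rn_borel n)"
      by (rule norm_sets[OF scale_preimage_borel[OF A]])
    then have DS: "{x\<in>Rn n. real n powr (1 / p - 1 / 2) * lp_norm n 2 x \<in> A} \<in> sets \<rho>" using s\<rho> by simp
    show ?thesis using DS by (subst nn_integral_multc) auto
  qed
  also have "\<dots> = emeasure (M n) {w\<in>space (M n). D n w \<in> A} *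
      emeasure (\<mu> n) {F\<in>space (\<mu> n). ?c * lp_norm n 2 (proj n F unit0) \<in> B}"
    unfolding \<rho>D ..
  finally show ?thesis .
qed

lemma R_law:
  assumes n: "n \<ge> 1" and B: "B \<in> sets borel"
  shows "\<P>(w in M n. R n w \<in> B) = proj_law k \<mu> n B"
proof -
  interpret prob_space "M n" by (rule M[OF n])
  have "emeasure (M n) {w\<in>space (M n). R n w \<in> B} = emeasure (\<mu> n) {F\<in>space (\<mu> n). sqrt (real n / real (k n)) * lp_norm n 2 (proj n F unit0) \<in> B}"
    using joint_prob[OF n _ B, of UNIV] by (simp add: emeasure_space_1)
  then show ?thesis
    by (simp add: measure_def proj_law_def)
qed

lemma D_R_indep:
  assumes n: "n \<ge> 1" and A: "A \<in> sets borel" and B: "B \<in> sets borel"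
  shows "\<P>(w in M n. D n w \<in> A \<and> R n w \<in> B) =
    \<P>(w in M n. D n w \<in> A) * \<P>(w in M n. R n w \<in> B)"
proof -
  interpret prob_space "M n" by (rule M[OF n])
  have "emeasure (M n) {w\<in>space (M n). R n w \<in> B} = emeasure (\<mu> n) {F\<in>space (\<mu> n). sqrt (real n / real (k n)) * lp_norm n 2 (proj n F unit0) \<in> B}"
    using joint_prob[OF n _ B, of UNIV] by (simp add: emeasure_space_1)
  then have "emeasure (M n) {w\<in>space (M n). D n w \<in> A \<and> R n w \<in> B} =
    emeasure (M n) {w\<in>space (M n). D n w \<in> A} * emeasure (M n) {w\<in>space (M n). R n w \<in> B}"
    using joint_prob[OF n A B] by simp
  then show ?thesis by (simp add: measure_def enn2real_mult)
qed

end

section \<open>From the two factors to their product\<close>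

lemma satisfies_LDP_cong:
  assumes eq: "\<And>n w. n \<ge> 1 \<Longrightarrow> w \<in> space (M n) \<Longrightarrow> X n w = Y n w" and X: "satisfies_LDP M X s I"
  shows "satisfies_LDP M Y s I"
proof -
  have meas: "X n \<in> borel_measurable (M n) \<longleftrightarrow> Y n \<in> borel_measurable (M n)" if "n \<ge> 1" for n
    using eq[OF that] by (rule measurable_cong)
  have ev: "\<forall>\<^sub>F n in sequentially. ereal (inverse (s n)) * log_prob (\<P>(w in M n. X n w \<in> A)) =
      ereal (inverse (s n)) * log_prob (\<P>(w in M n. Y n w \<in> A))" for A
    using eventually_ge_at_top[of "1::nat"]
  proof eventually_elim
    case (elim n)
    have "{w \<in> space (M n). X n w \<in> A} = {w \<in> space (M n). Y n w \<in> A}" using eq[OF elim] by auto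
    then show ?case by simp
  qed
  show ?thesis
    using X meas unfolding satisfies_LDP_def Let_def Liminf_eq[OF ev] Limsup_eq[OF ev] by simp
qed

lemma exp_ub_prob:
  assumes "\<And>n. n \<ge> 1 \<Longrightarrow> P n \<le> 1" "\<forall>\<^sub>F n in sequentially. 0 < s n"
  shows "exp_ub s P 0"
  unfolding exp_ub_def
proof (intro allI impI)
  fix r :: real assume "ereal r < 0"
  then have r: "r < 0" by simp
  show "\<forall>\<^sub>F n in sequentially. P n \<le> exp (- r * s n)"
    using eventually_ge_at_top[of "1::nat"] assms(2)
  proof eventually_elim
    case (elim n)
    have "0 \<le> - r * s n" using r elim by (intro mult_nonneg_nonneg) auto
    then have "1 \<le> exp (- r * s n)" by simp
    then show ?case using assms(1)[OF elim(1)] by linarith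
  qed
qed

lemma exp_lb_INF:
  assumes "\<And>y. y \<in> A \<Longrightarrow> exp_lb s P (f y)"
  shows "exp_lb s P (INF y\<in>A. f y)"
  unfolding exp_lb_def
proof (intro allI impI)
  fix r assume "(INF y\<in>A. f y) < ereal r"
  then obtain y where "y \<in> A" "f y < ereal r" by (auto simp: INF_less_iff)
  then show "\<forall>\<^sub>F n in sequentially. exp (- r * s n) \<le> P n" using assms unfolding exp_lb_def by blast
qed

lemma exp_lb_infinity: "exp_lb s P \<infinity>"
  by (simp add: exp_lb_def)

text \<open>
  The rate of an upper tail: below the typical value \<open>m\<close> a tail event is not rare.
\<close>

definition right_rate :: "real \<Rightarrow> (real \<Rightarrow> ereal) \<Rightarrow> real \<Rightarrow> ereal" where
  "right_rate m f y = (if y \<le> m then 0 else f y)"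

lemma right_rate_lsc:
  assumes f: "\<And>y. m < y \<Longrightarrow> f y = \<infinity> \<or> (\<exists>h. isCont h y \<and> (\<forall>z>m. f z = ereal (h z)))"
    and inf: "\<And>y z. m < y \<Longrightarrow> m < z \<Longrightarrow> f y = \<infinity> \<Longrightarrow> f z = \<infinity>"
    and r: "ereal r < right_rate m f y"
  shows "\<forall>\<^sub>F v in at_left y. ereal r < right_rate m f v"
proof (cases "y \<le> m")
  case True
  then have "r < 0" using r by (simp add: right_rate_def)
  have "\<forall>\<^sub>F v in at_left y. v < y" using eventually_at_left_real[of "y - 1" y] by (auto elim: eventually_mono)
  then show ?thesis by eventually_elim (use True \<open>r < 0\<close> in \<open>simp add: right_rate_def\<close>)
next
  case False
  then have y: "m < y" by simp
  have ev: "\<forall>\<^sub>F v in at_left y. m < v" using eventually_at_left_real[OF y] by eventually_elim simp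
  consider "f y = \<infinity>" | h where "isCont h y" "\<forall>z>m. f z = ereal (h z)" using f[OF y] by auto
  then show ?thesis
  proof cases
    case 1
    show ?thesis using ev by eventually_elim (use inf[OF y _ 1] in \<open>simp add: right_rate_def\<close>)
  next
    case 2
    have "(h \<longlongrightarrow> h y) (at_left y)" using 2(1) by (simp add: isCont_def filterlim_at_split)
    moreover have "r < h y" using r y 2(2) by (simp add: right_rate_def)
    ultimately have "\<forall>\<^sub>F v in at_left y. r < h v" by (rule order_tendstoD(1))
    with ev show ?thesis by eventually_elim (use 2(2) in \<open>simp add: right_rate_def\<close>)
  qed
qed

lemma eventually_at_left_shift:
  assumes "\<forall>\<^sub>F v in at_left (y::real). P v"
  shows "\<forall>\<^sub>F e in at_right 0. P (y - e)"
proof -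
  have "filterlim (\<lambda>e. y - e) (at_left y) (at_right 0)"
    unfolding filterlim_at
  proof
    have "((\<lambda>e. y - e) \<longlongrightarrow> y - 0) (at_right 0)" by (intro tendsto_intros)
    then show "((\<lambda>e. y - e) \<longlongrightarrow> y) (at_right 0)" by simp
    have "\<forall>\<^sub>F e in at_right (0::real). 0 < e" by (simp add: eventually_at_right_less)
    then show "\<forall>\<^sub>F e in at_right 0. y - e \<in> {..<y} \<and> y - e \<noteq> y" by eventually_elim simp
  qed
  with assms show ?thesis unfolding filterlim_iff by blast
qed

lemma isCont_jump_rate:
  assumes "0 < p" "0 \<le> m" "m < y" shows "isCont (jump_rate p m) y"
proof -
  have "m\<^sup>2 < y\<^sup>2" using assms by (intro power_strict_mono) auto
  then show ?thesis unfolding jump_rate_def[abs_def] by (intro continuous_intros) auto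
qed

context projected_point
begin

abbreviation "m \<equiv> sqrt (M2 p)"

lemma m_pos: "0 < m" using M2_pos[OF p_pos] by simp

lemma m_sq: "m\<^sup>2 = M2 p" using M2_pos[OF p_pos] by simp

text \<open>
  The common part of the four cases: rates for the tails of \<open>D\<close> and \<open>R\<close> yield the principle for the
  product, provided that \<open>I\<close> is at most the cost of every way to reach a half line (\<open>upper\<close>, \<open>lower\<close>)
  and that small balls attain it (\<open>loc\<close>). Lower tails of \<open>D\<close> are negligible at every slow speed, so only
  \<open>R\<close> can make the product small.
\<close>

lemma product_LDP:
  assumes s: "slow_speed s" "\<And>n. n \<ge> 1 \<Longrightarrow> 0 < s n"
    and I: "rate_function I" "I m = 0"
    and gD: "\<And>y. 0 \<le> gD y" "\<And>y r. ereal r < gD y \<Longrightarrow> \<forall>\<^sub>F v in at_left y. ereal r < gD v" "\<And>r. \<exists>y. ereal r < gD y"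
    and gR: "\<And>u. 0 \<le> gR u" "\<And>u r. ereal r < gR u \<Longrightarrow> \<forall>\<^sub>F v in at_left u. ereal r < gR v"
    and hR: "\<And>u r. u < 1 \<Longrightarrow> ereal r < hR u \<Longrightarrow> \<forall>\<^sub>F v in at_right u. ereal r < hR v"
    and Dub: "\<And>y. m < y \<Longrightarrow> exp_ub s (\<lambda>n. \<P>(w in M n. D n w \<in> {y..})) (gD y)"
    and gD0: "\<And>y. y \<le> m \<Longrightarrow> gD y = 0"
    and Rub: "\<And>u. 1 < u \<Longrightarrow> exp_ub s (\<lambda>n. \<P>(w in M n. R n w \<in> {u..})) (gR u)"
    and gR0: "\<And>u. u \<le> 1 \<Longrightarrow> gR u = 0"
    and Rlow: "\<And>u. 0 < u \<Longrightarrow> u < 1 \<Longrightarrow> exp_ub s (\<lambda>n. \<P>(w in M n. R n w \<in> {..u})) (hR u)"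
    and upper: "\<And>b y. m < b \<Longrightarrow> 0 < y \<Longrightarrow> I b \<le> gD y + gR (b / y)"
    and lower: "\<And>x. x < m \<Longrightarrow> I x \<le> hR (max 0 (x / m))"
    and loc: "\<And>x d. 0 < d \<Longrightarrow> exp_lb s (\<lambda>n. \<P>(w in M n. \<bar>D n w * R n w - x\<bar> < d)) (I x)"
  shows "satisfies_LDP M (\<lambda>n w. D n w * R n w) s I"
proof -
  have sl: "filterlim s at_top sequentially" using s by (simp add: slow_speed_def)
  note pos = slow_speed_pos[OF s(1)]
  have one: "exp_ub s (\<lambda>n. \<P>(w in M n. Q n w)) 0" for Q
    by (rule exp_ub_prob[OF _ pos]) (rule prob_space.prob_le_1[OF M])
  have Dub': "exp_ub s (\<lambda>n. \<P>(w in M n. D n w \<in> {y..})) (gD y)" for y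
    using Dub[of y] gD0[of y] one by (cases "y \<le> m") auto
  have Rub': "exp_ub s (\<lambda>n. \<P>(w in M n. R n w \<in> {u..})) (gR u)" for u
    using Rub[of u] gR0[of u] one by (cases "u \<le> 1") auto
  have Rlow': "exp_ub s (\<lambda>n. \<P>(w in M n. R n w \<in> {..u})) (hR (max 0 u))" if u: "u < 1" for u
  proof (cases "0 < u")
    case True then show ?thesis using Rlow[OF True u] by simp
  next
    case False
    show ?thesis
      unfolding exp_ub_def
    proof (intro allI impI)
      fix r assume r: "ereal r < hR (max 0 u)"
      then have "\<forall>\<^sub>F v in at_right 0. ereal r < hR v" using hR[of 0 r] False by simp
      moreover have "\<forall>\<^sub>F v in at_right (0::real). 0 < v \<and> v < 1" using eventually_at_right_real[of 0 "1::real"] by (auto elim: eventually_mono)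
      ultimately have "\<forall>\<^sub>F v in at_right 0. ereal r < hR v \<and> 0 < v \<and> v < 1" by eventually_elim auto
      then obtain v where v: "ereal r < hR v" "0 < v" "v < 1"
        using eventually_happens[of _ "at_right (0::real)"] by (metis (lifting) trivial_limit_at_right_real)
      have "exp_ub s (\<lambda>n. \<P>(w in M n. R n w \<in> {..u})) (hR v)"
      proof (rule exp_ub_mono[OF Rlow[OF v(2,3)] order_refl])
        show "\<forall>\<^sub>F n in sequentially. \<P>(w in M n. R n w \<in> {..u}) \<le> \<P>(w in M n. R n w \<in> {..v})"
          using eventually_ge_at_top[of "1::nat"]
        proof eventually_elim
          case (elim n)
          interpret prob_space "M n" by (rule M[OF elim])
          have "{w\<in>space (M n). R n w \<in> {..v}} \<in> sets (M n)"
            using measurable_sets[OF R_measurable[OF elim], of "{..v}"] by (simp add: vimage_def Int_def conj_commute)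
          then show ?case by (rule finite_measure_mono[rotated]) (use False v in auto)
        qed
      qed
      then show "\<forall>\<^sub>F n in sequentially. \<P>(w in M n. R n w \<in> {..u}) \<le> exp (- r * s n)"
        using v(1) unfolding exp_ub_def by blast
    qed
  qed
  show ?thesis
  proof (rule satisfies_LDP_of_half_lines[where m = m])
    show "prob_space (M n)" if "n \<ge> 1" for n by (rule M[OF that])
    show "(\<lambda>w. D n w * R n w) \<in> borel_measurable (M n)" if "n \<ge> 1" for n
      by (intro borel_measurable_times D_measurable R_measurable that)
    show "0 < s n" if "n \<ge> 1" for n by (rule s(2)[OF that])
    fix b assume b: "m < b"
    show "exp_ub s (\<lambda>n. \<P>(w in M n. b \<le> D n w * R n w)) (I b)"
    proof (rule product_upper_tail[where D = D and R = R and gD = gD and gR = gR and ?y0.0 = "m / 2",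
          OF M D_measurable R_measurable D_nonneg R_nonneg D_R_indep sl _ _ Dub' Rub' gD(1) _ gD(3) gR])
      show "0 < m / 2" using m_pos by simp
      show "0 < b" using m_pos b by linarith
      show "exp_ub s (\<lambda>n. \<P>(w in M n. D n w \<in> {..m / 2})) \<infinity>"
        by (rule D_ub_lower[OF s(1)]) (use m_pos in simp)
      show "\<forall>\<^sub>F e in at_right 0. ereal r < gD (y - e)" if "ereal r < gD y" for y r
        by (rule eventually_at_left_shift[OF gD(2)[OF that]])
      show "I b \<le> gD y + gR (b / y)" if "m / 2 \<le> y" for y by (rule upper[OF b]) (use that m_pos in linarith)
    qed
  next
    fix a assume a: "a < m"
    have "exp_ub s (\<lambda>n. \<P>(w in M n. D n w * R n w \<le> a)) (hR (max 0 (max 0 (a / m))))"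
    proof (rule product_lower_tail[where D = D and R = R and hR = "\<lambda>u. hR (max 0 u)",
          OF M D_measurable R_measurable D_nonneg R_nonneg sl m_pos D_ub_lower[OF s(1)] Rlow' _ a])
      fix u r assume u: "u < 1" and r: "ereal r < hR (max 0 u)"
      show "\<forall>\<^sub>F v in at_right u. ereal r < hR (max 0 v)"
      proof (cases "0 \<le> u")
        case True
        have "\<forall>\<^sub>F v in at_right u. u < v" by (simp add: eventually_at_right_less)
        moreover have "\<forall>\<^sub>F v in at_right u. ereal r < hR v" using hR[OF u] r True by simp
        ultimately show ?thesis by eventually_elim (use True in simp)
      next
        case False
        then have "\<forall>\<^sub>F v in at_right u. v < 0" using eventually_at_right_real[of u 0] by (auto elim: eventually_mono)
        then show ?thesis by eventually_elim (use r False in simp)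
      qed
    qed
    then show "exp_ub s (\<lambda>n. \<P>(w in M n. D n w * R n w \<le> a)) (I a)"
      by (rule exp_ub_mono) (use lower[OF a] in auto)
  qed (use sl I loc in auto)
qed

lemma R_ub_upper:
  assumes u: "1 < u"
  shows "exp_ub (\<lambda>n. real (k n)) (\<lambda>n. \<P>(w in M n. R n w \<in> {u..})) (ereal (chi_rate u))"
proof (rule exp_ub_mono[OF proj_law_upper[OF E_haar[folded \<mu>_def] k1 k_lim k_small u] order_refl])
  show "\<forall>\<^sub>F n in sequentially. \<P>(w in M n. R n w \<in> {u..}) \<le> proj_law k \<mu> n {u..}"
    using eventually_ge_at_top[of "1::nat"] by eventually_elim (simp only: R_law[OF _ closed_atLeast[THEN borel_closed]] order_refl)
qed

lemma R_ub_lower: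
  assumes u: "0 < u" "u < 1"
  shows "exp_ub (\<lambda>n. real (k n)) (\<lambda>n. \<P>(w in M n. R n w \<in> {..u})) (ereal (chi_rate u))"
proof (rule exp_ub_mono[OF proj_law_lower[OF E_haar[folded \<mu>_def] k1 k_lim k_small u] order_refl])
  show "\<forall>\<^sub>F n in sequentially. \<P>(w in M n. R n w \<in> {..u}) \<le> proj_law k \<mu> n {..u}"
    using eventually_ge_at_top[of "1::nat"] by eventually_elim (simp only: R_law[OF _ closed_atMost[THEN borel_closed]] order_refl)
qed

lemma R_lb:
  assumes u: "0 < u" and d: "0 < d"
  shows "exp_lb (\<lambda>n. real (k n)) (\<lambda>n. \<P>(w in M n. R n w \<in> ball u d)) (ereal (chi_rate u))"
proof (rule exp_lb_mono[OF proj_law_local[OF E_haar[folded \<mu>_def] k1 k_lim k_small u d] order_refl])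
  show "\<forall>\<^sub>F n in sequentially. proj_law k \<mu> n (ball u d) \<le> \<P>(w in M n. R n w \<in> ball u d)"
    using eventually_ge_at_top[of "1::nat"] by eventually_elim (simp only: R_law[OF _ open_ball[THEN borel_open]] order_refl)
qed

lemma R_near:
  assumes sl: "filterlim s at_top sequentially" and d: "0 < d"
  shows "exp_lb s (\<lambda>n. \<P>(w in M n. R n w \<in> ball 1 d)) 0"
proof (rule exp_lb_const[OF _ sl])
  show "(0::real) < 1/2" by simp
  define l where "l = max (1 - d) (1/2)"
  have l: "0 < l" "l < 1" "1 - d \<le> l" using d by (auto simp: l_def)
  have c: "0 < chi_rate l" "0 < chi_rate (1 + d)" using l d by (auto intro!: chi_rate_pos)
  have "1 < 1 + d" using d by simp
  have U: "\<forall>\<^sub>F n in sequentially. \<P>(w in M n. R n w \<in> {1 + d..}) \<le> 1/4"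
    by (rule exp_ub_tendsto_0[OF R_ub_upper[OF \<open>1 < 1 + d\<close>] _ k_lim]) (use c in auto)
  have L: "\<forall>\<^sub>F n in sequentially. \<P>(w in M n. R n w \<in> {..l}) \<le> 1/4"
    by (rule exp_ub_tendsto_0[OF R_ub_lower[OF l(1,2)] _ k_lim]) (use c in auto)
  show "\<forall>\<^sub>F n in sequentially. 1/2 \<le> \<P>(w in M n. R n w \<in> ball 1 d)"
    using U L eventually_ge_at_top[of "1::nat"]
  proof eventually_elim
    case (elim n)
    interpret prob_space "M n" by (rule M[OF elim(3)])
    have m: "{w\<in>space (M n). R n w \<in> B} \<in> sets (M n)" if "B \<in> sets borel" for B
      using measurable_sets[OF R_measurable[OF elim(3)] that] by (simp add: vimage_def Int_def conj_commute)
    let ?U = "{w\<in>space (M n). R n w \<in> {1 + d..}}" and ?L = "{w\<in>space (M n). R n w \<in> {..l}}" and ?B = "{w\<in>space (M n). R n w \<in> ball 1 d}"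
    have mU: "?U \<in> sets (M n)" and mL: "?L \<in> sets (M n)" and mB: "?B \<in> sets (M n)" by (rule m; simp)+
    have "1 = measure (M n) (space (M n))" by (simp add: prob_space)
    also have "\<dots> \<le> measure (M n) (?B \<union> (?U \<union> ?L))"
      by (rule finite_measure_mono[OF _ sets.Un[OF mB sets.Un[OF mU mL]]]) (use l in \<open>auto simp: dist_real_def abs_less_iff\<close>)
    also have "\<dots> \<le> measure (M n) ?B + measure (M n) (?U \<union> ?L)" by (rule measure_Un_le[OF mB sets.Un[OF mU mL]])
    also have "measure (M n) (?U \<union> ?L) \<le> measure (M n) ?U + measure (M n) ?L" by (rule measure_Un_le[OF mU mL])
    finally have "1 \<le> measure (M n) ?B + (measure (M n) ?U + measure (M n) ?L)" by simp
    then show ?case using elim(1,2) by linarith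
  qed
qed

lemma D_concentrated:
  assumes s: "slow_speed s" and d: "0 < d"
  shows "exp_lb s (\<lambda>n. \<P>(w in M n. D n w \<in> ball m d)) 0"
proof (rule D_lb[OF s m_pos _ d])
  fix a :: real assume a: "0 < a"
  have sl: "filterlim s at_top sequentially" using s by (simp add: slow_speed_def)
  show "exp_lb s (\<lambda>n. gprob p n (\<lambda>x. \<bar>(\<Sum>i<n. (x i)\<^sup>2) - real n * m\<^sup>2\<bar> < real n * a)) 0"
    unfolding m_sq by (rule exp_lb_const[OF _ sl gg_square_near[OF p a]]) simp
qed simp

lemma D_local_jump:
  assumes s: "slow_speed (\<lambda>n. real n powr (p / 2))" and p2: "p < 2" and y: "m \<le> y" and d: "0 < d"
  shows "exp_lb (\<lambda>n. real n powr (p / 2)) (\<lambda>n. \<P>(w in M n. D n w \<in> ball y d)) (ereal (jump_rate p m y))"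
proof (rule D_lb[OF s _ _ d])
  show "0 < y" using y m_pos by linarith
  have "m\<^sup>2 \<le> y\<^sup>2" using y m_pos by (intro power_mono) auto
  then have a: "0 \<le> y\<^sup>2 - M2 p" by (simp add: m_sq)
  fix b :: real assume b: "0 < b"
  show "exp_lb (\<lambda>n. real n powr (p / 2)) (\<lambda>n. gprob p n (\<lambda>x. \<bar>(\<Sum>i<n. (x i)\<^sup>2) - real n * y\<^sup>2\<bar> < real n * b)) (ereal (jump_rate p m y))"
    using gg_square_heavy_lower[OF p p2 a b] by (simp add: jump_rate_def m_sq)
qed simp

lemma D_upper_fast:
  assumes s: "slow_speed s" and y: "m < y"
    and ub: "\<And>a. 0 < a \<Longrightarrow> exp_ub s (\<lambda>n. gprob p n (\<lambda>x. real n * (M2 p + a) \<le> (\<Sum>i<n. (x i)\<^sup>2))) c"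
  shows "exp_ub s (\<lambda>n. \<P>(w in M n. D n w \<in> {y..})) c"
proof -
  have "m\<^sup>2 < y\<^sup>2" using y m_pos by (intro power_strict_mono) auto
  then obtain b where b: "M2 p < b" "b < y\<^sup>2" using dense m_sq by metis
  have y0: "0 < y" using y m_pos by linarith
  have "exp_ub s (\<lambda>n. gprob p n (\<lambda>x. real n * b \<le> (\<Sum>i<n. (x i)\<^sup>2))) c" using ub[of "b - M2 p"] b by simp
  from D_ub_upper[OF s y0 ratio_upper_ub[OF p s y0 b(2) this]] show ?thesis .
qed

text \<open>
  The tail bound for the sum of squares applies to every \<open>v < y\<close>, and the rate is continuous.
\<close>

lemma D_upper_jump:
  assumes s: "slow_speed (\<lambda>n. real n powr (p / 2))" and p2: "p < 2" and y: "m < y"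
  shows "exp_ub (\<lambda>n. real n powr (p / 2)) (\<lambda>n. \<P>(w in M n. D n w \<in> {y..})) (ereal (jump_rate p m y))"
  unfolding exp_ub_def
proof (intro allI impI)
  fix r assume "ereal r < ereal (jump_rate p m y)"
  then have r: "r < jump_rate p m y" by simp
  have y0: "0 < y" using y m_pos by linarith
  have "(jump_rate p m \<longlongrightarrow> jump_rate p m y) (at_left y)"
    using isCont_jump_rate[OF p_pos less_imp_le[OF m_pos] y] by (simp add: isCont_def filterlim_at_split)
  then have "\<forall>\<^sub>F v in at_left y. r < jump_rate p m v" using r by (rule order_tendstoD(1))
  moreover have "\<forall>\<^sub>F v in at_left y. m < v \<and> v < y" using eventually_at_left_real[OF y] by (auto elim: eventually_mono)
  ultimately have "\<forall>\<^sub>F v in at_left y. r < jump_rate p m v \<and> m < v \<and> v < y" by eventually_elim auto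
  then obtain v where v: "r < jump_rate p m v" "m < v" "v < y"
    using eventually_happens[of _ "at_left y"] by (metis (lifting) trivial_limit_at_left_real)
  have "m\<^sup>2 < v\<^sup>2" by (rule power_strict_mono[OF v(2) less_imp_le[OF m_pos]]) simp
  have "0 \<le> v" using v(2) m_pos by linarith
  then have "v\<^sup>2 < y\<^sup>2" by (rule power_strict_mono[OF v(3)]) simp
  from \<open>m\<^sup>2 < v\<^sup>2\<close> have a: "0 < v\<^sup>2 - M2 p" by (simp add: m_sq)
  have "exp_ub (\<lambda>n. real n powr (p / 2)) (\<lambda>n. gprob p n (\<lambda>x. real n * v\<^sup>2 \<le> (\<Sum>i<n. (x i)\<^sup>2))) (ereal (jump_rate p m v))"
    using gg_square_heavy_upper[OF p p2 a] by (simp add: jump_rate_def m_sq)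
  from D_ub_upper[OF s y0 ratio_upper_ub[OF p s y0 \<open>v\<^sup>2 < y\<^sup>2\<close> this]] v(1)
  show "\<forall>\<^sub>F n in sequentially. \<P>(w in M n. D n w \<in> {y..}) \<le> exp (- r * real n powr (p / 2))"
    unfolding exp_ub_def by simp
qed

lemma local_product:
  assumes "\<And>d. 0 < d \<Longrightarrow> exp_lb s (\<lambda>n. \<P>(w in M n. D n w \<in> ball y d)) cD"
    and "\<And>d. 0 < d \<Longrightarrow> exp_lb s (\<lambda>n. \<P>(w in M n. R n w \<in> ball u d)) cR"
    and "0 \<le> cD" "0 \<le> cR" "0 < d" "x = y * u"
  shows "exp_lb s (\<lambda>n. \<P>(w in M n. \<bar>D n w * R n w - x\<bar> < d)) (cD + cR)"
  unfolding assms(6) by (rule product_local[OF M D_measurable R_measurable D_R_indep assms(1-5)])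

lemma lsc_infinite: "ereal r < right_rate a (\<lambda>_. \<infinity>) y \<Longrightarrow> \<forall>\<^sub>F v in at_left y. ereal r < right_rate a (\<lambda>_. \<infinity>) v"
  by (rule right_rate_lsc) auto

lemma lsc_chi: "ereal r < right_rate 1 (\<lambda>u. ereal (chi_rate u)) y \<Longrightarrow> \<forall>\<^sub>F v in at_left y. ereal r < right_rate 1 (\<lambda>u. ereal (chi_rate u)) v"
  by (rule right_rate_lsc) (auto intro!: exI[of _ chi_rate] isCont_chi_rate)

lemma lsc_jump: "ereal r < right_rate m (\<lambda>u. ereal (jump_rate p m u)) y \<Longrightarrow> \<forall>\<^sub>F v in at_left y. ereal r < right_rate m (\<lambda>u. ereal (jump_rate p m u)) v"
  by (rule right_rate_lsc) (auto intro!: exI[of _ "jump_rate p m"] isCont_jump_rate p_pos less_imp_le[OF m_pos])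

text \<open>
  The rate of a lower tail of \<open>R\<close>; the product may be nonpositive at infinite cost only.
\<close>

definition left_chi :: "real \<Rightarrow> ereal" where
  "left_chi u = (if u \<le> 0 then \<infinity> else ereal (chi_rate u))"

lemma left_chi_lsc:
  assumes "ereal r < left_chi u" shows "\<forall>\<^sub>F v in at_right u. ereal r < left_chi v"
proof -
  consider "u < 0" | "u = 0" | "0 < u" by linarith
  then show ?thesis
  proof cases
    case 1
    then have "\<forall>\<^sub>F v in at_right u. v < 0" using eventually_at_right_real[of u 0] by (auto elim: eventually_mono)
    then show ?thesis by eventually_elim (simp add: left_chi_def)
  next
    case 2
    have "0 < exp (- r - 1/2)" by simp
    then have "\<forall>\<^sub>F v in at_right 0. 0 < v \<and> v < exp (- r - 1/2)" using eventually_at_right_real by (auto elim: eventually_mono)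
    then show ?thesis unfolding 2
    proof eventually_elim
      case (elim v)
      then have "r < chi_rate v" using chi_rate_sublevel(1)[of v r] by (meson not_le)
      then show ?case using elim by (simp add: left_chi_def)
    qed
  next
    case 3
    have "(chi_rate \<longlongrightarrow> chi_rate u) (at_right u)" using isCont_chi_rate[OF 3] by (simp add: isCont_def filterlim_at_split)
    moreover have "r < chi_rate u" using assms 3 by (simp add: left_chi_def)
    ultimately have "\<forall>\<^sub>F v in at_right u. r < chi_rate v" by (rule order_tendstoD(1))
    moreover have "\<forall>\<^sub>F v in at_right u. u < v" by (simp add: eventually_at_right_less)
    ultimately show ?thesis by eventually_elim (use 3 in \<open>simp add: left_chi_def\<close>)
  qed
qed

text \<open>
  When upper deviations of \<open>D\<close> are negligible at speed \<open>k\<close>, the factor \<open>D\<close> acts like the constant \<open>m\<close>.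
\<close>

lemma LDP_chi:
  assumes s: "slow_speed (\<lambda>n. real (k n))"
    and ub: "\<And>a. 0 < a \<Longrightarrow> exp_ub (\<lambda>n. real (k n)) (\<lambda>n. gprob p n (\<lambda>x. real n * (M2 p + a) \<le> (\<Sum>i<n. (x i)\<^sup>2))) \<infinity>"
  shows "satisfies_LDP M (\<lambda>n w. D n w * R n w) (\<lambda>n. real (k n)) (\<lambda>x. if x > 0 then ereal (chi_rate (x / m)) else \<infinity>)"
proof (rule product_LDP[OF s, where gD = "right_rate m (\<lambda>_. \<infinity>)" and gR = "right_rate 1 (\<lambda>u. ereal (chi_rate u))" and hR = left_chi])
  show "rate_function (\<lambda>x. if x > 0 then ereal (chi_rate (x / m)) else \<infinity>)" by (rule rate_function_chi[OF m_pos])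
  show "\<exists>y. ereal r < right_rate m (\<lambda>_. \<infinity>) y" for r by (rule exI[of _ "m + 1"]) (simp add: right_rate_def)
  show "exp_ub (\<lambda>n. real (k n)) (\<lambda>n. \<P>(w in M n. D n w \<in> {y..})) (right_rate m (\<lambda>_. \<infinity>) y)" if "m < y" for y
    using D_upper_fast[OF s that ub] that by (simp add: right_rate_def)
  show "exp_ub (\<lambda>n. real (k n)) (\<lambda>n. \<P>(w in M n. R n w \<in> {u..})) (right_rate 1 (\<lambda>u. ereal (chi_rate u)) u)" if "1 < u" for u
    using R_ub_upper[OF that] that by (simp add: right_rate_def)
  show "exp_ub (\<lambda>n. real (k n)) (\<lambda>n. \<P>(w in M n. R n w \<in> {..u})) (left_chi u)" if "0 < u" "u < 1" for u
    using R_ub_lower[OF that] that by (simp add: left_chi_def)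
  show "(if b > 0 then ereal (chi_rate (b / m)) else \<infinity>) \<le> right_rate m (\<lambda>_. \<infinity>) y + right_rate 1 (\<lambda>u. ereal (chi_rate u)) (b / y)"
    if b: "m < b" "0 < y" for b y
  proof (cases "y \<le> m")
    case True
    have b0: "0 < b" using b m_pos by linarith
    have "1 < b / m" using b m_pos by simp
    moreover have "b / m \<le> b / y" by (rule divide_left_mono[OF True less_imp_le[OF b0] mult_pos_pos[OF m_pos b(2)]])
    ultimately show ?thesis using True b0 chi_rate_mono[of "b / m" "b / y"] by (simp add: right_rate_def)
  qed (simp add: right_rate_def)
  show "(if x > 0 then ereal (chi_rate (x / m)) else \<infinity>) \<le> left_chi (max 0 (x / m))" if "x < m" for x
  proof (cases "x > 0")
    case True
    then have "0 < x / m" using m_pos by simp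
    then show ?thesis using True by (simp add: left_chi_def)
  next
    case False
    then have "x / m \<le> 0" using m_pos by (simp add: divide_le_0_iff)
    then show ?thesis by (simp add: left_chi_def)
  qed
  show "exp_lb (\<lambda>n. real (k n)) (\<lambda>n. \<P>(w in M n. \<bar>D n w * R n w - x\<bar> < d)) (if x > 0 then ereal (chi_rate (x / m)) else \<infinity>)"
    if d: "0 < d" for x d
  proof (cases "x > 0")
    case True
    have u: "0 < x / m" using True m_pos by simp
    have "exp_lb (\<lambda>n. real (k n)) (\<lambda>n. \<P>(w in M n. \<bar>D n w * R n w - x\<bar> < d)) (0 + ereal (chi_rate (x / m)))"
      by (rule local_product[OF D_concentrated[OF s] R_lb[OF u]]) (use d u m_pos chi_rate_nonneg in auto)
    then show ?thesis using True by simp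
  qed (simp add: exp_lb_infinity)
qed (use k1 m_pos chi_rate_nonneg lsc_infinite lsc_chi left_chi_lsc in \<open>auto simp: right_rate_def Suc_le_eq\<close>)

context
  assumes p2: "p < 2"
begin

lemma slow_power: "slow_speed (\<lambda>n. real n powr (p / 2))"
  unfolding slow_speed_def
proof
  show "filterlim (\<lambda>n. real n powr (p / 2)) at_top sequentially" using p by (intro filterlim_nat_powr) simp
  have "filterlim (\<lambda>n. real n powr (1 - p / 2)) at_top sequentially" using p2 by (intro filterlim_nat_powr) simp
  then show "filterlim (\<lambda>n. real n / real n powr (p / 2)) at_top sequentially"
    by (simp add: powr_diff)
qed

lemma jump_unbounded: "\<exists>y. ereal r < right_rate m (\<lambda>u. ereal (jump_rate p m u)) y"
proof -
  define y where "y = 2 + m\<^sup>2 + (p * \<bar>r\<bar>) powr (2 / p) + m"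
  have y: "m < y" "1 + m\<^sup>2 + (p * \<bar>r\<bar>) powr (2 / p) < y" using m_pos by (simp_all add: y_def add_pos_nonneg)
  then have "r < jump_rate p m y" using jump_rate_sublevel[OF p_pos less_imp_le[OF m_pos], of y r] by (meson less_imp_le not_le)
  then show ?thesis using y by (intro exI[of _ y]) (simp add: right_rate_def)
qed

text \<open>
  Both factors live on the same speed. For \<open>b > m\<close> values \<open>y \<ge> b\<close> of \<open>D\<close> are dominated by \<open>y = b\<close> with
  \<open>R\<close> typical, and values \<open>y \<le> m\<close> by \<open>y = m\<close>, so the infimum over \<open>y \<ge> m\<close> is at most every such cost.
\<close>

lemma LDP_joint:
  assumes k_s: "(\<lambda>n. real (k n) / real n powr (p / 2)) \<longlonglongrightarrow> 1"
  shows "satisfies_LDP M (\<lambda>n w. D n w * R n w) (\<lambda>n. real n powr (p / 2))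
    (\<lambda>x. if x > 0 then (INF y\<in>{m..}. ereal (chi_rate (x / y) + jump_rate p m y)) else \<infinity>)"
    (is "satisfies_LDP _ _ ?s ?I")
proof (rule product_LDP[OF slow_power, where gD = "right_rate m (\<lambda>u. ereal (jump_rate p m u))"
      and gR = "right_rate 1 (\<lambda>u. ereal (chi_rate u))" and hR = left_chi])
  note pos = slow_speed_pos[OF slow_power]
  have INF_le: "?I x \<le> ereal (chi_rate (x / y) + jump_rate p m y)" if "0 < x" "m \<le> y" for x y
    using that by (auto intro: INF_lower)
  show rf: "rate_function ?I" by (rule rate_function_joint[OF p_pos m_pos])
  have "?I m \<le> 0" using INF_le[OF m_pos order_refl] m_pos by (simp add: zero_ereal_def)
  moreover have "0 \<le> ?I m" using rf by (simp only: rate_function_def)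
  ultimately show "?I m = 0" by (rule antisym)
  show "\<exists>y. ereal r < right_rate m (\<lambda>u. ereal (jump_rate p m u)) y" for r by (rule jump_unbounded)
  show "exp_ub ?s (\<lambda>n. \<P>(w in M n. D n w \<in> {y..})) (right_rate m (\<lambda>u. ereal (jump_rate p m u)) y)" if "m < y" for y
    using D_upper_jump[OF slow_power p2 that] that by (simp add: right_rate_def)
  show "exp_ub ?s (\<lambda>n. \<P>(w in M n. R n w \<in> {u..})) (right_rate 1 (\<lambda>u. ereal (chi_rate u)) u)" if "1 < u" for u
    using exp_ub_speed_equiv[OF R_ub_upper[OF that] k_s pos] that by (simp add: right_rate_def)
  show "exp_ub ?s (\<lambda>n. \<P>(w in M n. R n w \<in> {..u})) (left_chi u)" if "0 < u" "u < 1" for u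
    using exp_ub_speed_equiv[OF R_ub_lower[OF that] k_s pos] that by (simp add: left_chi_def)
  show "?I b \<le> right_rate m (\<lambda>u. ereal (jump_rate p m u)) y + right_rate 1 (\<lambda>u. ereal (chi_rate u)) (b / y)"
    if b: "m < b" "0 < y" for b y
  proof -
    have b0: "0 < b" using b m_pos by linarith
    consider "y \<le> m" | "m < y" "y < b" | "b \<le> y" by linarith
    then show ?thesis
    proof cases
      case 1
      have "1 < b / m" using b m_pos by simp
      moreover have "b / m \<le> b / y" by (rule divide_left_mono[OF 1 less_imp_le[OF b0] mult_pos_pos[OF m_pos b(2)]])
      ultimately have "ereal (chi_rate (b / m) + jump_rate p m m) \<le> right_rate m (\<lambda>u. ereal (jump_rate p m u)) y + right_rate 1 (\<lambda>u. ereal (chi_rate u)) (b / y)"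
        using 1 chi_rate_mono[of "b / m" "b / y"] by (simp add: right_rate_def)
      then show ?thesis using INF_le[OF b0 order_refl] by (rule order_trans[rotated])
    next
      case 2
      then have "1 < b / y" using b by simp
      then show ?thesis using INF_le[OF b0, of y] 2 by (simp add: right_rate_def add.commute)
    next
      case 3
      have "?I b \<le> ereal (chi_rate (b / b) + jump_rate p m b)" by (rule INF_le) (use b0 b in auto)
      also have "\<dots> \<le> right_rate m (\<lambda>u. ereal (jump_rate p m u)) y + right_rate 1 (\<lambda>u. ereal (chi_rate u)) (b / y)"
        using 3 b b0 jump_rate_mono[OF p_pos less_imp_le[OF m_pos] less_imp_le[OF b(1)] 3] by (simp add: right_rate_def)
      finally show ?thesis .
    qed
  qed
  show "?I x \<le> left_chi (max 0 (x / m))" if "x < m" for x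
  proof (cases "x > 0")
    case True
    then have "0 < x / m" using m_pos by simp
    then show ?thesis using INF_le[OF True order_refl] by (simp add: left_chi_def)
  next
    case False
    then have "x / m \<le> 0" using m_pos by (simp add: divide_le_0_iff)
    then show ?thesis by (simp add: left_chi_def)
  qed
  show "exp_lb ?s (\<lambda>n. \<P>(w in M n. \<bar>D n w * R n w - x\<bar> < d)) (?I x)" if d: "0 < d" for x d
  proof (cases "x > 0")
    case True
    have "exp_lb ?s (\<lambda>n. \<P>(w in M n. \<bar>D n w * R n w - x\<bar> < d)) (INF y\<in>{m..}. ereal (chi_rate (x / y) + jump_rate p m y))"
    proof (rule exp_lb_INF)
      fix y assume "y \<in> {m..}"
      then have y: "m \<le> y" by simp
      then have y0: "0 < y" using m_pos by linarith
      have u: "0 < x / y" using True y0 by simp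
      have "exp_lb ?s (\<lambda>n. \<P>(w in M n. \<bar>D n w * R n w - x\<bar> < d)) (ereal (jump_rate p m y) + ereal (chi_rate (x / y)))"
        by (rule local_product[OF D_local_jump[OF slow_power p2 y] exp_lb_speed_equiv[OF R_lb[OF u] k_s pos]])
           (use d u y0 chi_rate_nonneg jump_rate_nonneg[OF p_pos] in auto)
      then show "exp_lb ?s (\<lambda>n. \<P>(w in M n. \<bar>D n w * R n w - x\<bar> < d)) (ereal (chi_rate (x / y) + jump_rate p m y))"
        by (simp add: add.commute)
    qed
    then show ?thesis using True by simp
  qed (simp add: exp_lb_infinity)
qed (use chi_rate_nonneg jump_rate_nonneg[OF p_pos] lsc_jump lsc_chi left_chi_lsc in \<open>auto simp: right_rate_def\<close>)

text \<open>
  Deviations of \<open>R\<close> have a faster speed, so \<open>R\<close> acts like the constant one.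
\<close>

lemma LDP_jump:
  assumes k_s: "filterlim (\<lambda>n. real (k n) / real n powr (p / 2)) at_top sequentially"
  shows "satisfies_LDP M (\<lambda>n w. D n w * R n w) (\<lambda>n. real n powr (p / 2))
    (\<lambda>x. if x \<ge> m then ereal (jump_rate p m x) else \<infinity>)"
    (is "satisfies_LDP _ _ ?s ?I")
proof (rule product_LDP[OF slow_power, where gD = "right_rate m (\<lambda>u. ereal (jump_rate p m u))"
      and gR = "right_rate 1 (\<lambda>_. \<infinity>)" and hR = "\<lambda>_. \<infinity>"])
  note pos = slow_speed_pos[OF slow_power]
  have sl: "filterlim ?s at_top sequentially" using slow_power by (simp add: slow_speed_def)
  show "rate_function ?I" by (rule rate_function_jump[OF p_pos m_pos])
  show "\<exists>y. ereal r < right_rate m (\<lambda>u. ereal (jump_rate p m u)) y" for r by (rule jump_unbounded)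
  show "exp_ub ?s (\<lambda>n. \<P>(w in M n. D n w \<in> {y..})) (right_rate m (\<lambda>u. ereal (jump_rate p m u)) y)" if "m < y" for y
    using D_upper_jump[OF slow_power p2 that] that by (simp add: right_rate_def)
  show "exp_ub ?s (\<lambda>n. \<P>(w in M n. R n w \<in> {u..})) (right_rate 1 (\<lambda>_. \<infinity>) u)" if u: "1 < u" for u
  proof -
    have "0 < chi_rate u" using u by (intro chi_rate_pos) auto
    then show ?thesis using exp_ub_speed_infinity[OF R_ub_upper[OF u] _ k_s pos] by simp
  qed
  show "exp_ub ?s (\<lambda>n. \<P>(w in M n. R n w \<in> {..u})) \<infinity>" if u: "0 < u" "u < 1" for u
  proof -
    have "0 < chi_rate u" using u by (intro chi_rate_pos) auto
    then show ?thesis using exp_ub_speed_infinity[OF R_ub_lower[OF u] _ k_s pos] by simp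
  qed
  show "?I b \<le> right_rate m (\<lambda>u. ereal (jump_rate p m u)) y + right_rate 1 (\<lambda>_. \<infinity>) (b / y)" if b: "m < b" "0 < y" for b y
  proof (cases "y < b")
    case True
    then have "1 < b / y" using b by simp
    moreover have "0 \<le> right_rate m (\<lambda>u. ereal (jump_rate p m u)) y" using jump_rate_nonneg[OF p_pos] by (simp add: right_rate_def)
    ultimately show ?thesis by (simp add: right_rate_def)
  next
    case False
    then show ?thesis
      using b jump_rate_mono[OF p_pos less_imp_le[OF m_pos] less_imp_le[OF b(1)], of y] by (auto simp: right_rate_def field_simps)
  qed
  show "exp_lb ?s (\<lambda>n. \<P>(w in M n. \<bar>D n w * R n w - x\<bar> < d)) (?I x)" if d: "0 < d" for x d
  proof (cases "x \<ge> m")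
    case True
    have "exp_lb ?s (\<lambda>n. \<P>(w in M n. \<bar>D n w * R n w - x\<bar> < d)) (ereal (jump_rate p m x) + 0)"
      by (rule local_product[OF D_local_jump[OF slow_power p2 True] R_near[OF sl]])
         (use d jump_rate_nonneg[OF p_pos] in auto)
    then show ?thesis using True by simp
  qed (simp add: exp_lb_infinity)
qed (use jump_rate_nonneg[OF p_pos] lsc_jump lsc_infinite in \<open>auto simp: right_rate_def\<close>)

end

end

section \<open>Moderate deviations of the projected norm\<close>

text \<open>
  The sublevel sets of the rate function on \<open>{a..}\<close> are compact and decreasing. If none were empty, a
  common point would be a zero of the rate function other than the origin.
\<close>

lemma LDP_tail_off_zero:
  assumes LDP: "satisfies_LDP N Y s I" and s: "\<And>n. n \<ge> 1 \<Longrightarrow> 0 < s n"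
    and I: "\<And>x. x \<noteq> 0 \<Longrightarrow> I x \<noteq> 0" and a: "(0::real) < a"
  shows "\<exists>c>0. exp_ub s (\<lambda>n. \<P>(w in N n. Y n w \<in> {a..})) (ereal c)"
proof -
  have rf: "rate_function I" using LDP unfolding satisfies_LDP_def by blast
  define C where "C j = {x. I x \<le> ereal (1 / (real j + 1))} \<inter> {a..}" for j :: nat
  have "\<exists>j. C j = {}"
  proof (rule ccontr)
    assume "\<not> ?thesis"
    then have ne: "C j \<noteq> {}" for j by blast
    have memC: "x \<in> C j \<longleftrightarrow> I x \<le> ereal (1 / (real j + 1)) \<and> a \<le> x" for x j by (simp only: C_def Int_iff mem_Collect_eq atLeast_iff)
    have cmp: "compact (C j)" for j
      unfolding C_def by (rule compact_Int_closed[OF _ closed_atLeast]) (use rf in \<open>unfold rate_function_def, blast\<close>)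
    have mono: "C j \<subseteq> C i" if "i \<le> j" for i j
    proof -
      have "1 / (real j + 1) \<le> 1 / (real i + 1)" by (rule divide_left_mono) (use that in auto)
      then have le: "ereal (1 / (real j + 1)) \<le> ereal (1 / (real i + 1))" by (simp only: ereal_less_eq)
      show ?thesis
      proof
        fix x assume "x \<in> C j"
        then have "I x \<le> ereal (1 / (real j + 1))" and x: "a \<le> x" by (simp_all only: memC)
        from this(1) le have "I x \<le> ereal (1 / (real i + 1))" by (rule order.trans)
        with x show "x \<in> C i" by (simp only: memC simp_thms)
      qed
    qed
    have "\<Inter>(range C) \<noteq> {}" by (rule compact_nest[OF cmp ne mono])
    then obtain x where "x \<in> \<Inter>(range C)" unfolding ex_in_conv[symmetric] ..
    then have x: "x \<in> C j" for j by (rule INT_D) simp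
    have "I x \<le> 0"
    proof (rule tendsto_lowerbound)
      have "(\<lambda>j. 1 / (real j + 1)) \<longlonglongrightarrow> 0" using LIMSEQ_inverse_real_of_nat by (simp add: inverse_eq_divide add.commute)
      then show "(\<lambda>j. ereal (1 / (real j + 1))) \<longlonglongrightarrow> 0" unfolding zero_ereal_def by (rule tendsto_ereal)
      show "\<forall>\<^sub>F j in sequentially. I x \<le> ereal (1 / (real j + 1))" using x by (intro always_eventually allI) (simp only: memC)
    qed simp
    moreover have "0 \<le> I x" using rf by (simp add: rate_function_def)
    ultimately have "I x = 0" by (rule antisym)
    moreover have "a \<le> x" using x[of 0] by (simp only: memC)
    ultimately show False using I[of x] a by simp
  qed
  then obtain j where j: "C j = {}" by blast
  define c where "c = 1 / (real j + 1)"
  have c: "0 < c" by (simp add: c_def)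
  define P where "P n = \<P>(w in N n. Y n w \<in> {a..})" for n
  have "ereal c \<le> (INF x\<in>closure {a..}. I x)"
  proof (rule INF_greatest)
    fix x assume "x \<in> closure {a..}"
    then have "a \<le> x" by simp
    then have "\<not> I x \<le> ereal c" using j unfolding C_def c_def by blast
    then show "ereal c \<le> I x" by simp
  qed
  then have neg: "- (INF x\<in>closure {a..}. I x) \<le> - ereal c" by (simp only: ereal_minus_le_minus)
  have "{a..} \<in> sets borel" by simp
  then have "limsup (\<lambda>n. ereal (inverse (s n)) * log_prob (P n)) \<le> - (INF x\<in>closure {a..}. I x)"
    using LDP unfolding satisfies_LDP_def Let_def P_def by blast
  then have ls: "limsup (\<lambda>n. ereal (inverse (s n)) * log_prob (P n)) \<le> - ereal c" using neg by (rule order_trans)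
  have "exp_ub s P (ereal c)"
    unfolding exp_ub_def
  proof (intro allI impI)
    fix r assume "ereal r < ereal c"
    then have "- ereal c < ereal (- r)" by simp
    then have "limsup (\<lambda>n. ereal (inverse (s n)) * log_prob (P n)) < ereal (- r)" using ls by (rule le_less_trans[rotated])
    then have "\<forall>\<^sub>F n in sequentially. ereal (inverse (s n)) * log_prob (P n) < ereal (- r)" by (rule Limsup_lessD)
    then show "\<forall>\<^sub>F n in sequentially. P n \<le> exp (- r * s n)" using eventually_ge_at_top[of "1::nat"]
    proof eventually_elim
      case (elim n)
      show ?case
      proof (cases "P n = 0")
        case False
        have sn: "0 < s n" by (rule s[OF elim(2)])
        have P0: "0 < P n" using False by (simp add: P_def zero_less_measure_iff)
        have "inverse (s n) * ln (P n) < - r" using elim(1) False by (simp add: log_prob_def)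
        then have "ln (P n) \<le> - r * s n" using sn by (simp add: field_simps)
        then have "exp (ln (P n)) \<le> exp (- r * s n)" by (simp only: exp_le_cancel_iff)
        then show ?thesis using P0 by simp
      qed simp
    qed
  qed
  then show ?thesis using c unfolding P_def by blast
qed

lemma smallomega_nonneg_at_top:
  fixes f g :: "nat \<Rightarrow> real"
  assumes "f \<in> \<omega>(g)" and g: "\<And>n. n \<ge> 1 \<Longrightarrow> 0 < g n" and f: "\<And>n. n \<ge> 1 \<Longrightarrow> 0 \<le> f n"
  shows "filterlim (\<lambda>n. f n / g n) at_top sequentially"
proof -
  have "\<forall>\<^sub>F n in sequentially. g n \<noteq> 0" using g by (force simp: eventually_sequentially)
  from smallomegaD_filterlim_at_top_norm[OF assms(1) this]
  have "filterlim (\<lambda>n. norm (f n / g n)) at_top sequentially" .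
  moreover have "\<forall>\<^sub>F n in sequentially. norm (f n / g n) = f n / g n"
    using eventually_ge_at_top[of "1::nat"] by eventually_elim (use g f in \<open>simp add: less_imp_le\<close>)
  ultimately show ?thesis by (simp only: filterlim_cong[OF refl refl])
qed

theorem theorem4p1:
  fixes p :: real and k :: "nat \<Rightarrow> nat"
    and W :: "nat \<Rightarrow> real measure" and I_W :: "real \<Rightarrow> ereal"
    and M :: "nat \<Rightarrow> 'a measure"
    and X :: "nat \<Rightarrow> 'a \<Rightarrow> (nat \<Rightarrow> real)" and E :: "nat \<Rightarrow> 'a \<Rightarrow> (nat \<Rightarrow> real) set"
    and Z :: "nat \<Rightarrow> 'a \<Rightarrow> real"
    and N :: "nat \<Rightarrow> 'b measure" and V :: "nat \<Rightarrow> 'b \<Rightarrow> real"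
  assumes p: "1 \<le> p"
    and k_bounds: "\<And>n. n \<ge> 1 \<Longrightarrow> 1 \<le> k n \<and> k n \<le> n"
    and k_omega: "(\<lambda>n. real (k n)) \<in> \<omega>(\<lambda>_. 1)"
    and k_o: "(\<lambda>n. real (k n)) \<in> o(\<lambda>n. real n)"
    and W: "\<And>n. n \<ge> 1 \<Longrightarrow> prob_space (W n) \<and> sets (W n) = sets borel \<and> emeasure (W n) {0..} = 1"
    and M: "\<And>n. n \<ge> 1 \<Longrightarrow> prob_space (M n)"
    and X: "\<And>n. n \<ge> 1 \<Longrightarrow> X n \<in> measurable (M n) (Rn_borel n)"
    and X_distr: "\<And>n. n \<ge> 1 \<Longrightarrow> distr (M n) (Rn_borel n) (X n) = P_W (W n) n p"
    and E: "\<And>n. n \<ge> 1 \<Longrightarrow> E n \<in> measurable (M n) (grassmannian_borel n (k n))"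
    and E_haar: "\<And>n. n \<ge> 1 \<Longrightarrow>
      haar_grassmannian n (k n) (distr (M n) (grassmannian_borel n (k n)) (E n))"
    and indep: "\<And>n. n \<ge> 1 \<Longrightarrow> prob_space.indep_set (M n)
      (sets (vimage_algebra (space (M n)) (X n) (Rn_borel n)))
      (sets (vimage_algebra (space (M n)) (E n) (grassmannian_borel n (k n))))"
    and Z: "\<And>n w. Z n w = real n powr (1 / p) * lp_norm n 2 (proj n (E n w) (X n w))"
    and N: "\<And>n. n \<ge> 1 \<Longrightarrow> prob_space (N n)"
    and V: "\<And>n. n \<ge> 1 \<Longrightarrow> V n \<in> borel_measurable (N n)"
    and V_distr: "\<And>n. n \<ge> 1 \<Longrightarrow> distr (N n) borel (V n) = W n"
    and V_LDP: "satisfies_LDP N (\<lambda>n w. V n w / real n) (\<lambda>n. real n) I_W"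
    and I_W: "\<And>x. x \<noteq> 0 \<Longrightarrow> I_W x \<noteq> 0"
  shows
    "(p \<ge> 2 \<longrightarrow>
        satisfies_LDP M (\<lambda>n w. Z n w / sqrt (real (k n))) (\<lambda>n. real (k n))
          (\<lambda>x. if x > 0 then ereal ((x\<^sup>2 - M2 p) / (2 * M2 p) - ln (x / sqrt (M2 p))) else \<infinity>)) \<and>
     (p < 2 \<and> (\<lambda>n. real (k n)) \<in> o(\<lambda>n. real n powr (p / 2)) \<longrightarrow>
        satisfies_LDP M (\<lambda>n w. Z n w / sqrt (real (k n))) (\<lambda>n. real (k n))
          (\<lambda>x. if x > 0 then ereal ((x\<^sup>2 - M2 p) / (2 * M2 p) - ln (x / sqrt (M2 p))) else \<infinity>)) \<and>
     (p < 2 \<and> (\<forall>n\<ge>1. \<bar>real (k n) - real n powr (p / 2)\<bar> < 1) \<longrightarrow>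
        satisfies_LDP M (\<lambda>n w. Z n w / sqrt (real (k n))) (\<lambda>n. real n powr (p / 2))
          (\<lambda>x. if x > 0
               then INF y\<in>{sqrt (M2 p)..}.
                      ereal (((x / y)\<^sup>2 - 1) / 2 - ln (x / y) + 1 / p * (y\<^sup>2 - M2 p) powr (p / 2))
               else \<infinity>)) \<and>
     (p < 2 \<and> (\<lambda>n. real (k n)) \<in> \<omega>(\<lambda>n. real n powr (p / 2)) \<longrightarrow>
        satisfies_LDP M (\<lambda>n w. Z n w / sqrt (real (k n))) (\<lambda>n. real n powr (p / 2))
          (\<lambda>x. if x \<ge> sqrt (M2 p) then ereal (1 / p * (x\<^sup>2 - M2 p) powr (p / 2)) else \<infinity>))"
proof -
  have k1: "1 \<le> k n" if "n \<ge> 1" for n using k_bounds[OF that] by blast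
  have kp: "0 < real (k n)" if "n \<ge> 1" for n using k1[OF that] by simp
  have Wn: "prob_space (W n)" "sets (W n) = sets borel" "emeasure (W n) {0..} = 1" if "n \<ge> 1" for n
    using W[OF that] by blast+
  \<comment> \<open>The hypotheses on \<open>I_W\<close> enter only here.\<close>
  have W_tail: "\<exists>c>0. exp_ub (\<lambda>n. real n) (\<lambda>n. measure (W n) {\<eta> * real n<..}) (ereal c)" if \<eta>: "0 < \<eta>" for \<eta>
  proof -
    obtain c where c: "0 < c" "exp_ub (\<lambda>n. real n) (\<lambda>n. \<P>(w in N n. V n w / real n \<in> {\<eta>..})) (ereal c)"
      using LDP_tail_off_zero[OF V_LDP _ I_W \<eta>] by auto
    have "exp_ub (\<lambda>n. real n) (\<lambda>n. measure (W n) {\<eta> * real n<..}) (ereal c)"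
    proof (rule exp_ub_mono[OF c(2) order_refl])
      show "\<forall>\<^sub>F n in sequentially. measure (W n) {\<eta> * real n<..} \<le> \<P>(w in N n. V n w / real n \<in> {\<eta>..})"
        using eventually_ge_at_top[of "1::nat"]
      proof eventually_elim
        case (elim n)
        interpret prob_space "N n" by (rule N[OF elim])
        have "measure (W n) {\<eta> * real n<..} = measure (N n) (V n -` {\<eta> * real n<..} \<inter> space (N n))"
          unfolding V_distr[OF elim, symmetric] by (rule measure_distr[OF V[OF elim]]) simp
        also have "\<dots> \<le> \<P>(w in N n. V n w / real n \<in> {\<eta>..})"
        proof (rule finite_measure_mono)
          show "V n -` {\<eta> * real n<..} \<inter> space (N n) \<subseteq> {w\<in>space (N n). V n w / real n \<in> {\<eta>..}}"
            using elim by (auto simp: field_simps)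
          have "(\<lambda>w. V n w / real n) \<in> borel_measurable (N n)" using V[OF elim] by simp
          from measurable_sets[OF this, of "{\<eta>..}"]
          show "{w\<in>space (N n). V n w / real n \<in> {\<eta>..}} \<in> sets (N n)" by (simp add: vimage_def Int_def conj_commute)
        qed
        finally show ?case .
      qed
    qed
    with c(1) show ?thesis by blast
  qed
  have k_lim: "filterlim (\<lambda>n. real (k n)) at_top sequentially"
    using smallomega_nonneg_at_top[OF k_omega] by simp
  have k_small: "filterlim (\<lambda>n. real n / real (k n)) at_top sequentially"
    by (rule smallomega_nonneg_at_top[OF k_o[folded smallomega_iff_smallo] kp]) auto
  interpret projected_point p k W M X E
    by (rule projected_point.intro) (fact p k1 k_lim k_small Wn W_tail M X X_distr E E_haar indep)+
  have slow: "slow_speed (\<lambda>n. real (k n))" using k_lim k_small by (simp add: slow_speed_def)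
  have k_pos: "\<forall>\<^sub>F n in sequentially. 0 < real (k n)" by (rule slow_speed_pos[OF slow])
  have product: "satisfies_LDP M (\<lambda>n w. Z n w / sqrt (real (k n))) s I"
    if "satisfies_LDP M (\<lambda>n w. D n w * R n w) s I" for s I
    by (rule satisfies_LDP_cong[OF _ that]) (simp only: Z D_times_R)
  have chi: "(if x > 0 then ereal (chi_rate (x / m)) else \<infinity>) =
      (if x > 0 then ereal ((x\<^sup>2 - M2 p) / (2 * M2 p) - ln (x / sqrt (M2 p))) else \<infinity>)" for x
  proof -
    have "((x / m)\<^sup>2 - 1) / 2 = (x\<^sup>2 - M2 p) / (2 * M2 p)"
      unfolding power_divide m_sq using M2_pos[OF p_pos] by (simp add: field_simps)
    then show ?thesis by (simp only: chi_rate_def)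
  qed
  have jump: "jump_rate p m y = 1 / p * (y\<^sup>2 - M2 p) powr (p / 2)" for y
    by (simp only: jump_rate_def m_sq)
  have powr_pos: "0 < real n powr (p / 2)" if "n \<ge> 1" for n using that by simp
  show ?thesis
  proof (intro conjI impI; (elim conjE)?)
    assume p2: "2 \<le> p"
    have "exp_ub (\<lambda>n. real (k n)) (\<lambda>n. gprob p n (\<lambda>x. real n * (M2 p + a) \<le> (\<Sum>i<n. (x i)\<^sup>2))) \<infinity>" if "0 < a" for a
      by (rule slow_speed_ub[OF slow gg_square_upper[OF p2 that]])
    from product[OF LDP_chi[OF slow this]]
    show "satisfies_LDP M (\<lambda>n w. Z n w / sqrt (real (k n))) (\<lambda>n. real (k n))
          (\<lambda>x. if x > 0 then ereal ((x\<^sup>2 - M2 p) / (2 * M2 p) - ln (x / sqrt (M2 p))) else \<infinity>)"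
      unfolding chi .
  next
    assume p2: "p < 2" and "(\<lambda>n. real (k n)) \<in> o(\<lambda>n. real n powr (p / 2))"
    then have "filterlim (\<lambda>n. real n powr (p / 2) / real (k n)) at_top sequentially"
      using kp by (intro smallomega_nonneg_at_top) (auto simp: smallomega_iff_smallo)
    then have "exp_ub (\<lambda>n. real (k n)) (\<lambda>n. gprob p n (\<lambda>x. real n * (M2 p + a) \<le> (\<Sum>i<n. (x i)\<^sup>2))) \<infinity>" if "0 < a" for a
      by (rule exp_ub_speed_infinity[OF gg_square_heavy_upper[OF p p2 that] _ _ k_pos, rotated]) (use that p in simp)
    from product[OF LDP_chi[OF slow this]]
    show "satisfies_LDP M (\<lambda>n w. Z n w / sqrt (real (k n))) (\<lambda>n. real (k n))
          (\<lambda>x. if x > 0 then ereal ((x\<^sup>2 - M2 p) / (2 * M2 p) - ln (x / sqrt (M2 p))) else \<infinity>)"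
      unfolding chi .
  next
    assume p2: "p < 2" and k: "\<forall>n\<ge>1. \<bar>real (k n) - real n powr (p / 2)\<bar> < 1"
    have "(\<lambda>n. real (k n) / real n powr (p / 2) - 1) \<longlonglongrightarrow> 0"
    proof (rule Lim_null_comparison)
      have "filterlim (\<lambda>n. real n powr (p / 2)) at_top sequentially" using slow_power[OF p2] by (simp add: slow_speed_def)
      then show "(\<lambda>n. inverse (real n powr (p / 2))) \<longlonglongrightarrow> 0" by (rule tendsto_inverse_0_at_top)
      show "\<forall>\<^sub>F n in sequentially. norm (real (k n) / real n powr (p / 2) - 1) \<le> inverse (real n powr (p / 2))"
        using eventually_ge_at_top[of "1::nat"]
      proof eventually_elim
        case (elim n)
        have q: "0 < real n powr (p / 2)" by (rule powr_pos[OF elim])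
        have "real (k n) / real n powr (p / 2) - 1 = (real (k n) - real n powr (p / 2)) * inverse (real n powr (p / 2))"
          using q by (simp add: field_simps)
        also have "norm \<dots> = \<bar>real (k n) - real n powr (p / 2)\<bar> * inverse (real n powr (p / 2))" using q by (simp add: abs_mult)
        also have "\<dots> \<le> 1 * inverse (real n powr (p / 2))" using k elim q by (intro mult_right_mono) (auto intro: less_imp_le)
        finally show ?case by simp
      qed
    qed
    then have "(\<lambda>n. real (k n) / real n powr (p / 2)) \<longlonglongrightarrow> 1" by (rule LIM_zero_cancel)
    from product[OF LDP_joint[OF p2 this]]
    show "satisfies_LDP M (\<lambda>n w. Z n w / sqrt (real (k n))) (\<lambda>n. real n powr (p / 2))
          (\<lambda>x. if x > 0
               then INF y\<in>{sqrt (M2 p)..}.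
                      ereal (((x / y)\<^sup>2 - 1) / 2 - ln (x / y) + 1 / p * (y\<^sup>2 - M2 p) powr (p / 2))
               else \<infinity>)"
      unfolding jump chi_rate_def .
  next
    assume p2: "p < 2" and k: "(\<lambda>n. real (k n)) \<in> \<omega>(\<lambda>n. real n powr (p / 2))"
    have "filterlim (\<lambda>n. real (k n) / real n powr (p / 2)) at_top sequentially"
      by (rule smallomega_nonneg_at_top[OF k powr_pos]) auto
    from product[OF LDP_jump[OF p2 this]]
    show "satisfies_LDP M (\<lambda>n w. Z n w / sqrt (real (k n))) (\<lambda>n. real n powr (p / 2))
          (\<lambda>x. if x \<ge> sqrt (M2 p) then ereal (1 / p * (x\<^sup>2 - M2 p) powr (p / 2)) else \<infinity>)"
      unfolding jump .
  qed
qed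

end
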